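(* Let $K=\mathbb{C}$, let $P$ be a lattice simplicial polytope in $N_{\mathbb{Q}}$ ($N\cong\mathbb{Z}^n$) with $0$ in its interior, and let $f=f_{P,\mathbf a}=\sum_{v\in P(0)}a_v\mathbf t^v$ with all $a_v\in\mathbb{C}^*$. For any $u\in\operatorname{Box}(\boldsymbol\Sigma_P)$: (1) There is a (non-canonical) isomorphism of vector spaces with endomorphism $$(H(u),\mathsf N)\xrightarrow{\sim}(\operatorname{Gr}^\Phi H(u),\mathsf N).$$ (2) There are canonical isomorphisms $$(\operatorname{Gr}^\Phi H(u),\mathsf N)\xrightarrow{\sim}(J_f^{\mathcal N}(u),[f])\xrightarrow{\sim}(H(\Sigma_P(u)),\deg_P),$$ under which, for every $p$, $$\operatorname{Gr}^\Phi_pH(u)\xrightarrow{\sim}\bigl(J_f^{\mathcal N}(u)\bigr)_{p+\{\deg(u)\}}\xrightarrow{\sim}H^{p-\lfloor\deg(u)\rfloor}(\Sigma_P(u)).$$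
   Context: **Polytope and fan.** $P$ is a polytope in $N_{\mathbb{Q}}=N\otimes\mathbb{Q}$ with vertex set $P(0)\subset N$, each facet has exactly $n$ vertices, and $0$ is an interior point. $\Sigma_P$ is the complete simplicial fan of cones over proper faces of $P$; rays $\rho$ correspond to vertices $v_\rho$; $\boldsymbol\Sigma_P=(N,\Sigma_P,P(0))$. $\deg(u)=\deg_P(u)=\min\{\lambda\ge0:u\in\lambda P\}$, a conewise linear function on $\Sigma_P$. For $u\in N_{\mathbb Q}$, $\sigma(u)$ is the cone of $\Sigma_P$ containing $u$ in its relative interior. $\operatorname{Box}(\sigma)=\{u\in N:u=\sum_{\rho\in\sigma(1)}\lambda_\rho v_\rho,\ 0\le\lambda_\rho<1\}$, $\operatorname{Box}(\boldsymbol\Sigma_P)=\bigcup_\sigma\operatorname{Box}(\sigma)$. Every $w\in N$ is uniquely $w=\{w\}+\lfloor w\rfloor$ with $\{w\}\in\operatorname{Box}(\sigma(w))$, $\lfloor w\rfloor\in\sum_{\rho\in\sigma(w)(1)}\mathbb{Z}_{\ge0}v_\rho$. For $u\in\operatorname{Box}(\boldsymbol\Sigma_P)$, $P_u=\{w\in N:\{w\}=u\}$. For real numbers, $\lfloor\cdot\rfloor$, $\{\cdot\}$ are integer and fractional parts. **Conewise polynomials.** $\Sigma_P(u):=\overline{\operatorname{Star}}(\sigma(u))$ is the fan of all faces of cones of $\Sigma_P$ containing $\sigma(u)$ as a face. For a simplicial fan $\Sigma$ in $N_{\mathbb{Q}}$, $\mathcal{A}(\Sigma)$ is the graded ring of $\mathbb{C}$-valued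 functions on $|\Sigma|$ restricting to polynomials on each cone (graded by degree), and $H(\Sigma)=\mathcal{A}(\Sigma)/\mathbf m\mathcal{A}(\Sigma)$, graded, with $\mathbf m$ generated by the global linear functions. $\deg_P$ acts by multiplication. **Gauss-Manin system.** $t_1,\dots,t_n$ is a basis of $\operatorname{Hom}(N,\mathbb{Z})$, $\mathbf t^w=\prod t_i^{w_i}$ for $w\in N$, $U=\operatorname{Spec}\mathbb{C}[\mathbf t^{\pm1}]$; $\theta$ is a variable, $\tau=\theta^{-1}$. Newton filtration ($\alpha\in\mathbb{Q}$): $\mathcal N_\alpha\mathbb{C}[\mathbf t^{\pm1}]=\operatorname{span}\{\mathbf t^w:\deg(w)\le\alpha\}$; $\mathcal N_\alpha\Omega^k(U)=\sum_{i_1<\dots<i_k}\mathcal N_{\alpha+k-n}\mathbb{C}[\mathbf t^{\pm1}]\frac{\mathrm dt_{i_1}}{t_{i_1}}\wedge\dots\wedge\frac{\mathrm dt_{i_k}}{t_{i_k}}$; $\mathcal N_\alpha\Omega^k(U)[\tau^{\pm1}]=\sum_{i\in\mathbb Z}\tau^i\mathcal N_{\alpha+i}\Omega^k(U)$. The operator $\nabla_{\partial_\tau}=\partial_\tau-f$ acts on $\Omega^\bullet(U)[\tau^{\pm1}]$. **The pieces.** For $u\in\operatorname{Box}(\boldsymbol\Sigma_P)$ let $A_P(u)=\operatorname{span}\{\mathbf t^w:w\in P_u\}$ with the induced Newton filtration, and $\overline\Omega^k_{\mathcal N}(u)=\bigoplus_{i_1<\dots<i_k}\operatorname{Gr}^{\mathcal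 N}A_P(u)\frac{\mathrm dt_{i_1}}{t_{i_1}}\wedge\dots\wedge\frac{\mathrm dt_{i_k}}{t_{i_k}}\subset\operatorname{Gr}^{\mathcal N}\Omega^k(U)$, $\Omega^k_{\mathcal N}(u)=\bigoplus_i\bigoplus_{i_1<\dots<i_k}\tau^i\operatorname{Gr}^{\mathcal N}_{\{\deg u\}+i+k-n}A_P(u)\frac{\mathrm dt_{i_1}}{t_{i_1}}\wedge\dots\wedge\frac{\mathrm dt_{i_k}}{t_{i_k}}\subset\operatorname{Gr}^{\mathcal N}_{\{\deg u\}}\Omega^k(U)[\tau^{\pm1}]$. These are subcomplexes for the differentials $-\mathrm df\wedge$ and $\theta\mathrm d-\mathrm df\wedge$ respectively. Put $J_f^{\mathcal N}(u)=H^n(\overline\Omega^\bullet_{\mathcal N}(u),-\mathrm df\wedge)$, graded by Newton degree (the class of $\mathbf t^w\frac{\mathrm dt_1}{t_1}\wedge\dots\wedge\frac{\mathrm dt_n}{t_n}$ has degree $\deg(w)$), with $[f]$ multiplication by the class of $f$ (raising degree by $1$); and $H(u)=H^n(\Omega^\bullet_{\mathcal N}(u),\theta\mathrm d-\mathrm df\wedge)$, with endomorphism $\mathsf N=-(\tau\nabla_{\partial_\tau}+\{\deg u\})$ and increasing filtration $\Phi_pH(u)$ = the image of the part of $\Omega^n_{\mathcal N}(u)$ with $\tau$-exponents $i\le p$. One has $\mathsf N\Phi_p\subset\Phi_{p+1}$, and $\mathsf N$ on $\operatorname{Gr}^\Phi H(u)$ is the induced map $\operatorname{Gr}^\Phi_p\to\operatorname{Gr}^\Phi_{p+1}$.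 *)

theory Defs
  imports
    "HOL-Analysis.Analysis"
    "HOL-Library.Poly_Mapping"
    "HOL-Algebra.Module"
    "HOL-Algebra.QuotRing"
begin

section \<open>Complex vector spaces with explicit carriers\<close>

text \<open>
  Complex vector spaces are HOL-Algebra \<open>module\<close> records with scalars of type \<^typ>\<open>complex\<close>.
  Their fields \<open>mult\<close> and \<open>one\<close> matter only for the algebra of conewise polynomials and its
  quotients; elsewhere they are left unspecified.
\<close>

text \<open>
  The quotient \<open>M/W\<close>. It extends \<open>M Quot W\<close> (the ring structure when \<open>W\<close> is an ideal)
  by scalar multiplication; adding \<open>W\<close> makes \<open>0 \<odot> X\<close> the coset \<open>W\<close> rather than \<open>{0}\<close>.
\<close>
definition quotient_module ::
    "(complex, 'v) module \<Rightarrow> 'v set \<Rightarrow> (complex, 'v set) module" where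
  "quotient_module M W =
     \<lparr>carrier = a_rcosets\<^bsub>M\<^esub> W, mult = rcoset_mult M W, one = W +>\<^bsub>M\<^esub> \<one>\<^bsub>M\<^esub>,
      zero = W, add = set_add M,
      smult = (\<lambda>c X. W <+>\<^bsub>M\<^esub> ((\<lambda>x. c \<odot>\<^bsub>M\<^esub> x) ` X))\<rparr>"

text \<open>
  The map induced by \<open>T\<close> on cosets, with values in the cosets of \<open>W\<close>; for \<open>T(W') \<subseteq> W\<close> it sends
  \<open>W' + x\<close> to \<open>W + T x\<close>.
\<close>
definition induced :: "(complex, 'w) module \<Rightarrow> 'w set \<Rightarrow> ('v \<Rightarrow> 'w) \<Rightarrow> 'v set \<Rightarrow> 'w set" where
  "induced M W T X = W <+>\<^bsub>M\<^esub> (T ` X)"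

definition direct_sum ::
    "'i set \<Rightarrow> ('i \<Rightarrow> (complex, 'v) module) \<Rightarrow> (complex, 'i \<Rightarrow> 'v) module" where
  "direct_sum J M =
     \<lparr>carrier = {x \<in> (\<Pi>\<^sub>E i\<in>J. carrier (M i)). finite {i \<in> J. x i \<noteq> \<zero>\<^bsub>M i\<^esub>}},
      mult = undefined, one = undefined,
      zero = (\<lambda>i\<in>J. \<zero>\<^bsub>M i\<^esub>),
      add = (\<lambda>x y. \<lambda>i\<in>J. x i \<oplus>\<^bsub>M i\<^esub> y i),
      smult = (\<lambda>c x. \<lambda>i\<in>J. c \<odot>\<^bsub>M i\<^esub> x i)\<rparr>"

definition dsum_component ::
    "'i set \<Rightarrow> ('i \<Rightarrow> (complex, 'v) module) \<Rightarrow> 'i \<Rightarrow> ('i \<Rightarrow> 'v) set" where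
  "dsum_component J M p =
     {x \<in> carrier (direct_sum J M). \<forall>q\<in>J - {p}. x q = \<zero>\<^bsub>M q\<^esub>}"

definition dsum_single ::
    "'i set \<Rightarrow> ('i \<Rightarrow> (complex, 'v) module) \<Rightarrow> 'i \<Rightarrow> 'v \<Rightarrow> 'i \<Rightarrow> 'v" where
  "dsum_single J M p x = (\<lambda>q\<in>J. if q = p then x else \<zero>\<^bsub>M q\<^esub>)"

subsection \<open>Increasing filtrations indexed by a set \<open>J\<close>\<close>

definition filt_below :: "'i::order set \<Rightarrow> ('i \<Rightarrow> 'v set) \<Rightarrow> 'i \<Rightarrow> 'v set" where
  "filt_below J F p = (\<Union>q\<in>{q \<in> J. q < p}. F q)"

definition gr ::
    "'i::order set \<Rightarrow> (complex, 'v) module \<Rightarrow> ('i \<Rightarrow> 'v set) \<Rightarrow> 'i \<Rightarrow> (complex, 'v set) module" where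
  "gr J M F p = quotient_module (M\<lparr>carrier := F p\<rparr>) (filt_below J F p)"

definition gr_class ::
    "'i::order set \<Rightarrow> (complex, 'v) module \<Rightarrow> ('i \<Rightarrow> 'v set) \<Rightarrow> 'i \<Rightarrow> 'v \<Rightarrow> 'v set" where
  "gr_class J M F p x = filt_below J F p +>\<^bsub>M\<^esub> x"

text \<open>The image in \<open>Gr\<^sub>p M\<close> of a subspace \<open>S\<close> of \<open>M\<close> with its induced filtration.\<close>
definition gr_image ::
    "'i::order set \<Rightarrow> (complex, 'v) module \<Rightarrow> ('i \<Rightarrow> 'v set) \<Rightarrow> 'i \<Rightarrow> 'v set \<Rightarrow> 'v set set" where
  "gr_image J M F p S = gr_class J M F p ` (F p \<inter> S)"

subsection \<open>Cohomology\<close>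

definition coboundaries ::
    "(int \<Rightarrow> (complex, 'v) module) \<Rightarrow> (int \<Rightarrow> 'v \<Rightarrow> 'v) \<Rightarrow> int \<Rightarrow> 'v set" where
  "coboundaries C D k = D (k - 1) ` carrier (C (k - 1))"

definition cohomology ::
    "(int \<Rightarrow> (complex, 'v) module) \<Rightarrow> (int \<Rightarrow> 'v \<Rightarrow> 'v) \<Rightarrow> int \<Rightarrow> (complex, 'v set) module" where
  "cohomology C D k =
     quotient_module (C k\<lparr>carrier := {x \<in> carrier (C k). D k x = \<zero>\<^bsub>C (k + 1)\<^esub>}\<rparr>)
       (coboundaries C D k)"

definition end_iso ::
    "(complex, 'v) module \<Rightarrow> ('v \<Rightarrow> 'v) \<Rightarrow> (complex, 'w) module \<Rightarrow> ('w \<Rightarrow> 'w) \<Rightarrow> ('v \<Rightarrow> 'w) \<Rightarrow> bool" where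
  "end_iso V S W T \<phi> \<longleftrightarrow>
     bij_betw \<phi> (carrier V) (carrier W) \<and>
     (\<forall>x\<in>carrier V. \<forall>y\<in>carrier V. \<phi> (x \<oplus>\<^bsub>V\<^esub> y) = \<phi> x \<oplus>\<^bsub>W\<^esub> \<phi> y) \<and>
     (\<forall>c. \<forall>x\<in>carrier V. \<phi> (c \<odot>\<^bsub>V\<^esub> x) = c \<odot>\<^bsub>W\<^esub> \<phi> x) \<and>
     (\<forall>x\<in>carrier V. S x \<in> carrier V \<and> \<phi> (S x) = T (\<phi> x))"


section \<open>Polytope and fan\<close>

text \<open>
  \<open>N = \<int>\<^sup>n\<close> is the type \<^typ>\<open>int ^ 'n\<close>. The ambient space is \<open>real ^ 'n\<close>, and \<open>N\<^sub>\<rat>\<close>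
  is its subset \<open>NQ\<close> of rational vectors: a polytope (or cone) of \<open>N\<^sub>\<rat>\<close> is represented by
  the real polytope (or cone) it spans, whose intersection with \<open>NQ\<close> it is.
\<close>

definition emb :: "int ^ 'n \<Rightarrow> real ^ 'n" where
  "emb w = (\<chi> i. real_of_int (w $ i))"

definition NQ :: "(real ^ 'n) set" where
  "NQ = {x. \<forall>i. x $ i \<in> \<rat>}"

definition verts :: "(real ^ 'n) set \<Rightarrow> (int ^ 'n) set" where
  "verts P = {v. emb v extreme_point_of P}"

definition lattice_simplicial :: "(real ^ 'n) set \<Rightarrow> bool" where
  "lattice_simplicial P \<longleftrightarrow> polytope P \<and>
     (\<forall>x. x extreme_point_of P \<longrightarrow> x \<in> range emb) \<and>
     (\<forall>F. F facet_of P \<longrightarrow> card {x. x extreme_point_of F} = CARD('n))"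

definition degP :: "(real ^ 'n) set \<Rightarrow> real ^ 'n \<Rightarrow> real" where
  "degP P x = (LEAST l. 0 \<le> l \<and> x \<in> (\<lambda>y. l *\<^sub>R y) ` P)"

text \<open>The empty face is included and gives the cone \<open>{0}\<close>.\<close>
definition fan :: "(real ^ 'n) set \<Rightarrow> (real ^ 'n) set set" where
  "fan P = {convex_cone hull F |F. F face_of P \<and> F \<noteq> P}"

definition min_cone :: "(real ^ 'n) set \<Rightarrow> int ^ 'n \<Rightarrow> (real ^ 'n) set" where
  "min_cone P w = (THE \<sigma>. \<sigma> \<in> fan P \<and> emb w \<in> rel_interior \<sigma>)"

text \<open>The generators \<open>v\<^sub>\<rho>\<close> of the rays of a cone of the fan.\<close>
definition gens :: "(real ^ 'n) set \<Rightarrow> (real ^ 'n) set \<Rightarrow> (int ^ 'n) set" where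
  "gens P \<sigma> = {v \<in> verts P. emb v \<in> \<sigma>}"

definition Box :: "(real ^ 'n) set \<Rightarrow> (real ^ 'n) set \<Rightarrow> (int ^ 'n) set" where
  "Box P \<sigma> = {u. \<exists>l. (\<forall>v\<in>gens P \<sigma>. 0 \<le> l v \<and> l v < 1) \<and>
                      emb u = (\<Sum>v\<in>gens P \<sigma>. l v *\<^sub>R emb v)}"

definition Box_fan :: "(real ^ 'n) set \<Rightarrow> (int ^ 'n) set" where
  "Box_fan P = (\<Union>\<sigma>\<in>fan P. Box P \<sigma>)"

text \<open>\<open>{w}\<close> in the unique decomposition \<open>w = {w} + \<lfloor>w\<rfloor>\<close>.\<close>
definition frac_part :: "(real ^ 'n) set \<Rightarrow> int ^ 'n \<Rightarrow> int ^ 'n" where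
  "frac_part P w = (THE u. u \<in> Box P (min_cone P w) \<and>
     (\<exists>m :: int ^ 'n \<Rightarrow> nat.
        emb w = emb u + (\<Sum>v\<in>gens P (min_cone P w). real (m v) *\<^sub>R emb v)))"

definition box_fibre :: "(real ^ 'n) set \<Rightarrow> int ^ 'n \<Rightarrow> (int ^ 'n) set" where
  "box_fibre P u = {w. frac_part P w = u}"

text \<open>\<open>\<Sigma>\<^sub>P(u)\<close>; the condition \<open>\<tau> \<noteq> {}\<close> removes the empty set, which is a \<open>face_of\<close> any set.\<close>
definition star_fan :: "(real ^ 'n) set \<Rightarrow> int ^ 'n \<Rightarrow> (real ^ 'n) set set" where
  "star_fan P u =
     {\<tau>. \<tau> \<noteq> {} \<and> (\<exists>\<sigma>\<in>fan P. min_cone P u face_of \<sigma> \<and> \<tau> face_of \<sigma>)}"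


section \<open>Conewise polynomials\<close>

text \<open>A polynomial in \<open>n\<close> variables is an element of \<^typ>\<open>(nat ^ 'n) \<Rightarrow>\<^sub>0 complex\<close>.\<close>
definition peval :: "((nat ^ 'n) \<Rightarrow>\<^sub>0 complex) \<Rightarrow> real ^ 'n \<Rightarrow> complex" where
  "peval p x = (\<Sum>m\<in>Poly_Mapping.keys p. Poly_Mapping.lookup p m * (\<Prod>i\<in>UNIV. complex_of_real (x $ i) ^ (m $ i)))"

text \<open>The degree is an integer, so that there are no nonzero conewise polynomials of negative degree.\<close>
definition homogeneous :: "int \<Rightarrow> ((nat ^ 'n) \<Rightarrow>\<^sub>0 complex) \<Rightarrow> bool" where
  "homogeneous k p \<longleftrightarrow> (\<forall>m\<in>Poly_Mapping.keys p. (\<Sum>i\<in>UNIV. int (m $ i)) = k)"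

definition supp :: "(real ^ 'n) set set \<Rightarrow> (real ^ 'n) set" where
  "supp \<Sigma> = \<Union>\<Sigma> \<inter> NQ"

definition conewise ::
    "(((nat ^ 'n) \<Rightarrow>\<^sub>0 complex) \<Rightarrow> bool) \<Rightarrow> (real ^ 'n) set set \<Rightarrow> (real ^ 'n \<Rightarrow> complex) set" where
  "conewise Q \<Sigma> = {g \<in> extensional (supp \<Sigma>).
     \<forall>\<sigma>\<in>\<Sigma>. \<exists>p. Q p \<and> (\<forall>x\<in>\<sigma> \<inter> NQ. g x = peval p x)}"

definition cpoly :: "(real ^ 'n) set set \<Rightarrow> (complex, real ^ 'n \<Rightarrow> complex) module" where
  "cpoly \<Sigma> =
     \<lparr>carrier = conewise (\<lambda>_. True) \<Sigma>,
      mult = (\<lambda>g h. \<lambda>x\<in>supp \<Sigma>. g x * h x), one = (\<lambda>x\<in>supp \<Sigma>. 1),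
      zero = (\<lambda>x\<in>supp \<Sigma>. 0), add = (\<lambda>g h. \<lambda>x\<in>supp \<Sigma>. g x + h x),
      smult = (\<lambda>c g. \<lambda>x\<in>supp \<Sigma>. c * g x)\<rparr>"

definition lin_ideal :: "(real ^ 'n) set set \<Rightarrow> (real ^ 'n \<Rightarrow> complex) set" where
  "lin_ideal \<Sigma> = Idl\<^bsub>cpoly \<Sigma>\<^esub>
     (range (\<lambda>c :: complex ^ 'n. \<lambda>x\<in>supp \<Sigma>. \<Sum>i\<in>UNIV. c $ i * complex_of_real (x $ i)))"

definition HS :: "(real ^ 'n) set set \<Rightarrow> (complex, (real ^ 'n \<Rightarrow> complex) set) module" where
  "HS \<Sigma> = quotient_module (cpoly \<Sigma>) (lin_ideal \<Sigma>)"

definition HS_class :: "(real ^ 'n) set set \<Rightarrow> (real ^ 'n \<Rightarrow> complex) \<Rightarrow> (real ^ 'n \<Rightarrow> complex) set" where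
  "HS_class \<Sigma> g = lin_ideal \<Sigma> +>\<^bsub>cpoly \<Sigma>\<^esub> (\<lambda>x\<in>supp \<Sigma>. g x)"

definition HS_graded :: "(real ^ 'n) set set \<Rightarrow> int \<Rightarrow> (real ^ 'n \<Rightarrow> complex) set set" where
  "HS_graded \<Sigma> k = HS_class \<Sigma> ` conewise (homogeneous k) \<Sigma>"

definition HS_deg ::
    "(real ^ 'n) set \<Rightarrow> (real ^ 'n) set set \<Rightarrow> (real ^ 'n \<Rightarrow> complex) set \<Rightarrow> (real ^ 'n \<Rightarrow> complex) set" where
  "HS_deg P \<Sigma> = induced (cpoly \<Sigma>) (lin_ideal \<Sigma>)
     (\<lambda>g. (\<lambda>x\<in>supp \<Sigma>. complex_of_real (degP P x)) \<otimes>\<^bsub>cpoly \<Sigma>\<^esub> g)"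


section \<open>Differential forms on the torus\<close>

text \<open>
  \<open>\<complex>[t\<^sup>\<plusminus>\<^sup>1]\<close> is the group algebra \<open>laurent\<close> of \<open>N\<close>, and \<open>\<complex>[t\<^sup>\<plusminus>\<^sup>1][\<tau>\<^sup>\<plusminus>\<^sup>1]\<close> is \<open>laurent_tau\<close>.
  A form \<open>\<Sum>\<^sub>I \<omega>\<^sub>I dt\<^sub>I/t\<^sub>I\<close> is the function \<open>I \<mapsto> \<omega>\<^sub>I\<close>, where
  \<open>dt\<^sub>I/t\<^sub>I\<close> is the wedge product of the \<open>dt\<^sub>i/t\<^sub>i\<close>, \<open>i \<in> I\<close>, in increasing order.
\<close>
type_synonym 'n laurent = "(int ^ 'n) \<Rightarrow>\<^sub>0 complex"
type_synonym 'n laurent_tau = "int \<Rightarrow>\<^sub>0 'n laurent"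
type_synonym ('n, 'r) form = "'n set \<Rightarrow> 'r"

definition const_L :: "complex \<Rightarrow> 'n::finite laurent" where
  "const_L c = Poly_Mapping.single 0 c"

definition tau :: "int \<Rightarrow> 'n::finite laurent_tau" where
  "tau i = Poly_Mapping.single i 1"

definition incl :: "'n::finite laurent \<Rightarrow> 'n laurent_tau" where
  "incl g = Poly_Mapping.single 0 g"

text \<open>\<open>t\<^sub>j \<partial>/\<partial>t\<^sub>j\<close> on \<open>\<complex>[t\<^sup>\<plusminus>\<^sup>1]\<close> and on \<open>\<complex>[t\<^sup>\<plusminus>\<^sup>1][\<tau>\<^sup>\<plusminus>\<^sup>1]\<close>, and \<open>\<partial>/\<partial>\<tau>\<close>.\<close>
definition log_deriv :: "'n::finite \<Rightarrow> 'n laurent \<Rightarrow> 'n laurent" where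
  "log_deriv j g =
     (\<Sum>w\<in>Poly_Mapping.keys g. Poly_Mapping.single w (of_int (w $ j) * Poly_Mapping.lookup g w))"

definition log_deriv_tau :: "'n::finite \<Rightarrow> 'n laurent_tau \<Rightarrow> 'n laurent_tau" where
  "log_deriv_tau j = Poly_Mapping.map (log_deriv j)"

definition d_tau :: "'n::finite laurent_tau \<Rightarrow> 'n laurent_tau" where
  "d_tau h =
     (\<Sum>i\<in>Poly_Mapping.keys h. Poly_Mapping.single (i - 1) (of_int i * Poly_Mapping.lookup h i))"

text \<open>\<open>(\<omega>\<^sub>I) \<mapsto> \<Sum>\<^sub>j\<Sum>\<^sub>I \<delta>\<^sub>j(\<omega>\<^sub>I) dt\<^sub>j/t\<^sub>j \<and> dt\<^sub>I/t\<^sub>I\<close>.\<close>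
definition ext_op ::
    "('n::{finite,linorder} \<Rightarrow> 'r \<Rightarrow> 'r) \<Rightarrow> ('n, 'r::comm_ring_1) form \<Rightarrow> ('n, 'r) form" where
  "ext_op \<delta> \<omega> = (\<lambda>I. \<Sum>j\<in>I. (-1) ^ card {i \<in> I. i < j} * \<delta> j (\<omega> (I - {j})))"

definition df_wedge :: "'n::{finite,linorder} laurent \<Rightarrow> ('n, 'n laurent) form \<Rightarrow> ('n, 'n laurent) form" where
  "df_wedge f = ext_op (\<lambda>j g. log_deriv j f * g)"

definition df_wedge_tau ::
    "'n::{finite,linorder} laurent \<Rightarrow> ('n, 'n laurent_tau) form \<Rightarrow> ('n, 'n laurent_tau) form" where
  "df_wedge_tau f = ext_op (\<lambda>j g. incl (log_deriv j f) * g)"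

text \<open>\<open>\<theta>d - df\<and>\<close>, with \<open>\<theta> = \<tau>\<^sup>-\<^sup>1\<close>.\<close>
definition twisted_d ::
    "'n::{finite,linorder} laurent \<Rightarrow> ('n, 'n laurent_tau) form \<Rightarrow> ('n, 'n laurent_tau) form" where
  "twisted_d f \<omega> = (\<lambda>I. tau (-1) * ext_op log_deriv_tau \<omega> I - df_wedge_tau f \<omega> I)"

definition nabla_tau ::
    "'n::finite laurent \<Rightarrow> ('n, 'n laurent_tau) form \<Rightarrow> ('n, 'n laurent_tau) form" where
  "nabla_tau f \<omega> = (\<lambda>I. d_tau (\<omega> I) - incl f * \<omega> I)"

definition forms :: "int \<Rightarrow> ('n::finite, 'r::zero) form set" where
  "forms k = {\<omega>. \<forall>I. int (card I) \<noteq> k \<longrightarrow> \<omega> I = 0}"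

definition form_space :: "(complex \<Rightarrow> 'r) \<Rightarrow> int \<Rightarrow> (complex, ('n::finite, 'r::comm_ring_1) form) module" where
  "form_space \<iota> k =
     \<lparr>carrier = forms k, mult = undefined, one = undefined, zero = (\<lambda>I. 0),
      add = (\<lambda>\<omega> \<eta> I. \<omega> I + \<eta> I), smult = (\<lambda>c \<omega> I. \<iota> c * \<omega> I)\<rparr>"

abbreviation Om :: "int \<Rightarrow> (complex, ('n::finite, 'n laurent) form) module" where
  "Om \<equiv> form_space const_L"

abbreviation Om_tau :: "int \<Rightarrow> (complex, ('n::finite, 'n laurent_tau) form) module" where
  "Om_tau \<equiv> form_space (\<lambda>c. incl (const_L c))"

definition top_form :: "'r::zero \<Rightarrow> ('n, 'r) form" where
  "top_form g = (\<lambda>I. if I = UNIV then g else 0)"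

subsection \<open>Newton filtration\<close>

definition newton :: "(real ^ 'n) set \<Rightarrow> real \<Rightarrow> 'n laurent set" where
  "newton P \<alpha> = {g. \<forall>w\<in>Poly_Mapping.keys g. degP P (emb w) \<le> \<alpha>}"

definition newton_forms :: "(real ^ 'n::finite) set \<Rightarrow> int \<Rightarrow> real \<Rightarrow> ('n, 'n laurent) form set" where
  "newton_forms P k \<alpha> = {\<omega> \<in> forms k. \<forall>I. \<omega> I \<in> newton P (\<alpha> + of_int k - CARD('n))}"

definition newton_forms_tau ::
    "(real ^ 'n::finite) set \<Rightarrow> int \<Rightarrow> real \<Rightarrow> ('n, 'n laurent_tau) form set" where
  "newton_forms_tau P k \<alpha> =
     {\<omega>. \<forall>i. (\<lambda>I. Poly_Mapping.lookup (\<omega> I) i) \<in> newton_forms P k (\<alpha> + of_int i)}"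

text \<open>\<open>\<rat>\<close> below is the set of rationals as a subset of the reals; it indexes the Newton filtration.\<close>
abbreviation GrOm :: "(real ^ 'n::finite) set \<Rightarrow> int \<Rightarrow> real \<Rightarrow> (complex, ('n, 'n laurent) form set) module" where
  "GrOm P k \<equiv> gr \<rat> (Om k) (newton_forms P k)"

abbreviation GrOm_tau ::
    "(real ^ 'n::finite) set \<Rightarrow> int \<Rightarrow> real \<Rightarrow> (complex, ('n, 'n laurent_tau) form set) module" where
  "GrOm_tau P k \<equiv> gr \<rat> (Om_tau k) (newton_forms_tau P k)"


section \<open>The pieces indexed by the box\<close>

definition A_box :: "(real ^ 'n) set \<Rightarrow> int ^ 'n \<Rightarrow> 'n laurent set" where
  "A_box P u = {g. Poly_Mapping.keys g \<subseteq> box_fibre P u}"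

definition box_forms :: "(real ^ 'n) set \<Rightarrow> int ^ 'n \<Rightarrow> ('n, 'n laurent) form set" where
  "box_forms P u = {\<omega>. \<forall>I. \<omega> I \<in> A_box P u}"

definition box_forms_tau :: "(real ^ 'n) set \<Rightarrow> int ^ 'n \<Rightarrow> ('n, 'n laurent_tau) form set" where
  "box_forms_tau P u = {\<omega>. \<forall>I i. Poly_Mapping.lookup (\<omega> I) i \<in> A_box P u}"

definition laurent_f :: "(real ^ 'n) set \<Rightarrow> (int ^ 'n \<Rightarrow> complex) \<Rightarrow> 'n laurent" where
  "laurent_f P a = (\<Sum>v\<in>verts P. Poly_Mapping.single v (a v))"

subsection \<open>The complex with differential \<open>-df\<and>\<close> and its top cohomology\<close>

definition Om_bar ::
    "(real ^ 'n::finite) set \<Rightarrow> int ^ 'n \<Rightarrow> int \<Rightarrow> (complex, real \<Rightarrow> ('n, 'n laurent) form set) module" where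
  "Om_bar P u k = (direct_sum \<rat> (GrOm P k))
     \<lparr>carrier := {x \<in> carrier (direct_sum \<rat> (GrOm P k)).
        \<forall>\<alpha>\<in>\<rat>. x \<alpha> \<in> gr_image \<rat> (Om k) (newton_forms P k) \<alpha> (box_forms P u)}\<rparr>"

text \<open>
  With the shift by \<open>k - n\<close> in \<open>\<N>\<^sub>\<alpha>\<Omega>\<^sup>k\<close>, the operator \<open>df\<and>\<close> maps \<open>\<N>\<^sub>\<alpha>\<Omega>\<^sup>k\<close> to \<open>\<N>\<^sub>\<alpha>\<Omega>\<^sup>k\<^sup>+\<^sup>1\<close>, whereas
  multiplication by \<open>f\<close> maps \<open>\<N>\<^sub>\<alpha>\<Omega>\<^sup>k\<close> to \<open>\<N>\<^sub>\<alpha>\<^sub>+\<^sub>1\<Omega>\<^sup>k\<close>.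
\<close>
definition d_bar ::
    "(real ^ 'n::{finite,linorder}) set \<Rightarrow> (int ^ 'n::_ \<Rightarrow> complex) \<Rightarrow> int \<Rightarrow>
     (real \<Rightarrow> ('n, 'n laurent) form set) \<Rightarrow> real \<Rightarrow> ('n, 'n laurent) form set" where
  "d_bar P a k x = (\<lambda>\<alpha>\<in>\<rat>. induced (Om (k + 1)) (filt_below \<rat> (newton_forms P (k + 1)) \<alpha>)
     (\<lambda>\<omega> I. - df_wedge (laurent_f P a) \<omega> I) (x \<alpha>))"

definition f_bar ::
    "(real ^ 'n::finite) set \<Rightarrow> (int ^ 'n \<Rightarrow> complex) \<Rightarrow> int \<Rightarrow>
     (real \<Rightarrow> ('n, 'n laurent) form set) \<Rightarrow> real \<Rightarrow> ('n, 'n laurent) form set" where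
  "f_bar P a k x = (\<lambda>\<alpha>\<in>\<rat>. induced (Om k) (filt_below \<rat> (newton_forms P k) \<alpha>)
     (\<lambda>\<omega> I. laurent_f P a * \<omega> I) (x (\<alpha> - 1)))"

definition JN ::
    "(real ^ 'n::{finite,linorder}) set \<Rightarrow> (int ^ 'n::_ \<Rightarrow> complex) \<Rightarrow> int ^ 'n::_ \<Rightarrow>
     (complex, (real \<Rightarrow> ('n, 'n laurent) form set) set) module" where
  "JN P a u = cohomology (Om_bar P u) (d_bar P a) CARD('n)"

definition JN_class ::
    "(real ^ 'n::{finite,linorder}) set \<Rightarrow> (int ^ 'n::_ \<Rightarrow> complex) \<Rightarrow> int ^ 'n::_ \<Rightarrow>
     (real \<Rightarrow> ('n, 'n laurent) form set) \<Rightarrow> (real \<Rightarrow> ('n, 'n laurent) form set) set" where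
  "JN_class P a u x = coboundaries (Om_bar P u) (d_bar P a) CARD('n) +>\<^bsub>Om_bar P u CARD('n)\<^esub> x"

definition JN_graded ::
    "(real ^ 'n::{finite,linorder}) set \<Rightarrow> (int ^ 'n::_ \<Rightarrow> complex) \<Rightarrow> int ^ 'n::_ \<Rightarrow> real \<Rightarrow>
     (real \<Rightarrow> ('n, 'n laurent) form set) set set" where
  "JN_graded P a u \<alpha> = JN_class P a u `
     (carrier (Om_bar P u CARD('n)) \<inter> dsum_component \<rat> (GrOm P CARD('n)) \<alpha>)"

definition JN_f ::
    "(real ^ 'n::{finite,linorder}) set \<Rightarrow> (int ^ 'n::_ \<Rightarrow> complex) \<Rightarrow> int ^ 'n::_ \<Rightarrow>
     (real \<Rightarrow> ('n, 'n laurent) form set) set \<Rightarrow> (real \<Rightarrow> ('n, 'n laurent) form set) set" where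
  "JN_f P a u = induced (Om_bar P u CARD('n)) (coboundaries (Om_bar P u) (d_bar P a) CARD('n))
     (f_bar P a CARD('n))"

subsection \<open>The complex with differential \<open>\<theta>d - df\<and>\<close> and its top cohomology\<close>

definition Om_u ::
    "(real ^ 'n::finite) set \<Rightarrow> int ^ 'n \<Rightarrow> int \<Rightarrow> (complex, ('n, 'n laurent_tau) form set) module" where
  "Om_u P u k = (GrOm_tau P k (frac (degP P (emb u))))
     \<lparr>carrier := gr_image \<rat> (Om_tau k) (newton_forms_tau P k) (frac (degP P (emb u)))
        (box_forms_tau P u)\<rparr>"

definition d_u ::
    "(real ^ 'n::{finite,linorder}) set \<Rightarrow> (int ^ 'n::_ \<Rightarrow> complex) \<Rightarrow> int ^ 'n::_ \<Rightarrow> int \<Rightarrow>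
     ('n, 'n laurent_tau) form set \<Rightarrow> ('n, 'n laurent_tau) form set" where
  "d_u P a u k = induced (Om_tau (k + 1))
     (filt_below \<rat> (newton_forms_tau P (k + 1)) (frac (degP P (emb u))))
     (twisted_d (laurent_f P a))"

definition Hu ::
    "(real ^ 'n::{finite,linorder}) set \<Rightarrow> (int ^ 'n::_ \<Rightarrow> complex) \<Rightarrow> int ^ 'n::_ \<Rightarrow>
     (complex, ('n, 'n laurent_tau) form set set) module" where
  "Hu P a u = cohomology (Om_u P u) (d_u P a u) CARD('n)"

definition Hu_class ::
    "(real ^ 'n::{finite,linorder}) set \<Rightarrow> (int ^ 'n::_ \<Rightarrow> complex) \<Rightarrow> int ^ 'n::_ \<Rightarrow>
     ('n, 'n laurent_tau) form set \<Rightarrow> ('n, 'n laurent_tau) form set set" where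
  "Hu_class P a u X = coboundaries (Om_u P u) (d_u P a u) CARD('n) +>\<^bsub>Om_u P u CARD('n)\<^esub> X"

text \<open>\<open>N = -(\<tau>\<nabla> + {deg u})\<close> on forms, on the graded piece, and on \<open>H(u)\<close>.\<close>
definition N_forms ::
    "(real ^ 'n::finite) set \<Rightarrow> (int ^ 'n \<Rightarrow> complex) \<Rightarrow> int ^ 'n \<Rightarrow>
     ('n, 'n laurent_tau) form \<Rightarrow> ('n, 'n laurent_tau) form" where
  "N_forms P a u \<omega> = (\<lambda>I. - (tau 1 * nabla_tau (laurent_f P a) \<omega> I
       + incl (const_L (complex_of_real (frac (degP P (emb u))))) * \<omega> I))"

definition N_gr ::
    "(real ^ 'n::finite) set \<Rightarrow> (int ^ 'n \<Rightarrow> complex) \<Rightarrow> int ^ 'n \<Rightarrow>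
     ('n, 'n laurent_tau) form set \<Rightarrow> ('n, 'n laurent_tau) form set" where
  "N_gr P a u = induced (Om_tau CARD('n))
     (filt_below \<rat> (newton_forms_tau P CARD('n)) (frac (degP P (emb u)))) (N_forms P a u)"

definition N_H ::
    "(real ^ 'n::{finite,linorder}) set \<Rightarrow> (int ^ 'n::_ \<Rightarrow> complex) \<Rightarrow> int ^ 'n::_ \<Rightarrow>
     ('n, 'n laurent_tau) form set set \<Rightarrow> ('n, 'n laurent_tau) form set set" where
  "N_H P a u = induced (Om_u P u CARD('n)) (coboundaries (Om_u P u) (d_u P a u) CARD('n))
     (N_gr P a u)"

definition Phi ::
    "(real ^ 'n::{finite,linorder}) set \<Rightarrow> (int ^ 'n::_ \<Rightarrow> complex) \<Rightarrow> int ^ 'n::_ \<Rightarrow> int \<Rightarrow>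
     ('n, 'n laurent_tau) form set set set" where
  "Phi P a u p = Hu_class P a u `
     gr_image \<rat> (Om_tau CARD('n)) (newton_forms_tau P CARD('n)) (frac (degP P (emb u)))
       (box_forms_tau P u \<inter> {\<omega>. \<forall>I. \<forall>i\<in>Poly_Mapping.keys (\<omega> I). i \<le> p})"

abbreviation GrPhi_piece ::
    "(real ^ 'n::{finite,linorder}) set \<Rightarrow> (int ^ 'n::_ \<Rightarrow> complex) \<Rightarrow> int ^ 'n::_ \<Rightarrow> int \<Rightarrow>
     (complex, ('n, 'n laurent_tau) form set set set) module" where
  "GrPhi_piece P a u \<equiv> gr UNIV (Hu P a u) (Phi P a u)"

definition GrPhi ::
    "(real ^ 'n::{finite,linorder}) set \<Rightarrow> (int ^ 'n::_ \<Rightarrow> complex) \<Rightarrow> int ^ 'n::_ \<Rightarrow>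
     (complex, int \<Rightarrow> ('n, 'n laurent_tau) form set set set) module" where
  "GrPhi P a u = direct_sum UNIV (GrPhi_piece P a u)"

definition N_GrPhi ::
    "(real ^ 'n::{finite,linorder}) set \<Rightarrow> (int ^ 'n::_ \<Rightarrow> complex) \<Rightarrow> int ^ 'n::_ \<Rightarrow>
     (int \<Rightarrow> ('n, 'n laurent_tau) form set set set) \<Rightarrow> int \<Rightarrow> ('n, 'n laurent_tau) form set set set" where
  "N_GrPhi P a u x = (\<lambda>p. induced (Hu P a u) (filt_below UNIV (Phi P a u) p) (N_H P a u) (x (p - 1)))"


section \<open>The canonical maps on monomials\<close>

text \<open>The class in \<open>Gr\<^sup>\<Phi>\<^sub>p H(u)\<close> of \<open>\<tau>\<^sup>p t\<^sup>w dt\<^sub>1/t\<^sub>1 \<and> \<dots> \<and> dt\<^sub>n/t\<^sub>n\<close>.\<close>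
definition GrPhi_monom ::
    "(real ^ 'n::{finite,linorder}) set \<Rightarrow> (int ^ 'n::_ \<Rightarrow> complex) \<Rightarrow> int ^ 'n::_ \<Rightarrow> int \<Rightarrow> int ^ 'n::_ \<Rightarrow>
     int \<Rightarrow> ('n, 'n laurent_tau) form set set set" where
  "GrPhi_monom P a u p w = dsum_single UNIV (GrPhi_piece P a u) p
     (gr_class UNIV (Hu P a u) (Phi P a u) p
       (Hu_class P a u
         (gr_class \<rat> (Om_tau CARD('n)) (newton_forms_tau P CARD('n)) (frac (degP P (emb u)))
           (top_form (Poly_Mapping.single p (Poly_Mapping.single w 1))))))"

text \<open>The class in \<open>J(u)\<close> of \<open>t\<^sup>w dt\<^sub>1/t\<^sub>1 \<and> \<dots> \<and> dt\<^sub>n/t\<^sub>n\<close>.\<close>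
definition JN_monom ::
    "(real ^ 'n::{finite,linorder}) set \<Rightarrow> (int ^ 'n::_ \<Rightarrow> complex) \<Rightarrow> int ^ 'n::_ \<Rightarrow> int ^ 'n::_ \<Rightarrow>
     (real \<Rightarrow> ('n, 'n laurent) form set) set" where
  "JN_monom P a u w = JN_class P a u
     (dsum_single \<rat> (GrOm P CARD('n)) (degP P (emb w))
       (gr_class \<rat> (Om CARD('n)) (newton_forms P CARD('n)) (degP P (emb w))
         (top_form (Poly_Mapping.single w 1))))"

text \<open>
  The coordinate \<open>\<lambda>\<^sub>v\<close> of \<open>x = \<Sum> \<lambda>\<^sub>v v\<close> with respect to the generators of a cone of the fan
  containing \<open>x\<close> (and 0 if \<open>v\<close> is not a generator of it): the conewise linear function with value
  1 at the vertex \<open>v\<close> and 0 at the other vertices.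
\<close>
definition courant :: "(real ^ 'n) set \<Rightarrow> int ^ 'n \<Rightarrow> real ^ 'n \<Rightarrow> real" where
  "courant P v x = (THE l. \<exists>\<sigma>\<in>fan P. x \<in> \<sigma> \<and>
     (\<exists>c. (\<forall>v'. v' \<notin> gens P \<sigma> \<longrightarrow> c v' = 0) \<and> x = (\<Sum>v'\<in>gens P \<sigma>. c v' *\<^sub>R emb v') \<and> l = c v))"

text \<open>
  For \<open>w = u + \<Sum> m\<^sub>v v\<close> with \<open>\<lfloor>w\<rfloor> = \<Sum> m\<^sub>v v\<close>, the class in \<open>H(\<Sigma>\<^sub>P(u))\<close> of the conewise polynomial
  \<open>\<Prod> (\<phi>\<^sub>v/a\<^sub>v)\<close> to the powers \<open>m\<^sub>v\<close>, \<open>\<phi>\<^sub>v\<close> being the Courant functions. Thus \<open>a\<^sub>v t\<^sup>v\<close> acts as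
  \<open>\<phi>\<^sub>v\<close>, hence \<open>f\<close> as \<open>deg\<^sub>P = \<Sum>\<^sub>v \<phi>\<^sub>v\<close> and \<open>t\<^sub>j\<partial>f/\<partial>t\<^sub>j\<close> as the \<open>j\<close>th coordinate \<open>\<Sum>\<^sub>v v\<^sub>j \<phi>\<^sub>v\<close>.
\<close>
definition HS_monom ::
    "(real ^ 'n) set \<Rightarrow> (int ^ 'n \<Rightarrow> complex) \<Rightarrow> int ^ 'n \<Rightarrow> int ^ 'n \<Rightarrow> (real ^ 'n \<Rightarrow> complex) set" where
  "HS_monom P a u w = HS_class (star_fan P u)
     (\<lambda>x. \<Prod>v\<in>verts P. (complex_of_real (courant P v x) / a v) ^ nat \<lfloor>courant P v (emb w)\<rfloor>)"

end

theory Submission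
  imports Defs "HOL-Library.Function_Algebras"
begin

text \<open>
  All four spaces are quotients of one polynomial ring \<open>R\<close> in variables \<open>x\<^sub>v\<close> indexed by the vertices,
  where \<open>x\<^sup>m = \<Prod> x\<^sub>v\<close> to the powers \<open>m\<^sub>v\<close> stands for \<open>a\<^sup>m t\<^sup>w\<close> with \<open>w = u + \<Sum> m\<^sub>v v\<close>, and for \<open>\<tau>\<close> to
  the power \<open>\<Sum> m\<^sub>v + \<lfloor>deg u\<rfloor>\<close> times that in \<open>H(u)\<close>. The monomials whose support does not span a cone
  together with \<open>\<sigma>(u)\<close> span the ideal of relations in \<open>Gr A\<^sub>P(u)\<close> and in \<open>\<A>(\<Sigma>\<^sub>P(u))\<close>, and
  \<open>t\<^sub>j \<partial>f/\<partial>t\<^sub>j\<close> and \<open>f\<close> act as the linear forms \<open>L\<^sub>j = \<Sum> v\<^sub>j x\<^sub>v\<close> and \<open>\<epsilon> = \<Sum> x\<^sub>v\<close>; hence \<open>J(u)\<close> and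
  \<open>H(\<Sigma>\<^sub>P(u))\<close> are the same quotient of \<open>R\<close>.

  With \<open>u = \<Sum> \<lambda>\<^sub>v v\<close>, the differential and \<open>N\<close> act on \<open>x\<^sup>m\<close> in \<open>H(u)\<close> as \<open>- \<Sum> v\<^sub>j (x\<^sub>v - \<lambda>\<^sub>v - m\<^sub>v)\<close> and
  \<open>\<Sum> (x\<^sub>v - \<lambda>\<^sub>v - m\<^sub>v)\<close>. The unitriangular map \<open>\<Psi>\<close> sending \<open>x\<^sup>m\<close> to the product of the Pochhammer
  symbols \<open>(x\<^sub>v + \<lambda>\<^sub>v)(x\<^sub>v + \<lambda>\<^sub>v + 1)\<cdots>(x\<^sub>v + \<lambda>\<^sub>v + m\<^sub>v - 1)\<close> preserves the monomial ideal and conjugates these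
  operators into multiplication by \<open>- L\<^sub>j\<close> and \<open>\<epsilon>\<close>. So \<open>\<Psi>\<close> induces \<open>(H(u), N) \<cong> (J(u), [f])\<close>, and since its
  leading part is the identity it also shows that \<open>Gr\<^sup>\<Phi> H(u)\<close> is \<open>J(u)\<close>, without any regularity of
  the sequence \<open>L\<^sub>j\<close>.
\<close>

section \<open>Coordinates on the fan\<close>

text \<open>The shifts are eigenvalues. \<open>t_j \<partial>/\<partial>t_j\<close> multiplies
  \<open>t^w\<close> by \<open>w_j = \<Sum> v_j (\<lambda>_v + m_v)\<close>, and
  \<open>\<tau> \<partial>/\<partial>\<tau> + {deg u}\<close> multiplies \<open>\<tau>^i t^w\<close>
  by \<open>i + {deg u}\<close>, which is \<open>deg w = \<Sum> (\<lambda>_v + m_v)\<close> for the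
  exponent \<open>i\<close> carried by \<open>x^m\<close>. All operators thus have the same shape
  with different coefficients, and one map straightens them together. The recursion
  \<open>\<Psi>(x_v x^m) = (x_v + \<lambda>_v + m_v) \<Psi>(x^m)\<close> is exactly what cancels the
  shift, which forces the Pochhammer products. \<open>\<Psi>\<close> lives on the free ring and has
  to descend. The constant \<open>\<lambda>_v + m_v\<close> can be nonzero only if \<open>v\<close>
  already lies in the support of \<open>x^m\<close> or is a ray of \<sigma>(u). Hence the support
  together with the rays of \<sigma>(u) never changes; this is why the star of \<sigma>(u) is the
  right complex. The other obstacle is that every space is an iterated quotient whose elements are
  sets of sets of cosets. \<open>presents\<close> describes each one as an honest additive group
  modulo an explicit kernel, so a further quotient merely enlarges the kernel.\<close>

lemma emb_add: "emb (x + y) = emb x + emb y"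
  and emb_diff: "emb (x - y) = emb x - emb y"
  and emb_zero [simp]: "emb 0 = 0"
  by (auto simp: emb_def vec_eq_iff)

lemma emb_eq_iff [simp]: "emb x = emb y \<longleftrightarrow> x = y"
  by (auto simp: emb_def vec_eq_iff)

lemma inj_emb: "inj_on emb A"
  by (simp add: inj_on_def)

lemma emb_sum: "emb (\<Sum>v\<in>A. g v) = (\<Sum>v\<in>A. emb (g v))"
  by (induction A rule: infinite_finite_induct) (auto simp: emb_add)

lemma emb_scale: "emb (k *s x) = real_of_int k *\<^sub>R emb x"
  by (auto simp: emb_def vec_eq_iff)

lemma Rats_sum: "(\<And>i. i \<in> A \<Longrightarrow> g i \<in> \<rat>) \<Longrightarrow> (\<Sum>i\<in>A. g i :: real) \<in> \<rat>"
  by (induction A rule: infinite_finite_induct) auto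

lemma Rats_prod: "(\<And>i. i \<in> A \<Longrightarrow> g i \<in> \<rat>) \<Longrightarrow> (\<Prod>i\<in>A. g i :: real) \<in> \<rat>"
  by (induction A rule: infinite_finite_induct) auto

section \<open>Faces and facets of the polytope\<close>

locale simplicial_polytope =
  fixes P :: "(real ^ 'n::finite) set"
  assumes simplicial: "lattice_simplicial P"
    and zero_interior: "0 \<in> interior P"
begin

abbreviation "V \<equiv> verts P"

definition facet_verts :: "(real ^ 'n) set \<Rightarrow> (int ^ 'n) set" where
  "facet_verts F = {v \<in> V. emb v \<in> F}"

text \<open>The boundary complex of \<open>P\<close> as an abstract simplicial complex. By
  \<open>fan_eq\<close> its members index the cones of the fan.\<close>

definition \<Delta> :: "(int ^ 'n) set set" where
  "\<Delta> = {T. \<exists>F. F facet_of P \<and> T \<subseteq> facet_verts F}"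

definition comb :: "(int ^ 'n \<Rightarrow> real) \<Rightarrow> real ^ 'n" where
  "comb c = (\<Sum>v\<in>V. c v *\<^sub>R emb v)"

lemma polytope: "polytope P"
  using simplicial by (simp add: lattice_simplicial_def)

lemma polyhedron: "polyhedron P"
  by (simp add: polytope polytope_imp_polyhedron)

lemma extreme_lattice: "x extreme_point_of P \<Longrightarrow> \<exists>v\<in>V. x = emb v"
  using simplicial by (auto simp: lattice_simplicial_def verts_def)

lemma finite_V: "finite V"
proof -
  have "finite (emb ` V)"
    by (rule finite_subset [OF _ finite_polyhedron_extreme_points [OF polyhedron]])
       (auto simp: verts_def)
  then show ?thesis
    by (simp add: finite_image_iff inj_emb)
qed

lemma V_subset_P: "v \<in> V \<Longrightarrow> emb v \<in> P"
  by (auto simp: verts_def extreme_point_of_def)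

lemma extreme_points_face:
  assumes "F face_of P"
  shows "{x. x extreme_point_of F} = emb ` facet_verts F"
  using assms extreme_lattice
  by (auto simp: extreme_point_of_face facet_verts_def verts_def image_iff)

lemma face_eq_hull:
  assumes "F face_of P"
  shows "F = convex hull (emb ` facet_verts F)"
proof -
  have "polytope F"
    using assms polytope face_of_polytope_polytope by blast
  then show ?thesis
    using Krein_Milman_Minkowski [of F] polytope_imp_compact polytope_imp_convex
    by (metis extreme_points_face [OF assms])
qed

lemma aff_dim_P: "aff_dim P = int CARD('n)"
  using zero_interior aff_dim_nonempty_interior [of P] by auto

text \<open>As 0 is interior, a functional that is at most 0 on \<open>P\<close> vanishes
  identically. So the bound defining a proper face is positive and can be scaled to 1. The
  functionals of the facets are the linear pieces of \<open>degP\<close>.\<close>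

lemma face_functional:
  assumes "F face_of P" "F \<noteq> P"
  shows "\<exists>h. (\<forall>x\<in>P. h \<bullet> x \<le> 1) \<and> F = {x \<in> P. h \<bullet> x = 1}"
proof -
  obtain a b where ab: "P \<subseteq> {x. a \<bullet> x \<le> b}" "F = P \<inter> {x. a \<bullet> x = b}"
    using iffD2 [OF exposed_face_of_polyhedron [OF polyhedron] assms(1)] unfolding exposed_face_of_def by blast
  have "0 \<in> P"
    using zero_interior interior_subset by blast
  then have "0 \<le> b"
    using ab(1) by auto
  moreover have "b \<noteq> 0"
  proof
    assume b: "b = 0"
    obtain e where e: "e > 0" "ball 0 e \<subseteq> P"
      using zero_interior by (auto simp: mem_interior)
    have "a = 0"
    proof (rule ccontr)
      assume "a \<noteq> 0"
      define y where "y = (e / 2 / norm a) *\<^sub>R a"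
      have "norm y < e"
        using e \<open>a \<noteq> 0\<close> by (simp add: y_def)
      then have "a \<bullet> y \<le> 0"
        using e ab(1) b by (auto simp: subset_iff)
      moreover have "a \<bullet> y > 0"
        using e \<open>a \<noteq> 0\<close> by (simp add: y_def)
      ultimately show False by simp
    qed
    then show False
      using ab assms b by auto
  qed
  ultimately have "b > 0" by simp
  then show ?thesis
    using ab by (intro exI [of _ "a /\<^sub>R b"]) (auto simp: field_simps)
qed

lemma facet_face: "F facet_of P \<Longrightarrow> F face_of P" "F facet_of P \<Longrightarrow> F \<noteq> P"
  by (auto simp: facet_of_def)

lemma exists_facet: "\<exists>F. F facet_of P"
  using polytope_facet_exists [OF polytope] aff_dim_P by auto

lemma finite_facet_verts: "finite (facet_verts F)"
  using finite_V by (simp add: facet_verts_def)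

text \<open>\<open>n\<close> points spanning an affine space of dimension \<open>n - 1\<close> are
  affinely independent. The span of a facet misses 0, which improves this to linear independence:
  the vertices of a facet are a basis of the ambient space.\<close>

lemma facet_independent:
  assumes F: "F facet_of P"
  shows "\<not> affine_dependent (emb ` facet_verts F)" "independent (emb ` facet_verts F)"
    "card (facet_verts F) = CARD('n)"
proof -
  have "aff_dim F = int CARD('n) - 1"
    using F aff_dim_P by (simp add: facet_of_def)
  moreover have c: "card (emb ` facet_verts F) = CARD('n)"
    using F simplicial by (simp add: lattice_simplicial_def extreme_points_face [OF facet_face(1), symmetric])
  then show "card (facet_verts F) = CARD('n)"
    by (simp add: card_image inj_emb)
  moreover have "aff_dim F = aff_dim (emb ` facet_verts F)"
    by (metis F face_eq_hull facet_face(1) aff_dim_convex_hull)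
  ultimately show ind: "\<not> affine_dependent (emb ` facet_verts F)"
    by (simp add: affine_independent_iff_card finite_facet_verts c)
  obtain h where h: "F = {x \<in> P. h \<bullet> x = 1}"
    using face_functional [OF facet_face [OF F]] by auto
  show "independent (emb ` facet_verts F)"
  proof
    assume "dependent (emb ` facet_verts F)"
    then obtain c where c: "(\<Sum>v\<in>emb ` facet_verts F. c v *\<^sub>R v) = 0" "\<exists>v\<in>emb ` facet_verts F. c v \<noteq> 0"
      using dependent_finite [of "emb ` facet_verts F"] finite_facet_verts by auto
    \<comment> \<open>Applying \<open>h\<close>, which is 1 on every vertex of the facet, makes the
      coefficients of a linear relation sum to 0, so the relation is an affine one.\<close>
    have "0 = h \<bullet> (\<Sum>v\<in>emb ` facet_verts F. c v *\<^sub>R v)"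
      by (simp add: c)
    also have "\<dots> = (\<Sum>v\<in>emb ` facet_verts F. c v)"
      unfolding inner_sum_right by (rule sum.cong) (auto simp: h facet_verts_def)
    finally have "affine_dependent (emb ` facet_verts F)"
      using c by (subst affine_dependent_explicit_finite) (auto simp: finite_facet_verts)
    then show False
      using ind by simp
  qed
qed

lemma \<Delta>_subset: "T \<in> \<Delta> \<Longrightarrow> T \<subseteq> V"
  by (auto simp: \<Delta>_def facet_verts_def)

lemma \<Delta>_mono: "T \<in> \<Delta> \<Longrightarrow> T' \<subseteq> T \<Longrightarrow> T' \<in> \<Delta>"
  by (auto simp: \<Delta>_def)

lemma \<Delta>_finite: "T \<in> \<Delta> \<Longrightarrow> finite T"
  using \<Delta>_subset finite_V finite_subset by blast

lemma empty_\<Delta>: "{} \<in> \<Delta>"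
  using exists_facet by (auto simp: \<Delta>_def)

section \<open>Conic coordinates with respect to the boundary complex\<close>

definition supported :: "(int ^ 'n \<Rightarrow> real) \<Rightarrow> bool" where
  "supported c \<longleftrightarrow> (\<forall>v. 0 \<le> c v) \<and> {v. c v \<noteq> 0} \<in> \<Delta>"

lemma comb_over:
  assumes "{v. c v \<noteq> 0} \<subseteq> T" "T \<subseteq> V"
  shows "comb c = (\<Sum>v\<in>T. c v *\<^sub>R emb v)"
  unfolding comb_def using assms finite_V by (intro sum.mono_neutral_right) auto

text \<open>Every vertex satisfies \<open>h \<bullet> v \<le> 1\<close>, with equality exactly on
  the facet, so the estimate is tight only for combinations supported there. Uniqueness of
  coordinates, the formula for \<open>degP\<close> and the equality case of its subadditivity all
  come from this.\<close>

lemma functional_comb: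
  assumes F: "F facet_of P" and c: "\<And>v. 0 \<le> c v"
    and h: "\<And>x. x \<in> P \<Longrightarrow> h \<bullet> x \<le> 1" "F = {x \<in> P. h \<bullet> x = 1}"
  shows "h \<bullet> comb c \<le> (\<Sum>v\<in>V. c v)"
    and "h \<bullet> comb c = (\<Sum>v\<in>V. c v) \<longleftrightarrow> {v \<in> V. c v \<noteq> 0} \<subseteq> facet_verts F"
proof -
  have *: "h \<bullet> comb c = (\<Sum>v\<in>V. c v * (h \<bullet> emb v))"
    by (simp add: comb_def inner_sum_right)
  have le: "c v * (h \<bullet> emb v) \<le> c v" if "v \<in> V" for v
    using h(1) [OF V_subset_P [OF that]] c [of v] by (simp add: mult_left_le)
  show "h \<bullet> comb c \<le> (\<Sum>v\<in>V. c v)"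
    unfolding * using le by (rule sum_mono)
  have "h \<bullet> comb c = (\<Sum>v\<in>V. c v) \<longleftrightarrow> (\<Sum>v\<in>V. c v - c v * (h \<bullet> emb v)) = 0"
    by (auto simp: * sum_subtractf)
  also have "\<dots> \<longleftrightarrow> (\<forall>v\<in>V. c v - c v * (h \<bullet> emb v) = 0)"
    using le finite_V by (intro sum_nonneg_eq_0_iff) (auto simp: algebra_simps)
  also have "\<dots> \<longleftrightarrow> {v \<in> V. c v \<noteq> 0} \<subseteq> facet_verts F"
    using V_subset_P by (auto simp: facet_verts_def h(2))
  finally show "h \<bullet> comb c = (\<Sum>v\<in>V. c v) \<longleftrightarrow> {v \<in> V. c v \<noteq> 0} \<subseteq> facet_verts F" .
qed

lemma facet_functional:
  assumes "F facet_of P"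
  obtains h where "\<And>x. x \<in> P \<Longrightarrow> h \<bullet> x \<le> 1" "F = {x \<in> P. h \<bullet> x = 1}"
  using face_functional [OF facet_face [OF assms]] by auto

lemma independent_coeffs:
  assumes "T \<in> \<Delta>" "(\<Sum>v\<in>T. c v *\<^sub>R emb v) = (\<Sum>v\<in>T. d v *\<^sub>R emb v)" "v \<in> T"
  shows "c v = d v"
proof -
  obtain F where F: "F facet_of P" "T \<subseteq> facet_verts F"
    using assms by (auto simp: \<Delta>_def)
  have "independent (emb ` T)"
    using facet_independent(2) [OF F(1)] F(2) by (meson image_mono independent_mono)
  moreover have "(\<Sum>w\<in>emb ` T. (c (inv_into UNIV emb w) - d (inv_into UNIV emb w)) *\<^sub>R w) = 0"
    using assms(2) by (subst sum.reindex) (auto simp: inj_emb algebra_simps sum_subtractf)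
  ultimately have "c (inv_into UNIV emb (emb v)) - d (inv_into UNIV emb (emb v)) = 0"
    using assms(3) \<Delta>_finite [OF assms(1)]
    by (intro independentD [of "emb ` T" "emb ` T" "\<lambda>w. c (inv_into UNIV emb w) - d (inv_into UNIV emb w)"]) auto
  then show ?thesis by (simp add: inj_emb)
qed

text \<open>Functionals of facets containing the two supports bound each coefficient sum by the
  other, so the sums agree. The equality case then puts both supports into one facet, whose vertices
  are independent.\<close>

lemma comb_unique:
  assumes c: "supported c" and d: "supported d" and eq: "comb c = comb d"
  shows "c = d"
proof -
  obtain F G where F: "F facet_of P" "{v. c v \<noteq> 0} \<subseteq> facet_verts F"
    and G: "G facet_of P" "{v. d v \<noteq> 0} \<subseteq> facet_verts G"
    using c d by (auto simp: supported_def \<Delta>_def)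
  obtain h where h: "\<And>x. x \<in> P \<Longrightarrow> h \<bullet> x \<le> 1" "F = {x \<in> P. h \<bullet> x = 1}"
    using facet_functional [OF F(1)] by blast
  obtain g where g: "\<And>x. x \<in> P \<Longrightarrow> g \<bullet> x \<le> 1" "G = {x \<in> P. g \<bullet> x = 1}"
    using facet_functional [OF G(1)] by blast
  have c0: "\<And>v. 0 \<le> c v" and d0: "\<And>v. 0 \<le> d v"
    using c d by (auto simp: supported_def)
  have "h \<bullet> comb c = sum c V" "g \<bullet> comb d = sum d V"
    using F G functional_comb(2) [OF F(1) c0 h] functional_comb(2) [OF G(1) d0 g] by auto
  moreover have "h \<bullet> comb d \<le> sum d V" "g \<bullet> comb c \<le> sum c V"
    using functional_comb(1) [OF F(1) d0 h] functional_comb(1) [OF G(1) c0 g] by auto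
  ultimately have "h \<bullet> comb d = sum d V"
    using eq by simp
  then have d_sub: "{v. d v \<noteq> 0} \<subseteq> facet_verts F"
    using functional_comb(2) [OF F(1) d0 h] G by (auto simp: facet_verts_def)
  have T: "facet_verts F \<in> \<Delta>" "facet_verts F \<subseteq> V"
    using F(1) by (auto simp: \<Delta>_def facet_verts_def)
  have "(\<Sum>v\<in>facet_verts F. c v *\<^sub>R emb v) = (\<Sum>v\<in>facet_verts F. d v *\<^sub>R emb v)"
    using eq comb_over [OF F(2) T(2)] comb_over [OF d_sub T(2)] by simp
  then have "c v = d v" if "v \<in> facet_verts F" for v
    using independent_coeffs T(1) that by blast
  then show ?thesis
    using F(2) d_sub by (intro ext) (metis (mono_tags) mem_Collect_eq subsetD)
qed

text \<open>The ray through \<open>x\<close> leaves \<open>P\<close> in a facet; the convex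
  coordinates of the exit point there are rescaled.\<close>

lemma comb_exists: "\<exists>c. supported c \<and> comb c = x"
proof (cases "x = 0")
  case True
  then show ?thesis
    using empty_\<Delta> by (intro exI [of _ "\<lambda>_. 0"]) (auto simp: supported_def comb_def)
next
  case False
  obtain d where d: "d > 0" "0 + d *\<^sub>R x \<in> frontier P"
    using ray_to_frontier [OF polytope_imp_bounded [OF polytope] zero_interior False] by metis
  \<comment> \<open>\<open>P\<close> is full-dimensional, so its frontier is its relative boundary
    and hence the union of its facets.\<close>
  have "frontier P = P - rel_interior P"
    using zero_interior polytope_imp_closed [OF polytope] rel_interior_nonempty_interior [of P]
    by (auto simp: frontier_def)
  then obtain F where F: "F facet_of P" "d *\<^sub>R x \<in> F"
    using d rel_boundary_of_polyhedron [OF polyhedron] by auto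
  then have "d *\<^sub>R x \<in> convex hull (emb ` facet_verts F)"
    using face_eq_hull [OF facet_face(1)] by metis
  then obtain e where e: "\<forall>w\<in>emb ` facet_verts F. 0 \<le> e w" "(\<Sum>w\<in>emb ` facet_verts F. e w *\<^sub>R w) = d *\<^sub>R x"
    using convex_hull_finite [of "emb ` facet_verts F"] finite_facet_verts by auto
  define c where "c v = (if v \<in> facet_verts F then e (emb v) / d else 0)" for v
  have sub: "{v. c v \<noteq> 0} \<subseteq> facet_verts F" "facet_verts F \<subseteq> V"
    by (auto simp: c_def facet_verts_def)
  have "(\<Sum>w\<in>facet_verts F. e (emb w) *\<^sub>R emb w) = d *\<^sub>R x"
    using e(2) by (subst (asm) sum.reindex) (auto simp: inj_emb)
  then have "d *\<^sub>R comb c = d *\<^sub>R x"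
    using d by (simp add: comb_over [OF sub] scaleR_sum_right c_def)
  then have "comb c = x"
    using d by simp
  moreover have "supported c"
    using F(1) e(1) d sub by (auto simp: supported_def \<Delta>_def c_def)
  ultimately show ?thesis by blast
qed

text \<open>As a function of \<open>x\<close> for a fixed vertex this is the Courant function, see
  \<open>courant_eq\<close>.\<close>

definition lam :: "real ^ 'n \<Rightarrow> int ^ 'n \<Rightarrow> real" where
  "lam x = (THE c. supported c \<and> comb c = x)"

lemma lam: "supported (lam x)" "comb (lam x) = x"
proof -
  have "\<exists>!c. supported c \<and> comb c = x"
    using comb_exists comb_unique by metis
  from theI' [OF this] show "supported (lam x)" "comb (lam x) = x"
    unfolding lam_def by simp_all
qed

lemma lam_eqI: "supported c \<Longrightarrow> comb c = x \<Longrightarrow> lam x = c"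
  by (metis comb_unique lam)

lemma lam_nonneg: "0 \<le> lam x v"
  using lam(1) by (auto simp: supported_def)

definition lsupp :: "real ^ 'n \<Rightarrow> (int ^ 'n) set" where
  "lsupp x = {v. lam x v \<noteq> 0}"

lemma lsupp_\<Delta>: "lsupp x \<in> \<Delta>"
  using lam(1) by (auto simp: supported_def lsupp_def)

lemma lam_outside: "v \<notin> V \<Longrightarrow> lam x v = 0"
  using \<Delta>_subset [OF lsupp_\<Delta>] by (auto simp: lsupp_def)

lemma supported_subset: "(\<And>v. 0 \<le> c v) \<Longrightarrow> {v. c v \<noteq> 0} \<subseteq> T \<Longrightarrow> T \<in> \<Delta> \<Longrightarrow> supported c"
  using \<Delta>_mono by (auto simp: supported_def)

lemma vertex_\<Delta>: 
  assumes "v \<in> V"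
  shows "{v} \<in> \<Delta>"
proof -
  have "{emb v} face_of P"
    using assms by (simp add: verts_def face_of_singleton)
  moreover have "{emb v} \<noteq> P"
    using aff_dim_P aff_dim_sing [of "emb v"] by auto
  ultimately obtain F where "F facet_of P" "{emb v} \<subseteq> F"
    using face_of_polyhedron_subset_facet [OF polyhedron, of "{emb v}"] by blast
  then show ?thesis
    using assms by (auto simp: \<Delta>_def facet_verts_def)
qed

lemma comb_single: "v \<in> V \<Longrightarrow> comb (\<lambda>w. if w = v then t else 0) = t *\<^sub>R emb v"
  using finite_V by (simp add: comb_def if_distrib [of "\<lambda>c. c *\<^sub>R _"] cong: if_cong)

lemma comb_add: "comb (\<lambda>v. c v + d v) = comb c + comb d"
  by (simp add: comb_def algebra_simps sum.distrib)

lemma comb_scale: "comb (\<lambda>v. t * c v) = t *\<^sub>R comb c"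
  by (simp add: comb_def scaleR_sum_right)

lemma lam_vertex: "v \<in> V \<Longrightarrow> lam (emb v) = (\<lambda>w. if w = v then 1 else 0)"
  using comb_single [of v 1] supported_subset [OF _ _ vertex_\<Delta>, of "\<lambda>w. if w = v then 1 else 0" v]
  by (intro lam_eqI) auto

lemma lam_zero: "lam 0 = (\<lambda>_. 0)"
  using empty_\<Delta> by (intro lam_eqI) (auto simp: supported_def comb_def)

lemma lam_scale: "0 \<le> t \<Longrightarrow> lam (t *\<^sub>R x) = (\<lambda>v. t * lam x v)"
  using supported_subset [OF _ _ lsupp_\<Delta>, of "\<lambda>v. t * lam x v" x]
  by (intro lam_eqI) (auto simp: comb_scale lam lam_nonneg lsupp_def)

lemma lam_add:
  assumes "lsupp x \<union> lsupp y \<in> \<Delta>"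
  shows "lam (x + y) = (\<lambda>v. lam x v + lam y v)"
proof (rule lam_eqI)
  have "{v. lam x v + lam y v \<noteq> 0} \<subseteq> lsupp x \<union> lsupp y"
    by (auto simp: lsupp_def)
  then show "supported (\<lambda>v. lam x v + lam y v)"
    using assms by (intro supported_subset [of _ "lsupp x \<union> lsupp y"]) (auto simp: lam_nonneg)
qed (simp add: comb_add lam)

text \<open>Scaling the coordinates to sum 1 writes \<open>x\<close> as a multiple of a convex
  combination of vertices. No smaller factor works: on the cone of \<open>x\<close> the sum is the
  value of a facet functional \<open>h\<close>, and \<open>h \<le> 1\<close> on \<open>P\<close>
  gives \<open>h \<bullet> x \<le> l\<close> for every \<open>x\<close> in
  \<open>l P\<close>.\<close>

lemma degP_eq: "degP P x = (\<Sum>v\<in>V. lam x v)"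
proof -
  let ?s = "\<Sum>v\<in>V. lam x v"
  obtain F where F: "F facet_of P" "lsupp x \<subseteq> facet_verts F"
    using lsupp_\<Delta> by (auto simp: \<Delta>_def)
  obtain h where h: "\<And>x. x \<in> P \<Longrightarrow> h \<bullet> x \<le> 1" "F = {x \<in> P. h \<bullet> x = 1}"
    using facet_functional [OF F(1)] by blast
  have hx: "h \<bullet> x = ?s"
    using functional_comb(2) [where c = "lam x", OF F(1) lam_nonneg h] F(2) by (auto simp: lam lsupp_def)
  have P0: "0 \<in> P"
    using zero_interior interior_subset by blast
  have s0: "0 \<le> ?s"
    by (simp add: sum_nonneg lam_nonneg)
  have "x \<in> (\<lambda>y. ?s *\<^sub>R y) ` P"
  proof (cases "?s = 0")
    case True
    then have "lam x v = 0" if "v \<in> V" for v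
      using that finite_V by (metis sum_nonneg_eq_0_iff lam_nonneg)
    then have "x = 0"
      using lam(2) [of x] by (simp add: comb_def)
    then show ?thesis
      using P0 by (simp add: True image_iff) blast
  next
    case False
    have "(\<Sum>v\<in>V. (lam x v / ?s) *\<^sub>R emb v) \<in> P"
      using False s0 finite_V V_subset_P polytope_imp_convex [OF polytope]
      by (intro convex_sum) (auto simp: sum_divide_distrib [symmetric] lam_nonneg)
    moreover have "x = ?s *\<^sub>R (\<Sum>v\<in>V. (lam x v / ?s) *\<^sub>R emb v)"
      using False lam(2) [of x] by (simp add: scaleR_sum_right comb_def)
    ultimately show ?thesis by blast
  qed
  moreover have "?s \<le> l" if l: "0 \<le> l" "x \<in> (\<lambda>y. l *\<^sub>R y) ` P" for l
  proof -
    obtain y where "y \<in> P" "x = l *\<^sub>R y"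
      using l by auto
    then show ?thesis
      using h(1) [of y] hx l by (metis inner_scaleR_right mult_left_le)
  qed
  ultimately show ?thesis
    unfolding degP_def using s0 by (intro Least_equality) auto
qed

text \<open>Take the functional of a facet whose cone contains \<open>x + y\<close>. It is below
  \<open>degP\<close> everywhere and equal to it exactly on that cone, so additivity forces both
  summands into the cone. The equality case is the source of the monomial relations in the graded
  ring.\<close>

lemma degP_add_le: "degP P (x + y) \<le> degP P x + degP P y"
  and degP_add_eq: "degP P (x + y) = degP P x + degP P y \<longleftrightarrow> lsupp x \<union> lsupp y \<in> \<Delta>"
proof -
  obtain F where F: "F facet_of P" "lsupp (x + y) \<subseteq> facet_verts F"
    using lsupp_\<Delta> by (auto simp: \<Delta>_def)
  obtain h where h: "\<And>x. x \<in> P \<Longrightarrow> h \<bullet> x \<le> 1" "F = {x \<in> P. h \<bullet> x = 1}"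
    using facet_functional [OF F(1)] by blast
  have le: "h \<bullet> z \<le> degP P z" for z
    using functional_comb(1) [where c = "lam z", OF F(1) lam_nonneg h] by (simp add: degP_eq lam)
  have eq: "h \<bullet> z = degP P z \<longleftrightarrow> lsupp z \<subseteq> facet_verts F" for z
    using functional_comb(2) [where c = "lam z", OF F(1) lam_nonneg h] lam_outside
    by (auto simp: degP_eq lam lsupp_def)
  have "degP P (x + y) = h \<bullet> x + h \<bullet> y"
    using eq [of "x + y"] F(2) by (simp add: inner_add_right)
  then show "degP P (x + y) \<le> degP P x + degP P y"
    using le [of x] le [of y] by simp
  show "degP P (x + y) = degP P x + degP P y \<longleftrightarrow> lsupp x \<union> lsupp y \<in> \<Delta>"
  proof
    assume "degP P (x + y) = degP P x + degP P y"
    then have "lsupp x \<union> lsupp y \<subseteq> facet_verts F"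
      using le [of x] le [of y] eq [of x] eq [of y] \<open>degP P (x + y) = h \<bullet> x + h \<bullet> y\<close> by auto
    then show "lsupp x \<union> lsupp y \<in> \<Delta>"
      using F(1) by (auto simp: \<Delta>_def)
  next
    assume "lsupp x \<union> lsupp y \<in> \<Delta>"
    then show "degP P (x + y) = degP P x + degP P y"
      by (simp add: degP_eq lam_add sum.distrib)
  qed
qed

lemma degP_vertex: "v \<in> V \<Longrightarrow> degP P (emb v) = 1"
  using finite_V by (simp add: degP_eq lam_vertex)

subsection \<open>Cones of the fan and lattice points\<close>

definition cone_of :: "(int ^ 'n) set \<Rightarrow> (real ^ 'n) set" where
  "cone_of T = {x. lsupp x \<subseteq> T}"

lemma lsupp_vertex: "v \<in> V \<Longrightarrow> lsupp (emb v) = {v}"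
  by (auto simp: lsupp_def lam_vertex)

lemma lsupp_add_subset: "lsupp x \<subseteq> T \<Longrightarrow> lsupp y \<subseteq> T \<Longrightarrow> T \<in> \<Delta> \<Longrightarrow> lsupp (x + y) \<subseteq> T"
  using lam_add [of x y] \<Delta>_mono [of T "lsupp x \<union> lsupp y"] by (fastforce simp: lsupp_def)

lemma lam_add_cone: "lsupp x \<subseteq> T \<Longrightarrow> lsupp y \<subseteq> T \<Longrightarrow> T \<in> \<Delta> \<Longrightarrow> lam (x + y) v = lam x v + lam y v"
  using lam_add [of x y] \<Delta>_mono [of T "lsupp x \<union> lsupp y"] by auto

lemma convex_cone_cone_of: "T \<in> \<Delta> \<Longrightarrow> convex_cone (cone_of T)"
  unfolding convex_cone_iff cone_of_def using lsupp_add_subset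
  by (auto simp: lsupp_def lam_zero lam_scale)

lemma convex_cone_sum:
  assumes "convex_cone C" "\<And>v. v \<in> T \<Longrightarrow> g v \<in> C"
  shows "sum g T \<in> C"
  using assms by (induction T rule: infinite_finite_induct) (auto simp: convex_cone_iff)

lemma comb_in_cone:
  assumes "convex_cone C" "\<And>v. v \<in> T \<Longrightarrow> emb v \<in> C" "lsupp x \<subseteq> T"
  shows "x \<in> C"
proof -
  have "x = (\<Sum>v\<in>lsupp x. lam x v *\<^sub>R emb v)"
    using comb_over [of "lam x" "lsupp x"] \<Delta>_subset [OF lsupp_\<Delta>] by (simp add: lam lsupp_def)
  moreover have "\<dots> \<in> C"
    using assms by (intro convex_cone_sum [OF assms(1)] convex_cone_scaleR) (auto simp: lam_nonneg)
  ultimately show ?thesis by simp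
qed

lemma cone_of_eq_hull:
  assumes "T \<in> \<Delta>"
  shows "cone_of T = convex_cone hull (emb ` T)"
proof (rule antisym)
  show "cone_of T \<subseteq> convex_cone hull (emb ` T)"
    using comb_in_cone [OF convex_cone_convex_cone_hull, of T "emb ` T"]
    by (auto simp: cone_of_def hull_inc)
  show "convex_cone hull (emb ` T) \<subseteq> cone_of T"
    using \<Delta>_subset [OF assms] convex_cone_cone_of [OF assms]
    by (intro hull_minimal) (auto simp: cone_of_def lsupp_vertex)
qed

lemma convex_cone_hull_convex_hull: "convex_cone hull (convex hull S) = convex_cone hull (S :: (real ^ 'n) set)"
  by (intro antisym hull_mono hull_subset hull_minimal convex_convex_cone_hull convex_cone_convex_cone_hull)

text \<open>A nonempty proper face lies in a facet, and each facet is a simplex, so every subset of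
  its vertices spans a face. The empty face gives the empty set of generators.\<close>

lemma fan_eq: "fan P = cone_of ` \<Delta>"
proof (intro antisym subsetI)
  fix \<sigma> assume "\<sigma> \<in> fan P"
  then obtain F where F: "\<sigma> = convex_cone hull F" "F face_of P" "F \<noteq> P"
    by (auto simp: fan_def)
  have "facet_verts F \<in> \<Delta>"
  proof (cases "F = {}")
    case True
    then show ?thesis using empty_\<Delta> by (simp add: facet_verts_def)
  next
    case False
    then obtain G where "G facet_of P" "F \<subseteq> G"
      using face_of_polyhedron_subset_facet [OF polyhedron] F by metis
    then show ?thesis by (auto simp: \<Delta>_def facet_verts_def)
  qed
  moreover have "\<sigma> = convex_cone hull (emb ` facet_verts F)"
    using F(1) face_eq_hull [OF F(2)] by (metis convex_cone_hull_convex_hull)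
  ultimately show "\<sigma> \<in> cone_of ` \<Delta>"
    by (simp add: cone_of_eq_hull)
next
  fix \<sigma> assume "\<sigma> \<in> cone_of ` \<Delta>"
  then obtain T G where T: "\<sigma> = cone_of T" "T \<in> \<Delta>" "G facet_of P" "T \<subseteq> facet_verts G"
    by (auto simp: \<Delta>_def)
  have "convex hull (emb ` T) face_of convex hull (emb ` facet_verts G)"
    using face_of_convex_hull_affine_independent [OF facet_independent(1) [OF T(3)]] T(4) by blast
  then have face: "convex hull (emb ` T) face_of G"
    using face_eq_hull [OF facet_face(1) [OF T(3)]] by simp
  moreover have "convex hull (emb ` T) \<noteq> P"
    using face_of_imp_subset [OF face] face_of_imp_subset [OF facet_face(1) [OF T(3)]] facet_face(2) [OF T(3)]
    by auto
  ultimately show "\<sigma> \<in> fan P"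
    unfolding fan_def T(1) cone_of_eq_hull [OF T(2)]
    using face_of_trans [OF _ facet_face(1) [OF T(3)]] convex_cone_hull_convex_hull by blast
qed

lemma gens_cone: "T \<in> \<Delta> \<Longrightarrow> gens P (cone_of T) = T"
  using \<Delta>_subset [of T] by (auto simp: gens_def cone_of_def lsupp_vertex subset_iff)

lemma comb_supported:
  assumes "T \<in> \<Delta>" "\<And>v. 0 \<le> c v" "{v. c v \<noteq> 0} \<subseteq> T"
  shows "lam (\<Sum>v\<in>T. c v *\<^sub>R emb v) = c"
  using assms supported_subset comb_over [OF assms(3) \<Delta>_subset [OF assms(1)]]
  by (intro lam_eqI) auto

text \<open>A point is in the relative interior iff every segment from the cone to it can be
  prolonged beyond it inside the cone. In coordinates this says that no generator of the cone has
  coefficient 0.\<close>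

lemma rel_interior_cone:
  assumes "T \<in> \<Delta>"
  shows "x \<in> rel_interior (cone_of T) \<longleftrightarrow> lsupp x = T"
proof -
  have cc: "convex (cone_of T)" "cone_of T \<noteq> {}"
    using convex_cone_cone_of [OF assms] by (auto simp: convex_cone_def)
  define s where "s = (\<Sum>v\<in>T. emb v)"
  have s: "lam s = (\<lambda>v. if v \<in> T then 1 else 0)"
    using comb_supported [OF assms, of "\<lambda>v. if v \<in> T then 1 else 0"] by (auto simp: s_def)
  show ?thesis
  proof
    assume x: "x \<in> rel_interior (cone_of T)"
    then have xT: "x \<in> cone_of T"
      using rel_interior_subset by blast
    have "s \<in> cone_of T"
      by (auto simp: cone_of_def lsupp_def s)
    then obtain e where e: "e > 1" "(1 - e) *\<^sub>R s + e *\<^sub>R x \<in> cone_of T"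
      using x convex_rel_interior_iff [OF cc] by blast
    \<comment> \<open>All coordinates of \<open>s\<close> are 1, so prolonging the segment from
      \<open>s\<close> beyond \<open>x\<close> by the factor \<open>e\<close> forces each coordinate
      of \<open>x\<close> to be at least \<open>(e - 1) / e\<close>.\<close>
    have "lam x v > 0" if "v \<in> T" for v
    proof -
      have "lam (((1 - e) *\<^sub>R s + e *\<^sub>R x) + (e - 1) *\<^sub>R s) v
          = lam ((1 - e) *\<^sub>R s + e *\<^sub>R x) v + lam ((e - 1) *\<^sub>R s) v"
        using e \<open>s \<in> cone_of T\<close> assms convex_cone_scaleR [OF convex_cone_cone_of [OF assms], of "e - 1" s]
        by (intro lam_add_cone [of _ T]) (auto simp: cone_of_def)
      moreover have "((1 - e) *\<^sub>R s + e *\<^sub>R x) + (e - 1) *\<^sub>R s = e *\<^sub>R x"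
        by (simp add: algebra_simps)
      ultimately have "e * lam x v \<ge> e - 1"
        using e that lam_nonneg [of "(1 - e) *\<^sub>R s + e *\<^sub>R x" v] by (simp add: lam_scale s)
      then show ?thesis
        using e by (smt (verit) mult_nonneg_nonpos)
    qed
    then show "lsupp x = T"
      using xT by (force simp: cone_of_def lsupp_def)
  next
    assume x: "lsupp x = T"
    have "\<exists>e. e > 1 \<and> (1 - e) *\<^sub>R y + e *\<^sub>R x \<in> cone_of T" if y: "y \<in> cone_of T" for y
    proof -
      \<comment> \<open>\<open>M\<close> dominates all ratios of coordinates, so
        \<open>t * lam y v \<le> lam x v\<close> at each generator and the prolonged point keeps
        nonnegative coordinates. The summand 1 keeps the denominator positive.\<close>
      define M where "M = (\<Sum>v\<in>T. lam y v / lam x v)"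
      define t where "t = 1 / (1 + M)"
      have pos: "lam x v > 0" if "v \<in> T" for v
        using that x lam_nonneg [of x v] by (auto simp: lsupp_def)
      have "0 \<le> M"
        unfolding M_def by (intro sum_nonneg divide_nonneg_nonneg lam_nonneg)
      have le: "t * lam y v \<le> lam x v" if "v \<in> T" for v
      proof -
        have "lam y v / lam x v \<le> M"
          unfolding M_def using that \<Delta>_finite [OF assms] lam_nonneg by (intro member_le_sum) auto
        then have "lam y v \<le> M * lam x v"
          using pos [OF that] by (simp add: field_simps)
        also have "\<dots> \<le> (1 + M) * lam x v"
          using lam_nonneg [of x v] by (simp add: algebra_simps)
        finally show ?thesis
          using \<open>0 \<le> M\<close> by (simp add: t_def field_simps)
      qed
      have t0: "t > 0" using \<open>0 \<le> M\<close> by (simp add: t_def)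
      define c where "c v = (if v \<in> T then (1 + t) * lam x v - t * lam y v else 0)" for v
      have c0: "0 \<le> c v" for v
      proof (cases "v \<in> T")
        case True
        then show ?thesis
          using le [OF True] mult_nonneg_nonneg [OF less_imp_le [OF t0] lam_nonneg [of x v]]
          by (simp add: c_def algebra_simps)
      qed (simp add: c_def)
      have "(1 - (1 + t)) *\<^sub>R y + (1 + t) *\<^sub>R x = (\<Sum>v\<in>T. c v *\<^sub>R emb v)"
      proof -
        have "x = (\<Sum>v\<in>T. lam x v *\<^sub>R emb v)" "y = (\<Sum>v\<in>T. lam y v *\<^sub>R emb v)"
          using comb_over [of "lam x" T] comb_over [of "lam y" T] x y \<Delta>_subset [OF assms]
          by (auto simp: lam lsupp_def cone_of_def)
        then have "(1 - (1 + t)) *\<^sub>R y + (1 + t) *\<^sub>R x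
            = (1 - (1 + t)) *\<^sub>R (\<Sum>v\<in>T. lam y v *\<^sub>R emb v) + (1 + t) *\<^sub>R (\<Sum>v\<in>T. lam x v *\<^sub>R emb v)"
          by simp
        also have "\<dots> = (\<Sum>v\<in>T. c v *\<^sub>R emb v)"
          unfolding scaleR_sum_right sum.distrib [symmetric]
          by (rule sum.cong) (auto simp: c_def algebra_simps)
        finally show ?thesis .
      qed
      moreover have "lam (\<Sum>v\<in>T. c v *\<^sub>R emb v) = c"
        using c0 by (intro comb_supported [OF assms]) (auto simp: c_def)
      ultimately have "(1 - (1 + t)) *\<^sub>R y + (1 + t) *\<^sub>R x \<in> cone_of T"
        by (auto simp: cone_of_def lsupp_def c_def)
      then show ?thesis
        using t0 by (intro exI [of _ "1 + t"]) auto
    qed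
    then show "x \<in> rel_interior (cone_of T)"
      using convex_rel_interior_iff [OF cc] by blast
  qed
qed

lemma min_cone_eq: "min_cone P w = cone_of (lsupp (emb w))"
  unfolding min_cone_def
proof (rule the_equality)
  show "cone_of (lsupp (emb w)) \<in> fan P \<and> emb w \<in> rel_interior (cone_of (lsupp (emb w)))"
    by (auto simp: fan_eq rel_interior_cone lsupp_\<Delta>)
qed (auto simp: fan_eq rel_interior_cone)

lemma gens_min_cone: "gens P (min_cone P w) = lsupp (emb w)"
  by (simp add: min_cone_eq gens_cone lsupp_\<Delta>)

lemma Box_cone:
  assumes "T \<in> \<Delta>"
  shows "u \<in> Box P (cone_of T) \<longleftrightarrow> lsupp (emb u) \<subseteq> T \<and> (\<forall>v. lam (emb u) v < 1)"
proof
  assume "u \<in> Box P (cone_of T)"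
  then obtain l where l: "\<forall>v\<in>T. 0 \<le> l v \<and> l v < 1" "emb u = (\<Sum>v\<in>T. l v *\<^sub>R emb v)"
    using assms by (auto simp: Box_def gens_cone)
  have "lam (\<Sum>v\<in>T. (if v \<in> T then l v else 0) *\<^sub>R emb v) = (\<lambda>v. if v \<in> T then l v else 0)"
    using l by (intro comb_supported [OF assms]) auto
  moreover have "(\<Sum>v\<in>T. (if v \<in> T then l v else 0) *\<^sub>R emb v) = emb u"
    unfolding l(2) by (rule sum.cong) auto
  ultimately show "lsupp (emb u) \<subseteq> T \<and> (\<forall>v. lam (emb u) v < 1)"
    using l by (auto simp: lsupp_def split: if_splits)
next
  assume "lsupp (emb u) \<subseteq> T \<and> (\<forall>v. lam (emb u) v < 1)"
  moreover from this have "emb u = (\<Sum>v\<in>T. lam (emb u) v *\<^sub>R emb v)"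
    using comb_over [of "lam (emb u)" T] \<Delta>_subset [OF assms] by (simp add: lam lsupp_def)
  ultimately show "u \<in> Box P (cone_of T)"
    using assms lam_nonneg by (auto simp: Box_def gens_cone intro!: exI [of _ "lam (emb u)"])
qed

lemma Box_fan_iff: "u \<in> Box_fan P \<longleftrightarrow> (\<forall>v. lam (emb u) v < 1)"
  using lsupp_\<Delta> by (auto simp: Box_fan_def fan_eq Box_cone)

section \<open>Box decomposition of lattice points\<close>

definition lattice_comb :: "(int ^ 'n \<Rightarrow> nat) \<Rightarrow> int ^ 'n" where
  "lattice_comb m = (\<Sum>v\<in>V. int (m v) *s v)"

lemma emb_lattice_comb: "emb (lattice_comb m) = comb (\<lambda>v. real (m v))"
  by (simp add: lattice_comb_def emb_sum emb_scale comb_def)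

lemma lam_lattice_comb:
  assumes "{v. m v \<noteq> 0} \<union> lsupp (emb u) \<in> \<Delta>"
  shows "lam (emb (u + lattice_comb m)) v = lam (emb u) v + real (m v)"
proof -
  have "lam (emb (lattice_comb m)) = (\<lambda>v. real (m v))"
    using \<Delta>_mono [OF assms]
    by (intro lam_eqI) (auto simp: supported_def emb_lattice_comb)
  moreover from this have "lam (emb u + emb (lattice_comb m)) v = lam (emb u) v + lam (emb (lattice_comb m)) v"
    using assms by (intro lam_add_cone [of _ "{v. m v \<noteq> 0} \<union> lsupp (emb u)"]) (auto simp: lsupp_def)
  ultimately show ?thesis
    by (simp add: emb_add)
qed

text \<open>Coordinates add inside one cone. Those of \<open>u\<close> lie in [0,1) and those of the
  rest are natural numbers, so \<open>u\<close> has the fractional parts of the coordinates of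
  \<open>w\<close> and is determined by them.\<close>

lemma frac_part_eqI:
  assumes "lsupp (emb u) \<subseteq> lsupp (emb w)" "\<And>v. lam (emb u) v < 1"
    and "emb w = emb u + comb (\<lambda>v. real (m v))" "{v. m v \<noteq> 0} \<subseteq> lsupp (emb w)"
  shows "frac_part P w = u"
proof -
  let ?T = "lsupp (emb w)"
  have "{v. m v \<noteq> 0} \<union> lsupp (emb u) \<in> \<Delta>" if "{v. m v \<noteq> 0} \<subseteq> ?T" "lsupp (emb u) \<subseteq> ?T" 
    for m :: "int ^ 'n \<Rightarrow> nat" and u
    using that \<Delta>_mono [OF lsupp_\<Delta>, of _ "emb w"] by simp
  then have fl: "lam (emb w) v = lam (emb u) v + real (m v)"
    if "lsupp (emb u) \<subseteq> ?T" "emb w = emb u + comb (\<lambda>v. real (m v))" "{v. m v \<noteq> 0} \<subseteq> ?T"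
    for u v and m :: "int ^ 'n \<Rightarrow> nat"
    using that lam_lattice_comb [of m u v] by (simp add: emb_add emb_lattice_comb)
  have fr: "lam (emb u) v = frac (lam (emb w) v)"
    if "lsupp (emb u) \<subseteq> ?T" "\<And>v. lam (emb u) v < 1" 
      "emb w = emb u + comb (\<lambda>v. real (m v))" "{v. m v \<noteq> 0} \<subseteq> ?T"
    for u v and m :: "int ^ 'n \<Rightarrow> nat"
    unfolding fl [OF that(1,3,4), of v] using that(2) [of v] lam_nonneg [of "emb u" v]
    by (intro sym [OF iffD2 [OF frac_unique_iff]]) auto
  \<comment> \<open>The multiplicities in \<open>frac_part\<close> matter only at the generators of
    the cone; cutting them off elsewhere makes them an exponent with support in the cone, as
    \<open>fr\<close> requires.\<close>
  have gen_sum: "(\<Sum>v\<in>?T. real (m v) *\<^sub>R emb v) = comb (\<lambda>v. real (if v \<in> ?T then m v else 0))"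
    for m :: "int ^ 'n \<Rightarrow> nat"
  proof -
    have "{v. real (if v \<in> ?T then m v else 0) \<noteq> 0} \<subseteq> ?T"
      by auto
    from comb_over [OF this \<Delta>_subset [OF lsupp_\<Delta>]] show ?thesis by simp
  qed
  show ?thesis
    unfolding frac_part_def gens_min_cone
  proof (rule the_equality)
    have "(\<lambda>v. real (if v \<in> ?T then m v else 0)) = (\<lambda>v. real (m v))"
      using assms(4) by (fastforce simp: fun_eq_iff)
    then show "u \<in> Box P (min_cone P w) \<and> (\<exists>m. emb w = emb u + (\<Sum>v\<in>?T. real (m v) *\<^sub>R emb v))"
      using assms(1-3) gen_sum [of m] by (intro conjI exI [of _ m]) (simp_all add: min_cone_eq Box_cone lsupp_\<Delta>)
  next
    fix u' assume u': "u' \<in> Box P (min_cone P w) \<and> (\<exists>m. emb w = emb u' + (\<Sum>v\<in>?T. real (m v) *\<^sub>R emb v))"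
    then obtain m' :: "int ^ 'n \<Rightarrow> nat" where m': "emb w = emb u' + comb (\<lambda>v. real (if v \<in> ?T then m' v else 0))"
      using gen_sum by metis
    have "lam (emb u') v = frac (lam (emb w) v)" for v
      using u' m' by (intro fr [of _ "\<lambda>v. if v \<in> ?T then m' v else 0"]) (auto simp: min_cone_eq Box_cone lsupp_\<Delta>)
    moreover have "lam (emb u) v = frac (lam (emb w) v)" for v
      using assms by (intro fr)
    ultimately have "lam (emb u') = lam (emb u)"
      by auto
    then show "u' = u"
      by (metis lam(2) emb_eq_iff)
  qed
qed

text \<open>Here \<open>m\<close> consists of the integer parts of the coordinates of
  \<open>w\<close>. The fibre is thereby indexed by the exponents whose support spans a cone
  together with \<sigma>(u), that is, by the standard monomials of a Stanley--Reisner
  module.\<close>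

lemma box_fibre_iff:
  assumes "\<And>v. lam (emb u) v < 1"
  shows "w \<in> box_fibre P u \<longleftrightarrow> (\<exists>m. {v. m v \<noteq> 0} \<union> lsupp (emb u) \<in> \<Delta> \<and> w = u + lattice_comb m)"
proof
  assume w: "w \<in> box_fibre P u"
  define m where "m v = nat \<lfloor>lam (emb w) v\<rfloor>" for v
  define u' where "u' = w - lattice_comb m"
  have m: "real (m v) = \<lfloor>lam (emb w) v\<rfloor>" for v
    using lam_nonneg [of "emb w" v] by (simp add: m_def)
  have "comb (\<lambda>v. frac (lam (emb w) v)) + comb (\<lambda>v. real (m v)) = emb w"
    using lam(2) [of "emb w"] by (simp add: comb_add [symmetric] m frac_def)
  then have "emb u' = comb (\<lambda>v. frac (lam (emb w) v))"
    by (simp add: u'_def emb_diff emb_lattice_comb algebra_simps)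
  moreover have "supported (\<lambda>v. frac (lam (emb w) v))"
    by (rule supported_subset [OF _ _ lsupp_\<Delta> [of "emb w"]]) (auto simp: lsupp_def)
  ultimately have lu': "lam (emb u') = (\<lambda>v. frac (lam (emb w) v))"
    using lam_eqI by metis
  have "frac_part P w = u'"
  proof (rule frac_part_eqI [of _ _ m])
    show "emb w = emb u' + comb (\<lambda>v. real (m v))"
      by (simp add: u'_def emb_diff emb_lattice_comb)
  qed (auto simp: lu' lsupp_def frac_lt_1 m_def)
  then have "u' = u"
    using w by (simp add: box_fibre_def)
  moreover have "{v. m v \<noteq> 0} \<union> lsupp (emb u') \<subseteq> lsupp (emb w)"
    by (auto simp: lu' lsupp_def m_def)
  ultimately show "\<exists>m. {v. m v \<noteq> 0} \<union> lsupp (emb u) \<in> \<Delta> \<and> w = u + lattice_comb m"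
    using \<Delta>_mono [OF lsupp_\<Delta>] by (intro exI [of _ m]) (auto simp: u'_def)
next
  assume "\<exists>m. {v. m v \<noteq> 0} \<union> lsupp (emb u) \<in> \<Delta> \<and> w = u + lattice_comb m"
  then obtain m where m: "{v. m v \<noteq> 0} \<union> lsupp (emb u) \<in> \<Delta>" "w = u + lattice_comb m"
    by blast
  have l: "lam (emb w) v = lam (emb u) v + real (m v)" for v
    using lam_lattice_comb [OF m(1)] by (simp add: m(2))
  have "frac_part P w = u"
  proof (rule frac_part_eqI [of _ _ m])
    show "emb w = emb u + comb (\<lambda>v. real (m v))"
      by (simp add: m(2) emb_add emb_lattice_comb)
  qed (auto simp: assms l lsupp_def add_nonneg_eq_0_iff lam_nonneg)
  then show "w \<in> box_fibre P u"
    by (simp add: box_fibre_def)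
qed

text \<open>A nonempty face is first shown to be a convex cone. If a point of it has a positive
  coordinate at \<open>v\<close>, splitting off that summand puts the point on a segment ending on
  the ray of \<open>v\<close>, so the face contains \<open>v\<close>. Conversely, a coordinate of a
  proper convex combination of points of the cone vanishes only if it vanishes at both ends.\<close>

lemma face_of_cone:
  assumes T: "T \<in> \<Delta>"
  shows "\<tau> face_of cone_of T \<and> \<tau> \<noteq> {} \<longleftrightarrow> (\<exists>T'. T' \<subseteq> T \<and> \<tau> = cone_of T')"
proof
  assume f: "\<tau> face_of cone_of T \<and> \<tau> \<noteq> {}"
  have sub: "\<tau> \<subseteq> cone_of T" and conv: "convex \<tau>"
    using f face_of_imp_subset face_of_imp_convex by auto
  have seg: "a \<in> \<tau> \<and> b \<in> \<tau>" if "a \<in> cone_of T" "b \<in> cone_of T" "x \<in> \<tau>" "x \<in> open_segment a b" for a b x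
    using f that unfolding face_of_def by blast
  note cc = convex_cone_cone_of [OF T]
  have mult: "t *\<^sub>R x \<in> \<tau>" if "x \<in> \<tau>" "0 \<le> t" for x t
  proof (cases "x = 0 \<or> t = 1")
    case False
    \<comment> \<open>\<open>t + 2\<close> exceeds both 1 and \<open>t\<close>: the segment from 0
      to \<open>?b\<close> has \<open>x\<close> in its interior, so its ends are in the face, and it
      also contains \<open>t x\<close>.\<close>
    let ?b = "(t + 2) *\<^sub>R x"
    have t2: "t + 2 > 0" using that by simp
    have "x = (1 - 1 / (t + 2)) *\<^sub>R 0 + (1 / (t + 2)) *\<^sub>R ?b" "0 < 1 / (t + 2)" "1 / (t + 2) < 1"
      using that by auto
    then have "x \<in> open_segment 0 ?b"
      using False that unfolding in_segment by (intro conjI exI [of _ "1 / (t + 2)"]) auto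
    then have 0: "0 \<in> \<tau>" "?b \<in> \<tau>"
      using seg [of 0 ?b x] that sub cc by (auto simp: convex_cone_iff)
    have "t *\<^sub>R x = (1 - t / (t + 2)) *\<^sub>R 0 + (t / (t + 2)) *\<^sub>R ?b"
      using t2 by simp
    also have "\<dots> \<in> \<tau>"
      using that t2 by (intro convexD [OF conv 0]) auto
    finally show ?thesis .
  qed (use that in auto)
  have cct: "convex_cone \<tau>"
    unfolding convex_cone_def conic_def using f conv mult by auto
  define T' where "T' = {v \<in> T. emb v \<in> \<tau>}"
  have "lsupp x \<subseteq> T'" if x: "x \<in> \<tau>" for x
  proof
    fix v assume v: "v \<in> lsupp x"
    have vT: "v \<in> T" "lam x v > 0" "v \<in> V"
      using v x sub lam_nonneg [of x v] \<Delta>_subset [OF T] by (auto simp: cone_of_def lsupp_def)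
    define y where "y = (\<Sum>w\<in>T. (if w = v then 0 else lam x w) *\<^sub>R emb w)"
    have ly: "lam y = (\<lambda>w. if w = v then 0 else lam x w)"
      unfolding y_def using x sub lam_nonneg
      by (intro comb_supported [OF T]) (auto simp: cone_of_def lsupp_def)
    have lxy: "lam (y + lam x v *\<^sub>R emb v) = lam x"
    proof
      fix w
      show "lam (y + lam x v *\<^sub>R emb v) w = lam x w"
        using x sub vT T by (subst lam_add_cone [of _ T])
          (auto simp: ly lam_scale lam_nonneg lam_vertex lsupp_def cone_of_def split: if_splits)
    qed
    have xy: "x = y + lam x v *\<^sub>R emb v"
      using lam(2) lxy by metis
    have yT: "y \<in> cone_of T" "emb v \<in> cone_of T"
      using x sub vT T by (auto simp: cone_of_def lsupp_def ly lam_vertex split: if_splits)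
    \<comment> \<open>The ends of an open segment must be distinct; these two differ in the
      coordinate at \<open>v\<close>. Their midpoint is \<open>x\<close>.\<close>
    have "2 *\<^sub>R lam x v *\<^sub>R emb v \<noteq> 2 *\<^sub>R y"
    proof
      assume "2 *\<^sub>R lam x v *\<^sub>R emb v = 2 *\<^sub>R y"
      then have "lam (lam x v *\<^sub>R emb v) v = lam y v"
        using scaleR_left_imp_eq [of 2 "lam x v *\<^sub>R emb v" y] by simp
      then show False using vT by (simp add: lam_scale ly lam_vertex)
    qed
    moreover have "x = (1 - 1 / 2) *\<^sub>R 2 *\<^sub>R y + (1 / 2) *\<^sub>R 2 *\<^sub>R lam x v *\<^sub>R emb v"
      by (simp add: xy [symmetric])
    ultimately have "x \<in> open_segment (2 *\<^sub>R y) (2 *\<^sub>R lam x v *\<^sub>R emb v)"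
      unfolding in_segment by (intro conjI exI [of _ "1 / 2"]) auto
    then have "2 *\<^sub>R lam x v *\<^sub>R emb v \<in> \<tau>"
      using seg [OF _ _ x] yT cc vT by (meson convex_cone_iff less_imp_le zero_le_numeral)
    from mult [OF this, of "1 / (2 * lam x v)"] show "v \<in> T'"
      using vT by (simp add: T'_def)
  qed
  moreover have "x \<in> \<tau>" if "lsupp x \<subseteq> T'" for x
    using that by (rule comb_in_cone [OF cct, rotated]) (simp add: T'_def)
  ultimately have "\<tau> = cone_of T'"
    unfolding cone_of_def by blast
  then show "\<exists>T'. T' \<subseteq> T \<and> \<tau> = cone_of T'"
    by (intro exI [of _ T']) (simp add: T'_def)
next
  assume "\<exists>T'. T' \<subseteq> T \<and> \<tau> = cone_of T'"
  then obtain T' where T': "T' \<subseteq> T" "\<tau> = cone_of T'" by blast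
  have T'\<Delta>: "T' \<in> \<Delta>" using T T' \<Delta>_mono by blast
  note cc = convex_cone_cone_of [OF T'\<Delta>] convex_cone_cone_of [OF T]
  have "a \<in> cone_of T' \<and> b \<in> cone_of T'"
    if ab: "a \<in> cone_of T" "b \<in> cone_of T" "x \<in> cone_of T'" "x \<in> open_segment a b" for a b x
  proof -
    obtain s where s: "0 < s" "s < 1" "x = (1 - s) *\<^sub>R a + s *\<^sub>R b"
      using ab(4) by (auto simp: in_segment)
    have "lam x v = (1 - s) * lam a v + s * lam b v" for v
      unfolding s(3) using s ab cc(2) T
      by (subst lam_add_cone [of _ T]) (auto simp: lam_scale cone_of_def lsupp_def)
    moreover have "lam x v = 0" if "v \<notin> T'" for v
      using that ab(3) by (auto simp: cone_of_def lsupp_def)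
    ultimately have "(1 - s) * lam a v + s * lam b v = 0" if "v \<notin> T'" for v
      using that by simp
    then have "lam a v = 0 \<and> lam b v = 0" if "v \<notin> T'" for v
      using that s lam_nonneg by (simp add: add_nonneg_eq_0_iff)
    then show ?thesis
      by (auto simp: cone_of_def lsupp_def)
  qed
  then have "\<forall>a\<in>cone_of T. \<forall>b\<in>cone_of T. \<forall>x\<in>cone_of T'.
      x \<in> open_segment a b \<longrightarrow> a \<in> cone_of T' \<and> b \<in> cone_of T'"
    by blast
  moreover have "cone_of T' \<subseteq> cone_of T"
    using T'(1) by (auto simp: cone_of_def)
  moreover have "convex (cone_of T')" "cone_of T' \<noteq> {}"
    using cc(1) by (auto simp: convex_cone_def)
  ultimately show "\<tau> face_of cone_of T \<and> \<tau> \<noteq> {}"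
    unfolding face_of_def T'(2) by simp
qed

lemma cone_of_inj: "T \<in> \<Delta> \<Longrightarrow> T' \<in> \<Delta> \<Longrightarrow> cone_of T = cone_of T' \<Longrightarrow> T = T'"
  by (metis gens_cone)

text \<open>The faces of a cone containing \<sigma>(u) are given by all subsets of its generators,
  and adding the generators of \<sigma>(u) to such a subset leads back to a cone containing
  \<sigma>(u).\<close>

lemma star_fan_eq: "star_fan P u = cone_of ` {T. T \<union> lsupp (emb u) \<in> \<Delta>}"
proof -
  let ?S = "lsupp (emb u)"
  have face: "min_cone P u face_of cone_of T \<longleftrightarrow> ?S \<subseteq> T" if T: "T \<in> \<Delta>" for T
  proof -
    have "cone_of ?S \<noteq> {}"
      by (auto simp: cone_of_def)
    then have "min_cone P u face_of cone_of T \<longleftrightarrow> (\<exists>T'\<subseteq>T. cone_of ?S = cone_of T')"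
      using face_of_cone [OF T, of "cone_of ?S"] by (simp add: min_cone_eq)
    also have "\<dots> \<longleftrightarrow> ?S \<subseteq> T"
      using cone_of_inj [OF lsupp_\<Delta>] \<Delta>_mono [OF T] by metis
    finally show ?thesis .
  qed
  show ?thesis
  proof (intro antisym subsetI)
    fix \<tau> assume "\<tau> \<in> star_fan P u"
    then obtain T where T: "T \<in> \<Delta>" "?S \<subseteq> T" "\<tau> face_of cone_of T \<and> \<tau> \<noteq> {}"
      using face by (auto simp: star_fan_def fan_eq)
    then obtain T' where "T' \<subseteq> T" "\<tau> = cone_of T'"
      using face_of_cone by blast
    moreover from this have "T' \<union> ?S \<in> \<Delta>"
      using \<Delta>_mono [OF T(1)] T(2) by simp
    ultimately show "\<tau> \<in> cone_of ` {T. T \<union> ?S \<in> \<Delta>}"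
      by simp
  next
    fix \<tau> assume "\<tau> \<in> cone_of ` {T. T \<union> ?S \<in> \<Delta>}"
    then obtain T' where T': "\<tau> = cone_of T'" "T' \<union> ?S \<in> \<Delta>" by blast
    then have "\<tau> face_of cone_of (T' \<union> ?S) \<and> \<tau> \<noteq> {}"
      using face_of_cone [OF T'(2), of \<tau>] by blast
    moreover have "min_cone P u face_of cone_of (T' \<union> ?S)"
      using face [OF T'(2)] by simp
    ultimately show "\<tau> \<in> star_fan P u"
      using T'(2) unfolding star_fan_def fan_eq mem_Collect_eq by (intro conjI bexI [OF _ imageI]) simp_all
  qed
qed

section \<open>Courant functions: linearity on cones and rationality at lattice points\<close>

lemma courant_eq: "courant P v x = lam x v"
  unfolding courant_def
proof (rule the_equality)
  show "\<exists>\<sigma>\<in>fan P. x \<in> \<sigma> \<and> (\<exists>c. (\<forall>v'. v' \<notin> gens P \<sigma> \<longrightarrow> c v' = 0)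
     \<and> x = (\<Sum>v'\<in>gens P \<sigma>. c v' *\<^sub>R emb v') \<and> lam x v = c v)"
    using comb_over [of "lam x" "lsupp x"] \<Delta>_subset [OF lsupp_\<Delta>]
    by (intro bexI [of _ "cone_of (lsupp x)"] conjI exI [of _ "lam x"])
       (simp_all add: gens_cone [OF lsupp_\<Delta>] fan_eq lsupp_\<Delta>, simp_all add: cone_of_def lam lsupp_def)
next
  fix l assume "\<exists>\<sigma>\<in>fan P. x \<in> \<sigma> \<and> (\<exists>c. (\<forall>v'. v' \<notin> gens P \<sigma> \<longrightarrow> c v' = 0)
     \<and> x = (\<Sum>v'\<in>gens P \<sigma>. c v' *\<^sub>R emb v') \<and> l = c v)"
  then obtain T c where T: "T \<in> \<Delta>" "x \<in> cone_of T" "\<forall>v. v \<notin> T \<longrightarrow> c v = 0"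
      "x = (\<Sum>v\<in>T. c v *\<^sub>R emb v)" "l = c v"
    unfolding fan_eq by (metis (no_types, lifting) gens_cone imageE)
  have "x = (\<Sum>v\<in>T. lam x v *\<^sub>R emb v)"
    using comb_over [of "lam x" T] T \<Delta>_subset by (auto simp: lam lsupp_def cone_of_def)
  then have "c v = lam x v" if "v \<in> T" for v
    using independent_coeffs [OF T(1), of c "lam x" v] T(4) that by simp
  then show "l = lam x v"
    using T by (cases "v \<in> T") (auto simp: lsupp_def cone_of_def)
qed

text \<open>The generators are linearly independent, so a linear functional exists that is 1 at
  \<open>v\<close> and 0 at the other generators; for \<open>v\<close> outside \<open>T\<close> it
  vanishes on the cone.\<close>

lemma lam_linear_on_cone:
  assumes "T \<in> \<Delta>"
  shows "\<exists>b. \<forall>x\<in>cone_of T. lam x v = (\<Sum>i\<in>UNIV. b $ i * x $ i)"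
proof -
  obtain F where F: "F facet_of P" "T \<subseteq> facet_verts F"
    using assms by (auto simp: \<Delta>_def)
  have "independent (emb ` T)"
    using facet_independent(2) [OF F(1)] F(2) by (meson image_mono independent_mono)
  then obtain g where g: "linear g" "\<forall>x\<in>emb ` T. g x = (if x = emb v then 1 else 0 :: real)"
    using linear_independent_extend [of "emb ` T" "\<lambda>x. if x = emb v then 1 else 0 :: real"] by blast
  have "lam x v = (\<Sum>i\<in>UNIV. (\<chi> i. g (axis i 1)) $ i * x $ i)" if x: "x \<in> cone_of T" for x
  proof -
    have "g x = g (\<Sum>i\<in>UNIV. x $ i *\<^sub>R axis i 1)"
      by (simp add: basis_expansion scalar_mult_eq_scaleR [symmetric])
    also have "\<dots> = (\<Sum>i\<in>UNIV. (\<chi> i. g (axis i 1)) $ i * x $ i)"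
      using g(1) by (simp add: linear_sum linear_scale mult.commute)
    finally have 1: "g x = (\<Sum>i\<in>UNIV. (\<chi> i. g (axis i 1)) $ i * x $ i)" .
    have "x = (\<Sum>w\<in>T. lam x w *\<^sub>R emb w)"
      using comb_over [of "lam x" T] x \<Delta>_subset [OF assms] by (simp add: lam lsupp_def cone_of_def)
    then have "g x = (\<Sum>w\<in>T. lam x w * g (emb w))"
      using arg_cong [of x "\<Sum>w\<in>T. lam x w *\<^sub>R emb w" g]
      unfolding linear_sum [OF g(1)] linear_scale [OF g(1)] by simp
    also have "\<dots> = (\<Sum>w\<in>T. if w = v then lam x v else 0)"
      using g(2) by (intro sum.cong) auto
    also have "\<dots> = lam x v"
      using x \<Delta>_finite [OF assms] by (auto simp: cone_of_def lsupp_def)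
    finally show ?thesis using 1 by simp
  qed
  then show ?thesis by blast
qed

text \<open>Cramer's rule, with the vertices of a facet as the columns of a square integer matrix.
  Rationality places the degrees of lattice points in the index set of the Newton
  filtration.\<close>

lemma lam_rational: "lam (emb w) v \<in> \<rat>"
proof -
  obtain F where F: "F facet_of P" "lsupp (emb w) \<subseteq> facet_verts F"
    using lsupp_\<Delta> by (auto simp: \<Delta>_def)
  have "card (UNIV :: 'n set) = card (facet_verts F)"
    using facet_independent(3) [OF F(1)] by simp
  then obtain e where e: "bij_betw e (UNIV :: 'n set) (facet_verts F)"
    using finite_same_card_bij [of "UNIV :: 'n set" "facet_verts F"] finite_facet_verts by auto
  have T: "facet_verts F \<in> \<Delta>" "facet_verts F \<subseteq> V"
    using F(1) by (auto simp: \<Delta>_def facet_verts_def)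
  define A :: "real ^ 'n ^ 'n" where "A = (\<chi> i j. emb (e j) $ i)"
  have Av: "A *v c = (\<Sum>v\<in>facet_verts F. c $ inv_into UNIV e v *\<^sub>R emb v)" for c
  proof -
    have "A *v c = (\<Sum>j\<in>UNIV. c $ j *\<^sub>R emb (e j))"
      by (simp add: A_def vec_eq_iff matrix_vector_mult_def mult.commute)
    also have "\<dots> = (\<Sum>v\<in>facet_verts F. c $ inv_into UNIV e v *\<^sub>R emb v)"
      using e by (subst sum.reindex_bij_betw [OF e, symmetric]) (simp add: bij_betw_def)
    finally show ?thesis .
  qed
  have "c = 0" if "A *v c = 0" for c
  proof -
    have "c $ inv_into UNIV e v = 0" if "v \<in> facet_verts F" for v
      using independent_coeffs [OF T(1), of "\<lambda>v. c $ inv_into UNIV e v" "\<lambda>_. 0" v] Av [of c]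
        \<open>A *v c = 0\<close> that by simp
    then show "c = 0"
      using e by (auto simp: vec_eq_iff bij_betw_def) (metis inv_into_f_f UNIV_I rangeI)
  qed
  then have "invertible A"
    using matrix_left_invertible_ker [of A] invertible_left_inverse [of A] by blast
  then have det0: "det A \<noteq> 0"
    by (simp add: invertible_det_nz)
  define l where "l = (\<chi> j. lam (emb w) (e j))"
  have "emb w = (\<Sum>v\<in>facet_verts F. lam (emb w) v *\<^sub>R emb v)"
    using comb_over [of "lam (emb w)" "facet_verts F"] F(2) T by (simp add: lam lsupp_def)
  also have "\<dots> = A *v l"
    unfolding Av using e by (intro sum.cong) (auto simp: l_def bij_betw_def f_inv_into_f)
  finally have eq: "l = (\<chi> k. det (\<chi> i j. if j = k then emb w $ i else A $ i $ j) / det A)"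
    using cramer [OF det0] by metis
  have det_rat: "det B \<in> \<rat>" if "\<And>i j. B $ i $ j \<in> \<rat>" for B :: "real ^ 'n ^ 'n"
    unfolding det_def using that by (intro Rats_sum Rats_mult Rats_prod) auto
  have "l $ k \<in> \<rat>" for k
    unfolding eq by (auto intro!: Rats_divide det_rat simp: A_def emb_def)
  then have "lam (emb w) (e k) \<in> \<rat>" for k
    by (simp add: l_def)
  moreover have "lam (emb w) v = 0" if "v \<notin> range e"
    using F(2) e that by (auto simp: bij_betw_def lsupp_def)
  ultimately show ?thesis
    by (cases "v \<in> range e") auto
qed

lemma degP_rational: "degP P (emb w) \<in> \<rat>"
  unfolding degP_eq using lam_rational by (intro Rats_sum) auto

end

section \<open>Presentations of complex vector spaces\<close>

text \<open>The scaling is a parameter because polynomials, Laurent coefficients and forms are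
  scaled through different embeddings of the complex numbers.\<close>

definition csubspace_of :: "(complex \<Rightarrow> 'z \<Rightarrow> 'z::ab_group_add) \<Rightarrow> 'z set \<Rightarrow> bool" where
  "csubspace_of sc A \<longleftrightarrow> 0 \<in> A \<and> (\<forall>x\<in>A. \<forall>y\<in>A. x - y \<in> A) \<and> (\<forall>c. \<forall>x\<in>A. sc c x \<in> A)"

lemma csubspaceD:
  assumes "csubspace_of sc A"
  shows "0 \<in> A" "x \<in> A \<Longrightarrow> y \<in> A \<Longrightarrow> x - y \<in> A" "x \<in> A \<Longrightarrow> sc c x \<in> A"
    "x \<in> A \<Longrightarrow> y \<in> A \<Longrightarrow> x + y \<in> A" "x \<in> A \<Longrightarrow> - x \<in> A"
proof -
  show *: "0 \<in> A" "x \<in> A \<Longrightarrow> y \<in> A \<Longrightarrow> x - y \<in> A" "x \<in> A \<Longrightarrow> sc c x \<in> A" for x y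
    using assms by (auto simp: csubspace_of_def)
  show m: "x \<in> A \<Longrightarrow> - x \<in> A" for x
    using *(2) [of 0 x] *(1) by simp
  show "x \<in> A \<Longrightarrow> y \<in> A \<Longrightarrow> x + y \<in> A"
    using *(2) [of x "- y"] m [of y] by simp
qed

lemma csubspace_Int: "csubspace_of sc A \<Longrightarrow> csubspace_of sc B \<Longrightarrow> csubspace_of sc (A \<inter> B)"
  by (auto simp: csubspace_of_def)

lemma csubspace_sum: "csubspace_of sc A \<Longrightarrow> (\<And>i. i \<in> I \<Longrightarrow> g i \<in> A) \<Longrightarrow> sum g I \<in> A"
  by (induction I rule: infinite_finite_induct) (auto simp: csubspaceD)

text \<open>
  The iterated quotients of the theorem are handled through representatives in a type with honest
  addition and a scaling \<open>sc\<close>: \<open>r\<close> is the projection with kernel \<open>B\<close>.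
\<close>
definition presents :: "('z \<Rightarrow> 'v) \<Rightarrow> (complex \<Rightarrow> 'z \<Rightarrow> 'z::ab_group_add) \<Rightarrow> 'z set \<Rightarrow> 'z set
    \<Rightarrow> (complex, 'v) module \<Rightarrow> bool" where
  "presents r sc A B V \<longleftrightarrow>
     (\<forall>c x y. sc c (x + y) = sc c x + sc c y) \<and> csubspace_of sc A \<and> csubspace_of sc B \<and> B \<subseteq> A \<and>
     r ` A = carrier V \<and> r 0 = \<zero>\<^bsub>V\<^esub> \<and>
     (\<forall>x\<in>A. \<forall>y\<in>A. r (x + y) = r x \<oplus>\<^bsub>V\<^esub> r y) \<and> (\<forall>c. \<forall>x\<in>A. r (sc c x) = c \<odot>\<^bsub>V\<^esub> r x) \<and>
     (\<forall>x\<in>A. \<forall>y\<in>A. r x = r y \<longleftrightarrow> x - y \<in> B)"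

lemma presentsD:
  assumes "presents r sc A B V"
  shows "sc c (x + y) = sc c x + sc c y" "csubspace_of sc A" "csubspace_of sc B" "B \<subseteq> A"
    "carrier V = r ` A" "r 0 = \<zero>\<^bsub>V\<^esub>"
    "x \<in> A \<Longrightarrow> y \<in> A \<Longrightarrow> r (x + y) = r x \<oplus>\<^bsub>V\<^esub> r y"
    "x \<in> A \<Longrightarrow> r (sc c x) = c \<odot>\<^bsub>V\<^esub> r x"
    "x \<in> A \<Longrightarrow> y \<in> A \<Longrightarrow> r x = r y \<longleftrightarrow> x - y \<in> B"
  using assms unfolding presents_def by auto

lemma presents_restrict:
  assumes "presents r sc A B V" "csubspace_of sc A'" "A' \<subseteq> A" "C = r ` A'"
  shows "presents r sc A' (B \<inter> A') (V\<lparr>carrier := C\<rparr>)"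
proof -
  note p = presentsD [OF assms(1)]
  show ?thesis
    unfolding presents_def
    using p assms csubspace_Int [OF p(3) assms(2)] csubspaceD(2) [OF assms(2)]
    by (auto simp: subset_iff)
qed

lemma coset_image:
  assumes V: "presents r sc A B V" and B': "csubspace_of sc B'" "B' \<subseteq> A" and x: "x \<in> A"
  shows "r ` B' +>\<^bsub>V\<^esub> r x = r ` {y \<in> A. y - x \<in> B'}"
proof -
  note p = presentsD [OF V]
  have "r ` B' +>\<^bsub>V\<^esub> r x = (\<lambda>b. r (b + x)) ` B'"
    using p(7) B'(2) x by (auto simp: a_r_coset_def r_coset_def subset_iff)
  also have "\<dots> = r ` {y \<in> A. y - x \<in> B'}"
  proof (intro antisym subsetI)
    fix z assume "z \<in> (\<lambda>b. r (b + x)) ` B'"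
    then obtain b where "b \<in> B'" "z = r (b + x)" by blast
    then show "z \<in> r ` {y \<in> A. y - x \<in> B'}"
      using B'(2) csubspaceD(4) [OF p(2)] x by (intro image_eqI [of _ _ "b + x"]) auto
  next
    fix z assume "z \<in> r ` {y \<in> A. y - x \<in> B'}"
    then obtain y where "y - x \<in> B'" "z = r y" by blast
    then show "z \<in> (\<lambda>b. r (b + x)) ` B'"
      by (intro image_eqI [of _ _ "y - x"]) auto
  qed
  finally show ?thesis .
qed

lemma coset_eq_iff:
  assumes V: "presents r sc A B V" and B': "csubspace_of sc B'" "B \<subseteq> B'" "B' \<subseteq> A"
    and x: "x \<in> A" and y: "y \<in> A"
  shows "r ` B' +>\<^bsub>V\<^esub> r x = r ` B' +>\<^bsub>V\<^esub> r y \<longleftrightarrow> x - y \<in> B'"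
    and "r x \<in> r ` B' +>\<^bsub>V\<^esub> r y \<longleftrightarrow> x - y \<in> B'"
proof -
  note p = presentsD [OF V]
  have mem: "r x \<in> r ` {z \<in> A. z - y \<in> B'} \<longleftrightarrow> x - y \<in> B'" if x: "x \<in> A" and y: "y \<in> A" for x y
  proof
    assume "r x \<in> r ` {z \<in> A. z - y \<in> B'}"
    then obtain z where z: "z \<in> A" "z - y \<in> B'" "r x = r z" by blast
    then have "x - z \<in> B'"
      using p(9) [OF x z(1)] B'(2) by blast
    then show "x - y \<in> B'"
      using csubspaceD(4) [OF B'(1), of "x - z" "z - y"] z by simp
  qed (use x in blast)
  show "r x \<in> r ` B' +>\<^bsub>V\<^esub> r y \<longleftrightarrow> x - y \<in> B'"
    unfolding coset_image [OF V B'(1,3) y] using mem [OF x y] .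
  show "r ` B' +>\<^bsub>V\<^esub> r x = r ` B' +>\<^bsub>V\<^esub> r y \<longleftrightarrow> x - y \<in> B'"
    unfolding coset_image [OF V B'(1,3) y] coset_image [OF V B'(1,3) x]
  proof
    assume "r ` {z \<in> A. z - x \<in> B'} = r ` {z \<in> A. z - y \<in> B'}"
    moreover have "r x \<in> r ` {z \<in> A. z - x \<in> B'}"
      using mem [OF x x] csubspaceD(1) [OF B'(1)] by simp
    ultimately show "x - y \<in> B'"
      using mem [OF x y] by simp
  next
    assume xy: "x - y \<in> B'"
    have "z - x \<in> B' \<longleftrightarrow> z - y \<in> B'" for z
      using csubspaceD(4) [OF B'(1), of "z - x" "x - y"] csubspaceD(2) [OF B'(1), of "z - y" "x - y"] xy
      by auto
    then show "r ` {z \<in> A. z - x \<in> B'} = r ` {z \<in> A. z - y \<in> B'}"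
      by simp
  qed
qed

text \<open>A quotient of a quotient is again a quotient of the original space: the representatives
  stay and the kernel grows from \<open>B\<close> to \<open>B'\<close>.\<close>

lemma presents_quotient:
  assumes V: "presents r sc A B V" and B': "csubspace_of sc B'" "B \<subseteq> B'" "B' \<subseteq> A" and W: "W = r ` B'"
  shows "presents (\<lambda>x. W +>\<^bsub>V\<^esub> r x) sc A B' (quotient_module V W)"
proof -
  note p = presentsD [OF V]
  note im = coset_image [OF V B'(1,3)]
  have zero: "W +>\<^bsub>V\<^esub> r 0 = W"
    using im [OF csubspaceD(1) [OF p(2)]] B'(3) by (auto simp: W)
  have add: "W +>\<^bsub>V\<^esub> r (x + y) = (W +>\<^bsub>V\<^esub> r x) <+>\<^bsub>V\<^esub> (W +>\<^bsub>V\<^esub> r y)" if xy: "x \<in> A" "y \<in> A" for x y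
  proof -
    have "(W +>\<^bsub>V\<^esub> r x) <+>\<^bsub>V\<^esub> (W +>\<^bsub>V\<^esub> r y)
        = {r a \<oplus>\<^bsub>V\<^esub> r b |a b. a \<in> A \<and> a - x \<in> B' \<and> b \<in> A \<and> b - y \<in> B'}"
      unfolding W im [OF xy(1)] im [OF xy(2)] by (auto simp: set_add_def set_mult_def)
    also have "\<dots> = {r (a + b) |a b. a \<in> A \<and> a - x \<in> B' \<and> b \<in> A \<and> b - y \<in> B'}"
      using p(7) by (intro Collect_cong) metis
    also have "\<dots> = r ` {z \<in> A. z - (x + y) \<in> B'}"
    proof (intro antisym subsetI)
      fix z assume "z \<in> {r (a + b) |a b. a \<in> A \<and> a - x \<in> B' \<and> b \<in> A \<and> b - y \<in> B'}"
      then obtain a b where ab: "z = r (a + b)" "a \<in> A" "a - x \<in> B'" "b \<in> A" "b - y \<in> B'" by blast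
      have "a + b - (x + y) = (a - x) + (b - y)" by simp
      then have "a + b - (x + y) \<in> B'"
        using csubspaceD(4) [OF B'(1) ab(3,5)] by metis
      then show "z \<in> r ` {z \<in> A. z - (x + y) \<in> B'}"
        using ab csubspaceD(4) [OF p(2) ab(2,4)] by blast
    next
      fix z assume "z \<in> r ` {z \<in> A. z - (x + y) \<in> B'}"
      then obtain w where w: "z = r w" "w \<in> A" "w - (x + y) \<in> B'" by blast
      have "w = (w - y) + y" "w - y - x = w - (x + y)" "w - y \<in> A" "y - y \<in> B'"
        using csubspaceD(2) [OF p(2) w(2) xy(2)] csubspaceD(1) [OF B'(1)] by (simp_all add: algebra_simps)
      then show "z \<in> {r (a + b) |a b. a \<in> A \<and> a - x \<in> B' \<and> b \<in> A \<and> b - y \<in> B'}"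
        using w xy by (metis (mono_tags, lifting) mem_Collect_eq)
    qed
    finally show ?thesis
      unfolding W using im [OF csubspaceD(4) [OF p(2) xy]] by simp
  qed
  have smult: "W +>\<^bsub>V\<^esub> r (sc c x) = W <+>\<^bsub>V\<^esub> ((\<lambda>v. c \<odot>\<^bsub>V\<^esub> v) ` (W +>\<^bsub>V\<^esub> r x))" if x: "x \<in> A" for c x
  proof -
    have "(\<lambda>v. c \<odot>\<^bsub>V\<^esub> v) ` (W +>\<^bsub>V\<^esub> r x) = (\<lambda>y. r (sc c y)) ` {y \<in> A. y - x \<in> B'}"
      unfolding W im [OF x] image_image using p(8) by (intro image_cong) auto
    then have "W <+>\<^bsub>V\<^esub> ((\<lambda>v. c \<odot>\<^bsub>V\<^esub> v) ` (W +>\<^bsub>V\<^esub> r x))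
      = {r b \<oplus>\<^bsub>V\<^esub> r (sc c y) |b y. b \<in> B' \<and> y \<in> A \<and> y - x \<in> B'}"
      by (auto simp: set_add_def set_mult_def W)
    also have "\<dots> = {r (b + sc c y) |b y. b \<in> B' \<and> y \<in> A \<and> y - x \<in> B'}"
      using p(7) csubspaceD(3) [OF p(2)] B'(3) by (intro Collect_cong) (metis subsetD)
    also have "\<dots> = r ` {z \<in> A. z - sc c x \<in> B'}"
    proof (intro antisym subsetI)
      fix z assume "z \<in> {r (b + sc c y) |b y. b \<in> B' \<and> y \<in> A \<and> y - x \<in> B'}"
      then obtain b y where b: "z = r (b + sc c y)" "b \<in> B'" "y \<in> A" "y - x \<in> B'" by blast
      have "sc c y = sc c x + sc c (y - x)"
        using p(1) [of c x "y - x"] by simp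
      then have "b + sc c y - sc c x = b + sc c (y - x)" by simp
      also have "\<dots> \<in> B'"
        using b csubspaceD(3,4) [OF B'(1)] by blast
      finally show "z \<in> r ` {z \<in> A. z - sc c x \<in> B'}"
        using b B'(3) csubspaceD(3,4) [OF p(2)] by blast
    next
      fix z assume "z \<in> r ` {z \<in> A. z - sc c x \<in> B'}"
      then obtain w where w: "z = r w" "w - sc c x \<in> B'" by blast
      moreover have "w = (w - sc c x) + sc c x" "x - x \<in> B'"
        using csubspaceD(1) [OF B'(1)] by auto
      ultimately show "z \<in> {r (b + sc c y) |b y. b \<in> B' \<and> y \<in> A \<and> y - x \<in> B'}"
        using x by (metis (mono_tags, lifting) mem_Collect_eq)
    qed
    finally show ?thesis
      unfolding W using im [OF csubspaceD(3) [OF p(2) x]] by simp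
  qed
  have car: "(\<lambda>x. W +>\<^bsub>V\<^esub> r x) ` A = a_rcosets\<^bsub>V\<^esub> W"
    using p(5) by (auto simp: A_RCOSETS_def RCOSETS_def a_r_coset_def)
  show ?thesis
    unfolding presents_def quotient_module_def
    using p(1,2) B' zero add smult car coset_eq_iff(1) [OF V B'] by (auto simp: W)
qed

text \<open>For exchanging the space of representatives: if the image of \<open>g\<close> meets
  every class modulo \<open>B\<close>, its source presents the same space. It is applied to the
  passage from polynomials to Laurent forms, to that from polynomials to top forms, and to the
  inclusion of homogeneous polynomials.\<close>

lemma presents_pullback:
  assumes V: "presents r sc A B V" and A1: "csubspace_of sc1 A1" "\<And>c x y. sc1 c (x + y) = sc1 c x + sc1 c y"
    and g: "\<And>x. x \<in> A1 \<Longrightarrow> g x \<in> A" "\<And>x y. x \<in> A1 \<Longrightarrow> y \<in> A1 \<Longrightarrow> g (x + y) = g x + g y"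
      "\<And>c x. x \<in> A1 \<Longrightarrow> g (sc1 c x) = sc c (g x)"
    and onto: "\<And>x. x \<in> A \<Longrightarrow> \<exists>y\<in>A1. x - g y \<in> B"
  shows "presents (\<lambda>x. r (g x)) sc1 A1 {x \<in> A1. g x \<in> B} V"
proof -
  note p = presentsD [OF V]
  have g0: "g 0 = 0"
    using g(2) [of 0 0] csubspaceD(1) [OF A1(1)] by simp
  have gd: "g (x - y) = g x - g y" if "x \<in> A1" "y \<in> A1" for x y
    using g(2) [of "x - y" y] csubspaceD(2) [OF A1(1) that] that by (simp add: algebra_simps)
  have "csubspace_of sc1 {x \<in> A1. g x \<in> B}"
    using csubspaceD [OF A1(1)] csubspaceD [OF p(3)] g gd g0 by (auto simp: csubspace_of_def)
  moreover have "(\<lambda>x. r (g x)) ` A1 = carrier V"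
  proof (intro antisym subsetI)
    fix v assume "v \<in> carrier V"
    then obtain x where x: "x \<in> A" "v = r x" using p(5) by blast
    then obtain y where "y \<in> A1" "x - g y \<in> B" using onto by blast
    then show "v \<in> (\<lambda>x. r (g x)) ` A1"
      using x p(9) g(1) by blast
  qed (use p(5) g(1) in auto)
  ultimately show ?thesis
    unfolding presents_def using A1 p g gd g0 csubspaceD(2) [OF A1(1)] by auto
qed

text \<open>The kernel is read off componentwise. Surjectivity rests on \<open>onto\<close>: a
  finitely supported family of representatives must come from a single representative.\<close>

lemma presents_direct_sum:
  assumes M: "\<And>i. i \<in> J \<Longrightarrow> presents (r i) sc1 (A i) (B i) (M i)"
    and A: "csubspace_of sc A0" "\<And>c x y. sc c (x + y) = sc c x + sc c y"
    and cmp: "\<And>i x. i \<in> J \<Longrightarrow> x \<in> A0 \<Longrightarrow> cmp i x \<in> A i"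
      "\<And>i x y. i \<in> J \<Longrightarrow> x \<in> A0 \<Longrightarrow> y \<in> A0 \<Longrightarrow> cmp i (x + y) = cmp i x + cmp i y"
      "\<And>i c x. i \<in> J \<Longrightarrow> x \<in> A0 \<Longrightarrow> cmp i (sc c x) = sc1 c (cmp i x)"
      "\<And>x. x \<in> A0 \<Longrightarrow> finite {i \<in> J. cmp i x \<noteq> 0}"
    and onto: "\<And>y. (\<And>i. i \<in> J \<Longrightarrow> y i \<in> A i) \<Longrightarrow> finite {i \<in> J. y i \<noteq> 0} \<Longrightarrow>
      \<exists>x\<in>A0. \<forall>i\<in>J. cmp i x = y i"
  shows "presents (\<lambda>x. \<lambda>i\<in>J. r i (cmp i x)) sc A0 {x \<in> A0. \<forall>i\<in>J. cmp i x \<in> B i} (direct_sum J M)"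
proof -
  note p = presentsD [OF M]
  have cmp0: "cmp i 0 = 0" if "i \<in> J" for i
    using cmp(2) [OF that, of 0 0] csubspaceD(1) [OF A(1)] by simp
  have cmpd: "cmp i (x - y) = cmp i x - cmp i y" if "i \<in> J" "x \<in> A0" "y \<in> A0" for i x y
    using cmp(2) [OF that(1), of "x - y" y] csubspaceD(2) [OF A(1)] that by (simp add: algebra_simps)
  have sub: "csubspace_of sc {x \<in> A0. \<forall>i\<in>J. cmp i x \<in> B i}"
    using csubspaceD [OF A(1)] csubspaceD [OF p(3)] cmp cmp0 cmpd by (auto simp: csubspace_of_def)
  have onto': "(\<lambda>x. \<lambda>i\<in>J. r i (cmp i x)) ` A0 = carrier (direct_sum J M)"
  proof (intro antisym subsetI)
    fix X assume "X \<in> (\<lambda>x. \<lambda>i\<in>J. r i (cmp i x)) ` A0"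
    then obtain x where x: "x \<in> A0" "X = (\<lambda>i\<in>J. r i (cmp i x))" by blast
    have "{i \<in> J. X i \<noteq> \<zero>\<^bsub>M i\<^esub>} \<subseteq> {i \<in> J. cmp i x \<noteq> 0}"
      using p(6) x by auto
    then show "X \<in> carrier (direct_sum J M)"
      using x p(5) cmp(1) finite_subset [OF _ cmp(4) [OF x(1)]] by (auto simp: direct_sum_def)
  next
    fix X assume X: "X \<in> carrier (direct_sum J M)"
    then have X': "X \<in> (\<Pi>\<^sub>E i\<in>J. carrier (M i))" "finite {i \<in> J. X i \<noteq> \<zero>\<^bsub>M i\<^esub>}"
      by (auto simp: direct_sum_def)
    \<comment> \<open>A zero component gets the representative 0 and not just any element of the
      kernel, so that the family of representatives is again finitely supported.\<close>
    define y where "y i = (if X i = \<zero>\<^bsub>M i\<^esub> then 0 else SOME z. z \<in> A i \<and> r i z = X i)" for i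
    have y: "y i \<in> A i \<and> r i (y i) = X i" if "i \<in> J" for i
    proof (cases "X i = \<zero>\<^bsub>M i\<^esub>")
      case True
      then show ?thesis
        using p(6) [OF that] csubspaceD(1) [OF p(2) [OF that]] by (simp add: y_def)
    next
      case False
      have "\<exists>z. z \<in> A i \<and> r i z = X i"
        using PiE_mem [OF X'(1) that] p(5) [OF that] by (metis imageE)
      then show ?thesis
        unfolding y_def using False someI_ex [of "\<lambda>z. z \<in> A i \<and> r i z = X i"] by simp
    qed
    have "finite {i \<in> J. y i \<noteq> 0}"
      by (rule finite_subset [OF _ X'(2)]) (auto simp: y_def)
    then obtain x where x: "x \<in> A0" "\<forall>i\<in>J. cmp i x = y i"
      using onto [of y] y by blast
    then have "X = (\<lambda>i\<in>J. r i (cmp i x))"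
      using X'(1) y by (auto simp: PiE_iff extensional_def fun_eq_iff)
    then show "X \<in> (\<lambda>x. \<lambda>i\<in>J. r i (cmp i x)) ` A0"
      using x by blast
  qed
  have eq: "(\<lambda>i\<in>J. r i (cmp i x)) = (\<lambda>i\<in>J. r i (cmp i y)) \<longleftrightarrow> (\<forall>i\<in>J. cmp i (x - y) \<in> B i)"
    if "x \<in> A0" "y \<in> A0" for x y
    using p(9) cmp(1) cmpd that by (auto simp: fun_eq_iff)
  show ?thesis
    unfolding presents_def
    using A sub onto' eq cmp0 p(6-8) cmp csubspaceD(2) [OF A(1)]
    by (auto simp: direct_sum_def fun_eq_iff)
qed

text \<open>A component can vanish as a class while its representative does not. \<open>sub\<close>
  supplies a representative whose other components are honestly 0.\<close>

lemma dsum_component_presents: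
  assumes D: "presents (\<lambda>x. \<lambda>i\<in>J. r i (cmp i x)) sc A0 B0 (direct_sum J M)"
    and M: "\<And>i. i \<in> J \<Longrightarrow> r i 0 = \<zero>\<^bsub>M i\<^esub>"
    and sub: "\<And>x. x \<in> A0 \<Longrightarrow> \<exists>x'\<in>A0. \<forall>i\<in>J. cmp i x' = (if i = k then cmp i x else 0)"
  shows "dsum_component J M k = (\<lambda>x. \<lambda>i\<in>J. r i (cmp i x)) ` {x \<in> A0. \<forall>i\<in>J - {k}. cmp i x = 0}"
proof (intro antisym subsetI)
  fix X assume "X \<in> dsum_component J M k"
  then have X: "X \<in> carrier (direct_sum J M)" "\<forall>i\<in>J - {k}. X i = \<zero>\<^bsub>M i\<^esub>"
    by (auto simp: dsum_component_def)
  then obtain x where x: "x \<in> A0" "X = (\<lambda>i\<in>J. r i (cmp i x))"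
    using presentsD(5) [OF D] by blast
  then obtain x' where x': "x' \<in> A0" "\<forall>i\<in>J. cmp i x' = (if i = k then cmp i x else 0)"
    using sub by blast
  have "X = (\<lambda>i\<in>J. r i (cmp i x'))"
    using X(2) x x' M by (auto simp: fun_eq_iff)
  then show "X \<in> (\<lambda>x. \<lambda>i\<in>J. r i (cmp i x)) ` {x \<in> A0. \<forall>i\<in>J - {k}. cmp i x = 0}"
    using x' by auto
next
  fix X assume "X \<in> (\<lambda>x. \<lambda>i\<in>J. r i (cmp i x)) ` {x \<in> A0. \<forall>i\<in>J - {k}. cmp i x = 0}"
  then obtain x where "X = (\<lambda>i\<in>J. r i (cmp i x))" "x \<in> A0" "\<forall>i\<in>J - {k}. cmp i x = 0" by blast
  then show "X \<in> dsum_component J M k"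
    using presentsD(5) [OF D] M by (simp add: dsum_component_def)
qed

text \<open>The images of all elements of \<open>X\<close> are congruent modulo \<open>B'\<close>,
  so adding \<open>W\<close> merges them into a single coset. This is the well-definedness argument
  for every induced map of the development.\<close>

lemma induced_eq:
  assumes V: "presents r sc A B V" and B': "csubspace_of sc B'" "B \<subseteq> B'" "B' \<subseteq> A" and W: "W = r ` B'"
    and x: "x \<in> A" and X: "X \<noteq> {}" "\<And>z. z \<in> X \<Longrightarrow> \<exists>y\<in>A. T z = r y \<and> y - x \<in> B'"
  shows "induced V W T X = W +>\<^bsub>V\<^esub> r x"
proof -
  note p = presentsD [OF V]
  have im: "W +>\<^bsub>V\<^esub> r x = r ` {y \<in> A. y - x \<in> B'}"
    unfolding W by (rule coset_image [OF V B'(1,3) x])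
  show ?thesis
    unfolding im induced_def
  proof (intro antisym subsetI)
    fix z assume "z \<in> W <+>\<^bsub>V\<^esub> (T ` X)"
    then obtain b t where b: "b \<in> B'" "t \<in> X" "z = r b \<oplus>\<^bsub>V\<^esub> T t"
      by (auto simp: set_add_def set_mult_def W)
    then obtain y where y: "y \<in> A" "T t = r y" "y - x \<in> B'"
      using X(2) by blast
    have "z = r (b + y)" "b + y \<in> A"
      using p(7) [of b y] csubspaceD(4) [OF p(2)] b y B'(3) by auto
    moreover have "b + y - x = b + (y - x)" by simp
    then have "b + y - x \<in> B'"
      using csubspaceD(4) [OF B'(1) b(1) y(3)] by metis
    ultimately show "z \<in> r ` {y \<in> A. y - x \<in> B'}" by blast
  next
    fix z assume "z \<in> r ` {y \<in> A. y - x \<in> B'}"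
    then obtain y where y: "z = r y" "y \<in> A" "y - x \<in> B'" by blast
    obtain t where t: "t \<in> X" using X(1) by blast
    obtain y' where y': "y' \<in> A" "T t = r y'" "y' - x \<in> B'"
      using X(2) [OF t] by blast
    have "y - y' \<in> B'"
      using csubspaceD(2) [OF B'(1) y(3) y'(3)] by simp
    moreover have "z = r (y - y') \<oplus>\<^bsub>V\<^esub> T t"
      using p(7) [of "y - y'" y'] y y' calculation B'(3) by (simp add: subset_iff)
    ultimately show "z \<in> W <+>\<^bsub>V\<^esub> (T ` X)"
      using t by (auto simp: set_add_def set_mult_def W)
  qed
qed

text \<open>An isomorphism of quotients obtained from a map \<open>g\<close> of representatives:
  \<open>g(4)\<close> makes it well defined and injective, \<open>g(5)\<close> surjective. The
  endomorphisms commute with \<open>g\<close> modulo the kernel \<open>B'\<close>.\<close>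

lemma presents_end_iso:
  assumes V: "presents r sc A B V" and V': "presents r' sc' A' B' V'"
    and g: "\<And>x. x \<in> A \<Longrightarrow> g x \<in> A'" "\<And>x y. x \<in> A \<Longrightarrow> y \<in> A \<Longrightarrow> g (x + y) = g x + g y"
      "\<And>c x. x \<in> A \<Longrightarrow> g (sc c x) = sc' c (g x)" "\<And>x. x \<in> A \<Longrightarrow> g x \<in> B' \<longleftrightarrow> x \<in> B"
      "\<And>y. y \<in> A' \<Longrightarrow> \<exists>x\<in>A. y - g x \<in> B'"
    and S: "\<And>x. x \<in> A \<Longrightarrow> s x \<in> A \<and> S (r x) = r (s x)"
    and T: "\<And>x. x \<in> A' \<Longrightarrow> t x \<in> A' \<and> T (r' x) = r' (t x)"
    and st: "\<And>x. x \<in> A \<Longrightarrow> g (s x) - t (g x) \<in> B'"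
  shows "\<exists>\<phi>. end_iso V S V' T \<phi> \<and> (\<forall>x\<in>A. \<phi> (r x) = r' (g x))"
proof -
  note p = presentsD [OF V] and q = presentsD [OF V']
  have gd: "g (x - y) = g x - g y" if "x \<in> A" "y \<in> A" for x y
    using g(2) [of "x - y" y] csubspaceD(2) [OF p(2) that] that by (simp add: algebra_simps)
  \<comment> \<open>The choice of representative is immaterial by \<open>phi\<close>, because
    \<open>g\<close> maps \<open>B\<close> into \<open>B'\<close>.\<close>
  define \<phi> where "\<phi> v = r' (g (SOME x. x \<in> A \<and> r x = v))" for v
  have phi: "\<phi> (r x) = r' (g x)" if x: "x \<in> A" for x
  proof -
    define y where "y = (SOME y. y \<in> A \<and> r y = r x)"
    have y: "y \<in> A \<and> r y = r x"
      unfolding y_def by (rule someI [of _ x]) (simp add: x)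
    then have "y - x \<in> B" using p(9) [of y x] x by simp
    then have "g y - g x \<in> B'"
      using g(4) [of "y - x"] gd y x csubspaceD(2) [OF p(2)] by simp
    then show ?thesis
      using q(9) [of "g y" "g x"] g(1) x y by (simp add: \<phi>_def y_def)
  qed
  have "inj_on \<phi> (carrier V)"
  proof (rule inj_onI)
    fix v w assume vw: "v \<in> carrier V" "w \<in> carrier V" "\<phi> v = \<phi> w"
    then obtain x y where xy: "x \<in> A" "v = r x" "y \<in> A" "w = r y"
      using p(5) by blast
    then have "g (x - y) \<in> B'"
      using vw phi q(9) [of "g x" "g y"] g(1) gd by simp
    then show "v = w"
      using xy g(4) [of "x - y"] csubspaceD(2) [OF p(2)] p(9) by simp
  qed
  moreover have "\<phi> ` carrier V = carrier V'"
  proof (intro antisym subsetI)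
    fix w assume "w \<in> carrier V'"
    then obtain y where y: "y \<in> A'" "w = r' y" using q(5) by blast
    then obtain x where x: "x \<in> A" "y - g x \<in> B'" using g(5) by blast
    then have "w = \<phi> (r x)"
      using y phi q(9) g(1) by simp
    then show "w \<in> \<phi> ` carrier V"
      using x p(5) by blast
  qed (use p(5) q(5) phi g(1) in auto)
  moreover have "\<phi> (S (r x)) = T (\<phi> (r x))" if "x \<in> A" for x
    using S [OF that] T [OF g(1) [OF that]] phi st [OF that] that q(9) g(1) by simp
  moreover have "\<phi> (r x \<oplus>\<^bsub>V\<^esub> r y) = \<phi> (r x) \<oplus>\<^bsub>V'\<^esub> \<phi> (r y)" if "x \<in> A" "y \<in> A" for x y
    using phi [OF csubspaceD(4) [OF p(2) that]] phi that p(7) q(7) g by simp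
  moreover have "\<phi> (c \<odot>\<^bsub>V\<^esub> r x) = c \<odot>\<^bsub>V'\<^esub> \<phi> (r x)" if "x \<in> A" for x c
    using phi [OF csubspaceD(3) [OF p(2) that]] phi that p(8) q(8) g by simp
  ultimately have "end_iso V S V' T \<phi>"
    unfolding end_iso_def bij_betw_def p(5) using S by auto
  then show ?thesis
    using phi by blast
qed

section \<open>Forms\<close>

definition form_scale :: "(complex \<Rightarrow> 'r) \<Rightarrow> complex \<Rightarrow> ('n, 'r::comm_ring_1) form \<Rightarrow> ('n, 'r) form" where
  "form_scale \<iota> c \<omega> = (\<lambda>I. \<iota> c * \<omega> I)"

lemma csubspace_forms: "csubspace_of (form_scale \<iota>) (forms k)"
  by (auto simp: csubspace_of_def forms_def form_scale_def)

lemma form_scale_add: "form_scale \<iota> c (x + y) = form_scale \<iota> c x + form_scale \<iota> c y"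
  by (auto simp: form_scale_def fun_eq_iff algebra_simps)

lemma presents_form_space: "presents (\<lambda>\<omega>. \<omega>) (form_scale \<iota>) (forms k) {0} (form_space \<iota> k)"
proof -
  have "csubspace_of (form_scale \<iota>) {0 :: ('a, 'b) form}"
    by (auto simp: csubspace_of_def form_scale_def fun_eq_iff)
  then show ?thesis
    unfolding presents_def using csubspace_forms csubspaceD(1) [OF csubspace_forms]
    by (auto simp: form_space_def form_scale_add) (auto simp: fun_eq_iff form_scale_def)
qed

lemma a_r_coset_carrier_update: "W +>\<^bsub>M\<lparr>carrier := C\<rparr>\<^esub> x = W +>\<^bsub>M\<^esub> (x :: 'v)"
  for M :: "(complex, 'v) module"
  by (simp add: a_r_coset_def r_coset_def)

lemma presents_gr_base:
  assumes F: "csubspace_of (form_scale \<iota>) (F p)" "F p \<subseteq> forms k"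
    and L: "csubspace_of (form_scale \<iota>) (filt_below J F p)" "filt_below J F p \<subseteq> F p"
  shows "presents (gr_class J (form_space \<iota> k) F p) (form_scale \<iota>) (F p) (filt_below J F p)
      (gr J (form_space \<iota> k) F p)"
proof -
  have base: "presents (\<lambda>\<omega>. \<omega>) (form_scale \<iota>) (F p) ({0} \<inter> F p) ((form_space \<iota> k)\<lparr>carrier := F p\<rparr>)"
    by (rule presents_restrict [OF presents_form_space F]) simp
  have "{0} \<inter> F p \<subseteq> filt_below J F p"
    using csubspaceD(1) [OF L(1)] by blast
  from presents_quotient [OF base L(1) this L(2), of "filt_below J F p"] show ?thesis
    by (simp add: gr_class_def [abs_def] gr_def a_r_coset_carrier_update)
qed

lemma presents_gr:
  assumes F: "csubspace_of (form_scale \<iota>) (F p)" "F p \<subseteq> forms k"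
    and L: "csubspace_of (form_scale \<iota>) (filt_below J F p)" "filt_below J F p \<subseteq> F p"
    and S: "csubspace_of (form_scale \<iota>) S"
  shows "presents (gr_class J (form_space \<iota> k) F p) (form_scale \<iota>) (F p \<inter> S) (filt_below J F p \<inter> (F p \<inter> S))
      ((gr J (form_space \<iota> k) F p)\<lparr>carrier := gr_image J (form_space \<iota> k) F p S\<rparr>)"
  by (rule presents_restrict [OF presents_gr_base [OF F L]])
     (auto simp: csubspace_Int F S gr_image_def)

section \<open>Linear maps out of a monoid algebra\<close>

abbreviation Const :: "complex \<Rightarrow> 'm::zero \<Rightarrow>\<^sub>0 complex" where
  "Const c \<equiv> Poly_Mapping.single 0 c"

abbreviation Mon :: "'m \<Rightarrow> 'm \<Rightarrow>\<^sub>0 complex" where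
  "Mon m \<equiv> Poly_Mapping.single m 1"

abbreviation "lookup \<equiv> Poly_Mapping.lookup"
abbreviation "keys \<equiv> Poly_Mapping.keys"

text \<open>The ring maps from the complex numbers to themselves, to polynomials, to Laurent
  polynomials and to Laurent polynomials in \<tau> are all of this kind, so one notion of linearity
  serves for all targets.\<close>

definition scalar_hom :: "(complex \<Rightarrow> 'b::comm_ring_1) \<Rightarrow> bool" where
  "scalar_hom \<iota> \<longleftrightarrow> \<iota> 0 = 0 \<and> \<iota> 1 = 1 \<and> (\<forall>a b. \<iota> (a + b) = \<iota> a + \<iota> b) \<and> (\<forall>a b. \<iota> (a * b) = \<iota> a * \<iota> b)"

lemma scalar_homD:
  assumes "scalar_hom \<iota>"
  shows "\<iota> 0 = 0" "\<iota> 1 = 1" "\<iota> (a + b) = \<iota> a + \<iota> b" "\<iota> (a * b) = \<iota> a * \<iota> b"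
  using assms by (auto simp: scalar_hom_def)

lemma scalar_hom_Const: "scalar_hom (Const :: complex \<Rightarrow> 'm::comm_monoid_add \<Rightarrow>\<^sub>0 complex)"
  by (auto simp: scalar_hom_def single_add mult_single)

lemma scalar_hom_id: "scalar_hom (\<lambda>c. c)"
  by (auto simp: scalar_hom_def)

definition linear_over :: "(complex \<Rightarrow> 'b::comm_ring_1) \<Rightarrow> (('m::comm_monoid_add \<Rightarrow>\<^sub>0 complex) \<Rightarrow> 'b) \<Rightarrow> bool" where
  "linear_over \<iota> T \<longleftrightarrow> (\<forall>p q. T (p + q) = T p + T q) \<and> (\<forall>c p. T (Const c * p) = \<iota> c * T p)"

lemma linear_overD:
  assumes "linear_over \<iota> T"
  shows "T (p + q) = T p + T q" "T (Const c * p) = \<iota> c * T p" "T 0 = 0" "T (p - q) = T p - T q" "T (- p) = - T p"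
proof -
  show *: "T (p + q) = T p + T q" "T (Const c * p) = \<iota> c * T p" for p q c
    using assms by (auto simp: linear_over_def)
  show 0: "T 0 = 0"
    using *(1) [of 0 0] by simp
  show "T (p - q) = T p - T q" for p q
    using *(1) [of "p - q" q] by simp
  from this [of 0 p] 0 show "T (- p) = - T p" by simp
qed

lemma linear_over_sum: "linear_over \<iota> T \<Longrightarrow> T (\<Sum>i\<in>A. g i) = (\<Sum>i\<in>A. T (g i))"
  by (induction A rule: infinite_finite_induct) (auto simp: linear_overD)

lemma poly_mapping_sum_single: "p = (\<Sum>m\<in>keys p. Poly_Mapping.single m (lookup p m))"
  by (rule poly_mapping_eqI) (auto simp: lookup_sum lookup_single when_def in_keys_iff)

lemma linear_over_expand:
  assumes "linear_over \<iota> T"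
  shows "T p = (\<Sum>m\<in>keys p. \<iota> (lookup p m) * T (Mon m))"
proof -
  have "T p = T (\<Sum>m\<in>keys p. Const (lookup p m) * Mon m)"
    using poly_mapping_sum_single [of p] by (simp add: mult_single)
  then show ?thesis
    by (simp only: linear_over_sum [OF assms] linear_overD [OF assms])
qed

lemma linear_over_eqI:
  assumes "linear_over \<iota> T" "linear_over \<iota> T'" "\<And>m. m \<in> keys p \<Longrightarrow> T (Mon m) = T' (Mon m)"
  shows "T p = T' p"
  using assms linear_over_expand [of \<iota> T p] linear_over_expand [of \<iota> T' p] by simp

definition lin :: "(complex \<Rightarrow> 'b::comm_ring_1) \<Rightarrow> ('m::comm_monoid_add \<Rightarrow> 'b) \<Rightarrow> ('m \<Rightarrow>\<^sub>0 complex) \<Rightarrow> 'b" where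
  "lin \<iota> F p = (\<Sum>m\<in>keys p. \<iota> (lookup p m) * F m)"

lemma lin_superset:
  assumes "scalar_hom \<iota>" "finite A" "keys p \<subseteq> A"
  shows "lin \<iota> F p = (\<Sum>m\<in>A. \<iota> (lookup p m) * F m)"
  unfolding lin_def using assms
  by (intro sum.mono_neutral_left) (auto simp: in_keys_iff scalar_homD)

lemma lin_linear:
  assumes "scalar_hom \<iota>"
  shows "linear_over \<iota> (lin \<iota> F)"
  unfolding linear_over_def
proof (intro conjI allI)
  fix p q :: "'b \<Rightarrow>\<^sub>0 complex"
  have "lin \<iota> F (p + q) = (\<Sum>m\<in>keys p \<union> keys q. \<iota> (lookup (p + q) m) * F m)"
    using keys_add [of p q] by (intro lin_superset assms) auto
  also have "\<dots> = (\<Sum>m\<in>keys p \<union> keys q. \<iota> (lookup p m) * F m) + (\<Sum>m\<in>keys p \<union> keys q. \<iota> (lookup q m) * F m)"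
    by (simp add: lookup_add scalar_homD [OF assms] algebra_simps sum.distrib)
  also have "\<dots> = lin \<iota> F p + lin \<iota> F q"
    using lin_superset [OF assms, of "keys p \<union> keys q"] by simp
  finally show "lin \<iota> F (p + q) = lin \<iota> F p + lin \<iota> F q" .
next
  fix c and p :: "'b \<Rightarrow>\<^sub>0 complex"
  have lk: "lookup (Const c * p) m = c * lookup p m" for m
    by (simp add: mult_map_scale_conv_mult [symmetric] map.rep_eq when_def)
  then have "keys (Const c * p) \<subseteq> keys p"
    by (auto simp: in_keys_iff)
  then have "lin \<iota> F (Const c * p) = (\<Sum>m\<in>keys p. \<iota> (lookup (Const c * p) m) * F m)"
    by (intro lin_superset assms) auto
  then show "lin \<iota> F (Const c * p) = \<iota> c * lin \<iota> F p"
    by (simp add: lk scalar_homD [OF assms] lin_def sum_distrib_left mult.assoc)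
qed

lemma lin_Mon: "scalar_hom \<iota> \<Longrightarrow> lin \<iota> F (Mon m) = F m"
  by (simp add: lin_def scalar_homD)

lemma lookup_Const_mult: "lookup (Const c * p) m = c * lookup p m"
  for p :: "'m::comm_monoid_add \<Rightarrow>\<^sub>0 complex"
  by (simp add: mult_map_scale_conv_mult [symmetric] map.rep_eq when_def)

lemma keys_Const_mult: "keys (Const c * p) \<subseteq> keys p"
  for p :: "'m::comm_monoid_add \<Rightarrow>\<^sub>0 complex"
  by (auto simp: in_keys_iff lookup_Const_mult)

lemma linear_over_mult: "linear_over Const (\<lambda>p. q * p)"
  by (auto simp: linear_over_def algebra_simps)

lemma linear_over_comp:
  "linear_over \<iota> T \<Longrightarrow> linear_over Const T' \<Longrightarrow> linear_over \<iota> (\<lambda>p. T (T' p))"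
  by (auto simp: linear_over_def)

lemma linear_over_mult_left: "linear_over \<iota> T \<Longrightarrow> linear_over \<iota> (\<lambda>p. q * T p)"
  by (auto simp: linear_over_def algebra_simps)

lemma lin_mult:
  assumes \<iota>: "scalar_hom \<iota>" and F: "\<And>m m'. F (m + m') = F m * F m'"
  shows "lin \<iota> F (p * q) = lin \<iota> F p * lin \<iota> F q"
proof (rule linear_over_eqI [where p = p])
  show "linear_over \<iota> (\<lambda>p. lin \<iota> F (p * q))"
    using lin_linear [OF \<iota>, of F] by (simp add: linear_over_def distrib_right mult.assoc)
  show "linear_over \<iota> (\<lambda>p. lin \<iota> F p * lin \<iota> F q)"
    using lin_linear [OF \<iota>, of F] by (simp add: linear_over_def distrib_right mult.assoc)
  show "lin \<iota> F (Mon m * q) = lin \<iota> F (Mon m) * lin \<iota> F q" for m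
  proof (rule linear_over_eqI [where p = q])
    show "linear_over \<iota> (\<lambda>q. lin \<iota> F (Mon m * q))"
      by (rule linear_over_comp [OF lin_linear [OF \<iota>] linear_over_mult])
    show "linear_over \<iota> (\<lambda>q. lin \<iota> F (Mon m) * lin \<iota> F q)"
      by (rule linear_over_mult_left [OF lin_linear [OF \<iota>]])
  qed (simp add: mult_single lin_Mon \<iota> F)
qed

definition keep :: "('m \<Rightarrow> bool) \<Rightarrow> ('m::comm_monoid_add \<Rightarrow>\<^sub>0 complex) \<Rightarrow> 'm \<Rightarrow>\<^sub>0 complex" where
  "keep Q = lin Const (\<lambda>m. if Q m then Mon m else 0)"

lemma keep_linear: "linear_over Const (keep Q)"
  unfolding keep_def by (rule lin_linear [OF scalar_hom_Const])

lemma lookup_keep: "lookup (keep Q p) m = (if Q m then lookup p m else 0)"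
proof -
  have "lookup (keep Q p) m = (\<Sum>k\<in>keys p. if k = m then (if Q m then lookup p m else 0) else 0)"
    unfolding keep_def lin_def lookup_sum
    by (rule sum.cong) (auto simp: lookup_Const_mult lookup_single when_def)
  then show ?thesis
    by (simp add: in_keys_iff)
qed

lemma keys_keep: "keys (keep Q p) = {m \<in> keys p. Q m}"
  by (auto simp: in_keys_iff lookup_keep split: if_splits)

definition with_keys :: "('m \<Rightarrow> bool) \<Rightarrow> ('m \<Rightarrow>\<^sub>0 complex) set" where
  "with_keys Q = {p. \<forall>m\<in>keys p. Q m}"

definition cscale :: "complex \<Rightarrow> ('m::comm_monoid_add \<Rightarrow>\<^sub>0 complex) \<Rightarrow> 'm \<Rightarrow>\<^sub>0 complex" where
  "cscale c p = Const c * p"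

lemma cscale_add: "cscale c (p + q) = cscale c p + cscale c q"
  by (simp add: cscale_def algebra_simps)

lemma csubspace_with_keys: "csubspace_of cscale (with_keys Q)"
  using keys_diff keys_Const_mult by (fastforce simp: csubspace_of_def with_keys_def cscale_def)

lemma csubspace_UNIV: "csubspace_of sc UNIV"
  by (simp add: csubspace_of_def)

lemma linear_over_mem:
  assumes T: "linear_over Const T" and G: "csubspace_of cscale G" "\<And>m. m \<in> keys p \<Longrightarrow> T (Mon m) \<in> G"
  shows "T p \<in> G"
  unfolding linear_over_expand [OF T, of p]
  using csubspaceD(3) [OF G(1)] G(2) by (intro csubspace_sum [OF G(1)]) (auto simp: cscale_def)

lemma csubspace_vimage:
  "linear_over Const T \<Longrightarrow> csubspace_of cscale G \<Longrightarrow> csubspace_of cscale {p. T p \<in> G}"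
  by (auto simp: csubspace_of_def linear_overD cscale_def)

section \<open>The deformed and the graded Stanley--Reisner module\<close>

type_synonym 'v mpoly = "('v \<Rightarrow>\<^sub>0 nat) \<Rightarrow>\<^sub>0 complex"

abbreviation Var :: "'v \<Rightarrow> 'v mpoly" where
  "Var v \<equiv> Mon (Poly_Mapping.single v 1)"

definition tot :: "('v \<Rightarrow>\<^sub>0 nat) \<Rightarrow> nat" where
  "tot m = (\<Sum>v\<in>keys m. lookup m v)"

lemma keys_add_nat: "keys (m + m' :: 'v \<Rightarrow>\<^sub>0 nat) = keys m \<union> keys m'"
  by (auto simp: in_keys_iff lookup_add)

lemma tot_superset: "finite A \<Longrightarrow> keys m \<subseteq> A \<Longrightarrow> tot m = (\<Sum>v\<in>A. lookup m v)"
  unfolding tot_def by (intro sum.mono_neutral_left) (auto simp: in_keys_iff)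

lemma tot_add: "tot (m + m') = tot m + tot m'"
  using tot_superset [of "keys m \<union> keys m'"] by (simp add: keys_add_nat lookup_add sum.distrib)

lemma tot_single [simp]: "tot (Poly_Mapping.single v k) = k"
  by (cases "k = 0") (auto simp: tot_def)

lemma monomial_cases:
  obtains "m = 0" | m' v where "m = m' + Poly_Mapping.single v (1::nat)"
proof (cases "m = 0")
  case False
  then obtain v where v: "v \<in> keys m"
    by (meson all_not_in_conv keys_eq_empty)
  then have "m = (m - Poly_Mapping.single v 1) + Poly_Mapping.single v 1"
    by (intro poly_mapping_eqI) (auto simp: lookup_add lookup_minus lookup_single when_def in_keys_iff)
  then show ?thesis using that by blast
qed (use that in blast)

lemma monomial_induct [case_names zero add]:
  assumes "Q 0" "\<And>m v. Q m \<Longrightarrow> Q (m + Poly_Mapping.single v (1::nat))"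
  shows "Q m"
proof (induction "tot m" arbitrary: m rule: less_induct)
  case less
  show ?case
  proof (cases m rule: monomial_cases)
    case (2 m' v)
    then have "tot m' < tot m" by (simp add: tot_add)
    then show ?thesis using less 2 assms(2) by simp
  qed (use assms(1) in simp)
qed

lemma keys_mult_Mon: "k \<in> keys (Mon m * p) \<Longrightarrow> \<exists>k'\<in>keys p. k = m + k'"
  using keys_mult [of "Mon m" p] by auto

lemma keys_Var_mult: "k \<in> keys (Var v * p) \<Longrightarrow> \<exists>k'\<in>keys p. k = k' + Poly_Mapping.single v 1"
  by (drule keys_mult_Mon) (auto simp: add.commute)

text \<open>In the application \<open>w v\<close> is the coordinate \<open>\<lambda>_v\<close> of
  \<open>u\<close>, \<open>d0\<close> is \<open>deg u\<close> and \<open>b j v\<close> is the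
  \<open>j\<close>-th coordinate of \<open>v\<close>. Geometry enters only through the complex
  \<open>D\<close>.\<close>

locale simplicial_module =
  fixes V :: "'v set" and D :: "'v set set" and w :: "'v \<Rightarrow> complex" and d0 :: real
    and b :: "'n::finite \<Rightarrow> 'v \<Rightarrow> complex"
  assumes V: "finite V" and D: "\<And>T T'. T \<in> D \<Longrightarrow> T' \<subseteq> T \<Longrightarrow> T' \<in> D" "\<And>T. T \<in> D \<Longrightarrow> T \<subseteq> V"
begin

definition S :: "'v set" where "S = {v. w v \<noteq> 0}"

definition adm :: "('v \<Rightarrow>\<^sub>0 nat) \<Rightarrow> bool" where
  "adm m \<longleftrightarrow> keys m \<union> S \<in> D"

definition dg :: "('v \<Rightarrow>\<^sub>0 nat) \<Rightarrow> real" where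
  "dg m = d0 + real (tot m)"

abbreviation "SRideal \<equiv> with_keys (\<lambda>m. \<not> adm m)"
abbreviation "homog \<beta> \<equiv> with_keys (\<lambda>m. dg m = \<beta>)"
abbreviation "below \<beta> \<equiv> with_keys (\<lambda>m. dg m < \<beta>)"
abbreviation "atmost \<beta> \<equiv> with_keys (\<lambda>m. dg m \<le> \<beta>)"
abbreviation "hc \<beta> \<equiv> keep (\<lambda>m. dg m = \<beta>)"

lemma dg_add_single: "dg (m + Poly_Mapping.single v 1) = dg m + 1"
  by (simp add: dg_def tot_add)

lemma adm_mono: "adm (m + m') \<Longrightarrow> adm m"
  unfolding adm_def by (erule D(1)) (auto simp: keys_add_nat)

lemma SRideal_mult: "p \<in> SRideal \<Longrightarrow> q * p \<in> SRideal"
  using keys_mult [of q p] adm_mono by (fastforce simp: with_keys_def add.commute)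

section \<open>The Pochhammer map and the deformed operators\<close>

definition \<Psi>mon :: "('v \<Rightarrow>\<^sub>0 nat) \<Rightarrow> 'v mpoly" where
  "\<Psi>mon m = (\<Prod>v\<in>keys m. pochhammer (Var v + Const (w v)) (lookup m v))"

definition \<Psi> :: "'v mpoly \<Rightarrow> 'v mpoly" where
  "\<Psi> = lin Const \<Psi>mon"

definition Lop :: "('v \<Rightarrow> complex) \<Rightarrow> 'v mpoly" where
  "Lop c = (\<Sum>v\<in>V. Const (c v) * Var v)"

text \<open>With \<open>c v = v_j\<close> this is minus the \<open>j\<close>-th component of the
  twisted differential, with \<open>c = 1\<close> it is the operator N; see \<open>dT_Qt\<close> and
  \<open>NN_Qt\<close>.\<close>

definition Eop :: "('v \<Rightarrow> complex) \<Rightarrow> 'v mpoly \<Rightarrow> 'v mpoly" where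
  "Eop c = lin Const (\<lambda>m. \<Sum>v\<in>V. Const (c v) * ((Var v - Const (w v + of_nat (lookup m v))) * Mon m))"

lemma \<Psi>_linear: "linear_over Const \<Psi>"
  unfolding \<Psi>_def by (rule lin_linear [OF scalar_hom_Const])

lemma Eop_linear: "linear_over Const (Eop c)"
  unfolding Eop_def by (rule lin_linear [OF scalar_hom_Const])

lemma \<Psi>_Mon: "\<Psi> (Mon m) = \<Psi>mon m"
  by (simp add: \<Psi>_def lin_Mon scalar_hom_Const)

lemma \<Psi>mon_superset:
  assumes "finite A" "keys m \<subseteq> A"
  shows "\<Psi>mon m = (\<Prod>v\<in>A. pochhammer (Var v + Const (w v)) (lookup m v))"
  unfolding \<Psi>mon_def using assms by (intro prod.mono_neutral_left) (auto simp: in_keys_iff)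

lemma of_nat_Const: "(of_nat k :: 'v mpoly) = Const (of_nat k)"
  by (metis single_of_nat)

lemma \<Psi>mon_add: "\<Psi>mon (m + Poly_Mapping.single v 1) = (Var v + Const (w v + of_nat (lookup m v))) * \<Psi>mon m"
proof -
  let ?A = "insert v (keys m)" and ?m = "m + Poly_Mapping.single v 1"
  let ?f = "\<lambda>m x. pochhammer (Var x + Const (w x)) (lookup m x)"
  have "\<Psi>mon ?m = (\<Prod>x\<in>?A. ?f ?m x)"
    by (rule \<Psi>mon_superset) (auto simp: keys_add_nat)
  also have "\<dots> = ?f ?m v * (\<Prod>x\<in>?A - {v}. ?f ?m x)"
    by (rule prod.remove) auto
  also have "(\<Prod>x\<in>?A - {v}. ?f ?m x) = (\<Prod>x\<in>?A - {v}. ?f m x)"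
    by (intro prod.cong) (auto simp: lookup_add lookup_single when_def)
  also have "?f ?m v = (Var v + Const (w v + of_nat (lookup m v))) * ?f m v"
  proof -
    have "lookup ?m v = Suc (lookup m v)"
      by (simp add: lookup_add)
    then have "?f ?m v = ?f m v * (Var v + Const (w v) + Const (of_nat (lookup m v)))"
      by (simp only: pochhammer_Suc of_nat_Const)
    then show ?thesis
      by (simp only: single_add add.assoc mult.commute)
  qed
  also have "\<dots> * (\<Prod>x\<in>?A - {v}. ?f m x) = (Var v + Const (w v + of_nat (lookup m v))) * (\<Prod>x\<in>?A. ?f m x)"
    by (subst prod.remove [of ?A v]) (auto simp: mult.assoc)
  also have "(\<Prod>x\<in>?A. ?f m x) = \<Psi>mon m"
    by (rule \<Psi>mon_superset [symmetric]) auto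
  finally show ?thesis .
qed

lemma \<Psi>_Var_mult: "\<Psi> (Var v * Mon m) = (Var v + Const (w v + of_nat (lookup m v))) * \<Psi> (Mon m)"
  using \<Psi>mon_add [of m v] by (simp add: mult_single \<Psi>_Mon add.commute)

text \<open>The shift in \<open>Eop\<close> is cancelled by the next Pochhammer factor, see \<open>\<Psi>_Var_mult\<close>.\<close>
lemma \<Psi>_Eop: "\<Psi> (Eop c p) = Lop c * \<Psi> p"
proof (rule linear_over_eqI [where p = p])
  show "linear_over Const (\<lambda>p. \<Psi> (Eop c p))"
    by (rule linear_over_comp [OF \<Psi>_linear Eop_linear])
  show "linear_over Const (\<lambda>p. Lop c * \<Psi> p)"
    by (rule linear_over_mult_left [OF \<Psi>_linear])
  fix m
  have "\<Psi> (Eop c (Mon m)) = (\<Sum>v\<in>V. \<Psi> (Const (c v) * (Var v * Mon m - Const (w v + of_nat (lookup m v)) * Mon m)))"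
    by (simp add: Eop_def lin_Mon scalar_hom_Const linear_over_sum [OF \<Psi>_linear] left_diff_distrib)
  also have "\<dots> = (\<Sum>v\<in>V. Const (c v) * (Var v * \<Psi> (Mon m)))"
    by (intro sum.cong refl)
       (simp only: linear_overD [OF \<Psi>_linear] \<Psi>_Var_mult distrib_right add_diff_cancel)
  finally show "\<Psi> (Eop c (Mon m)) = Lop c * \<Psi> (Mon m)"
    by (simp add: Lop_def sum_distrib_right mult.assoc)
qed

text \<open>Induction over the factors. The drop in degree makes \<open>\<Psi>\<close> invertible
  and trivial on leading parts; the constancy of \<open>keys k \<union> S\<close> makes it
  compatible with admissibility, which depends on that union alone.\<close>

lemma \<Psi>_triangular:
  "\<Psi> (Mon m) - Mon m \<in> with_keys (\<lambda>k. tot k < tot m \<and> keys k \<union> S = keys m \<union> S)"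
proof (induction m rule: monomial_induct)
  case zero
  have "\<Psi> (Mon 0) = Mon 0"
    unfolding \<Psi>_Mon by (simp add: \<Psi>mon_def)
  then show ?case by (simp add: with_keys_def)
next
  case (add m v)
  let ?m = "m + Poly_Mapping.single v (1::nat)" and ?c = "w v + of_nat (lookup m v)"
  let ?G = "with_keys (\<lambda>k. tot k < tot ?m \<and> keys k \<union> S = keys ?m \<union> S)"
  note G = csubspace_with_keys [of "\<lambda>k. tot k < tot ?m \<and> keys k \<union> S = keys ?m \<union> S"]
  define r where "r = \<Psi> (Mon m) - Mon m"
  have "Var v * r \<in> ?G"
    using add keys_Var_mult [of _ v r] by (fastforce simp: with_keys_def r_def tot_add keys_add_nat)
  moreover have "Const ?c * (Mon m + r) \<in> ?G"
  proof (cases "?c = 0")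
    case False
    \<comment> \<open>A nonzero constant needs \<open>m_v > 0\<close> or
      \<open>w v \<noteq> 0\<close>. In either case \<open>v\<close> is already counted, and
      multiplying by the constant in place of \<open>x_v\<close> loses no vertex.\<close>
    have "v \<in> keys m \<union> S"
    proof (rule ccontr)
      assume "v \<notin> keys m \<union> S"
      then have "?c = 0" by (simp add: S_def in_keys_iff)
      with False show False by simp
    qed
    then have "keys ?m \<union> S = keys m \<union> S" by (auto simp: keys_add_nat)
    moreover have "k = m \<or> k \<in> keys r" if "k \<in> keys (Mon m + r)" for k
      using that keys_add [of "Mon m" r] by auto
    ultimately have "Mon m + r \<in> ?G"
      using add by (fastforce simp: with_keys_def r_def [symmetric] tot_add)
    then show ?thesis
      using csubspaceD(3) [OF G] by (simp add: cscale_def)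
  qed (use csubspaceD(1) [OF G] in simp)
  ultimately have "Var v * r + Const ?c * (Mon m + r) \<in> ?G"
    by (rule csubspaceD(4) [OF G])
  moreover have "\<Psi> (Mon ?m) - Mon ?m = Var v * r + Const ?c * (Mon m + r)"
  proof -
    have "Mon ?m = Var v * Mon m" by (simp add: mult_single add.commute)
    moreover have "\<Psi> (Mon m) = Mon m + r" by (simp add: r_def)
    ultimately show ?thesis
      by (simp only: \<Psi>_Var_mult) (simp add: algebra_simps)
  qed
  ultimately show ?case by simp
qed

lemma \<Psi>_minus_below: "p \<in> atmost \<beta> \<Longrightarrow> \<Psi> p - p \<in> below \<beta>"
proof -
  assume p: "p \<in> atmost \<beta>"
  have "linear_over Const (\<lambda>p. \<Psi> p - p)"
    using \<Psi>_linear by (auto simp: linear_over_def algebra_simps)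
  then show ?thesis
  proof (rule linear_over_mem [OF _ csubspace_with_keys])
    fix m assume "m \<in> keys p"
    then show "\<Psi> (Mon m) - Mon m \<in> below \<beta>"
      using \<Psi>_triangular [of m] p by (fastforce simp: with_keys_def dg_def)
  qed
qed

lemma below_atmost: "p \<in> below \<beta> \<Longrightarrow> p \<in> atmost \<beta>"
  by (auto simp: with_keys_def)

lemma \<Psi>_atmost: "p \<in> atmost \<beta> \<Longrightarrow> \<Psi> p \<in> atmost \<beta>"
  using csubspaceD(4) [OF csubspace_with_keys below_atmost [OF \<Psi>_minus_below]] by fastforce

lemma \<Psi>_below: "p \<in> below \<beta> \<Longrightarrow> \<Psi> p \<in> below \<beta>"
  using csubspaceD(4) [OF csubspace_with_keys, of "\<Psi> p - p" "\<lambda>m. dg m < \<beta>" p] \<Psi>_minus_below [OF below_atmost]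
  by simp

lemma atmost_nat: "p \<in> atmost (d0 + real k) \<longleftrightarrow> (\<forall>m\<in>keys p. tot m \<le> k)"
  by (auto simp: with_keys_def dg_def)

lemma below_Suc: "p \<in> below (d0 + real (Suc k)) \<longleftrightarrow> p \<in> atmost (d0 + real k)"
  by (auto simp: with_keys_def dg_def)

lemma below_0: "p \<in> below (d0 + real 0) \<longleftrightarrow> p = 0"
  by (auto simp: with_keys_def dg_def)

lemma atmost_exists: "\<exists>k. p \<in> atmost (d0 + real k)"
  unfolding atmost_nat by (intro exI [of _ "Max (tot ` keys p)"]) auto

text \<open>The error \<open>\<Psi> p - p\<close> has smaller degree, so by induction it has a
  preimage, and subtracting that from \<open>p\<close> gives a preimage of \<open>p\<close>.\<close>

lemma \<Psi>_surj_atmost: "p \<in> atmost (d0 + real k) \<Longrightarrow> \<exists>q \<in> atmost (d0 + real k). \<Psi> q = p"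
proof (induction k arbitrary: p)
  case 0
  have "\<Psi> p - p = 0"
    using \<Psi>_minus_below [OF 0] below_0 by blast
  then show ?case using 0 by auto
next
  case (Suc k)
  have "\<Psi> p - p \<in> atmost (d0 + real k)"
    using \<Psi>_minus_below [OF Suc.prems] below_Suc by blast
  then obtain q where q: "q \<in> atmost (d0 + real k)" "\<Psi> q = \<Psi> p - p"
    using Suc.IH by blast
  have "\<Psi> (p - q) = p"
    by (simp add: linear_overD [OF \<Psi>_linear] q)
  moreover have "q \<in> atmost (d0 + real (Suc k))"
    using q(1) unfolding atmost_nat by (auto intro: le_SucI)
  ultimately show ?case
    using csubspaceD(2) [OF csubspace_with_keys Suc.prems] by blast
qed

lemma \<Psi>_surj: "\<exists>q. \<Psi> q = p"
  using \<Psi>_surj_atmost atmost_exists by blast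

lemma \<Psi>_inj: "\<Psi> p = 0 \<Longrightarrow> p = 0"
proof -
  assume 0: "\<Psi> p = 0"
  have "p \<in> atmost (d0 + real k) \<Longrightarrow> p = 0" for k
  proof (induction k)
    case 0
    then show ?case using \<Psi>_minus_below [OF 0] below_0 [of "- p"] \<open>\<Psi> p = 0\<close> by simp
  next
    case (Suc k)
    then have "- p \<in> atmost (d0 + real k)"
      using \<Psi>_minus_below [OF Suc.prems] below_Suc 0 by simp
    then show ?case
      using Suc.IH csubspaceD(5) [OF csubspace_with_keys, of "- p"] by simp
  qed
  then show ?thesis using atmost_exists by blast
qed

text \<open>For an arbitrary real bound the induction is started at the top degree actually attained
  by \<open>p\<close>, which exists as soon as \<open>p\<close> is nonzero.\<close>

lemma \<Psi>_surj_atmost': "p \<in> atmost \<beta> \<Longrightarrow> \<exists>q \<in> atmost \<beta>. \<Psi> q = p"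
proof -
  assume p: "p \<in> atmost \<beta>"
  show ?thesis
  proof (cases "p = 0")
    case True
    then show ?thesis
      using csubspaceD(1) [OF csubspace_with_keys] linear_overD(3) [OF \<Psi>_linear] by auto
  next
    case False
    define k where "k = Max (tot ` keys p)"
    have "p \<in> atmost (d0 + real k)"
      by (auto simp: atmost_nat k_def)
    then obtain q where q: "q \<in> atmost (d0 + real k)" "\<Psi> q = p"
      using \<Psi>_surj_atmost by blast
    have "k \<in> tot ` keys p"
      unfolding k_def using False by (intro Max_in) auto
    then have "d0 + real k \<le> \<beta>"
      using p by (auto simp: with_keys_def dg_def)
    then have "q \<in> atmost \<beta>"
      using q(1) by (force simp: with_keys_def)
    then show ?thesis using q by blast
  qed
qed

text \<open>\<open>\<Psi>\<close> maps the span of the admissible monomials and the span of the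
  others each into itself. If \<open>\<Psi> p\<close> is in the ideal, the image of the admissible
  part of \<open>p\<close> lies in both spans and is 0, so by injectivity that part is 0.\<close>

lemma \<Psi>_SRideal: "\<Psi> p \<in> SRideal \<longleftrightarrow> p \<in> SRideal"
proof -
  have mon: "k \<in> keys (\<Psi> (Mon m)) \<Longrightarrow> adm k = adm m" for k m
    using \<Psi>_triangular [of m] keys_add [of "\<Psi> (Mon m) - Mon m" "Mon m"]
    by (fastforce simp: with_keys_def adm_def)
  have pres: "\<Psi> q \<in> with_keys (\<lambda>m. adm m = c)" if q: "q \<in> with_keys (\<lambda>m. adm m = c)" for q c
  proof (rule linear_over_mem [OF \<Psi>_linear csubspace_with_keys])
    fix m assume "m \<in> keys q"
    then have "adm m = c" using q by (simp add: with_keys_def)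
    then show "\<Psi> (Mon m) \<in> with_keys (\<lambda>m. adm m = c)"
      using mon [of _ m] by (simp add: with_keys_def)
  qed
  have non: "\<Psi> q \<in> SRideal" if "q \<in> SRideal" for q
    using pres [of q False] that by simp
  show ?thesis
  proof
    assume p: "\<Psi> p \<in> SRideal"
    define q where "q = keep adm p"
    have "p - q \<in> SRideal"
      by (auto simp: with_keys_def q_def in_keys_iff lookup_minus lookup_keep split: if_splits)
    then have "\<Psi> p - \<Psi> (p - q) \<in> SRideal"
      using p non csubspaceD(2) [OF csubspace_with_keys] by blast
    then have 1: "\<Psi> q \<in> SRideal"
      by (simp add: linear_overD [OF \<Psi>_linear])
    have "q \<in> with_keys adm"
      by (auto simp: q_def with_keys_def keys_keep)
    then have 2: "\<Psi> q \<in> with_keys adm"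
      using pres [of q True] by simp
    have "keys (\<Psi> q) = {}"
      using 1 2 unfolding with_keys_def by blast
    then have "q = 0" using \<Psi>_inj by simp
    then show "p \<in> SRideal" using \<open>p - q \<in> SRideal\<close> by simp
  qed (rule non)
qed

text \<open>The monomial ideal plus the ideal generated by the linear forms, written with explicit
  multipliers because these become the coefficients of an (n-1)-form in
  \<open>top_coboundaries\<close>.\<close>

definition KJ :: "'v mpoly set" where
  "KJ = {p. \<exists>g. p - (\<Sum>j\<in>UNIV. Lop (b j) * g j) \<in> SRideal}"

text \<open>A preimage under \<open>\<Psi>\<close>, so that \<open>\<Psi>\<close> compares the two
  quotients by construction. That these are the twisted coboundaries is
  \<open>KH_iff\<close>.\<close>

definition KH :: "'v mpoly set" where
  "KH = {p. \<Psi> p \<in> KJ}"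

lemma KJ_I: "p - (\<Sum>j\<in>UNIV. Lop (b j) * g j) \<in> SRideal \<Longrightarrow> p \<in> KJ"
  by (auto simp: KJ_def)

lemma SRideal_KJ: "SRideal \<subseteq> KJ"
  by (auto intro: KJ_I [of _ "\<lambda>_. 0"])

lemma KJ_mult: "p \<in> KJ \<Longrightarrow> q * p \<in> KJ"
proof -
  assume "p \<in> KJ"
  then obtain g where "p - (\<Sum>j\<in>UNIV. Lop (b j) * g j) \<in> SRideal" by (auto simp: KJ_def)
  from SRideal_mult [OF this, of q] show ?thesis
    by (intro KJ_I [of _ "\<lambda>j. q * g j"]) (simp add: right_diff_distrib sum_distrib_left mult.left_commute)
qed

lemma csubspace_KJ: "csubspace_of cscale KJ"
  unfolding csubspace_of_def
proof (intro conjI ballI allI)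
  show "0 \<in> KJ" using csubspaceD(1) [OF csubspace_with_keys] SRideal_KJ by blast
  fix p q assume "p \<in> KJ" "q \<in> KJ"
  then obtain g h where "p - (\<Sum>j\<in>UNIV. Lop (b j) * g j) \<in> SRideal"
      "q - (\<Sum>j\<in>UNIV. Lop (b j) * h j) \<in> SRideal"
    by (auto simp: KJ_def)
  from csubspaceD(2) [OF csubspace_with_keys this] show "p - q \<in> KJ"
    by (intro KJ_I [of _ "\<lambda>j. g j - h j"]) (simp add: right_diff_distrib sum_subtractf algebra_simps)
qed (simp add: cscale_def KJ_mult)

lemma csubspace_KH: "csubspace_of cscale KH"
  unfolding KH_def by (rule csubspace_vimage [OF \<Psi>_linear csubspace_KJ])

lemma SRideal_KH: "SRideal \<subseteq> KH"
  using \<Psi>_SRideal SRideal_KJ by (auto simp: KH_def)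

text \<open>By \<open>\<Psi>_Eop\<close> the map \<open>\<Psi>\<close> turns
  \<open>Eop (b j) (g j)\<close> into a multiple of \<open>Lop (b j)\<close>, and by surjectivity
  every multiplier has the form \<open>\<Psi> (g j)\<close>.\<close>

lemma KH_iff: "p \<in> KH \<longleftrightarrow> (\<exists>g. p - (\<Sum>j\<in>UNIV. Eop (b j) (g j)) \<in> SRideal)"
proof
  assume "p \<in> KH"
  then obtain h where h: "\<Psi> p - (\<Sum>j\<in>UNIV. Lop (b j) * h j) \<in> SRideal"
    by (auto simp: KH_def KJ_def)
  have "\<forall>j. \<exists>q. \<Psi> q = h j"
    using \<Psi>_surj by blast
  then obtain g where g: "\<And>j. \<Psi> (g j) = h j"
    by metis
  have "\<Psi> (p - (\<Sum>j\<in>UNIV. Eop (b j) (g j))) \<in> SRideal"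
    using h by (simp add: linear_overD [OF \<Psi>_linear] linear_over_sum [OF \<Psi>_linear] \<Psi>_Eop g)
  then show "\<exists>g. p - (\<Sum>j\<in>UNIV. Eop (b j) (g j)) \<in> SRideal"
    using \<Psi>_SRideal by blast
next
  assume "\<exists>g. p - (\<Sum>j\<in>UNIV. Eop (b j) (g j)) \<in> SRideal"
  then obtain g where "p - (\<Sum>j\<in>UNIV. Eop (b j) (g j)) \<in> SRideal" by blast
  then have "\<Psi> (p - (\<Sum>j\<in>UNIV. Eop (b j) (g j))) \<in> SRideal"
    using \<Psi>_SRideal by blast
  then have "\<Psi> p - (\<Sum>j\<in>UNIV. Lop (b j) * \<Psi> (g j)) \<in> SRideal"
    by (simp add: linear_overD [OF \<Psi>_linear] linear_over_sum [OF \<Psi>_linear] \<Psi>_Eop)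
  then show "p \<in> KH"
    unfolding KH_def by (auto intro: KJ_I)
qed

lemma Lop_Mon: "Lop c * Mon m = (\<Sum>v\<in>V. Const (c v) * Mon (m + Poly_Mapping.single v 1))"
  unfolding Lop_def sum_distrib_right by (rule sum.cong) (simp_all add: mult_single add.commute)

section \<open>Homogeneous components and symbols\<close>

lemma hc_Lop: "hc (\<beta> + 1) (Lop c * p) = Lop c * hc \<beta> p"
proof (rule linear_over_eqI [where p = p])
  show "linear_over Const (\<lambda>p. hc (\<beta> + 1) (Lop c * p))"
    by (rule linear_over_comp [OF keep_linear linear_over_mult])
  show "linear_over Const (\<lambda>p. Lop c * hc \<beta> p)"
    by (rule linear_over_mult_left [OF keep_linear])
  fix m
  have "hc (\<beta> + 1) (Lop c * Mon m)
      = (\<Sum>v\<in>V. Const (c v) * hc (\<beta> + 1) (Mon (m + Poly_Mapping.single v 1)))"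
    by (simp only: Lop_Mon linear_over_sum [OF keep_linear] linear_overD [OF keep_linear])
  also have "\<dots> = (\<Sum>v\<in>V. if dg m = \<beta> then Const (c v) * Mon (m + Poly_Mapping.single v 1) else 0)"
    unfolding keep_def lin_Mon [OF scalar_hom_Const] dg_add_single by (rule sum.cong) auto
  also have "\<dots> = Lop c * hc \<beta> (Mon m)"
    unfolding keep_def lin_Mon [OF scalar_hom_Const] by (simp add: Lop_Mon)
  finally show "hc (\<beta> + 1) (Lop c * Mon m) = Lop c * hc \<beta> (Mon m)" .
qed

lemma hc_KJ: "p \<in> KJ \<Longrightarrow> hc \<beta> p \<in> KJ"
proof -
  assume "p \<in> KJ"
  then obtain g where g: "p - (\<Sum>j\<in>UNIV. Lop (b j) * g j) \<in> SRideal" by (auto simp: KJ_def)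
  have "hc \<beta> (p - (\<Sum>j\<in>UNIV. Lop (b j) * g j)) \<in> SRideal"
    using g by (auto simp: with_keys_def keys_keep)
  moreover have "hc \<beta> (p - (\<Sum>j\<in>UNIV. Lop (b j) * g j)) = hc \<beta> p - (\<Sum>j\<in>UNIV. Lop (b j) * hc (\<beta> - 1) (g j))"
    using hc_Lop [of "\<beta> - 1"] by (simp add: linear_overD [OF keep_linear] linear_over_sum [OF keep_linear])
  ultimately show ?thesis
    by (auto intro: KJ_I)
qed

lemma hc_homog: "hc \<beta> p \<in> homog \<beta>"
  by (auto simp: with_keys_def keys_keep)

lemma homog_hc: "p \<in> homog \<beta> \<Longrightarrow> hc \<gamma> p = (if \<gamma> = \<beta> then p else 0)"
  by (rule poly_mapping_eqI) (auto simp: lookup_keep with_keys_def in_keys_iff)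

lemma atmost_hc: "p \<in> atmost \<beta> \<Longrightarrow> p - hc \<beta> p \<in> below \<beta>"
  by (force simp: with_keys_def in_keys_iff lookup_minus lookup_keep split: if_splits)

lemma below_hc: "p \<in> below \<beta> \<Longrightarrow> hc \<beta> p = 0"
  by (rule poly_mapping_eqI) (auto simp: lookup_keep with_keys_def in_keys_iff)

text \<open>No regularity of the sequence \<open>Lop (b j)\<close> is needed, because \<open>\<Psi>\<close> is unitriangular.\<close>
lemma symbol_KH:
  assumes "p \<in> homog \<beta>"
  shows "(\<exists>k\<in>KH \<inter> atmost \<beta>. p - k \<in> below \<beta>) \<longleftrightarrow> p \<in> KJ"
proof
  assume "\<exists>k\<in>KH \<inter> atmost \<beta>. p - k \<in> below \<beta>"
  then obtain k where k: "k \<in> KH" "k \<in> atmost \<beta>" "p - k \<in> below \<beta>" by blast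
  have "hc \<beta> (\<Psi> k) \<in> KJ"
    using k hc_KJ by (auto simp: KH_def)
  moreover have "hc \<beta> (\<Psi> k - k) = 0" "hc \<beta> (p - k) = 0"
    using k \<Psi>_minus_below below_hc by auto
  then have "hc \<beta> (\<Psi> k) = p"
    using homog_hc [OF assms, of \<beta>] by (simp add: linear_overD [OF keep_linear])
  ultimately show "p \<in> KJ" by simp
next
  assume p: "p \<in> KJ"
  have pu: "p \<in> atmost \<beta>" using assms by (auto simp: with_keys_def)
  then obtain k where k: "k \<in> atmost \<beta>" "\<Psi> k = p"
    using \<Psi>_surj_atmost' by blast
  then show "\<exists>k\<in>KH \<inter> atmost \<beta>. p - k \<in> below \<beta>"
    using p \<Psi>_minus_below [OF k(1)] by (intro bexI [of _ k]) (auto simp: KH_def)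
qed

lemma Eop_KH: "p \<in> KH \<Longrightarrow> Eop c p \<in> KH"
  by (simp add: KH_def \<Psi>_Eop KJ_mult)

lemma Eop_Mon_atmost: "Eop c (Mon m) - Lop c * Mon m \<in> atmost (dg m)"
proof -
  have "Eop c (Mon m) - Lop c * Mon m = - (\<Sum>v\<in>V. Const (c v) * (Const (w v + of_nat (lookup m v)) * Mon m))"
    by (simp add: Eop_def lin_Mon scalar_hom_Const Lop_def sum_distrib_right left_diff_distrib
        right_diff_distrib sum_subtractf mult.assoc)
  also have "\<dots> \<in> atmost (dg m)"
    using csubspaceD(3) [OF csubspace_with_keys]
    by (intro csubspaceD(5) [OF csubspace_with_keys] csubspace_sum [OF csubspace_with_keys])
       (simp add: mult.assoc [symmetric] cscale_def mult_single with_keys_def)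
  finally show ?thesis .
qed

text \<open>The shift in \<open>Eop\<close> preserves degree while the variables raise it, so the
  symbol of \<open>Eop c\<close> is multiplication by \<open>Lop c\<close>.\<close>

lemma Eop_atmost: "p \<in> atmost \<beta> \<Longrightarrow> Eop c p - Lop c * p \<in> atmost \<beta>"
proof -
  assume p: "p \<in> atmost \<beta>"
  have "linear_over Const (\<lambda>p. Eop c p - Lop c * p)"
    using Eop_linear by (auto simp: linear_over_def algebra_simps)
  then show ?thesis
  proof (rule linear_over_mem [OF _ csubspace_with_keys])
    fix m assume "m \<in> keys p"
    then show "Eop c (Mon m) - Lop c * Mon m \<in> atmost \<beta>"
      using Eop_Mon_atmost [of c m] p by (force simp: with_keys_def)
  qed
qed

lemma Lop_keys: "k \<in> keys (Lop c * p) \<Longrightarrow> \<exists>k'\<in>keys p. \<exists>v. k = k' + Poly_Mapping.single v 1"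
proof -
  assume "k \<in> keys (Lop c * p)"
  then obtain v where "k \<in> keys (Const (c v) * (Var v * p))"
    using keys_sum [of "\<lambda>v. Const (c v) * (Var v * p)" V] by (auto simp: Lop_def sum_distrib_right mult.assoc)
  then have "k \<in> keys (Var v * p)"
    using keys_Const_mult by blast
  from keys_Var_mult [OF this] show ?thesis by blast
qed

lemma Lop_shift:
  "p \<in> atmost \<beta> \<Longrightarrow> Lop c * p \<in> atmost (\<beta> + 1)" "p \<in> homog \<beta> \<Longrightarrow> Lop c * p \<in> homog (\<beta> + 1)"
  "p \<in> below \<beta> \<Longrightarrow> Lop c * p \<in> below (\<beta> + 1)"
proof -
  have *: "\<exists>k'\<in>keys p. dg k = dg k' + 1" if "k \<in> keys (Lop c * p)" for k
    using Lop_keys [OF that] dg_add_single by metis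
  show "p \<in> atmost \<beta> \<Longrightarrow> Lop c * p \<in> atmost (\<beta> + 1)" "p \<in> homog \<beta> \<Longrightarrow> Lop c * p \<in> homog (\<beta> + 1)"
    "p \<in> below \<beta> \<Longrightarrow> Lop c * p \<in> below (\<beta> + 1)"
    unfolding with_keys_def using * by (smt (verit) mem_Collect_eq)+
qed

end

section \<open>The monomials of a box element\<close>

lemma linear_over_mem_gen:
  assumes T: "linear_over \<iota> T" and G: "csubspace_of (\<lambda>c x. \<iota> c * x) G" "\<And>m. m \<in> keys p \<Longrightarrow> T (Mon m) \<in> G"
  shows "T p \<in> G"
  unfolding linear_over_expand [OF T, of p]
  using csubspaceD(3) [OF G(1)] G(2) by (intro csubspace_sum [OF G(1)]) auto

lemma linear_over_diff: "linear_over \<iota> T \<Longrightarrow> linear_over \<iota> T' \<Longrightarrow> linear_over \<iota> (\<lambda>p. T p - T' p)"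
  by (auto simp: linear_over_def algebra_simps)

lemma lookup_single_mult: "lookup (Poly_Mapping.single i x * h) k = x * lookup h (k - i)"
  for h :: "int \<Rightarrow>\<^sub>0 'b::comm_ring_1"
proof -
  have "Poly_Mapping.single i x * h = (\<Sum>j\<in>keys h. Poly_Mapping.single (i + j) (x * lookup h j))"
    by (subst (1) poly_mapping_sum_single [of h]) (simp add: sum_distrib_left mult_single)
  then have "lookup (Poly_Mapping.single i x * h) k = (\<Sum>j\<in>keys h. if j = k - i then x * lookup h (k - i) else 0)"
    by (simp only: lookup_sum) (rule sum.cong, auto simp: lookup_single when_def)
  then show ?thesis
    by (simp add: in_keys_iff)
qed

lemma emb_nth: "emb x $ i = real_of_int (x $ i)"
  by (simp add: emb_def)

lemma keep_Mon: "keep Q (Mon m) = (if Q m then Mon m else 0)"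
  by (simp add: keep_def lin_Mon [OF scalar_hom_Const])

lemma Const_sum: "Const (sum g A) = (\<Sum>i\<in>A. Const (g i) :: 'm::comm_monoid_add \<Rightarrow>\<^sub>0 complex)"
  by (induction A rule: infinite_finite_induct) (auto simp: single_add)

lemma lookup_tau_mult: "lookup (tau k * h) i = lookup h (i - k)"
  by (simp add: tau_def lookup_single_mult)

lemma const_L_eq: "const_L = Const"
  by (simp add: const_L_def fun_eq_iff)

abbreviation const_LT :: "complex \<Rightarrow> 'n::finite laurent_tau" where
  "const_LT c \<equiv> incl (const_L c)"

lemma scalar_hom_const_L: "scalar_hom const_L"
  using scalar_hom_Const by (simp add: const_L_eq)

lemma scalar_hom_const_LT: "scalar_hom const_LT"
  by (auto simp: scalar_hom_def incl_def const_L_def single_add mult_single)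

lemma lookup_incl_mult: "lookup (incl x * h) k = x * lookup h k"
  by (simp add: incl_def lookup_single_mult)

lemma lookup_const_LT_mult: "lookup (const_LT c * h) k = cscale c (lookup h k)"
  by (simp add: lookup_incl_mult const_L_eq cscale_def)

lemma log_deriv_eq: "log_deriv j = lin const_L (\<lambda>w. Poly_Mapping.single w (of_int (w $ j)))"
  by (simp add: log_deriv_def lin_def fun_eq_iff const_L_def mult_single mult.commute)

lemma log_deriv_linear: "linear_over const_L (log_deriv j)"
  unfolding log_deriv_eq by (rule lin_linear [OF scalar_hom_const_L])

lemma lookup_log_deriv: "lookup (log_deriv j g) w = of_int (w $ j) * lookup g w"
proof -
  have "lookup (log_deriv j g) w = (\<Sum>k\<in>keys g. if k = w then of_int (w $ j) * lookup g w else 0)"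
    unfolding log_deriv_def lookup_sum by (rule sum.cong) (auto simp: lookup_single when_def)
  then show ?thesis by (simp add: in_keys_iff)
qed

lemma log_deriv_single: "log_deriv j (Poly_Mapping.single w c) = Poly_Mapping.single w (of_int (w $ j) * c)"
  by (rule poly_mapping_eqI) (auto simp: lookup_log_deriv lookup_single when_def)

lemma lookup_log_deriv_tau: "lookup (log_deriv_tau j g) i = log_deriv j (lookup g i)"
  by (simp add: log_deriv_tau_def map.rep_eq when_def linear_overD(3) [OF log_deriv_linear])

lemma lookup_tau_d_tau: "lookup (tau 1 * d_tau h) i = of_int i * lookup h i"
proof -
  have "lookup (d_tau h) (i - 1) = (\<Sum>k\<in>keys h. if k = i then of_int i * lookup h i else 0)"
    unfolding d_tau_def lookup_sum by (rule sum.cong) (auto simp: lookup_single when_def)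
  then have "lookup (d_tau h) (i - 1) = of_int i * lookup h i"
    by (simp add: in_keys_iff)
  then show ?thesis
    by (simp add: tau_def lookup_single_mult)
qed

lemma of_int_cscale: "(of_int i :: 'm::comm_monoid_add \<Rightarrow>\<^sub>0 complex) * x = cscale (of_int i) x"
  by (metis cscale_def single_of_int)

locale box_piece = simplicial_polytope P for P :: "(real ^ 'n::{finite,linorder}) set" +
  fixes a :: "(int, 'n) vec \<Rightarrow> complex" and u :: "(int, 'n) vec"
  assumes a: "\<And>v. v \<in> V \<Longrightarrow> a v \<noteq> 0"
    and u: "u \<in> Box_fan P"
begin

sublocale sr: simplicial_module "verts P" \<Delta> "\<lambda>v. complex_of_real (lam (emb u) v)" "degP P (emb u)"
    "\<lambda>j v. of_int (v $ j)"
  using finite_V \<Delta>_mono \<Delta>_subset by unfold_locales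

definition pt :: "((int, 'n) vec \<Rightarrow>\<^sub>0 nat) \<Rightarrow> (int, 'n) vec" where
  "pt m = u + lattice_comb (lookup m)"

definition am :: "((int, 'n) vec \<Rightarrow>\<^sub>0 nat) \<Rightarrow> complex" where
  "am m = (\<Prod>v\<in>keys m. a v ^ lookup m v)"

lemma sr_S: "sr.S = lsupp (emb u)"
  by (simp add: sr.S_def lsupp_def)

lemma adm_iff: "sr.adm m \<longleftrightarrow> {v. lookup m v \<noteq> 0} \<union> lsupp (emb u) \<in> \<Delta>"
  by (simp add: sr.adm_def sr_S keys.rep_eq)

lemma adm_keys: "sr.adm m \<Longrightarrow> keys m \<subseteq> V"
  using \<Delta>_subset by (fastforce simp: sr.adm_def)

lemma pt_lam: "sr.adm m \<Longrightarrow> lam (emb (pt m)) v = lam (emb u) v + real (lookup m v)"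
  unfolding pt_def adm_iff by (rule lam_lattice_comb)

lemma pt_lsupp: "sr.adm m \<Longrightarrow> lsupp (emb (pt m)) = keys m \<union> lsupp (emb u)"
  by (auto simp: lsupp_def pt_lam in_keys_iff add_nonneg_eq_0_iff lam_nonneg)

lemma pt_degP: "sr.adm m \<Longrightarrow> degP P (emb (pt m)) = sr.dg m"
  using tot_superset [OF finite_V adm_keys, of m] unfolding sr.dg_def
  by (simp add: degP_eq pt_lam sum.distrib)

lemma pt_inj:
  assumes "sr.adm m" "sr.adm m'" "pt m = pt m'"
  shows "m = m'"
proof (rule poly_mapping_eqI)
  fix v show "lookup m v = lookup m' v"
    using pt_lam [OF assms(1), of v] pt_lam [OF assms(2), of v] assms(3) by simp
qed

lemma box_fibre_eq: "w \<in> box_fibre P u \<longleftrightarrow> (\<exists>m. sr.adm m \<and> w = pt m)"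
proof -
  have "lam (emb u) v < 1" for v
    using u Box_fan_iff by blast
  then have *: "w \<in> box_fibre P u \<longleftrightarrow> (\<exists>m. {v. m v \<noteq> 0} \<union> lsupp (emb u) \<in> \<Delta> \<and> w = u + lattice_comb m)"
    by (rule box_fibre_iff)
  show ?thesis
  proof
    assume "w \<in> box_fibre P u"
    then obtain m where m: "{v. m v \<noteq> 0} \<union> lsupp (emb u) \<in> \<Delta>" "w = u + lattice_comb m"
      using * by blast
    have "finite {v. m v \<noteq> 0}"
      using \<Delta>_finite [OF m(1)] by simp
    then have "lookup (Abs_poly_mapping m) = m" by simp
    then show "\<exists>m. sr.adm m \<and> w = pt m"
      using m by (intro exI [of _ "Abs_poly_mapping m"]) (simp add: adm_iff pt_def)
  qed (use * in \<open>auto simp: adm_iff pt_def\<close>)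
qed

lemma pt_add_vertex:
  assumes "v \<in> V"
  shows "pt (m + Poly_Mapping.single v 1) = v + pt m"
proof -
  have "lattice_comb (\<lambda>x. if x = v then 1 else 0) = (\<Sum>x\<in>V. if x = v then v else 0)"
    unfolding lattice_comb_def by (rule sum.cong) auto
  then have "lattice_comb (\<lambda>x. if x = v then 1 else 0) = v"
    using assms finite_V by simp
  moreover have "lattice_comb (lookup (m + Poly_Mapping.single v 1))
      = lattice_comb (lookup m) + lattice_comb (\<lambda>x. if x = v then 1 else 0)"
    unfolding lattice_comb_def sum.distrib [symmetric]
    by (rule sum.cong) (auto simp: lookup_add lookup_single when_def vec_eq_iff algebra_simps)
  ultimately show ?thesis
    by (simp add: pt_def)
qed

lemma am_add_vertex: "am (m + Poly_Mapping.single v 1) = a v * am m"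
proof -
  have am: "am m = (\<Prod>x\<in>A. a x ^ lookup m x)" if "finite A" "keys m \<subseteq> A" for m A
    unfolding am_def using that by (intro prod.mono_neutral_left) (auto simp: in_keys_iff)
  let ?A = "insert v (keys m)" and ?m = "m + Poly_Mapping.single v (1 :: nat)"
  have "am ?m = (\<Prod>x\<in>?A. a x ^ lookup m x * (if x = v then a v else 1))"
    by (subst am [of ?A]) (auto simp: keys_add_nat lookup_add lookup_single when_def intro!: prod.cong)
  also have "\<dots> = am m * a v"
    by (subst am [of ?A m]) (auto simp: prod.distrib)
  finally show ?thesis by simp
qed

lemma am_nonzero: "sr.adm m \<Longrightarrow> am m \<noteq> 0"
  using adm_keys a by (auto simp: am_def)

lemma degP_add_vertex_le: "v \<in> V \<Longrightarrow> degP P (emb (v + x)) \<le> degP P (emb x) + 1"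
  using degP_add_le [of "emb v" "emb x"] by (simp add: emb_add degP_vertex)

text \<open>The equality case \<open>degP_add_eq\<close> fails, so \<open>t^v t^w\<close> drops
  below the expected degree. This is why inadmissible monomials vanish in the graded ring.\<close>

lemma degP_add_vertex_less:
  assumes "sr.adm m" "v \<in> V" "\<not> sr.adm (m + Poly_Mapping.single v 1)"
  shows "degP P (emb (v + pt m)) < sr.dg m + 1"
proof -
  have "lsupp (emb v) \<union> lsupp (emb (pt m)) \<notin> \<Delta>"
    using assms by (simp add: lsupp_vertex pt_lsupp sr.adm_def sr_S keys_add_nat Un_assoc)
  then have "degP P (emb v + emb (pt m)) \<noteq> degP P (emb v) + degP P (emb (pt m))"
    using degP_add_eq by blast
  then show ?thesis
    using degP_add_vertex_le [OF assms(2), of "pt m"] assms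
    by (simp add: emb_add degP_vertex pt_degP)
qed

text \<open>The eigenvalue of \<open>t_j \<partial>/\<partial>t_j\<close> on \<open>t^w\<close> in
  conic coordinates, the origin of the shift in \<open>Eop\<close>. \<open>dg_sum\<close> is its
  analogue for N.\<close>

lemma pt_coord:
  assumes "sr.adm m"
  shows "(of_int (pt m $ j) :: complex)
    = (\<Sum>v\<in>V. of_int (v $ j) * (complex_of_real (lam (emb u) v) + of_nat (lookup m v)))"
proof -
  have "real_of_int (pt m $ j) = comb (lam (emb (pt m))) $ j"
    by (simp add: lam emb_nth)
  also have "\<dots> = (\<Sum>v\<in>V. of_int (v $ j) * (lam (emb u) v + real (lookup m v)))"
    by (simp add: comb_def pt_lam [OF assms] emb_nth mult.commute)
  finally have "complex_of_real (real_of_int (pt m $ j))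
      = complex_of_real (\<Sum>v\<in>V. of_int (v $ j) * (lam (emb u) v + real (lookup m v)))"
    by simp
  then show ?thesis by simp
qed

lemma dg_sum:
  assumes "sr.adm m"
  shows "complex_of_real (sr.dg m) = (\<Sum>v\<in>V. 1 * (complex_of_real (lam (emb u) v) + of_nat (lookup m v)))"
  using arg_cong [OF pt_degP [OF assms, symmetric], of complex_of_real]
  by (simp add: degP_eq pt_lam [OF assms])

subsection \<open>Multiplication by vertex monomials\<close>

text \<open>One notation for \<open>f\<close> (\<open>c = 1\<close>) and for
  \<open>t_j \<partial>f/\<partial>t_j\<close> (\<open>c v = v_j\<close>). \<open>Lop c\<close> is
  its counterpart in the vertex variables.\<close>

definition F :: "((int, 'n) vec \<Rightarrow> complex) \<Rightarrow> 'n laurent" where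
  "F c = (\<Sum>v\<in>V. Poly_Mapping.single v (c v * a v))"

lemma laurent_f_eq: "laurent_f P a = F (\<lambda>_. 1)"
  by (simp add: laurent_f_def F_def)

lemma log_deriv_f: "log_deriv j (laurent_f P a) = F (\<lambda>v. of_int (v $ j))"
  by (simp add: laurent_f_def F_def linear_over_sum [OF log_deriv_linear] log_deriv_single)

text \<open>The relation \<open>R\<close> is \<open>(\<le>)\<close> for a step of the Newton
  filtration and \<open>(<)\<close> for what is divided out in its graded piece, so that estimates
  are proved once for both.\<close>

definition NP :: "(real \<Rightarrow> real \<Rightarrow> bool) \<Rightarrow> real \<Rightarrow> 'n laurent set" where
  "NP R \<gamma> = with_keys (\<lambda>w. R (degP P (emb w)) \<gamma>)"

definition NT :: "(real \<Rightarrow> real \<Rightarrow> bool) \<Rightarrow> real \<Rightarrow> 'n laurent_tau set" where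
  "NT R \<gamma> = {g. \<forall>i. lookup g i \<in> NP R (\<gamma> + of_int i)}"

lemma csubspace_NP: "csubspace_of (\<lambda>c x. const_L c * x) (NP R \<gamma>)"
  using csubspace_with_keys unfolding NP_def const_L_eq cscale_def .

lemma csubspace_NT: "csubspace_of (\<lambda>c x. const_LT c * x) (NT R \<gamma>)"
  using csubspaceD [OF csubspace_NP]
  unfolding csubspace_of_def NT_def by (simp add: lookup_minus lookup_incl_mult)

lemma NP_mono: "NP (<) \<gamma> \<subseteq> NP (\<le>) \<gamma>"
  by (auto simp: NP_def with_keys_def)

lemma NT_mono: "NT (<) \<gamma> \<subseteq> NT (\<le>) \<gamma>"
  using NP_mono by (fastforce simp: NT_def)

lemma NP_F_mult:
  assumes g: "g \<in> NP R \<gamma>" and R: "R = (\<le>) \<or> R = (<)"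
  shows "F c * g \<in> NP R (\<gamma> + 1)"
proof -
  have "F c * g = (\<Sum>v\<in>V. Poly_Mapping.single v (c v * a v) * g)"
    by (simp add: F_def sum_distrib_right)
  moreover have "Poly_Mapping.single v (c v * a v) * g \<in> NP R (\<gamma> + 1)" if v: "v \<in> V" for v
    unfolding NP_def with_keys_def mem_Collect_eq
  proof
    fix w assume "w \<in> keys (Poly_Mapping.single v (c v * a v) * g)"
    then obtain x where x: "x \<in> keys g" "w = v + x"
      using keys_mult [of "Poly_Mapping.single v (c v * a v)" g] by (auto split: if_splits)
    then have "R (degP P (emb x)) \<gamma>"
      using g by (simp add: NP_def with_keys_def)
    then show "R (degP P (emb w)) (\<gamma> + 1)"
      using degP_add_vertex_le [OF v, of x] R x(2) by auto
  qed
  ultimately show ?thesis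
    by (simp add: csubspace_sum [OF csubspace_NP])
qed

text \<open>Compatible with multiplication only modulo lower Newton degree, see
  \<open>Q_Lop\<close>: a product of Laurent monomials can survive although the corresponding
  \<open>x^m\<close> is killed.\<close>

definition Q :: "((int, 'n) vec) mpoly \<Rightarrow> 'n laurent" where
  "Q = lin const_L (\<lambda>m. if sr.adm m then Poly_Mapping.single (pt m) (am m) else 0)"

lemma Q_linear: "linear_over const_L Q"
  unfolding Q_def by (rule lin_linear [OF scalar_hom_const_L])

lemma Q_Mon: "Q (Mon m) = (if sr.adm m then Poly_Mapping.single (pt m) (am m) else 0)"
  by (simp add: Q_def lin_Mon [OF scalar_hom_const_L])

text \<open>For each vertex \<open>v\<close>, either \<open>m\<close> remains admissible after
  adding \<open>v\<close> and the factor \<open>a^m\<close> makes the two terms equal, or the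
  polynomial term is killed and the Laurent term has strictly smaller degree.\<close>

lemma Q_Lop:
  assumes "sr.adm m"
  shows "F c * Q (Mon m) - Q (sr.Lop c * Mon m) \<in> NP (<) (sr.dg m + 1)"
proof -
  have "F c * Q (Mon m) - Q (sr.Lop c * Mon m) = (\<Sum>v\<in>V. Poly_Mapping.single (v + pt m) (c v * a v * am m)
      - const_L (c v) * Q (Mon (m + Poly_Mapping.single v 1)))"
    using assms by (simp only: F_def sr.Lop_Mon linear_over_sum [OF Q_linear] linear_overD [OF Q_linear])
       (simp add: Q_Mon sum_distrib_right mult_single sum_subtractf)
  also have "\<dots> \<in> NP (<) (sr.dg m + 1)"
  proof (rule csubspace_sum [OF csubspace_NP])
    fix v assume v: "v \<in> V"
    show "Poly_Mapping.single (v + pt m) (c v * a v * am m)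
      - const_L (c v) * Q (Mon (m + Poly_Mapping.single v 1)) \<in> NP (<) (sr.dg m + 1)"
    proof (cases "sr.adm (m + Poly_Mapping.single v 1)")
      case True
      then have "Poly_Mapping.single (v + pt m) (c v * a v * am m)
          - const_L (c v) * Q (Mon (m + Poly_Mapping.single v 1)) = 0"
        by (simp only: Q_Mon pt_add_vertex [OF v] am_add_vertex) (simp add: const_L_def mult_single mult.assoc)
      then show ?thesis
        using csubspaceD(1) [OF csubspace_NP] by metis
    next
      case False
      then show ?thesis
        using degP_add_vertex_less [OF assms v False] by (simp add: Q_Mon NP_def with_keys_def)
    qed
  qed
  finally show ?thesis .
qed

lemma Q_Lop_homog:
  assumes "p \<in> sr.homog \<beta>"
  shows "F c * Q p - Q (sr.Lop c * p) \<in> NP (<) (\<beta> + 1)"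
proof (rule linear_over_mem_gen [where T = "\<lambda>p. F c * Q p - Q (sr.Lop c * p)", OF _ csubspace_NP])
  show "linear_over const_L (\<lambda>p. F c * Q p - Q (sr.Lop c * p))"
    by (intro linear_over_diff linear_over_mult_left linear_over_comp [OF Q_linear] linear_over_mult Q_linear)
  fix m assume "m \<in> keys p"
  then have dg: "sr.dg m = \<beta>" using assms by (simp add: with_keys_def)
  show "F c * Q (Mon m) - Q (sr.Lop c * Mon m) \<in> NP (<) (\<beta> + 1)"
  proof (cases "sr.adm m")
    case True
    then show ?thesis using Q_Lop [OF True] dg by simp
  next
    case False
    then have "Mon m \<in> sr.SRideal" by (simp add: with_keys_def)
    then have "sr.Lop c * Mon m \<in> sr.SRideal" by (rule sr.SRideal_mult)
    then have "Q (sr.Lop c * Mon m) = 0"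
      unfolding Q_def lin_def by (intro sum.neutral) (auto simp: with_keys_def)
    then show ?thesis
      using False csubspaceD(1) [OF csubspace_NP] by (simp add: Q_Mon)
  qed
qed

lemma Q_SRideal: "p \<in> sr.SRideal \<Longrightarrow> Q p = 0"
  unfolding Q_def lin_def by (intro sum.neutral) (auto simp: with_keys_def)

lemma lookup_Q: "sr.adm m \<Longrightarrow> lookup (Q p) (pt m) = am m * lookup p m"
proof -
  assume m: "sr.adm m"
  have "lookup (Q p) (pt m) = (\<Sum>k\<in>keys p. if k = m then am m * lookup p m else 0)"
    unfolding Q_def lin_def lookup_sum
  proof (rule sum.cong [OF refl])
    fix k
    show "lookup (const_L (lookup p k) * (if sr.adm k then Poly_Mapping.single (pt k) (am k) else 0)) (pt m)
      = (if k = m then am m * lookup p m else 0)"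
      using m pt_inj [OF _ m, of k] by (auto simp: const_L_def mult_single lookup_single when_def)
  qed
  then show ?thesis by (simp add: in_keys_iff)
qed

lemma keys_Q: "keys (Q p) \<subseteq> pt ` {m \<in> keys p. sr.adm m}"
proof
  fix w assume "w \<in> keys (Q p)"
  then obtain m where "m \<in> keys p" "w \<in> keys (const_L (lookup p m) * (if sr.adm m then Poly_Mapping.single (pt m) (am m) else 0))"
    using keys_sum [of "\<lambda>m. const_L (lookup p m) * (if sr.adm m then Poly_Mapping.single (pt m) (am m) else 0)" "keys p"]
    by (auto simp: Q_def lin_def)
  then show "w \<in> pt ` {m \<in> keys p. sr.adm m}"
    by (auto simp: const_L_def mult_single split: if_splits)
qed

lemma Q_box: "Q p \<in> A_box P u"
  using keys_Q box_fibre_eq by (fastforce simp: A_box_def)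

text \<open>The exponent of \<tau> grows with the degree of \<open>t^w\<close>, so their difference
  is constant and all admissible monomials land in one graded piece. \<open>s\<close> is the
  exponent given to \<open>t^u\<close>.\<close>

definition Qt :: "int \<Rightarrow> ((int, 'n) vec) mpoly \<Rightarrow> 'n laurent_tau" where
  "Qt s = lin const_LT (\<lambda>m. Poly_Mapping.single (int (tot m) + s) (Q (Mon m)))"

lemma Qt_linear: "linear_over const_LT (Qt s)"
  unfolding Qt_def by (rule lin_linear [OF scalar_hom_const_LT])

lemma Qt_Mon: "Qt s (Mon m) = Poly_Mapping.single (int (tot m) + s) (Q (Mon m))"
  by (simp add: Qt_def lin_Mon [OF scalar_hom_const_LT])

lemma lookup_Qt: "lookup (Qt s p) i = Q (keep (\<lambda>m. int (tot m) + s = i) p)"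
proof (rule linear_over_eqI [where p = p])
  show "linear_over const_L (\<lambda>p. lookup (Qt s p) i)"
    using Qt_linear [of s] by (simp add: linear_over_def lookup_add lookup_incl_mult)
  show "linear_over const_L (\<lambda>p. Q (keep (\<lambda>m. int (tot m) + s = i) p))"
    by (rule linear_over_comp [OF Q_linear keep_linear])
  show "lookup (Qt s (Mon m)) i = Q (keep (\<lambda>m. int (tot m) + s = i) (Mon m))" for m
    by (simp add: Qt_Mon lookup_single when_def keep_def lin_Mon [OF scalar_hom_Const]
        linear_overD [OF Q_linear])
qed

lemma Qt_SRideal: "p \<in> sr.SRideal \<Longrightarrow> Qt s p = 0"
  unfolding Qt_def lin_def by (intro sum.neutral) (auto simp: with_keys_def Q_Mon)

lemma Qt_NT: "Qt s p \<in> NT (\<le>) (degP P (emb u) - of_int s)"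
proof -
  have "w \<in> keys (Q (keep (\<lambda>m. int (tot m) + s = i) p)) \<Longrightarrow>
      degP P (emb w) \<le> degP P (emb u) - of_int s + of_int i" for w i
    using keys_Q [of "keep (\<lambda>m. int (tot m) + s = i) p"]
    by (auto simp: keys_keep pt_degP sr.dg_def)
  then show ?thesis
    by (simp add: NT_def NP_def with_keys_def lookup_Qt)
qed

text \<open>Distinct admissible monomials have distinct images, each exactly at the boundary degree
  of its \<tau>-exponent. Nothing cancels, and none of them lies in the strictly lower step.\<close>

lemma Qt_zero_iff: "Qt s p \<in> NT (<) (degP P (emb u) - of_int s) \<longleftrightarrow> p \<in> sr.SRideal"
proof
  assume Qt: "Qt s p \<in> NT (<) (degP P (emb u) - of_int s)"
  show "p \<in> sr.SRideal"
    unfolding with_keys_def mem_Collect_eq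
  proof (intro ballI notI)
    fix m assume m: "m \<in> keys p" "sr.adm m"
    have "lookup (lookup (Qt s p) (int (tot m) + s)) (pt m) \<noteq> 0"
      using m am_nonzero by (simp add: lookup_Qt lookup_Q lookup_keep in_keys_iff)
    then have "pt m \<in> keys (lookup (Qt s p) (int (tot m) + s))"
      by (simp add: in_keys_iff)
    moreover have "lookup (Qt s p) (int (tot m) + s) \<in> NP (<) (sr.dg m)"
      using Qt by (auto simp: NT_def sr.dg_def dest!: spec [of _ "int (tot m) + s"])
    ultimately have "degP P (emb (pt m)) < sr.dg m"
      unfolding NP_def with_keys_def by blast
    then show False
      using pt_degP [OF m(2)] by simp
  qed
qed (use csubspaceD(1) [OF csubspace_NT] in \<open>simp add: Qt_SRideal\<close>)

lemma single_NT: "x \<in> NP R (\<gamma> + of_int i) \<Longrightarrow> Poly_Mapping.single i x \<in> NT R \<gamma>"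
  using csubspaceD(1) [OF csubspace_NP] by (simp add: NT_def lookup_single when_def)

lemma Qt_Lop:
  assumes "sr.adm m" "i = int (tot m) + 1 + s"
  shows "Poly_Mapping.single i (F c * Q (Mon m)) - Qt s (sr.Lop c * Mon m)
    \<in> NT (<) (degP P (emb u) - of_int s)"
proof -
  have "lookup (Qt s (sr.Lop c * Mon m)) k = Q (if k = i then sr.Lop c * Mon m else 0)" for k
  proof -
    have "keep (\<lambda>m. int (tot m) + s = k) (sr.Lop c * Mon m) = (if k = i then sr.Lop c * Mon m else 0)"
      unfolding sr.Lop_Mon linear_over_sum [OF keep_linear] linear_overD [OF keep_linear] keep_Mon
      using assms(2) by (auto simp: tot_add intro!: sum.cong)
    then show ?thesis by (simp add: lookup_Qt)
  qed
  then have "Poly_Mapping.single i (F c * Q (Mon m)) - Qt s (sr.Lop c * Mon m)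
      = Poly_Mapping.single i (F c * Q (Mon m) - Q (sr.Lop c * Mon m))"
    by (intro poly_mapping_eqI [where 'a = int])
      (auto simp: lookup_minus lookup_single when_def linear_overD [OF Q_linear])
  moreover have "degP P (emb u) - of_int s + of_int i = sr.dg m + 1"
    using assms(2) by (simp add: sr.dg_def)
  ultimately show ?thesis
    using single_NT Q_Lop [OF assms(1), of c] by simp
qed

subsection \<open>The twisted differential and the residue operator on coefficients\<close>

text \<open>The component of the twisted differential in the direction \<open>dt_j/t_j\<close>, see
  \<open>twisted_d_eq\<close>.\<close>

definition dT :: "'n \<Rightarrow> 'n laurent_tau \<Rightarrow> 'n laurent_tau" where
  "dT j g = tau (- 1) * log_deriv_tau j g - incl (log_deriv j (laurent_f P a)) * g"

lemma dT_add: "dT j (g + h) = dT j g + dT j h"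
proof -
  have "log_deriv_tau j (g + h) = log_deriv_tau j g + log_deriv_tau j h"
    by (rule poly_mapping_eqI [where 'a = int])
       (simp add: lookup_log_deriv_tau lookup_add linear_overD [OF log_deriv_linear])
  then show ?thesis by (simp add: dT_def algebra_simps)
qed

lemma dT_scale: "dT j (const_LT c * g) = const_LT c * dT j g"
proof -
  have "log_deriv_tau j (const_LT c * g) = const_LT c * log_deriv_tau j g"
    by (rule poly_mapping_eqI [where 'a = int])
       (simp add: lookup_log_deriv_tau lookup_incl_mult const_L_eq linear_overD [OF log_deriv_linear])
  then show ?thesis by (simp add: dT_def algebra_simps)
qed

lemma incl_F_NT: "g \<in> NT R \<gamma> \<Longrightarrow> R = (\<le>) \<or> R = (<) \<Longrightarrow> incl (F c) * g \<in> NT R (\<gamma> + 1)"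
  using NP_F_mult by (fastforce simp: NT_def lookup_incl_mult add.assoc add.commute [of 1])

lemma dT_NT:
  assumes g: "g \<in> NT R \<gamma>" and R: "R = (\<le>) \<or> R = (<)"
  shows "dT j g \<in> NT R (\<gamma> + 1)"
proof -
  have "keys (log_deriv j x) \<subseteq> keys x" for x
    by (auto simp: in_keys_iff lookup_log_deriv)
  then have "log_deriv j x \<in> NP R \<beta>" if "x \<in> NP R \<beta>" for x \<beta>
    using that by (auto simp: NP_def with_keys_def)
  \<comment> \<open>Multiplication by \<theta> lowers the \<tau>-exponent by one, so the coefficient
    at \<open>i\<close> comes from \<open>i + 1\<close>. This accounts for the bound
    \<open>\<gamma> + 1\<close>.\<close>
  then have ld: "log_deriv j (lookup g (i + 1)) \<in> NP R (\<gamma> + of_int (i + 1))" for i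
    using g by (simp only: NT_def mem_Collect_eq)
  have "tau (- 1) * log_deriv_tau j g \<in> NT R (\<gamma> + 1)"
    using ld by (simp add: NT_def lookup_tau_mult lookup_log_deriv_tau add_ac)
  then show ?thesis
    unfolding dT_def log_deriv_f using incl_F_NT [OF g R] csubspaceD(2) [OF csubspace_NT] by blast
qed

lemma sr_Eop_Mon:
  "sr.Eop c (Mon m) = sr.Lop c * Mon m
    - Const (\<Sum>v\<in>V. c v * (complex_of_real (lam (emb u) v) + of_nat (lookup m v))) * Mon m"
proof -
  have split: "Const (x * y) = Const x * (Const y :: (int, 'n) vec mpoly)" for x y
    by (simp add: mult_single)
  show ?thesis
    unfolding sr.Eop_def lin_Mon [OF scalar_hom_Const] sr.Lop_def Const_sum sum_distrib_right
      sum_subtractf [symmetric] split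
    by (rule sum.cong) (simp_all only: left_diff_distrib right_diff_distrib mult.assoc)
qed

lemma sr_Eop_SRideal: "p \<in> sr.SRideal \<Longrightarrow> sr.Eop c p \<in> sr.SRideal"
proof -
  assume p: "p \<in> sr.SRideal"
  show ?thesis
  proof (rule linear_over_mem [OF sr.Eop_linear csubspace_with_keys])
    fix m assume "m \<in> keys p"
    then have "Mon m \<in> sr.SRideal" using p by (simp add: with_keys_def)
    then show "sr.Eop c (Mon m) \<in> sr.SRideal"
      unfolding sr_Eop_Mon by (intro csubspaceD(2) [OF csubspace_with_keys] sr.SRideal_mult)
  qed
qed

text \<open>The logarithmic derivative contributes the eigenvalue of \<open>pt_coord\<close>, and
  multiplication by \<open>t_j \<partial>f/\<partial>t_j\<close> contributes \<open>Lop\<close> up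
  to lower degree. The parameter drops from \<open>s + 1\<close> to \<open>s\<close> because of the
  factor \<theta>.\<close>

lemma dT_Qt:
  "dT j (Qt (s + 1) p) - Qt s (- sr.Eop (\<lambda>v. of_int (v $ j)) p) \<in> NT (<) (degP P (emb u) - of_int s)"
proof (rule linear_over_mem_gen [where T = "\<lambda>p. dT j (Qt (s + 1) p) - Qt s (- sr.Eop (\<lambda>v. of_int (v $ j)) p)",
      OF _ csubspace_NT])
  show "linear_over const_LT (\<lambda>p. dT j (Qt (s + 1) p) - Qt s (- sr.Eop (\<lambda>v. of_int (v $ j)) p))"
    unfolding linear_over_def
    by (intro conjI allI) (simp_all add: linear_overD [OF Qt_linear] linear_overD [OF sr.Eop_linear]
        dT_add dT_scale distrib_left)
  fix m
  show "dT j (Qt (s + 1) (Mon m)) - Qt s (- sr.Eop (\<lambda>v. of_int (v $ j)) (Mon m))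
      \<in> NT (<) (degP P (emb u) - of_int s)"
  proof (cases "sr.adm m")
    case True
    define e where "e = int (tot m) + 1 + s"
    have ld: "log_deriv j (Q (Mon m)) = const_L (of_int (pt m $ j)) * Q (Mon m)"
      using True by (simp add: Q_Mon log_deriv_single const_L_def mult_single del: single_of_int)
    have "tau (- 1) * log_deriv_tau j (Qt (s + 1) (Mon m)) = const_LT (of_int (pt m $ j)) * Qt s (Mon m)"
      by (rule poly_mapping_eqI [where 'a = int])
         (auto simp: tau_def lookup_single_mult lookup_log_deriv_tau Qt_Mon lookup_incl_mult
           lookup_single when_def ld linear_overD [OF log_deriv_linear])
    moreover have "incl (F c) * Qt (s + 1) (Mon m) = Poly_Mapping.single e (F c * Q (Mon m))" for c
      by (simp add: Qt_Mon incl_def mult_single e_def algebra_simps)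
    ultimately have "dT j (Qt (s + 1) (Mon m)) - Qt s (- sr.Eop (\<lambda>v. of_int (v $ j)) (Mon m))
      = - (Poly_Mapping.single e (F (\<lambda>v. of_int (v $ j)) * Q (Mon m)) - Qt s (sr.Lop (\<lambda>v. of_int (v $ j)) * Mon m))"
      by (simp only: dT_def log_deriv_f sr_Eop_Mon pt_coord [OF True, symmetric] linear_overD [OF Qt_linear])
         simp
    then show ?thesis
      using csubspaceD(5) [OF csubspace_NT Qt_Lop [OF True e_def]] by simp
  next
    case False
    then have "Mon m \<in> sr.SRideal" by (simp add: with_keys_def)
    then have "Qt (s + 1) (Mon m) = 0" "Qt s (sr.Eop (\<lambda>v. of_int (v $ j)) (Mon m)) = 0"
      using Qt_SRideal sr_Eop_SRideal by auto
    then show ?thesis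
      using csubspaceD(1) [OF csubspace_NT] dT_add [of j 0 0] by (simp add: linear_overD [OF Qt_linear])
  qed
qed

definition NN :: "'n laurent_tau \<Rightarrow> 'n laurent_tau" where
  "NN g = - (tau 1 * (d_tau g - incl (laurent_f P a) * g)
      + const_LT (complex_of_real (frac (degP P (emb u)))) * g)"

lemma lookup_NN: "lookup (NN g) i = laurent_f P a * lookup g (i - 1)
    - cscale (of_int i + complex_of_real (frac (degP P (emb u)))) (lookup g i)"
proof -
  have "lookup (NN g) i = - (lookup (tau 1 * d_tau g) i - lookup (tau 1 * (incl (laurent_f P a) * g)) i
      + cscale (complex_of_real (frac (degP P (emb u)))) (lookup g i))"
    by (simp add: NN_def right_diff_distrib lookup_add lookup_minus lookup_incl_mult cscale_def const_L_eq)
  moreover have "lookup (tau 1 * d_tau g) i = cscale (of_int i) (lookup g i)"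
    by (simp only: lookup_tau_d_tau of_int_cscale)
  moreover have "lookup (tau 1 * (incl (laurent_f P a) * g)) i = laurent_f P a * lookup g (i - 1)"
    by (simp only: lookup_tau_mult lookup_incl_mult)
  ultimately show ?thesis
    by (simp add: cscale_def single_add distrib_right del: single_of_int)
qed

lemma NN_add: "NN (g + h) = NN g + NN h"
  by (rule poly_mapping_eqI [where 'a = int])
     (simp add: lookup_NN lookup_add cscale_add algebra_simps)

lemma NN_scale: "NN (const_LT c * g) = const_LT c * NN g"
  by (rule poly_mapping_eqI [where 'a = int])
     (simp add: lookup_NN lookup_const_LT_mult, simp add: cscale_def right_diff_distrib mult.left_commute)

lemma NN_NT:
  assumes g: "g \<in> NT R \<gamma>" and R: "R = (\<le>) \<or> R = (<)"
  shows "NN g \<in> NT R \<gamma>"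
  unfolding NT_def mem_Collect_eq
proof
  fix i
  have "lookup g (i - 1) \<in> NP R (\<gamma> + of_int (i - 1))" "lookup g i \<in> NP R (\<gamma> + of_int i)"
    using g by (simp_all only: NT_def mem_Collect_eq)
  from NP_F_mult [OF this(1) R, of "\<lambda>_. 1"] this(2) show "lookup (NN g) i \<in> NP R (\<gamma> + of_int i)"
    unfolding lookup_NN laurent_f_eq
    by (intro csubspaceD(2) [OF csubspace_NP])
       (simp_all add: cscale_def csubspaceD(3) [OF csubspace_NP, unfolded const_L_eq])
qed

text \<open>With \<open>s = \<lfloor>deg u\<rfloor>\<close> the \<tau>-exponent \<open>i\<close> of
  \<open>x^m\<close> satisfies \<open>i + {deg u} = deg w\<close>, so the scalar part of N is the
  sum of all \<open>\<lambda>_v + m_v\<close>, the shift of \<open>Eop\<close> for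
  \<open>c = 1\<close>.\<close>

lemma NN_Qt:
  assumes s: "s = \<lfloor>degP P (emb u)\<rfloor>"
  shows "NN (Qt s p) - Qt s (sr.Eop (\<lambda>_. 1) p) \<in> NT (<) (degP P (emb u) - of_int s)"
proof (rule linear_over_mem_gen [where T = "\<lambda>p. NN (Qt s p) - Qt s (sr.Eop (\<lambda>_. 1) p)",
      OF _ csubspace_NT])
  show "linear_over const_LT (\<lambda>p. NN (Qt s p) - Qt s (sr.Eop (\<lambda>_. 1) p))"
    unfolding linear_over_def
    by (intro conjI allI) (simp_all add: linear_overD [OF Qt_linear] linear_overD [OF sr.Eop_linear]
        NN_add NN_scale right_diff_distrib)
  fix m
  show "NN (Qt s (Mon m)) - Qt s (sr.Eop (\<lambda>_. 1) (Mon m)) \<in> NT (<) (degP P (emb u) - of_int s)"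
  proof (cases "sr.adm m")
    case True
    define e where "e = int (tot m) + 1 + s"
    have "real_of_int (int (tot m) + s) + frac (degP P (emb u)) = sr.dg m"
      by (simp add: s sr.dg_def frac_def)
    from arg_cong [OF this, of complex_of_real]
    have "of_int (int (tot m) + s) + complex_of_real (frac (degP P (emb u))) = complex_of_real (sr.dg m)"
      by simp
    then have "NN (Qt s (Mon m)) = Poly_Mapping.single e (F (\<lambda>_. 1) * Q (Mon m))
        - const_LT (complex_of_real (sr.dg m)) * Qt s (Mon m)"
      by (intro poly_mapping_eqI [where 'a = int])
         (auto simp: lookup_NN Qt_Mon lookup_single when_def lookup_minus lookup_incl_mult e_def
           laurent_f_eq cscale_def const_L_eq)
    then have "NN (Qt s (Mon m)) - Qt s (sr.Eop (\<lambda>_. 1) (Mon m))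
        = Poly_Mapping.single e (F (\<lambda>_. 1) * Q (Mon m)) - Qt s (sr.Lop (\<lambda>_. 1) * Mon m)"
      by (simp only: sr_Eop_Mon dg_sum [OF True, symmetric] linear_overD [OF Qt_linear]) simp
    then show ?thesis
      using Qt_Lop [OF True e_def, of "\<lambda>_. 1"] by simp
  next
    case False
    then have "Mon m \<in> sr.SRideal" by (simp add: with_keys_def)
    then have "Qt s (Mon m) = 0" "Qt s (sr.Eop (\<lambda>_. 1) (Mon m)) = 0"
      using Qt_SRideal sr_Eop_SRideal by auto
    then show ?thesis
      using csubspaceD(1) [OF csubspace_NT] NN_add [of 0 0] by simp
  qed
qed

end

section \<open>The Gauss--Manin piece and the graded Jacobian piece\<close>

definition coeff_forms :: "int \<Rightarrow> 'r set \<Rightarrow> ('n::finite, 'r::zero) form set" where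
  "coeff_forms k G = {\<omega> \<in> forms k. \<forall>I. \<omega> I \<in> G}"

lemma csubspace_coeff_forms:
  fixes G :: "'r::comm_ring_1 set"
  assumes "csubspace_of (\<lambda>c x. \<iota> c * x) G"
  shows "csubspace_of (form_scale \<iota>) (coeff_forms k G :: ('n::finite, 'r) form set)"
  using assms unfolding csubspace_of_def
  by (auto simp: coeff_forms_def forms_def form_scale_def)

lemma ext_op_forms:
  assumes "\<omega> \<in> forms k" "\<And>j. \<delta> j 0 = 0"
  shows "ext_op \<delta> \<omega> \<in> forms (k + 1)"
  unfolding forms_def mem_Collect_eq
proof (intro allI impI)
  fix I :: "'a set" assume I: "int (card I) \<noteq> k + 1"
  have "\<omega> (I - {j}) = 0" if "j \<in> I" for j
  proof -
    have "card I > 0"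
      using that card_gt_0_iff by fastforce
    then have "int (card (I - {j})) \<noteq> k"
      using I that by (simp add: card_Diff_singleton of_nat_diff)
    then show ?thesis using assms(1) by (simp add: forms_def)
  qed
  then show "ext_op \<delta> \<omega> I = 0"
    by (simp add: ext_op_def assms(2))
qed

lemma sign_mult_mem:
  assumes "csubspace_of sc G" "x \<in> G"
  shows "(- 1) ^ k * x \<in> (G :: 'r::comm_ring_1 set)"
  using assms by (cases "even k") (simp_all add: csubspaceD)

lemma ext_op_coeff:
  assumes \<omega>: "\<And>I. \<omega> I \<in> G" and \<delta>: "\<And>j x. x \<in> G \<Longrightarrow> \<delta> j x \<in> G'" and G': "csubspace_of sc G'"
  shows "ext_op \<delta> \<omega> I \<in> G'"
  unfolding ext_op_def by (intro csubspace_sum [OF G'] sign_mult_mem [OF G'] \<delta> \<omega>)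

lemma ext_op_add:
  assumes "\<And>j x y. \<delta> j (x + y) = \<delta> j x + \<delta> j y"
  shows "ext_op \<delta> (\<omega> + \<eta>) = ext_op \<delta> \<omega> + ext_op \<delta> \<eta>"
  by (simp add: ext_op_def fun_eq_iff assms distrib_left sum.distrib)

lemma forms_top: "\<omega> \<in> forms (int CARD('n::finite)) \<longleftrightarrow> \<omega> = top_form (\<omega> (UNIV :: 'n set))"
proof
  assume "\<omega> \<in> forms (int CARD('n))"
  then have "\<omega> I = 0" if "I \<noteq> UNIV" for I
    using that card_seteq [of UNIV I] by (auto simp: forms_def) (metis finite top_greatest order_refl)
  then show "\<omega> = top_form (\<omega> UNIV)"
    by (auto simp: top_form_def fun_eq_iff)
next
  assume *: "\<omega> = top_form (\<omega> UNIV)"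
  show "\<omega> \<in> forms (int CARD('n))"
    by (subst *) (auto simp: forms_def top_form_def)
qed

lemma top_form_forms: "(top_form g :: ('n::finite, 'r::zero) form) \<in> forms (int CARD('n))"
  by (auto simp: forms_def top_form_def)

lemma forms_above: "\<omega> \<in> forms (int CARD('n::finite) + 1) \<Longrightarrow> \<omega> = (\<lambda>I :: 'n set. 0)"
proof
  fix I :: "'n set" assume "\<omega> \<in> forms (int CARD('n) + 1)"
  moreover have "card I \<le> CARD('n)" by (simp add: card_mono)
  then have "int (card I) \<noteq> int CARD('n) + 1" by linarith
  ultimately show "\<omega> I = 0" by (simp add: forms_def)
qed

lemma top_form_add: "top_form (x + y) = top_form x + top_form (y :: 'r::comm_ring_1)"
  and top_form_scale: "top_form (\<iota> c * x) = form_scale \<iota> c (top_form x)"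
  and top_form_diff: "top_form (x - y) = top_form x - top_form (y :: 'r::comm_ring_1)"
  by (auto simp: top_form_def form_scale_def fun_eq_iff)

lemma csubspace_mult_const: "csubspace_of cscale G \<Longrightarrow> csubspace_of (\<lambda>c x. Const c * x) G"
  by (simp add: cscale_def [abs_def])

text \<open>The filtration is indexed by rationals, so a strict bound on finitely many degrees has
  to be improved to a non-strict bound by a smaller rational.\<close>

lemma rational_bound:
  assumes "finite E" "\<And>e. e \<in> E \<Longrightarrow> e < (\<alpha> :: real)"
  shows "\<exists>q\<in>\<rat>. q < \<alpha> \<and> (\<forall>e\<in>E. e \<le> q)"
proof -
  \<comment> \<open>Inserting \<open>\<alpha> - 1\<close> keeps the maximum meaningful for empty
    \<open>E\<close>.\<close>
  have "Max (insert (\<alpha> - 1) E) < \<alpha>"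
    using assms by simp
  then obtain q where "q \<in> \<rat>" "Max (insert (\<alpha> - 1) E) < q" "q < \<alpha>"
    using Rats_dense_in_real by blast
  then show ?thesis
    using assms(1) by (intro bexI [of _ q]) auto
qed

text \<open>The signs cancel those of \<open>ext_op\<close> in top degree.\<close>
definition cotop_form :: "('n::{finite,linorder} \<Rightarrow> 'r::comm_ring_1) \<Rightarrow> ('n, 'r) form" where
  "cotop_form g = (\<lambda>I. if card (- I) = 1 then (- 1) ^ card {i. i < the_elem (- I)} * g (the_elem (- I)) else 0)"

lemma cotop_form_forms:
  "(cotop_form g :: ('n::{finite,linorder}, 'r::comm_ring_1) form) \<in> forms (int CARD('n) - 1)"
  unfolding forms_def mem_Collect_eq
proof (intro allI impI)
  fix I :: "'n set" assume I: "int (card I) \<noteq> int CARD('n) - 1"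
  have "card (- I) = CARD('n) - card I" "card I \<le> CARD('n)"
    by (simp_all add: Compl_eq_Diff_UNIV card_Diff_subset card_mono)
  with I have "card (- I) \<noteq> 1" by linarith
  then show "cotop_form g I = 0" by (simp add: cotop_form_def)
qed

lemma ext_op_top:
  "ext_op \<delta> \<omega> (UNIV :: 'n::{finite,linorder} set) = (\<Sum>j\<in>UNIV. (- 1) ^ card {i. i < j} * \<delta> j (\<omega> (- {j})))"
  by (simp add: ext_op_def Compl_eq_Diff_UNIV)

context box_piece
begin

abbreviation "dgu \<equiv> degP P (emb u)"

text \<open>The exponent of \<tau> that accompanies \<open>t^u\<close> in k-forms: the solution
  \<open>i\<close> of \<open>{deg u} + i + k - n = deg u\<close>.\<close>

definition shift :: "int \<Rightarrow> int" where
  "shift k = \<lfloor>dgu\<rfloor> + (int CARD('n)) - k"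

lemma shift_eq: "frac dgu + of_int k - real CARD('n) = dgu - of_int (shift k)"
  by (simp add: shift_def frac_def)

lemma newton_eq: "newton P \<alpha> = NP (\<le>) \<alpha>"
  by (simp add: newton_def NP_def with_keys_def)

lemma newton_forms_eq: "newton_forms P k \<alpha> = coeff_forms k (NP (\<le>) (\<alpha> + of_int k - CARD('n)))"
  by (simp add: newton_forms_def coeff_forms_def newton_eq)

lemma newton_forms_tau_eq: "newton_forms_tau P k \<alpha> = coeff_forms k (NT (\<le>) (\<alpha> + of_int k - CARD('n)))"
proof -
  have "\<omega> I = 0" if "\<forall>i. (\<lambda>I. lookup (\<omega> I) i) \<in> forms k" "int (card I) \<noteq> k" for \<omega> :: "('n, 'n laurent_tau) form" and I
    using that by (intro poly_mapping_eqI [where 'a = int]) (auto simp: forms_def)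
  then show ?thesis
    by (auto simp: newton_forms_tau_def newton_forms_eq coeff_forms_def NT_def forms_def algebra_simps)
qed

lemma filt_below_newton:
  "filt_below \<rat> (newton_forms P k) \<alpha> = coeff_forms k (NP (<) (\<alpha> + of_int k - CARD('n)))"
proof (intro antisym subsetI)
  fix \<omega> assume "\<omega> \<in> filt_below \<rat> (newton_forms P k) \<alpha>"
  then obtain q where "q < \<alpha>" "\<omega> \<in> coeff_forms k (NP (\<le>) (q + of_int k - CARD('n)))"
    by (auto simp: filt_below_def newton_forms_eq)
  then show "\<omega> \<in> coeff_forms k (NP (<) (\<alpha> + of_int k - CARD('n)))"
    by (fastforce simp: coeff_forms_def NP_def with_keys_def)
next
  fix \<omega> :: "('n, 'n laurent) form" assume \<omega>: "\<omega> \<in> coeff_forms k (NP (<) (\<alpha> + of_int k - CARD('n)))"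
  \<comment> \<open>The finitely many degrees occurring in the coefficients, converted back into
    filtration indices.\<close>
  define E where "E = (\<Union>I. (\<lambda>w. degP P (emb w) - of_int k + CARD('n)) ` keys (\<omega> I))"
  have "finite E" by (simp add: E_def)
  moreover have "e < \<alpha>" if "e \<in> E" for e
    using that \<omega> by (fastforce simp: E_def coeff_forms_def NP_def with_keys_def)
  ultimately obtain q where q: "q \<in> \<rat>" "q < \<alpha>" "\<forall>e\<in>E. e \<le> q"
    using rational_bound by blast
  have "degP P (emb w) \<le> q + of_int k - CARD('n)" if "w \<in> keys (\<omega> I)" for w I
    using q(3) that by (auto simp: E_def dest!: bspec)
  then have "\<omega> \<in> newton_forms P k q"
    using \<omega> by (simp add: newton_forms_eq coeff_forms_def NP_def with_keys_def)
  then show "\<omega> \<in> filt_below \<rat> (newton_forms P k) \<alpha>"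
    using q by (auto simp: filt_below_def)
qed

lemma filt_below_newton_tau:
  "filt_below \<rat> (newton_forms_tau P k) \<alpha> = coeff_forms k (NT (<) (\<alpha> + of_int k - CARD('n)))"
proof (intro antisym subsetI)
  fix \<omega> assume "\<omega> \<in> filt_below \<rat> (newton_forms_tau P k) \<alpha>"
  then obtain q where "q < \<alpha>" "\<omega> \<in> coeff_forms k (NT (\<le>) (q + of_int k - CARD('n)))"
    by (auto simp: filt_below_def newton_forms_tau_eq)
  then show "\<omega> \<in> coeff_forms k (NT (<) (\<alpha> + of_int k - CARD('n)))"
    by (fastforce simp: coeff_forms_def NT_def NP_def with_keys_def)
next
  fix \<omega> :: "('n, 'n laurent_tau) form" assume \<omega>: "\<omega> \<in> coeff_forms k (NT (<) (\<alpha> + of_int k - CARD('n)))"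
  define E where "E = (\<Union>I. \<Union>i\<in>keys (\<omega> I). (\<lambda>w. degP P (emb w) - of_int i - of_int k + CARD('n)) ` keys (lookup (\<omega> I) i))"
  have "finite E" by (simp add: E_def)
  moreover have "e < \<alpha>" if "e \<in> E" for e
    using that \<omega> by (fastforce simp: E_def coeff_forms_def NT_def NP_def with_keys_def)
  ultimately obtain q where q: "q \<in> \<rat>" "q < \<alpha>" "\<forall>e\<in>E. e \<le> q"
    using rational_bound by blast
  have "degP P (emb w) \<le> q + of_int k - CARD('n) + of_int i" if w: "w \<in> keys (lookup (\<omega> I) i)" for w I i
  proof -
    have "i \<in> keys (\<omega> I)" using w by (auto simp: in_keys_iff)
    then have "degP P (emb w) - of_int i - of_int k + CARD('n) \<in> E"
      using w by (auto simp: E_def)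
    then have "degP P (emb w) - of_int i - of_int k + CARD('n) \<le> q" using q(3) by blast
    then show ?thesis by simp
  qed
  then have "\<omega> \<in> newton_forms_tau P k q"
    using \<omega> by (simp add: newton_forms_tau_eq coeff_forms_def NT_def NP_def with_keys_def)
  then show "\<omega> \<in> filt_below \<rat> (newton_forms_tau P k) \<alpha>"
    using q by (auto simp: filt_below_def)
qed

subsection \<open>Presentation of the twisted complex\<close>

text \<open>A monomial \<tau>^i t^w of the piece has \<open>deg w = deg u + tot m\<close>, and the
  filtration gives \<open>tot m \<le> i - s\<close>. In case of equality it is the image of a
  multiple of \<open>x^m\<close>, otherwise it lies in the lower step. The control of the
  \<tau>-exponents is for \<open>Phi_eq\<close>.\<close>

lemma Qt_onto:
  assumes g: "g \<in> NT (\<le>) (dgu - of_int s)" "\<And>i. lookup g i \<in> A_box P u"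
  shows "\<exists>p. g - Qt s p \<in> NT (<) (dgu - of_int s) \<and> (\<forall>m\<in>keys p. int (tot m) + s \<in> keys g)"
proof -
  define L where "L = {h. \<exists>p. h - Qt s p \<in> NT (<) (dgu - of_int s) \<and> (\<forall>m\<in>keys p. int (tot m) + s \<in> keys g)}"
  have L_add: "x + y \<in> L" if xy: "x \<in> L" "y \<in> L" for x y
  proof -
    obtain p q where p: "x - Qt s p \<in> NT (<) (dgu - of_int s)" "\<forall>m\<in>keys p. int (tot m) + s \<in> keys g"
      and q: "y - Qt s q \<in> NT (<) (dgu - of_int s)" "\<forall>m\<in>keys q. int (tot m) + s \<in> keys g"
      using xy by (auto simp: L_def)
    have "x + y - Qt s (p + q) = (x - Qt s p) + (y - Qt s q)"
      by (simp add: linear_overD [OF Qt_linear])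
    then have "x + y - Qt s (p + q) \<in> NT (<) (dgu - of_int s)"
      using csubspaceD(4) [OF csubspace_NT p(1) q(1)] by (simp only:)
    moreover have "\<forall>m\<in>keys (p + q). int (tot m) + s \<in> keys g"
      using p(2) q(2) keys_add [of p q] by blast
    ultimately show ?thesis unfolding L_def by blast
  qed
  have L_0: "0 \<in> L"
    using csubspaceD(1) [OF csubspace_NT] unfolding L_def
    by (auto intro!: exI [of _ 0] simp: linear_overD [OF Qt_linear])
  have L_sum: "sum h A \<in> L" if "\<And>x. x \<in> A \<Longrightarrow> h x \<in> L" for h and A :: "'x set"
    using that by (induction A rule: infinite_finite_induct) (auto intro: L_add L_0)
  have L_single: "Poly_Mapping.single i (Poly_Mapping.single w c) \<in> L"
    if i: "i \<in> keys g" "w \<in> keys (lookup g i)" for i w c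
  proof -
    have le: "degP P (emb w) \<le> dgu - of_int s + of_int i"
      using g(1) i(2) by (auto simp: NT_def NP_def with_keys_def)
    have "w \<in> box_fibre P u"
      using g(2) [of i] i(2) by (auto simp: A_box_def)
    then obtain m where m: "sr.adm m" "w = pt m"
      using box_fibre_eq by blast
    then have dw: "degP P (emb w) = dgu + real (tot m)"
      by (simp add: pt_degP sr.dg_def)
    show ?thesis
    proof (cases "int (tot m) + s = i")
      case True
      have "Qt s (Const (c / am m) * Mon m) = Poly_Mapping.single i (Poly_Mapping.single w c)"
        using m am_nonzero [OF m(1)] True
        by (simp only: linear_overD [OF Qt_linear] Qt_Mon Q_Mon)
           (simp add: incl_def const_L_def mult_single)
      moreover have "\<forall>k\<in>keys (Const (c / am m) * Mon m). int (tot k) + s \<in> keys g"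
        using keys_Const_mult [of "c / am m" "Mon m"] True i(1) by auto
      ultimately show ?thesis
        unfolding L_def using csubspaceD(1) [OF csubspace_NT]
        by (intro CollectI exI [of _ "Const (c / am m) * Mon m"]) simp
    next
      case False
      then have "degP P (emb w) < dgu - of_int s + of_int i"
        using le dw by linarith
      then have "Poly_Mapping.single i (Poly_Mapping.single w c) \<in> NT (<) (dgu - of_int s)"
        by (intro single_NT) (simp add: NP_def with_keys_def)
      then show ?thesis
        unfolding L_def by (intro CollectI exI [of _ 0]) (simp add: linear_overD [OF Qt_linear])
    qed
  qed
  have "g = (\<Sum>i\<in>keys g. \<Sum>w\<in>keys (lookup g i). Poly_Mapping.single i (Poly_Mapping.single w (lookup (lookup g i) w)))"
  proof -
    have inner: "Poly_Mapping.single i x = (\<Sum>w\<in>keys x. Poly_Mapping.single i (Poly_Mapping.single w (lookup x w)))"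
      for i :: int and x :: "'n laurent"
    proof -
      have "Poly_Mapping.single i (sum h A) = (\<Sum>w\<in>A. Poly_Mapping.single i (h w))"
        for h :: "(int, 'n) vec \<Rightarrow> 'n laurent" and A
        by (induction A rule: infinite_finite_induct) (auto simp: single_add)
      then show ?thesis
        using poly_mapping_sum_single [of x] by metis
    qed
    have "g = (\<Sum>i\<in>keys g. Poly_Mapping.single i (lookup g i))"
      by (rule poly_mapping_sum_single)
    also have "\<dots> = (\<Sum>i\<in>keys g. \<Sum>w\<in>keys (lookup g i). Poly_Mapping.single i (Poly_Mapping.single w (lookup (lookup g i) w)))"
      by (rule sum.cong [OF refl inner])
    finally show ?thesis .
  qed
  moreover have "(\<Sum>i\<in>keys g. \<Sum>w\<in>keys (lookup g i). Poly_Mapping.single i (Poly_Mapping.single w (lookup (lookup g i) w))) \<in> L"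
    by (intro L_sum L_single)
  ultimately have "g \<in> L" by (simp only:)
  then show ?thesis unfolding L_def by blast
qed

definition rT :: "int \<Rightarrow> ('n, (int, 'n) vec mpoly) form \<Rightarrow> ('n, 'n laurent_tau) form set" where
  "rT k \<rho> = gr_class \<rat> (Om_tau k) (newton_forms_tau P k) (frac dgu) (\<lambda>I. Qt (shift k) (\<rho> I))"

lemma csubspace_box_forms_tau: "csubspace_of (form_scale const_LT) (box_forms_tau P u)"
proof -
  have "A_box P u = with_keys (\<lambda>w. w \<in> box_fibre P u)"
    by (auto simp: A_box_def with_keys_def)
  then show ?thesis
    using csubspaceD [OF csubspace_with_keys [of "\<lambda>w. w \<in> box_fibre P u"]]
    by (simp add: csubspace_of_def box_forms_tau_def form_scale_def lookup_minus lookup_const_LT_mult)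
qed

text \<open>Laurent forms present the graded piece by definition; \<open>Qt_onto\<close> and
  \<open>Qt_zero_iff\<close>, applied to each coefficient, replace them by polynomial forms and
  identify the kernel.\<close>

lemma presents_Om_u:
  "presents (rT k) (form_scale Const) (forms k) (coeff_forms k sr.SRideal) (Om_u P u k)"
proof -
  let ?F = "coeff_forms k (NT (\<le>) (dgu - of_int (shift k))) :: ('n, 'n laurent_tau) form set"
  let ?L = "coeff_forms k (NT (<) (dgu - of_int (shift k))) :: ('n, 'n laurent_tau) form set"
  let ?S = "box_forms_tau P u"
  let ?g = "\<lambda>\<rho> I. Qt (shift k) (\<rho> I)"
  have F: "newton_forms_tau P k (frac dgu) = ?F"
    by (simp add: newton_forms_tau_eq shift_eq)
  have L: "filt_below \<rat> (newton_forms_tau P k) (frac dgu) = ?L"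
    by (simp add: filt_below_newton_tau shift_eq)
  have LF: "?L \<subseteq> ?F"
    using NT_mono by (auto simp: coeff_forms_def)
  note csF = csubspace_coeff_forms [OF csubspace_NT] and csS = csubspace_box_forms_tau
  have base: "presents (gr_class \<rat> (Om_tau k) (newton_forms_tau P k) (frac dgu)) (form_scale const_LT)
      (?F \<inter> ?S) (?L \<inter> (?F \<inter> ?S)) (Om_u P u k)"
    unfolding Om_u_def L [symmetric] F [symmetric]
    by (rule presents_gr) (use csF csS LF F L in \<open>auto simp: coeff_forms_def\<close>)
  have g: "?g \<rho> \<in> ?F \<inter> ?S" if "\<rho> \<in> forms k" for \<rho>
    using that Qt_NT [of "shift k"] Q_box
    by (auto simp: coeff_forms_def forms_def box_forms_tau_def lookup_Qt linear_overD [OF Qt_linear])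
  have "presents (\<lambda>\<rho>. gr_class \<rat> (Om_tau k) (newton_forms_tau P k) (frac dgu) (?g \<rho>)) (form_scale Const)
      (forms k) {\<rho> \<in> forms k. ?g \<rho> \<in> ?L \<inter> (?F \<inter> ?S)} (Om_u P u k)"
  proof (rule presents_pullback [OF base csubspace_forms form_scale_add g])
    fix \<omega> assume \<omega>: "\<omega> \<in> ?F \<inter> ?S"
    have "\<exists>p. \<omega> I - Qt (shift k) p \<in> NT (<) (dgu - of_int (shift k))" for I
      using \<omega> Qt_onto [of "\<omega> I" "shift k"] by (auto simp: coeff_forms_def box_forms_tau_def)
    then obtain \<rho>0 where \<rho>0: "\<And>I. \<omega> I - Qt (shift k) (\<rho>0 I) \<in> NT (<) (dgu - of_int (shift k))"
      by metis
    \<comment> \<open>Coefficients at index sets of the wrong size are reset to 0, which makes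
      \<open>\<rho>\<close> a k-form.\<close>
    define \<rho> where "\<rho> I = (if int (card I) = k then \<rho>0 I else 0)" for I
    have \<rho>: "\<rho> \<in> forms k" by (simp add: forms_def \<rho>_def)
    have "(\<omega> - ?g \<rho>) I \<in> NT (<) (dgu - of_int (shift k))" for I
      using \<rho>0 [of I] \<omega> csubspaceD(1) [OF csubspace_NT]
      by (auto simp: \<rho>_def coeff_forms_def forms_def linear_overD [OF Qt_linear])
    moreover have "\<omega> - ?g \<rho> \<in> ?F \<inter> ?S"
      by (rule csubspaceD(2) [OF csubspace_Int [OF csF csS] \<omega> g [OF \<rho>]])
    ultimately have "\<omega> - ?g \<rho> \<in> ?L \<inter> (?F \<inter> ?S)"
      by (simp add: coeff_forms_def)
    then show "\<exists>\<rho>\<in>forms k. \<omega> - ?g \<rho> \<in> ?L \<inter> (?F \<inter> ?S)"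
      using \<rho> by blast
  qed (auto simp: fun_eq_iff form_scale_def linear_overD [OF Qt_linear])
  moreover have "{\<rho> \<in> forms k. ?g \<rho> \<in> ?L \<inter> (?F \<inter> ?S)} = coeff_forms k sr.SRideal"
  proof -
    have "?g \<rho> \<in> ?L \<inter> (?F \<inter> ?S) \<longleftrightarrow> (\<forall>I. \<rho> I \<in> sr.SRideal)" if "\<rho> \<in> forms k" for \<rho>
      using g [OF that] Qt_zero_iff [of "shift k"] by (auto simp: coeff_forms_def)
    then show ?thesis by (auto simp: coeff_forms_def)
  qed
  ultimately show ?thesis
    by (simp add: rT_def [abs_def])
qed

definition dR :: "('n, (int, 'n) vec mpoly) form \<Rightarrow> ('n, (int, 'n) vec mpoly) form" where
  "dR = ext_op (\<lambda>j p. - sr.Eop (\<lambda>v. of_int (v $ j)) p)"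

lemma dR_forms: "\<rho> \<in> forms k \<Longrightarrow> dR \<rho> \<in> forms (k + 1)"
  unfolding dR_def by (rule ext_op_forms) (simp_all add: linear_overD [OF sr.Eop_linear])

lemma twisted_d_eq: "twisted_d (laurent_f P a) \<omega> = ext_op dT \<omega>"
  by (simp add: twisted_d_def ext_op_def df_wedge_tau_def dT_def fun_eq_iff sum_distrib_left
      sum_subtractf right_diff_distrib mult.left_commute)

lemma mem_gr_class: "z \<in> gr_class J (form_space \<iota> k) G p \<omega> \<longleftrightarrow> (\<exists>l\<in>filt_below J G p. z = l + \<omega>)"
  by (auto simp: gr_class_def a_r_coset_def r_coset_def form_space_def plus_fun_def)

lemma induced_gr_class:
  assumes T: "\<And>x y. T (x + y) = T x + T y" "\<And>l. l \<in> filt_below J G p \<Longrightarrow> T l \<in> filt_below J' G' p'"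
    and L: "csubspace_of (form_scale \<iota>) (filt_below J G p)"
    and L': "csubspace_of (form_scale \<iota>) (filt_below J' G' p')" "filt_below J' G' p' \<subseteq> forms k'"
    and x: "x \<in> forms k'" "T \<omega> - x \<in> filt_below J' G' p'"
  shows "induced (form_space \<iota> k') (filt_below J' G' p') T (gr_class J (form_space \<iota> k) G p \<omega>)
    = gr_class J' (form_space \<iota> k') G' p' x"
proof -
  have "induced (form_space \<iota> k') (filt_below J' G' p') T (gr_class J (form_space \<iota> k) G p \<omega>)
      = filt_below J' G' p' +>\<^bsub>form_space \<iota> k'\<^esub> x"
  proof (rule induced_eq [OF presents_form_space L'(1) _ L'(2) _ x(1)])
    have "0 + \<omega> \<in> gr_class J (form_space \<iota> k) G p \<omega>"
      unfolding mem_gr_class using csubspaceD(1) [OF L] by blast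
    then show "gr_class J (form_space \<iota> k) G p \<omega> \<noteq> {}" by blast
    fix z assume "z \<in> gr_class J (form_space \<iota> k) G p \<omega>"
    then obtain l where l: "l \<in> filt_below J G p" "z = l + \<omega>"
      unfolding mem_gr_class by blast
    have "T z - x = T l + (T \<omega> - x)"
      by (simp add: l(2) T(1))
    then have Tz: "T z - x \<in> filt_below J' G' p'"
      using csubspaceD(4) [OF L'(1) T(2) [OF l(1)] x(2)] by (simp only:)
    then have "(T z - x) + x \<in> forms k'"
      using csubspaceD(4) [OF csubspace_forms [of \<iota> k'], of "T z - x" x] L'(2) x(1) by blast
    then show "\<exists>y\<in>forms k'. T z = y \<and> y - x \<in> filt_below J' G' p'"
      using Tz by auto
  qed (use csubspaceD(1) [OF L'(1)] in auto)
  then show ?thesis by (simp add: gr_class_def)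
qed

text \<open>Passing from k-forms to (k+1)-forms lowers \<open>shift\<close> by one, which is the
  change of parameter in \<open>dT_Qt\<close>. The estimate there is summed over the terms of
  \<open>ext_op\<close>, whose signs commute with \<open>Qt\<close>.\<close>

lemma d_u_rT:
  assumes \<rho>: "\<rho> \<in> forms k"
  shows "d_u P a u k (rT k \<rho>) = rT (k + 1) (dR \<rho>)"
  unfolding d_u_def rT_def
proof (rule induced_gr_class)
  show "twisted_d (laurent_f P a) (x + y) = twisted_d (laurent_f P a) x + twisted_d (laurent_f P a) y" for x y
    unfolding twisted_d_eq by (rule ext_op_add) (rule dT_add)
  have cs: "csubspace_of (form_scale const_LT) (filt_below \<rat> (newton_forms_tau P k) (frac dgu))" for k
    unfolding filt_below_newton_tau by (rule csubspace_coeff_forms [OF csubspace_NT])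
  show "csubspace_of (form_scale const_LT) (filt_below \<rat> (newton_forms_tau P k) (frac dgu))"
    "csubspace_of (form_scale const_LT) (filt_below \<rat> (newton_forms_tau P (k + 1)) (frac dgu))"
    by (rule cs)+
  have dT0: "dT j 0 = 0" for j
    using dT_add [of j 0 0] by simp
  have sh: "dgu - of_int (shift (k + 1)) = dgu - of_int (shift k) + 1" "shift k = shift (k + 1) + 1"
    by (simp_all add: shift_def)
  show "twisted_d (laurent_f P a) l \<in> filt_below \<rat> (newton_forms_tau P (k + 1)) (frac dgu)"
    if "l \<in> filt_below \<rat> (newton_forms_tau P k) (frac dgu)" for l
    using that ext_op_forms [of l k dT] dT0
      ext_op_coeff [of l "NT (<) (dgu - of_int (shift k))" dT "NT (<) (dgu - of_int (shift (k + 1)))", OF _ _ csubspace_NT]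
      dT_NT [of _ "(<)" "dgu - of_int (shift k)"]
    unfolding filt_below_newton_tau twisted_d_eq coeff_forms_def shift_eq sh(1) by blast
  show "filt_below \<rat> (newton_forms_tau P (k + 1)) (frac dgu) \<subseteq> forms (k + 1)"
    by (auto simp: filt_below_newton_tau coeff_forms_def)
  show Qd: "(\<lambda>I. Qt (shift (k + 1)) (dR \<rho> I)) \<in> forms (k + 1)"
    using dR_forms [OF \<rho>] by (auto simp: forms_def linear_overD [OF Qt_linear])
  have Qr: "(\<lambda>I. Qt (shift k) (\<rho> I)) \<in> forms k"
    using \<rho> by (auto simp: forms_def linear_overD [OF Qt_linear])
  have "twisted_d (laurent_f P a) (\<lambda>I. Qt (shift k) (\<rho> I)) I - Qt (shift (k + 1)) (dR \<rho> I)
      = (\<Sum>j\<in>I. (- 1) ^ card {i \<in> I. i < j} * (dT j (Qt (shift (k + 1) + 1) (\<rho> (I - {j})))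
          - Qt (shift (k + 1)) (- sr.Eop (\<lambda>v. of_int (v $ j)) (\<rho> (I - {j})))))" for I
  proof -
    have sgn: "Qt s ((- 1) ^ c * p) = (- 1) ^ c * Qt s p" for s c p
      by (cases "even c") (simp_all add: linear_overD [OF Qt_linear])
    show ?thesis
      unfolding twisted_d_eq dR_def ext_op_def linear_over_sum [OF Qt_linear] sgn sh(2)
      by (simp add: sum_subtractf right_diff_distrib)
  qed
  then have "(twisted_d (laurent_f P a) (\<lambda>I. Qt (shift k) (\<rho> I)) - (\<lambda>I. Qt (shift (k + 1)) (dR \<rho> I))) I
      \<in> NT (<) (dgu - of_int (shift (k + 1)))" for I
    unfolding fun_diff_def
    by (simp only:) (intro csubspace_sum [OF csubspace_NT] sign_mult_mem [OF csubspace_NT] dT_Qt)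
  moreover have "twisted_d (laurent_f P a) (\<lambda>I. Qt (shift k) (\<rho> I)) - (\<lambda>I. Qt (shift (k + 1)) (dR \<rho> I)) \<in> forms (k + 1)"
    unfolding twisted_d_eq
    by (rule csubspaceD(2) [OF csubspace_forms _ Qd]) (rule ext_op_forms [where \<delta> = dT, OF Qr dT0])
  ultimately show "twisted_d (laurent_f P a) (\<lambda>I. Qt (shift k) (\<rho> I)) - (\<lambda>I. Qt (shift (k + 1)) (dR \<rho> I))
      \<in> filt_below \<rat> (newton_forms_tau P (k + 1)) (frac dgu)"
    unfolding filt_below_newton_tau coeff_forms_def shift_eq by blast
qed

section \<open>Top forms and the cokernel H(u)\<close>

definition r1 :: "(int, 'n) vec mpoly \<Rightarrow> ('n, 'n laurent_tau) form set" where
  "r1 p = gr_class \<rat> (Om_tau (int CARD('n))) (newton_forms_tau P (int CARD('n))) (frac dgu) (top_form (Qt \<lfloor>dgu\<rfloor> p))"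

lemma r1_eq: "rT (int CARD('n)) (top_form p) = r1 p"
proof -
  have "(\<lambda>I. Qt \<lfloor>dgu\<rfloor> (top_form p I)) = (top_form (Qt \<lfloor>dgu\<rfloor> p) :: ('n, _) form)"
    by (auto simp: top_form_def fun_eq_iff linear_overD [OF Qt_linear])
  then show ?thesis
    by (simp add: rT_def r1_def shift_def)
qed

lemma presents_r1: "presents r1 cscale UNIV sr.SRideal (Om_u P u (int CARD('n)))"
proof -
  have "presents (\<lambda>p. rT (int CARD('n)) (top_form p)) cscale UNIV
      {p \<in> UNIV. (top_form p :: ('n, _) form) \<in> coeff_forms (int CARD('n)) sr.SRideal} (Om_u P u (int CARD('n)))"
  proof (rule presents_pullback [OF presents_Om_u csubspace_UNIV cscale_add top_form_forms])
    fix \<omega> :: "('n, (int, 'n) vec mpoly) form" assume "\<omega> \<in> forms (int CARD('n))"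
    then have "\<omega> - top_form (\<omega> UNIV) = 0" using forms_top by auto
    then show "\<exists>p\<in>UNIV. \<omega> - top_form p \<in> coeff_forms (int CARD('n)) sr.SRideal"
      using csubspaceD(1) [OF csubspace_coeff_forms [OF csubspace_mult_const [OF csubspace_with_keys]]]
      by (metis UNIV_I)
  qed (simp_all add: top_form_add cscale_def top_form_scale)
  moreover have "{p \<in> UNIV. (top_form p :: ('n, (int, 'n) vec mpoly) form) \<in> coeff_forms (int CARD('n)) sr.SRideal} = sr.SRideal"
    using top_form_forms csubspaceD(1) [OF csubspace_with_keys]
    by (auto simp: coeff_forms_def top_form_def split: if_splits)
  ultimately show ?thesis
    by (simp add: r1_eq)
qed

text \<open>An (n-1)-form is a family of \<open>n\<close> coefficients, so the boundaries in top
  degree are the sums of values of the \<open>T j\<close>. The lemma serves both complexes, with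
  \<open>T j\<close> equal to \<open>Eop\<close> and to multiplication by
  \<open>Lop\<close>.\<close>

lemma top_coboundaries:
  fixes T :: "'n \<Rightarrow> (int, 'n) vec mpoly \<Rightarrow> (int, 'n) vec mpoly"
  assumes T: "\<And>j. linear_over Const (T j)"
    and K: "\<And>p. p \<in> K \<longleftrightarrow> (\<exists>g. p - (\<Sum>j\<in>UNIV. T j (g j)) \<in> sr.SRideal)"
    and r: "presents r cscale UNIV sr.SRideal M"
  shows "(\<lambda>\<rho>. r (ext_op (\<lambda>j p. - T j p) \<rho> UNIV)) ` forms ((int CARD('n)) - 1) = r ` K"
proof (intro antisym subsetI)
  have sgn: "T j ((- 1) ^ c * p) = (- 1) ^ c * T j p" for j c p
    by (cases "even c") (simp_all add: linear_overD [OF T])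
  have top: "ext_op (\<lambda>j p. - T j p) \<rho> UNIV = (\<Sum>j\<in>UNIV. T j (- ((- 1) ^ card {i. i < j} * \<rho> (- {j}))))" for \<rho>
    unfolding ext_op_top by (rule sum.cong) (simp_all add: linear_overD [OF T] sgn)
  {
    fix z assume "z \<in> (\<lambda>\<rho>. r (ext_op (\<lambda>j p. - T j p) \<rho> UNIV)) ` forms ((int CARD('n)) - 1)"
    then obtain \<rho> where z: "z = r (ext_op (\<lambda>j p. - T j p) \<rho> UNIV)" by blast
    have "ext_op (\<lambda>j p. - T j p) \<rho> UNIV \<in> K"
      unfolding K top using csubspaceD(1) [OF csubspace_with_keys]
      by (intro exI [of _ "\<lambda>j. - ((- 1) ^ card {i. i < j} * \<rho> (- {j}))"]) simp
    then show "z \<in> r ` K" using z by blast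
  }
  fix z assume "z \<in> r ` K"
  then obtain p g where p: "z = r p" "p - (\<Sum>j\<in>UNIV. T j (g j)) \<in> sr.SRideal"
    using K by blast
  \<comment> \<open>The signs of \<open>cotop_form\<close> undo those of \<open>ext_op\<close>, and
    the minus sign undoes that in \<open>- T j p\<close>.\<close>
  define \<rho> where "\<rho> = cotop_form (\<lambda>j. - g j)"
  have \<rho>: "\<rho> (- {j}) = (- 1) ^ card {i. i < j} * - g j" for j
    by (simp add: \<rho>_def cotop_form_def)
  have "- ((- 1) ^ c * ((- 1) ^ c * - x)) = x" for c and x :: "(int, 'n) vec mpoly"
    by (cases "even c") simp_all
  then have "ext_op (\<lambda>j p. - T j p) \<rho> UNIV = (\<Sum>j\<in>UNIV. T j (g j))"
    unfolding top \<rho> by simp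
  then have "z = r (ext_op (\<lambda>j p. - T j p) \<rho> UNIV)"
    using p presentsD(9) [OF r] by simp
  moreover have "\<rho> \<in> forms ((int CARD('n)) - 1)"
    unfolding \<rho>_def by (rule cotop_form_forms)
  ultimately show "z \<in> (\<lambda>\<rho>. r (ext_op (\<lambda>j p. - T j p) \<rho> UNIV)) ` forms ((int CARD('n)) - 1)"
    by blast
qed

lemma coboundaries_Hu: "coboundaries (Om_u P u) (d_u P a u) (int CARD('n)) = r1 ` sr.KH"
proof -
  have "coboundaries (Om_u P u) (d_u P a u) (int CARD('n)) = (\<lambda>\<rho>. d_u P a u ((int CARD('n)) - 1) (rT ((int CARD('n)) - 1) \<rho>)) ` forms ((int CARD('n)) - 1)"
    by (simp add: coboundaries_def presentsD(5) [OF presents_Om_u] image_image)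
  also have "\<dots> = (\<lambda>\<rho>. r1 (dR \<rho> UNIV)) ` forms ((int CARD('n)) - 1)"
  proof (rule image_cong [OF refl])
    fix \<rho> :: "('n, (int, 'n) vec mpoly) form" assume \<rho>: "\<rho> \<in> forms ((int CARD('n)) - 1)"
    then have "dR \<rho> = top_form (dR \<rho> UNIV)"
      using dR_forms [OF \<rho>] forms_top [of "dR \<rho>"] by simp
    then have "rT (int CARD('n)) (dR \<rho>) = r1 (dR \<rho> UNIV)"
      by (metis r1_eq)
    then show "d_u P a u ((int CARD('n)) - 1) (rT ((int CARD('n)) - 1) \<rho>) = r1 (dR \<rho> UNIV)"
      using d_u_rT [OF \<rho>] by simp
  qed
  also have "\<dots> = r1 ` sr.KH"
    unfolding dR_def by (rule top_coboundaries [OF sr.Eop_linear sr.KH_iff presents_r1])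
  finally show ?thesis .
qed

definition rH :: "(int, 'n) vec mpoly \<Rightarrow> ('n, 'n laurent_tau) form set set" where
  "rH p = Hu_class P a u (r1 p)"

text \<open>There are no nonzero (n+1)-forms, so every top form is closed and the cohomology is the
  cokernel of the last differential.\<close>

lemma presents_Hu: "presents rH cscale UNIV sr.KH (Hu P a u)"
proof -
  have "d_u P a u (int CARD('n)) x = \<zero>\<^bsub>Om_u P u ((int CARD('n)) + 1)\<^esub>" if x: "x \<in> carrier (Om_u P u (int CARD('n)))" for x
  proof -
    obtain \<rho> where \<rho>: "\<rho> \<in> forms (int CARD('n))" "x = rT (int CARD('n)) \<rho>"
      using x unfolding presentsD(5) [OF presents_Om_u] by (auto elim!: imageE)
    have "dR \<rho> = (\<lambda>I. 0)"
      by (rule forms_above [OF dR_forms [OF \<rho>(1)]])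
    then have "dR \<rho> = 0" by (simp add: zero_fun_def)
    then have "d_u P a u (int CARD('n)) x = rT (int CARD('n) + 1) 0"
      using d_u_rT [OF \<rho>(1)] \<rho>(2) by (simp only:)
    then show ?thesis
      by (simp only: presentsD(6) [OF presents_Om_u])
  qed
  then have "{x \<in> carrier (Om_u P u (int CARD('n))). d_u P a u (int CARD('n)) x = \<zero>\<^bsub>Om_u P u ((int CARD('n)) + 1)\<^esub>} = carrier (Om_u P u (int CARD('n)))"
    by blast
  then have "Hu P a u = quotient_module (Om_u P u (int CARD('n))) (coboundaries (Om_u P u) (d_u P a u) (int CARD('n)))"
    by (simp add: Hu_def cohomology_def)
  moreover have "rH = (\<lambda>p. coboundaries (Om_u P u) (d_u P a u) (int CARD('n)) +>\<^bsub>Om_u P u (int CARD('n))\<^esub> r1 p)"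
    by (simp add: rH_def [abs_def] Hu_class_def)
  ultimately show ?thesis
    using presents_quotient [OF presents_r1 sr.csubspace_KH sr.SRideal_KH _ coboundaries_Hu] by simp
qed

lemma N_gr_r1: "N_gr P a u (r1 p) = r1 (sr.Eop (\<lambda>_. 1) p)"
  unfolding N_gr_def r1_def
proof (rule induced_gr_class)
  have Nf: "N_forms P a u \<omega> = (\<lambda>I. NN (\<omega> I))" for \<omega>
    by (simp add: N_forms_def nabla_tau_def NN_def)
  show "N_forms P a u (x + y) = N_forms P a u x + N_forms P a u y" for x y
    by (simp add: Nf NN_add fun_eq_iff)
  have cs: "csubspace_of (form_scale const_LT) (filt_below \<rat> (newton_forms_tau P (int CARD('n))) (frac dgu))"
    unfolding filt_below_newton_tau by (rule csubspace_coeff_forms [OF csubspace_NT])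
  show "csubspace_of (form_scale const_LT) (filt_below \<rat> (newton_forms_tau P (int CARD('n))) (frac dgu))"
    "csubspace_of (form_scale const_LT) (filt_below \<rat> (newton_forms_tau P (int CARD('n))) (frac dgu))"
    by (rule cs)+
  have NN0: "NN 0 = 0" using NN_add [of 0 0] by simp
  show "N_forms P a u l \<in> filt_below \<rat> (newton_forms_tau P (int CARD('n))) (frac dgu)"
    if "l \<in> filt_below \<rat> (newton_forms_tau P (int CARD('n))) (frac dgu)" for l
    using that NN_NT unfolding filt_below_newton_tau Nf coeff_forms_def forms_def by (simp add: NN0)
  show "filt_below \<rat> (newton_forms_tau P (int CARD('n))) (frac dgu) \<subseteq> forms (int CARD('n))"
    by (auto simp: filt_below_newton_tau coeff_forms_def)
  show "(top_form (Qt \<lfloor>dgu\<rfloor> (sr.Eop (\<lambda>_. 1) p)) :: ('n, _) form) \<in> forms (int CARD('n))"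
    by (rule top_form_forms)
  have "frac dgu + of_int (int CARD('n)) - real CARD('n) = dgu - of_int \<lfloor>dgu\<rfloor>"
    by (simp add: frac_def)
  then show "N_forms P a u (top_form (Qt \<lfloor>dgu\<rfloor> p)) - top_form (Qt \<lfloor>dgu\<rfloor> (sr.Eop (\<lambda>_. 1) p))
      \<in> filt_below \<rat> (newton_forms_tau P (int CARD('n))) (frac dgu)"
    unfolding filt_below_newton_tau Nf coeff_forms_def
    using NN_Qt [of "\<lfloor>dgu\<rfloor>" p] NN0 csubspaceD(1) [OF csubspace_NT]
    by (auto simp: top_form_def forms_def)
qed

lemma N_H_rH: "N_H P a u (rH p) = rH (sr.Eop (\<lambda>_. 1) p)"
proof -
  have cos: "rH p = r1 ` {y. y - p \<in> sr.KH}" for p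
    using coset_image [OF presents_r1 sr.csubspace_KH] by (simp add: rH_def Hu_class_def coboundaries_Hu)
  have "N_H P a u (rH p) = coboundaries (Om_u P u) (d_u P a u) (int CARD('n)) +>\<^bsub>Om_u P u (int CARD('n))\<^esub> r1 (sr.Eop (\<lambda>_. 1) p)"
    unfolding N_H_def
  proof (rule induced_eq [OF presents_r1 sr.csubspace_KH sr.SRideal_KH subset_UNIV coboundaries_Hu])
    show "rH p \<noteq> {}"
      unfolding cos using csubspaceD(1) [OF sr.csubspace_KH] by (auto intro: exI [of _ p])
    fix z assume "z \<in> rH p"
    then obtain y where y: "z = r1 y" "y - p \<in> sr.KH" unfolding cos by blast
    have "sr.Eop (\<lambda>_. 1) y - sr.Eop (\<lambda>_. 1) p \<in> sr.KH"
      using sr.Eop_KH [OF y(2), of "\<lambda>_. 1"] by (simp add: linear_overD [OF sr.Eop_linear])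
    then show "\<exists>x\<in>UNIV. N_gr P a u z = r1 x \<and> x - sr.Eop (\<lambda>_. 1) p \<in> sr.KH"
      using y(1) N_gr_r1 by blast
  qed simp
  then show ?thesis by (simp add: rH_def Hu_class_def)
qed

text \<open>The \<tau>-exponent of \<open>x^m\<close> is
  \<open>tot m + \<lfloor>deg u\<rfloor>\<close>, so bounding it by \<open>p\<close> bounds the
  degree by \<open>p + {deg u}\<close>. For the converse inclusion the polynomial representing a
  form must involve no new \<tau>-exponents, as \<open>Qt_onto\<close> guarantees.\<close>

lemma Phi_eq: "Phi P a u p = rH ` sr.atmost (of_int p + frac dgu)"
proof (intro antisym subsetI)
  have at: "x \<in> sr.atmost (of_int p + frac dgu) \<longleftrightarrow> (\<forall>m\<in>keys x. int (tot m) + \<lfloor>dgu\<rfloor> \<le> p)" for x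
  proof -
    have "sr.dg m \<le> of_int p + frac dgu \<longleftrightarrow> int (tot m) + \<lfloor>dgu\<rfloor> \<le> p" for m
    proof -
      have "sr.dg m \<le> of_int p + frac dgu \<longleftrightarrow> real_of_int (int (tot m) + \<lfloor>dgu\<rfloor>) \<le> real_of_int p"
        by (simp add: sr.dg_def frac_def le_diff_eq)
      then show ?thesis by linarith
    qed
    then show ?thesis by (simp add: with_keys_def)
  qed
  have sh: "frac dgu + of_int (int CARD('n)) - real CARD('n) = dgu - of_int \<lfloor>dgu\<rfloor>"
    by (simp add: frac_def)
  let ?S = "box_forms_tau P u \<inter> {\<omega>. \<forall>I. \<forall>i\<in>keys (\<omega> I). i \<le> p}"
  {
    fix z assume "z \<in> rH ` sr.atmost (of_int p + frac dgu)"
    then obtain x where x: "z = rH x" "\<forall>m\<in>keys x. int (tot m) + \<lfloor>dgu\<rfloor> \<le> p"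
      using at by blast
    have "i \<le> p" if "i \<in> keys (Qt \<lfloor>dgu\<rfloor> x)" for i
    proof (rule ccontr)
      assume "\<not> i \<le> p"
      then have "keep (\<lambda>m. int (tot m) + \<lfloor>dgu\<rfloor> = i) x = 0"
        using x(2) by (intro poly_mapping_eqI) (auto simp: lookup_keep in_keys_iff)
      then show False using that by (simp add: in_keys_iff lookup_Qt linear_overD [OF Q_linear])
    qed
    then have "(top_form (Qt \<lfloor>dgu\<rfloor> x) :: ('n, _) form) \<in> newton_forms_tau P (int CARD('n)) (frac dgu) \<inter> ?S"
      using top_form_forms [of "Qt \<lfloor>dgu\<rfloor> x"] Qt_NT [of "\<lfloor>dgu\<rfloor>" x] csubspaceD(1) [OF csubspace_NT] Q_box
      unfolding newton_forms_tau_eq coeff_forms_def sh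
      by (auto simp: top_form_def box_forms_tau_def lookup_Qt A_box_def)
    then show "z \<in> Phi P a u p"
      unfolding Phi_def gr_image_def x(1) rH_def r1_def by blast
  }
  fix z assume "z \<in> Phi P a u p"
  then obtain \<omega> where \<omega>: "\<omega> \<in> newton_forms_tau P (int CARD('n)) (frac dgu)" "\<omega> \<in> ?S"
    and z: "z = Hu_class P a u (gr_class \<rat> (Om_tau (int CARD('n))) (newton_forms_tau P (int CARD('n))) (frac dgu) \<omega>)"
    unfolding Phi_def gr_image_def by blast
  define g where "g = \<omega> UNIV"
  have tf: "\<omega> = top_form g"
    using \<omega>(1) forms_top unfolding g_def newton_forms_tau_eq coeff_forms_def by blast
  have "g \<in> NT (\<le>) (dgu - of_int \<lfloor>dgu\<rfloor>)" "\<And>i. lookup g i \<in> A_box P u"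
    using \<omega> unfolding g_def newton_forms_tau_eq coeff_forms_def sh box_forms_tau_def by blast+
  from Qt_onto [OF this] obtain x where x: "g - Qt \<lfloor>dgu\<rfloor> x \<in> NT (<) (dgu - of_int \<lfloor>dgu\<rfloor>)"
      "\<forall>m\<in>keys x. int (tot m) + \<lfloor>dgu\<rfloor> \<in> keys g"
    by blast
  have "x \<in> sr.atmost (of_int p + frac dgu)"
    unfolding at using x(2) \<omega>(2) by (auto simp: g_def)
  moreover have "gr_class \<rat> (Om_tau (int CARD('n))) (newton_forms_tau P (int CARD('n))) (frac dgu) \<omega> = r1 x"
  proof -
    have L: "filt_below \<rat> (newton_forms_tau P (int CARD('n))) (frac dgu) = coeff_forms (int CARD('n)) (NT (<) (dgu - of_int \<lfloor>dgu\<rfloor>))"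
      by (simp only: filt_below_newton_tau sh)
    have "(top_form g - top_form (Qt \<lfloor>dgu\<rfloor> x) :: ('n, _) form) \<in> filt_below \<rat> (newton_forms_tau P (int CARD('n))) (frac dgu)"
      unfolding L coeff_forms_def top_form_diff [symmetric]
      using x(1) top_form_forms [of "g - Qt \<lfloor>dgu\<rfloor> x"] csubspaceD(1) [OF csubspace_NT]
      by (auto simp: top_form_def)
    moreover have cs: "csubspace_of (form_scale const_LT) (filt_below \<rat> (newton_forms_tau P (int CARD('n))) (frac dgu))"
      unfolding L by (rule csubspace_coeff_forms [OF csubspace_NT])
    moreover have "filt_below \<rat> (newton_forms_tau P (int CARD('n))) (frac dgu) \<subseteq> forms (int CARD('n))"
      unfolding L by (auto simp: coeff_forms_def)
    moreover have "{0} \<subseteq> filt_below \<rat> (newton_forms_tau P (int CARD('n))) (frac dgu)"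
      using csubspaceD(1) [OF cs] by blast
    ultimately show ?thesis
      using coset_eq_iff(1) [OF presents_form_space cs _ _ top_form_forms [of g] top_form_forms [of "Qt \<lfloor>dgu\<rfloor> x"]]
      unfolding tf gr_class_def r1_def by simp
  qed
  ultimately show "z \<in> rH ` sr.atmost (of_int p + frac dgu)"
    unfolding z rH_def by auto
qed

end

context box_piece
begin

subsection \<open>The associated graded space\<close>

text \<open>The Newton degree belonging to the \<tau>-exponent \<open>p\<close>.\<close>

definition bt :: "int \<Rightarrow> real" where
  "bt p = of_int p + frac dgu"

lemma bt_step: "bt p = bt (p - 1) + 1"
  by (simp add: bt_def)

lemma bt_eq_iff [simp]: "bt p = bt q \<longleftrightarrow> p = q"
  by (simp add: bt_def)

lemma dg_bt: "sr.dg m = bt (int (tot m) + \<lfloor>dgu\<rfloor>)"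
  by (simp add: sr.dg_def bt_def frac_def)

lemma bt_less_iff: "bt p < bt q \<longleftrightarrow> p < q" "bt p \<le> bt q \<longleftrightarrow> p \<le> q"
  by (simp_all add: bt_def)

lemma below_atmost: "x \<in> sr.below (bt p) \<longleftrightarrow> x \<in> sr.atmost (bt (p - 1))"
  by (simp add: with_keys_def dg_bt bt_less_iff)

lemma filt_below_Phi: "filt_below UNIV (Phi P a u) p = rH ` sr.below (bt p)"
proof (intro antisym subsetI)
  fix z assume "z \<in> filt_below UNIV (Phi P a u) p"
  then obtain q x where q: "q < p" "z = rH x" "x \<in> sr.atmost (bt q)"
    by (auto simp: filt_below_def Phi_eq bt_def)
  then have "x \<in> sr.below (bt p)"
    using bt_less_iff(1) [of q p] by (fastforce simp: with_keys_def)
  then show "z \<in> rH ` sr.below (bt p)"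
    using q by blast
next
  fix z assume "z \<in> rH ` sr.below (bt p)"
  then obtain x where x: "z = rH x" "x \<in> sr.atmost (bt (p - 1))"
    using below_atmost by blast
  then show "z \<in> filt_below UNIV (Phi P a u) p"
    by (auto simp: filt_below_def Phi_eq bt_def intro!: exI [of _ "p - 1"])
qed

text \<open>For \<beta> = \<open>bt p\<close> these are the representatives of classes in
  \<open>\<Phi>_(p-1) H(u)\<close>.\<close>

definition KB :: "real \<Rightarrow> (int, 'n) vec mpoly set" where
  "KB \<beta> = {x. \<exists>k\<in>sr.KH. x - k \<in> sr.below \<beta>}"

lemma csubspace_KB: "csubspace_of cscale (KB \<beta>)"
  unfolding csubspace_of_def
proof (intro conjI ballI allI)
  show "0 \<in> KB \<beta>"
    using csubspaceD(1) [OF sr.csubspace_KH] csubspaceD(1) [OF csubspace_with_keys]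
    by (auto simp: KB_def intro!: bexI [of _ 0])
next
  fix x y assume "x \<in> KB \<beta>" "y \<in> KB \<beta>"
  then obtain k l where k: "k \<in> sr.KH" "x - k \<in> sr.below \<beta>" and l: "l \<in> sr.KH" "y - l \<in> sr.below \<beta>"
    by (auto simp: KB_def)
  have "(x - y) - (k - l) = (x - k) - (y - l)" by simp
  then have "(x - y) - (k - l) \<in> sr.below \<beta>"
    using csubspaceD(2) [OF csubspace_with_keys k(2) l(2)] by metis
  then show "x - y \<in> KB \<beta>"
    using csubspaceD(2) [OF sr.csubspace_KH k(1) l(1)] by (auto simp: KB_def)
next
  fix c x assume "x \<in> KB \<beta>"
  then obtain k where k: "k \<in> sr.KH" "x - k \<in> sr.below \<beta>" by (auto simp: KB_def)
  have "cscale c x - cscale c k = cscale c (x - k)"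
    by (simp add: cscale_def right_diff_distrib)
  then have "cscale c x - cscale c k \<in> sr.below \<beta>"
    using csubspaceD(3) [OF csubspace_with_keys k(2), of c] by simp
  then show "cscale c x \<in> KB \<beta>"
    using csubspaceD(3) [OF sr.csubspace_KH k(1), of c] by (auto simp: KB_def)
qed

lemma KH_KB: "sr.KH \<subseteq> KB \<beta>"
  using csubspaceD(1) [OF csubspace_with_keys] by (auto simp: KB_def intro!: bexI)

lemma below_KB: "sr.below \<beta> \<subseteq> KB \<beta>"
  using csubspaceD(1) [OF sr.csubspace_KH] by (auto simp: KB_def intro!: bexI [of _ 0])

lemma rH_eq_iff: "rH x = rH y \<longleftrightarrow> x - y \<in> sr.KH"
  using presentsD(9) [OF presents_Hu] by simp

text \<open>\<open>C\<close> is the space of representatives in use: polynomials of degree at most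
  \<open>bt p\<close> when the surrounding space is \<open>\<Phi>_p\<close>, and all polynomials
  when it is H(u).\<close>

lemma rH_KB:
  assumes "sr.below (bt p) \<subseteq> C"
  shows "filt_below UNIV (Phi P a u) p = rH ` (KB (bt p) \<inter> C)"
proof (intro antisym subsetI)
  fix z assume "z \<in> rH ` (KB (bt p) \<inter> C)"
  then obtain x k where x: "z = rH x" "k \<in> sr.KH" "x - k \<in> sr.below (bt p)"
    by (auto simp: KB_def)
  then have "z = rH (x - k)"
    by (simp add: rH_eq_iff)
  then show "z \<in> filt_below UNIV (Phi P a u) p"
    unfolding filt_below_Phi using x(3) by blast
qed (use below_KB [of "bt p"] assms in \<open>auto simp: filt_below_Phi\<close>)

definition rG :: "int \<Rightarrow> (int, 'n) vec mpoly \<Rightarrow> ('n, 'n laurent_tau) form set set set" where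
  "rG p x = gr_class UNIV (Hu P a u) (Phi P a u) p (rH x)"

text \<open>Modulo lower degree every element of \<open>\<Phi>_p\<close> is represented by its
  homogeneous component of degree \<open>bt p\<close>. Such a component dies in the graded piece iff
  it is the symbol of an element of \<open>KH\<close>, and by \<open>symbol_KH\<close> these symbols
  are its members in \<open>KJ\<close>.\<close>

lemma presents_piece:
  "presents (rG p) cscale (sr.homog (bt p)) (sr.homog (bt p) \<inter> sr.KJ) (GrPhi_piece P a u p)"
proof -
  let ?A = "sr.atmost (bt p)" and ?B = "KB (bt p) \<inter> sr.atmost (bt p)"
  have Phi: "Phi P a u p = rH ` ?A"
    by (simp add: Phi_eq bt_def)
  have sub: "sr.below (bt p) \<subseteq> ?A"
    using sr.below_atmost by blast
  have 1: "presents rH cscale ?A (sr.KH \<inter> ?A) ((Hu P a u)\<lparr>carrier := Phi P a u p\<rparr>)"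
    by (rule presents_restrict [OF presents_Hu csubspace_with_keys _ Phi]) simp
  have 2: "presents (rG p) cscale ?A ?B (GrPhi_piece P a u p)"
    using presents_quotient [OF 1 csubspace_Int [OF csubspace_KB csubspace_with_keys] _ _ rH_KB [OF sub]] KH_KB
    unfolding gr_def rG_def gr_class_def a_r_coset_carrier_update by blast
  have "presents (\<lambda>x. rG p x) cscale (sr.homog (bt p)) {x \<in> sr.homog (bt p). x \<in> ?B} (GrPhi_piece P a u p)"
  proof (rule presents_pullback [OF 2 csubspace_with_keys cscale_add])
    show "x \<in> ?A" if "x \<in> sr.homog (bt p)" for x
      using that by (auto simp: with_keys_def)
    fix x assume x: "x \<in> ?A"
    then have "x - sr.hc (bt p) x \<in> sr.below (bt p)"
      by (rule sr.atmost_hc)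
    then show "\<exists>y\<in>sr.homog (bt p). x - y \<in> ?B"
      using sr.hc_homog below_KB sub by blast
  qed simp_all
  moreover have "{x \<in> sr.homog (bt p). x \<in> ?B} = sr.homog (bt p) \<inter> sr.KJ"
  proof -
    have "x \<in> ?B \<longleftrightarrow> x \<in> sr.KJ" if x: "x \<in> sr.homog (bt p)" for x
    proof -
      have xA: "x \<in> ?A" using x by (auto simp: with_keys_def)
      have "k \<in> ?A" if "x - k \<in> sr.below (bt p)" for k
        using csubspaceD(2) [OF csubspace_with_keys xA subsetD [OF sub that]] by simp
      then have "x \<in> ?B \<longleftrightarrow> (\<exists>k\<in>sr.KH \<inter> ?A. x - k \<in> sr.below (bt p))"
        using xA by (auto simp: KB_def)
      then show ?thesis using sr.symbol_KH [OF x] by simp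
    qed
    then show ?thesis by blast
  qed
  ultimately show ?thesis by simp
qed

definition rGG :: "(int, 'n) vec mpoly \<Rightarrow> int \<Rightarrow> ('n, 'n laurent_tau) form set set set" where
  "rGG x = (\<lambda>p\<in>UNIV. rG p (sr.hc (bt p) x))"

lemma hc_sum_bt: 
  assumes "\<And>m. m \<in> keys x \<Longrightarrow> sr.dg m \<in> E" "finite E"
  shows "x = (\<Sum>\<beta>\<in>E. sr.hc \<beta> x)"
proof (rule poly_mapping_eqI)
  fix m
  have "lookup (\<Sum>\<beta>\<in>E. sr.hc \<beta> x) m = (\<Sum>\<beta>\<in>E. if \<beta> = sr.dg m then lookup x m else 0)"
    unfolding lookup_sum by (rule sum.cong) (auto simp: lookup_keep)
  then show "lookup x m = lookup (\<Sum>\<beta>\<in>E. sr.hc \<beta> x) m"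
    using assms by (auto simp: in_keys_iff)
qed

lemma csubspace_hc:
  assumes K: "csubspace_of cscale K" "\<And>m. sr.hc (sr.dg m) x \<in> K"
  shows "x \<in> K"
proof -
  have "x = (\<Sum>\<beta>\<in>sr.dg ` keys x. sr.hc \<beta> x)"
    by (rule hc_sum_bt) auto
  also have "\<dots> \<in> K"
    using K(2) by (intro csubspace_sum [OF K(1)]) auto
  finally show ?thesis .
qed

lemma hc_sum_family:
  assumes "finite E" "\<And>i. i \<in> E \<Longrightarrow> y i \<in> sr.homog (h i)" "inj h" "\<And>i. i \<notin> E \<Longrightarrow> y i = 0"
  shows "sr.hc (h k) (\<Sum>i\<in>E. y i) = y k"
proof -
  have "sr.hc (h k) (\<Sum>i\<in>E. y i) = (\<Sum>i\<in>E. if i = k then y k else 0)"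
    unfolding linear_over_sum [OF keep_linear]
  proof (rule sum.cong [OF refl])
    fix i assume "i \<in> E"
    then show "sr.hc (h k) (y i) = (if i = k then y k else 0)"
      using sr.homog_hc [OF assms(2), of i "h k"] injD [OF assms(3), of k i] by auto
  qed
  also have "\<dots> = y k"
    using assms(1,4) by simp
  finally show ?thesis .
qed

text \<open>\<open>KJ\<close> is a graded subspace, so membership can be tested on homogeneous
  components. The degrees \<open>bt p\<close> with integral \<open>p\<close> include the degree of
  every monomial, so no component is missed.\<close>

lemma presents_GrPhi: "presents rGG cscale UNIV sr.KJ (GrPhi P a u)"
proof -
  have fin: "finite {p \<in> UNIV. sr.hc (bt p) x \<noteq> 0}" for x
  proof (rule finite_subset)
    show "{p \<in> UNIV. sr.hc (bt p) x \<noteq> 0} \<subseteq> (\<lambda>m. int (tot m) + \<lfloor>dgu\<rfloor>) ` keys x"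
    proof
      fix p assume "p \<in> {p \<in> UNIV. sr.hc (bt p) x \<noteq> 0}"
      then obtain m where "m \<in> keys (sr.hc (bt p) x)"
        by (metis (mono_tags) all_not_in_conv keys_eq_empty mem_Collect_eq)
      then show "p \<in> (\<lambda>m. int (tot m) + \<lfloor>dgu\<rfloor>) ` keys x"
        by (auto simp: keys_keep dg_bt)
    qed
  qed simp
  have "presents (\<lambda>x. \<lambda>p\<in>UNIV. rG p (sr.hc (bt p) x)) cscale UNIV
      {x \<in> UNIV. \<forall>p\<in>UNIV. sr.hc (bt p) x \<in> sr.homog (bt p) \<inter> sr.KJ} (direct_sum UNIV (GrPhi_piece P a u))"
  proof (rule presents_direct_sum [OF presents_piece csubspace_UNIV cscale_add sr.hc_homog _ _ fin])
    fix y :: "int \<Rightarrow> (int, 'n) vec mpoly"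
    assume y: "\<And>i. i \<in> UNIV \<Longrightarrow> y i \<in> sr.homog (bt i)" "finite {i \<in> UNIV. y i \<noteq> 0}"
    have "sr.hc (bt k) (\<Sum>i | y i \<noteq> 0. y i) = y k" for k
      using y by (intro hc_sum_family) (auto simp: inj_def)
    then show "\<exists>x\<in>UNIV. \<forall>i\<in>UNIV. sr.hc (bt i) x = y i"
      by blast
  qed (simp_all add: linear_overD [OF keep_linear] cscale_def)
  moreover have "{x \<in> UNIV. \<forall>p\<in>UNIV. sr.hc (bt p) x \<in> sr.homog (bt p) \<inter> sr.KJ} = sr.KJ"
  proof (intro antisym subsetI)
    fix x assume "x \<in> {x \<in> UNIV. \<forall>p\<in>UNIV. sr.hc (bt p) x \<in> sr.homog (bt p) \<inter> sr.KJ}"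
    then have comps: "sr.hc (bt q) x \<in> sr.KJ" for q
      by blast
    show "x \<in> sr.KJ"
    proof (rule csubspace_hc [OF sr.csubspace_KJ])
      show "sr.hc (sr.dg m) x \<in> sr.KJ" for m
        using comps [of "int (tot m) + \<lfloor>dgu\<rfloor>"] by (simp only: dg_bt [of m, symmetric])
    qed
  next
    fix x assume "x \<in> sr.KJ"
    from sr.hc_KJ [OF this] show "x \<in> {x \<in> UNIV. \<forall>p\<in>UNIV. sr.hc (bt p) x \<in> sr.homog (bt p) \<inter> sr.KJ}"
      by (simp add: sr.hc_homog)
  qed
  ultimately show ?thesis
    by (simp add: GrPhi_def rGG_def [abs_def])
qed

lemma N_GrPhi_rGG: "N_GrPhi P a u (rGG x) = rGG (sr.Lop (\<lambda>_. 1) * x)"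
proof
  fix p
  let ?y = "sr.hc (bt (p - 1)) x"
  have hc: "sr.hc (bt p) (sr.Lop (\<lambda>_. 1) * x) = sr.Lop (\<lambda>_. 1) * ?y"
    using sr.hc_Lop [of "bt (p - 1)"] bt_step [of p] by simp
  have filt: "filt_below UNIV (Phi P a u) q = rH ` KB (bt q)" for q
    using rH_KB [of q UNIV] by simp
  have cos: "rG (p - 1) ?y = rH ` {z. z - ?y \<in> KB (bt (p - 1))}"
    using coset_image [OF presents_Hu csubspace_KB, of "bt (p - 1)" ?y] by (simp add: rG_def gr_class_def filt)
  have up: "sr.atmost (bt (p - 1)) \<subseteq> sr.below (bt p)"
    using below_atmost by blast
  have "induced (Hu P a u) (filt_below UNIV (Phi P a u) p) (N_H P a u) (rG (p - 1) ?y)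
      = filt_below UNIV (Phi P a u) p +>\<^bsub>Hu P a u\<^esub> rH (sr.Lop (\<lambda>_. 1) * ?y)"
  proof (rule induced_eq [OF presents_Hu csubspace_KB KH_KB subset_UNIV filt UNIV_I])
    show "rG (p - 1) ?y \<noteq> {}"
      unfolding cos using csubspaceD(1) [OF csubspace_KB] by (auto intro: exI [of _ ?y])
    fix z assume "z \<in> rG (p - 1) ?y"
    then obtain t k where t: "z = rH t" "k \<in> sr.KH" "t - ?y - k \<in> sr.below (bt (p - 1))"
      unfolding cos KB_def by blast
    \<comment> \<open>An arbitrary representative is \<open>?y\<close> plus a relation plus this
      lower-order term. \<open>Eop\<close> raises the degree of \<open>b\<close> by at most one,
      which keeps it below \<open>bt p\<close>, and on \<open>?y\<close> it differs from
      \<open>Lop\<close> by lower order.\<close>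
    define b where "b = t - ?y - k"
    have b: "b \<in> sr.below (bt (p - 1))" using t(3) by (simp add: b_def)
    have y: "?y \<in> sr.atmost (bt (p - 1))"
      by (auto simp: with_keys_def keys_keep)
    have "sr.Eop (\<lambda>_. 1) b - sr.Lop (\<lambda>_. 1) * b \<in> sr.below (bt p)"
      using sr.Eop_atmost [OF sr.below_atmost [OF b]] up by blast
    moreover have "sr.Lop (\<lambda>_. 1) * b \<in> sr.below (bt p)"
      using sr.Lop_shift(3) [OF b] bt_step [of p] by simp
    moreover have "sr.Eop (\<lambda>_. 1) ?y - sr.Lop (\<lambda>_. 1) * ?y \<in> sr.below (bt p)"
      using sr.Eop_atmost [OF y] up by blast
    ultimately have "(sr.Eop (\<lambda>_. 1) b - sr.Lop (\<lambda>_. 1) * b) + sr.Lop (\<lambda>_. 1) * b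
        + (sr.Eop (\<lambda>_. 1) ?y - sr.Lop (\<lambda>_. 1) * ?y) \<in> sr.below (bt p)"
      by (intro csubspaceD(4) [OF csubspace_with_keys])
    moreover have "t = k + b + ?y" by (simp add: b_def)
    then have "sr.Eop (\<lambda>_. 1) t = sr.Eop (\<lambda>_. 1) k + sr.Eop (\<lambda>_. 1) b + sr.Eop (\<lambda>_. 1) ?y"
      by (simp only: linear_overD [OF sr.Eop_linear])
    ultimately have "sr.Eop (\<lambda>_. 1) t - sr.Lop (\<lambda>_. 1) * ?y - sr.Eop (\<lambda>_. 1) k \<in> sr.below (bt p)"
      by simp
    then have "sr.Eop (\<lambda>_. 1) t - sr.Lop (\<lambda>_. 1) * ?y \<in> KB (bt p)"
      using sr.Eop_KH [OF t(2)] by (auto simp: KB_def)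
    then show "\<exists>x\<in>UNIV. N_H P a u z = rH x \<and> x - sr.Lop (\<lambda>_. 1) * ?y \<in> KB (bt p)"
      using N_H_rH t(1) by blast
  qed
  then show "N_GrPhi P a u (rGG x) p = rGG (sr.Lop (\<lambda>_. 1) * x) p"
    by (simp add: N_GrPhi_def rGG_def hc) (simp add: rG_def gr_class_def)
qed

lemma GrPhi_component: "dsum_component UNIV (GrPhi_piece P a u) p = rGG ` sr.homog (bt p)"
proof -
  have "presents (\<lambda>x. \<lambda>p\<in>UNIV. rG p (sr.hc (bt p) x)) cscale UNIV sr.KJ (direct_sum UNIV (GrPhi_piece P a u))"
    using presents_GrPhi by (simp add: GrPhi_def rGG_def [abs_def])
  then have "dsum_component UNIV (GrPhi_piece P a u) p
      = (\<lambda>x. \<lambda>p\<in>UNIV. rG p (sr.hc (bt p) x)) ` {x \<in> UNIV. \<forall>i\<in>UNIV - {p}. sr.hc (bt i) x = 0}"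
  proof (rule dsum_component_presents)
    show "\<exists>x'\<in>UNIV. \<forall>i\<in>UNIV. sr.hc (bt i) x' = (if i = p then sr.hc (bt i) x else 0)" for x
      using sr.homog_hc [OF sr.hc_homog [of "bt p" x]] by (intro bexI [of _ "sr.hc (bt p) x"]) auto
  qed (rule presentsD(6) [OF presents_piece])
  also have "{x \<in> UNIV. \<forall>i\<in>UNIV - {p}. sr.hc (bt i) x = 0} = sr.homog (bt p)"
  proof (intro antisym subsetI)
    fix x assume x: "x \<in> {x \<in> UNIV. \<forall>i\<in>UNIV - {p}. sr.hc (bt i) x = 0}"
    show "x \<in> sr.homog (bt p)"
    proof (rule csubspace_hc [OF csubspace_with_keys])
      fix m
      obtain q where q: "sr.dg m = bt q" using dg_bt by blast
      have "sr.hc (bt q) x = 0" if "q \<noteq> p"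
        using x that by blast
      then show "sr.hc (sr.dg m) x \<in> sr.homog (bt p)"
        unfolding q using sr.hc_homog [of "bt p" x] csubspaceD(1) [OF csubspace_with_keys]
        by (cases "q = p") simp_all
    qed
  next
    fix x assume "x \<in> sr.homog (bt p)"
    from sr.homog_hc [OF this] show "x \<in> {x \<in> UNIV. \<forall>i\<in>UNIV - {p}. sr.hc (bt i) x = 0}"
      by simp
  qed
  finally show ?thesis
    unfolding rGG_def [abs_def] .
qed

text \<open>The factor \<open>1 / am m\<close> cancels the coefficient \<open>a^m\<close> built into
  \<open>Q\<close>. The same polynomial represents the monomial class in all three canonical
  spaces.\<close>

lemma GrPhi_monom_eq:
  assumes m: "sr.adm m" "sr.dg m = bt p"
  shows "GrPhi_monom P a u p (pt m) = rGG (Const (1 / am m) * Mon m)"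
proof -
  let ?x = "Const (1 / am m) * Mon m"
  have "Qt \<lfloor>dgu\<rfloor> ?x = Poly_Mapping.single p (Poly_Mapping.single (pt m) 1)"
    using m am_nonzero [OF m(1)]
    by (simp only: linear_overD [OF Qt_linear] Qt_Mon Q_Mon dg_bt bt_eq_iff)
       (simp add: incl_def const_L_def mult_single)
  then have "GrPhi_monom P a u p (pt m) = dsum_single UNIV (GrPhi_piece P a u) p (rG p ?x)"
    by (simp add: GrPhi_monom_def rG_def rH_def r1_def)
  also have "\<dots> = rGG ?x"
  proof
    fix q
    have "?x \<in> sr.homog (bt p)"
      using m keys_Const_mult [of "1 / am m" "Mon m"] by (auto simp: with_keys_def)
    then show "dsum_single UNIV (GrPhi_piece P a u) p (rG p ?x) q = rGG ?x q"
      using presentsD(6) [OF presents_piece, of q] by (simp add: dsum_single_def rGG_def sr.homog_hc)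
  qed
  finally show ?thesis .
qed

subsection \<open>The graded Jacobian piece\<close>

lemma Q_NP: "p \<in> sr.homog \<gamma> \<Longrightarrow> Q p \<in> NP (\<le>) \<gamma>"
  using keys_Q [of p] by (auto simp: NP_def with_keys_def pt_degP)

lemma Q_zero_iff:
  assumes "p \<in> sr.homog \<gamma>"
  shows "Q p \<in> NP (<) \<gamma> \<longleftrightarrow> p \<in> sr.SRideal"
proof
  assume Q: "Q p \<in> NP (<) \<gamma>"
  show "p \<in> sr.SRideal"
    unfolding with_keys_def mem_Collect_eq
  proof (intro ballI notI)
    fix m assume m: "m \<in> keys p" "sr.adm m"
    then have "pt m \<in> keys (Q p)"
      using am_nonzero by (simp add: in_keys_iff lookup_Q)
    then have "degP P (emb (pt m)) < \<gamma>"
      using Q unfolding NP_def with_keys_def by blast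
    then show False
      using pt_degP [OF m(2)] assms m(1) by (auto simp: with_keys_def)
  qed
qed (use csubspaceD(1) [OF csubspace_NP] in \<open>simp add: Q_SRideal\<close>)

text \<open>Monomials of degree exactly \<gamma> are hit by homogeneous polynomials, and those of
  smaller degree already vanish in the graded piece.\<close>

lemma Q_onto:
  assumes g: "g \<in> NP (\<le>) \<gamma>" "g \<in> A_box P u"
  shows "\<exists>p\<in>sr.homog \<gamma>. g - Q p \<in> NP (<) \<gamma>"
proof -
  define L where "L = {h. \<exists>p\<in>sr.homog \<gamma>. h - Q p \<in> NP (<) \<gamma>}"
  have L_add: "x + y \<in> L" if xy: "x \<in> L" "y \<in> L" for x y
  proof -
    obtain p q where p: "p \<in> sr.homog \<gamma>" "x - Q p \<in> NP (<) \<gamma>" and q: "q \<in> sr.homog \<gamma>" "y - Q q \<in> NP (<) \<gamma>"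
      using xy by (auto simp: L_def)
    have "x + y - Q (p + q) = (x - Q p) + (y - Q q)"
      by (simp add: linear_overD [OF Q_linear])
    then have "x + y - Q (p + q) \<in> NP (<) \<gamma>"
      using csubspaceD(4) [OF csubspace_NP p(2) q(2)] by (simp only:)
    then show ?thesis
      unfolding L_def using csubspaceD(4) [OF csubspace_with_keys p(1) q(1)] by blast
  qed
  have L_0: "0 \<in> L"
    using csubspaceD(1) [OF csubspace_NP] csubspaceD(1) [OF csubspace_with_keys] unfolding L_def
    by (auto intro!: bexI [of _ 0] simp: linear_overD [OF Q_linear])
  have L_sum: "sum h A \<in> L" if "\<And>x. x \<in> A \<Longrightarrow> h x \<in> L" for h and A :: "'x set"
    using that by (induction A rule: infinite_finite_induct) (auto intro: L_add L_0)
  have L_single: "Poly_Mapping.single w c \<in> L" if w: "w \<in> keys g" for w c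
  proof -
    have le: "degP P (emb w) \<le> \<gamma>"
      using g(1) w by (auto simp: NP_def with_keys_def)
    have "w \<in> box_fibre P u"
      using g(2) w by (auto simp: A_box_def)
    then obtain m where m: "sr.adm m" "w = pt m"
      using box_fibre_eq by blast
    show ?thesis
    proof (cases "sr.dg m = \<gamma>")
      case True
      have "Q (Const (c / am m) * Mon m) = Poly_Mapping.single w c"
        using m am_nonzero [OF m(1)]
        by (simp only: linear_overD [OF Q_linear] Q_Mon) (simp add: const_L_def mult_single)
      moreover have "Const (c / am m) * Mon m \<in> sr.homog \<gamma>"
        using keys_Const_mult [of "c / am m" "Mon m"] True by (auto simp: with_keys_def)
      ultimately show ?thesis
        unfolding L_def using csubspaceD(1) [OF csubspace_NP]
        by (intro CollectI bexI [of _ "Const (c / am m) * Mon m"]) simp_all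
    next
      case False
      then have "degP P (emb w) < \<gamma>"
        using le pt_degP [OF m(1)] m(2) by simp
      then have "Poly_Mapping.single w c \<in> NP (<) \<gamma>"
        by (simp add: NP_def with_keys_def)
      then show ?thesis
        unfolding L_def using csubspaceD(1) [OF csubspace_with_keys]
        by (intro CollectI bexI [of _ 0]) (simp_all add: linear_overD [OF Q_linear])
    qed
  qed
  have "g = (\<Sum>w\<in>keys g. Poly_Mapping.single w (lookup g w))"
    by (rule poly_mapping_sum_single)
  moreover have "(\<Sum>w\<in>keys g. Poly_Mapping.single w (lookup g w)) \<in> L"
    by (intro L_sum L_single)
  ultimately have "g \<in> L" by (simp only:)
  then show ?thesis unfolding L_def by blast
qed

lemma csubspace_box_forms: "csubspace_of (form_scale const_L) (box_forms P u)"
proof -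
  have "A_box P u = with_keys (\<lambda>w. w \<in> box_fibre P u)"
    by (auto simp: A_box_def with_keys_def)
  then show ?thesis
    using csubspaceD [OF csubspace_with_keys [of "\<lambda>w. w \<in> box_fibre P u"]]
    by (simp add: csubspace_of_def box_forms_def form_scale_def const_L_eq cscale_def)
qed

text \<open>The Newton degree of the coefficients of a k-form in filtration degree \<alpha>; in top
  degree the two agree.\<close>

definition wt :: "int \<Rightarrow> real \<Rightarrow> real" where
  "wt k \<alpha> = \<alpha> + of_int k - CARD('n)"

definition GrOm_box :: "int \<Rightarrow> real \<Rightarrow> (complex, ('n, 'n laurent) form set) module" where
  "GrOm_box k \<alpha> = (GrOm P k \<alpha>)\<lparr>carrier := gr_image \<rat> (Om k) (newton_forms P k) \<alpha> (box_forms P u)\<rparr>"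

definition rp :: "int \<Rightarrow> real \<Rightarrow> ('n, (int, 'n) vec mpoly) form \<Rightarrow> ('n, 'n laurent) form set" where
  "rp k \<alpha> \<rho> = gr_class \<rat> (Om k) (newton_forms P k) \<alpha> (\<lambda>I. Q (\<rho> I))"

lemma csubspace_coeff_Const: "csubspace_of cscale G \<Longrightarrow>
    csubspace_of (form_scale Const) (coeff_forms k G :: ('n, (int, 'n) vec mpoly) form set)"
  by (rule csubspace_coeff_forms [OF csubspace_mult_const])

lemma presents_GrOm_box:
  "presents (rp k \<alpha>) (form_scale Const) (coeff_forms k (sr.homog (wt k \<alpha>)))
     (coeff_forms k (sr.homog (wt k \<alpha>) \<inter> sr.SRideal)) (GrOm_box k \<alpha>)"
proof -
  let ?\<gamma> = "wt k \<alpha>"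
  let ?F = "coeff_forms k (NP (\<le>) ?\<gamma>) :: ('n, 'n laurent) form set"
  let ?L = "coeff_forms k (NP (<) ?\<gamma>) :: ('n, 'n laurent) form set"
  let ?S = "box_forms P u"
  let ?A = "coeff_forms k (sr.homog ?\<gamma>) :: ('n, (int, 'n) vec mpoly) form set"
  let ?g = "\<lambda>\<rho> I. Q (\<rho> I)"
  have F: "newton_forms P k \<alpha> = ?F"
    by (simp add: newton_forms_eq wt_def)
  have L: "filt_below \<rat> (newton_forms P k) \<alpha> = ?L"
    by (simp add: filt_below_newton wt_def)
  have LF: "?L \<subseteq> ?F"
    using NP_mono by (auto simp: coeff_forms_def)
  note csF = csubspace_coeff_forms [OF csubspace_NP] and csS = csubspace_box_forms
  have base: "presents (gr_class \<rat> (Om k) (newton_forms P k) \<alpha>) (form_scale const_L)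
      (?F \<inter> ?S) (?L \<inter> (?F \<inter> ?S)) (GrOm_box k \<alpha>)"
    unfolding GrOm_box_def L [symmetric] F [symmetric]
    by (rule presents_gr) (use csF csS LF F L in \<open>auto simp: coeff_forms_def\<close>)
  have g: "?g \<rho> \<in> ?F \<inter> ?S" if "\<rho> \<in> ?A" for \<rho>
    using that Q_NP Q_box
    by (auto simp: coeff_forms_def forms_def box_forms_def linear_overD [OF Q_linear])
  have "presents (\<lambda>\<rho>. gr_class \<rat> (Om k) (newton_forms P k) \<alpha> (?g \<rho>)) (form_scale Const)
      ?A {\<rho> \<in> ?A. ?g \<rho> \<in> ?L \<inter> (?F \<inter> ?S)} (GrOm_box k \<alpha>)"
  proof (rule presents_pullback [OF base csubspace_coeff_Const [OF csubspace_with_keys] form_scale_add g])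
    fix \<omega> assume \<omega>: "\<omega> \<in> ?F \<inter> ?S"
    have "\<exists>p\<in>sr.homog ?\<gamma>. \<omega> I - Q p \<in> NP (<) ?\<gamma>" for I
      using \<omega> by (intro Q_onto) (auto simp: coeff_forms_def box_forms_def)
    then obtain \<rho>0 where \<rho>0: "\<And>I. \<rho>0 I \<in> sr.homog ?\<gamma>" "\<And>I. \<omega> I - Q (\<rho>0 I) \<in> NP (<) ?\<gamma>"
      by metis
    define \<rho> where "\<rho> I = (if int (card I) = k then \<rho>0 I else 0)" for I
    have \<rho>: "\<rho> \<in> ?A"
      using \<rho>0(1) csubspaceD(1) [OF csubspace_with_keys] by (auto simp: coeff_forms_def forms_def \<rho>_def)
    have "(\<omega> - ?g \<rho>) I \<in> NP (<) ?\<gamma>" for I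
      using \<rho>0(2) [of I] \<omega> csubspaceD(1) [OF csubspace_NP]
      by (auto simp: \<rho>_def coeff_forms_def forms_def linear_overD [OF Q_linear])
    moreover have "\<omega> - ?g \<rho> \<in> ?F \<inter> ?S"
      by (rule csubspaceD(2) [OF csubspace_Int [OF csF csS] \<omega> g [OF \<rho>]])
    ultimately have "\<omega> - ?g \<rho> \<in> ?L \<inter> (?F \<inter> ?S)"
      by (simp add: coeff_forms_def)
    then show "\<exists>\<rho>\<in>?A. \<omega> - ?g \<rho> \<in> ?L \<inter> (?F \<inter> ?S)"
      using \<rho> by blast
  qed (auto simp: fun_eq_iff form_scale_def linear_overD [OF Q_linear])
  moreover have "{\<rho> \<in> ?A. ?g \<rho> \<in> ?L \<inter> (?F \<inter> ?S)} = coeff_forms k (sr.homog ?\<gamma> \<inter> sr.SRideal)"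
  proof -
    have "?g \<rho> \<in> ?L \<inter> (?F \<inter> ?S) \<longleftrightarrow> (\<forall>I. \<rho> I \<in> sr.SRideal)" if \<rho>: "\<rho> \<in> ?A" for \<rho>
    proof -
      have "Q (\<rho> I) \<in> NP (<) ?\<gamma> \<longleftrightarrow> \<rho> I \<in> sr.SRideal" for I
        using \<rho> by (intro Q_zero_iff) (simp add: coeff_forms_def)
      then show ?thesis
        using g [OF \<rho>] by (auto simp: coeff_forms_def)
    qed
    then show ?thesis by (auto simp: coeff_forms_def)
  qed
  ultimately show ?thesis
    by (simp add: rp_def [abs_def])
qed

definition hcf :: "int \<Rightarrow> real \<Rightarrow> ('n, (int, 'n) vec mpoly) form \<Rightarrow> ('n, (int, 'n) vec mpoly) form" where
  "hcf k \<alpha> \<rho> = (\<lambda>I. sr.hc (wt k \<alpha>) (\<rho> I))"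

definition rB :: "int \<Rightarrow> ('n, (int, 'n) vec mpoly) form \<Rightarrow> real \<Rightarrow> ('n, 'n laurent) form set" where
  "rB k \<rho> = (\<lambda>\<alpha>\<in>\<rat>. rp k \<alpha> (hcf k \<alpha> \<rho>))"

text \<open>Finitely supported families with all entries in subspaces are the direct sum of these
  subspaces, and the image of the box forms is a subspace of each graded piece.\<close>

lemma Om_bar_eq: "Om_bar P u k = direct_sum \<rat> (GrOm_box k)"
proof -
  have sub: "gr_image \<rat> (Om k) (newton_forms P k) \<alpha> (box_forms P u) \<subseteq> carrier (GrOm P k \<alpha>)" for \<alpha>
  proof -
    have "presents (gr_class \<rat> (Om k) (newton_forms P k) \<alpha>) (form_scale const_L) (newton_forms P k \<alpha>)
        (filt_below \<rat> (newton_forms P k) \<alpha>) (GrOm P k \<alpha>)"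
      by (rule presents_gr_base)
         (use csubspace_coeff_forms [OF csubspace_NP] in
           \<open>auto simp: newton_forms_eq filt_below_newton coeff_forms_def dest: subsetD [OF NP_mono]\<close>)
    then show ?thesis
      by (auto simp: gr_image_def presentsD(5))
  qed
  have "{x \<in> carrier (direct_sum \<rat> (GrOm P k)). \<forall>\<alpha>\<in>\<rat>. x \<alpha> \<in> gr_image \<rat> (Om k) (newton_forms P k) \<alpha> (box_forms P u)}
      = carrier (direct_sum \<rat> (GrOm_box k))"
    using sub by (auto simp: direct_sum_def GrOm_box_def PiE_iff)
  then show ?thesis
    by (simp add: Om_bar_def) (simp add: direct_sum_def GrOm_box_def)
qed

lemma wt_inj: "inj (wt k)"
  by (auto simp: inj_def wt_def)

lemma dg_rational: "sr.dg m \<in> \<rat>"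
  unfolding sr.dg_def using degP_rational [of u] by simp

lemma wt_surj: "\<exists>\<alpha>\<in>\<rat>. wt k \<alpha> = sr.dg m"
  using dg_rational [of m] by (intro bexI [of _ "sr.dg m - of_int k + CARD('n)"]) (auto simp: wt_def)

text \<open>A polynomial form is the sum of its homogeneous components, one for each filtration
  index. All degrees are rational, so every component is seen by some index, and a form is in the
  kernel iff its coefficients are in the monomial ideal.\<close>

lemma presents_Om_bar:
  "presents (rB k) (form_scale Const) (forms k) (coeff_forms k sr.SRideal) (Om_bar P u k)"
proof -
  have "presents (\<lambda>\<rho>. \<lambda>\<alpha>\<in>\<rat>. rp k \<alpha> (hcf k \<alpha> \<rho>)) (form_scale Const) (forms k)
      {\<rho> \<in> forms k. \<forall>\<alpha>\<in>\<rat>. hcf k \<alpha> \<rho> \<in> coeff_forms k (sr.homog (wt k \<alpha>) \<inter> sr.SRideal)} (direct_sum \<rat> (GrOm_box k))"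
  proof (rule presents_direct_sum [OF presents_GrOm_box csubspace_forms form_scale_add])
    show "hcf k \<alpha> \<rho> \<in> coeff_forms k (sr.homog (wt k \<alpha>))" if "\<rho> \<in> forms k" for \<alpha> \<rho>
      using that sr.hc_homog by (auto simp: coeff_forms_def hcf_def forms_def linear_overD [OF keep_linear])
    show "finite {\<alpha> \<in> \<rat>. hcf k \<alpha> \<rho> \<noteq> 0}" for \<rho>
    proof (rule finite_subset)
      show "{\<alpha> \<in> \<rat>. hcf k \<alpha> \<rho> \<noteq> 0} \<subseteq> (\<Union>I. (\<lambda>m. sr.dg m - of_int k + CARD('n)) ` keys (\<rho> I))"
      proof
        fix \<alpha> assume "\<alpha> \<in> {\<alpha> \<in> \<rat>. hcf k \<alpha> \<rho> \<noteq> 0}"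
        then obtain I where "sr.hc (wt k \<alpha>) (\<rho> I) \<noteq> 0"
          by (auto simp: hcf_def fun_eq_iff)
        then obtain m where "m \<in> keys (sr.hc (wt k \<alpha>) (\<rho> I))"
          by (metis all_not_in_conv keys_eq_empty)
        then have "m \<in> keys (\<rho> I)" "\<alpha> = sr.dg m - of_int k + CARD('n)"
          by (auto simp: keys_keep wt_def)
        then show "\<alpha> \<in> (\<Union>I. (\<lambda>m. sr.dg m - of_int k + CARD('n)) ` keys (\<rho> I))"
          by blast
      qed
    qed simp
    fix y :: "real \<Rightarrow> ('n, (int, 'n) vec mpoly) form"
    assume y: "\<And>\<alpha>. \<alpha> \<in> \<rat> \<Longrightarrow> y \<alpha> \<in> coeff_forms k (sr.homog (wt k \<alpha>))" "finite {\<alpha> \<in> \<rat>. y \<alpha> \<noteq> 0}"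
    let ?E = "{\<alpha> \<in> \<rat>. y \<alpha> \<noteq> 0}"
    define \<rho> where "\<rho> I = (\<Sum>\<alpha>\<in>?E. y \<alpha> I)" for I
    have "hcf k \<beta> \<rho> = y \<beta>" if \<beta>: "\<beta> \<in> \<rat>" for \<beta>
    proof
      fix I
      \<comment> \<open>At irrational indices \<open>y\<close> is arbitrary; it is replaced by 0
        there so that it vanishes outside \<open>?E\<close>.\<close>
      have "sr.hc (wt k \<beta>) (\<Sum>\<alpha>\<in>?E. (if \<alpha> \<in> \<rat> then y \<alpha> I else 0)) = (if \<beta> \<in> \<rat> then y \<beta> I else 0)"
      proof (rule hc_sum_family [OF y(2) _ wt_inj])
        show "(if \<alpha> \<in> \<rat> then y \<alpha> I else 0) \<in> sr.homog (wt k \<alpha>)" if "\<alpha> \<in> ?E" for \<alpha>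
          using y(1) that by (simp add: coeff_forms_def)
      qed (auto simp: fun_eq_iff)
      then show "hcf k \<beta> \<rho> I = y \<beta> I"
        using \<beta> by (simp add: hcf_def \<rho>_def cong: sum.cong_simp)
    qed
    moreover have "\<rho> \<in> forms k"
      unfolding forms_def \<rho>_def mem_Collect_eq
    proof (intro allI impI sum.neutral ballI)
      fix I :: "'n set" and \<alpha> assume "int (card I) \<noteq> k" "\<alpha> \<in> ?E"
      then show "y \<alpha> I = 0"
        using y(1) [of \<alpha>] by (simp add: coeff_forms_def forms_def)
    qed
    ultimately show "\<exists>\<rho>\<in>forms k. \<forall>\<alpha>\<in>\<rat>. hcf k \<alpha> \<rho> = y \<alpha>"
      by blast
  qed (auto simp: hcf_def fun_eq_iff form_scale_def linear_overD [OF keep_linear])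
  moreover have "{\<rho> \<in> forms k. \<forall>\<alpha>\<in>\<rat>. hcf k \<alpha> \<rho> \<in> coeff_forms k (sr.homog (wt k \<alpha>) \<inter> sr.SRideal)}
      = coeff_forms k sr.SRideal"
  proof (intro antisym subsetI)
    fix \<rho> assume \<rho>: "\<rho> \<in> {\<rho> \<in> forms k. \<forall>\<alpha>\<in>\<rat>. hcf k \<alpha> \<rho> \<in> coeff_forms k (sr.homog (wt k \<alpha>) \<inter> sr.SRideal)}"
    have "\<rho> I \<in> sr.SRideal" for I
    proof (rule csubspace_hc [OF csubspace_with_keys])
      fix m
      obtain \<alpha> where \<alpha>: "\<alpha> \<in> \<rat>" "wt k \<alpha> = sr.dg m" using wt_surj by blast
      then have "hcf k \<alpha> \<rho> \<in> coeff_forms k (sr.homog (wt k \<alpha>) \<inter> sr.SRideal)"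
        using \<rho> by blast
      then show "sr.hc (sr.dg m) (\<rho> I) \<in> sr.SRideal"
        unfolding \<alpha>(2) [symmetric] by (simp add: coeff_forms_def hcf_def)
    qed
    then show "\<rho> \<in> coeff_forms k sr.SRideal"
      using \<rho> by (simp add: coeff_forms_def)
  next
    fix \<rho> :: "('n, (int, 'n) vec mpoly) form" assume \<rho>: "\<rho> \<in> coeff_forms k sr.SRideal"
    then show "\<rho> \<in> {\<rho> \<in> forms k. \<forall>\<alpha>\<in>\<rat>. hcf k \<alpha> \<rho> \<in> coeff_forms k (sr.homog (wt k \<alpha>) \<inter> sr.SRideal)}"
      using sr.hc_homog
      by (auto simp: coeff_forms_def hcf_def forms_def linear_overD [OF keep_linear])
         (auto simp: with_keys_def keys_keep)
  qed
  ultimately show ?thesis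
    by (simp add: rB_def [abs_def] Om_bar_eq)
qed

definition dJ :: "('n, (int, 'n) vec mpoly) form \<Rightarrow> ('n, (int, 'n) vec mpoly) form" where
  "dJ = ext_op (\<lambda>j p. - (sr.Lop (\<lambda>v. of_int (v $ j)) * p))"

lemma dJ_forms: "\<rho> \<in> forms k \<Longrightarrow> dJ \<rho> \<in> forms (k + 1)"
  unfolding dJ_def by (rule ext_op_forms) simp_all

lemma csubspace_filt_newton: "csubspace_of (form_scale const_L) (filt_below \<rat> (newton_forms P k) \<alpha>)"
  unfolding filt_below_newton by (rule csubspace_coeff_forms [OF csubspace_NP])

lemma filt_newton_forms: "filt_below \<rat> (newton_forms P k) \<alpha> \<subseteq> forms k"
  by (auto simp: filt_below_newton coeff_forms_def)

lemma d_bar_rp: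
  assumes \<rho>: "\<rho> \<in> coeff_forms k (sr.homog (wt k \<alpha>))"
  shows "induced (Om (k + 1)) (filt_below \<rat> (newton_forms P (k + 1)) \<alpha>)
      (\<lambda>\<omega> I. - df_wedge (laurent_f P a) \<omega> I) (rp k \<alpha> \<rho>) = rp (k + 1) \<alpha> (dJ \<rho>)"
  unfolding rp_def
proof (rule induced_gr_class)
  let ?T = "\<lambda>\<omega> I. - df_wedge (laurent_f P a) \<omega> I" and ?\<delta> = "\<lambda>j g. - (F (\<lambda>v. of_int (v $ j)) * g)"
  have T: "?T \<omega> = ext_op ?\<delta> \<omega>" for \<omega>
    by (simp add: df_wedge_def ext_op_def fun_eq_iff log_deriv_f sum_negf)
  have w: "wt (k + 1) \<alpha> = wt k \<alpha> + 1"
    by (simp add: wt_def)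
  have filt: "filt_below \<rat> (newton_forms P k) \<alpha> = coeff_forms k (NP (<) (wt k \<alpha>))" for k
    by (simp add: filt_below_newton wt_def)
  have rho: "\<rho> \<in> forms k" "\<And>I. \<rho> I \<in> sr.homog (wt k \<alpha>)"
    using \<rho> by (auto simp: coeff_forms_def)
  show "?T (x + y) = ?T x + ?T y" for x y
    unfolding T by (rule ext_op_add) (simp add: distrib_left)
  show "csubspace_of (form_scale const_L) (filt_below \<rat> (newton_forms P k) \<alpha>)"
    "csubspace_of (form_scale const_L) (filt_below \<rat> (newton_forms P (k + 1)) \<alpha>)"
    by (rule csubspace_filt_newton)+
  show "filt_below \<rat> (newton_forms P (k + 1)) \<alpha> \<subseteq> forms (k + 1)"
    by (rule filt_newton_forms)
  have \<delta>: "?\<delta> j x \<in> NP (<) (wt (k + 1) \<alpha>)" if "x \<in> NP (<) (wt k \<alpha>)" for j x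
    unfolding w using NP_F_mult [OF that] csubspaceD(5) [OF csubspace_NP] by blast
  show "?T l \<in> filt_below \<rat> (newton_forms P (k + 1)) \<alpha>" if l: "l \<in> filt_below \<rat> (newton_forms P k) \<alpha>" for l
  proof -
    have "ext_op ?\<delta> l \<in> forms (k + 1)"
      using l by (intro ext_op_forms) (auto simp: filt coeff_forms_def)
    moreover have "ext_op ?\<delta> l I \<in> NP (<) (wt (k + 1) \<alpha>)" for I
      by (rule ext_op_coeff [where G = "NP (<) (wt k \<alpha>)", OF _ \<delta> csubspace_NP])
         (use l in \<open>simp_all add: filt coeff_forms_def\<close>)
    ultimately show ?thesis
      unfolding T by (simp add: filt coeff_forms_def)
  qed
  show Qd: "(\<lambda>I. Q (dJ \<rho> I)) \<in> forms (k + 1)"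
    using dJ_forms [OF rho(1)] by (auto simp: forms_def linear_overD [OF Q_linear])
  have Qr: "ext_op ?\<delta> (\<lambda>I. Q (\<rho> I)) \<in> forms (k + 1)"
    using rho(1) by (intro ext_op_forms) (auto simp: forms_def linear_overD [OF Q_linear])
  have "ext_op ?\<delta> (\<lambda>I. Q (\<rho> I)) I - Q (dJ \<rho> I)
      = (\<Sum>j\<in>I. (- 1) ^ card {i \<in> I. i < j} * - (F (\<lambda>v. of_int (v $ j)) * Q (\<rho> (I - {j}))
          - Q (sr.Lop (\<lambda>v. of_int (v $ j)) * \<rho> (I - {j}))))" for I
  proof -
    have sgn: "Q ((- 1) ^ c * p) = (- 1) ^ c * Q p" for c p
      by (cases "even c") (simp_all add: linear_overD [OF Q_linear])
    show ?thesis
      unfolding dJ_def ext_op_def linear_over_sum [OF Q_linear] sgn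
      by (simp add: linear_overD [OF Q_linear] sum_subtractf [symmetric] right_diff_distrib)
  qed
  then have "(ext_op ?\<delta> (\<lambda>I. Q (\<rho> I)) - (\<lambda>I. Q (dJ \<rho> I))) I \<in> NP (<) (wt (k + 1) \<alpha>)" for I
    unfolding fun_diff_def w
    by (simp only:) (intro csubspace_sum [OF csubspace_NP] sign_mult_mem [OF csubspace_NP]
        csubspaceD(5) [OF csubspace_NP] Q_Lop_homog rho(2))
  moreover have "ext_op ?\<delta> (\<lambda>I. Q (\<rho> I)) - (\<lambda>I. Q (dJ \<rho> I)) \<in> forms (k + 1)"
    by (rule csubspaceD(2) [OF csubspace_forms Qr Qd])
  ultimately show "?T (\<lambda>I. Q (\<rho> I)) - (\<lambda>I. Q (dJ \<rho> I)) \<in> filt_below \<rat> (newton_forms P (k + 1)) \<alpha>"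
    unfolding T by (simp add: filt coeff_forms_def)
qed

lemma hcf_coeff: "\<rho> \<in> forms k \<Longrightarrow> hcf k \<alpha> \<rho> \<in> coeff_forms k (sr.homog (wt k \<alpha>))"
  using sr.hc_homog by (auto simp: coeff_forms_def hcf_def forms_def linear_overD [OF keep_linear])

text \<open>\<open>Lop\<close> raises the degree by one, and so does \<open>wt\<close> when
  \<open>k\<close> becomes \<open>k + 1\<close>, so the differential preserves the filtration
  index.\<close>

lemma d_bar_rB:
  assumes \<rho>: "\<rho> \<in> forms k"
  shows "d_bar P a k (rB k \<rho>) = rB (k + 1) (dJ \<rho>)"
proof -
  have hcf: "hcf (k + 1) \<alpha> (dJ \<rho>) = dJ (hcf k \<alpha> \<rho>)" for \<alpha>
  proof -
    have sgn: "sr.hc \<gamma> ((- 1) ^ c * p) = (- 1) ^ c * sr.hc \<gamma> p" for \<gamma> c p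
      by (cases "even c") (simp_all add: linear_overD [OF keep_linear])
    have w: "wt (k + 1) \<alpha> = wt k \<alpha> + 1"
      by (simp add: wt_def)
    show ?thesis
      unfolding hcf_def dJ_def ext_op_def linear_over_sum [OF keep_linear] sgn w linear_overD [OF keep_linear]
        sr.hc_Lop ..
  qed
  have "induced (Om (k + 1)) (filt_below \<rat> (newton_forms P (k + 1)) \<alpha>)
      (\<lambda>\<omega> I. - df_wedge (laurent_f P a) \<omega> I) (rp k \<alpha> (hcf k \<alpha> \<rho>)) = rp (k + 1) \<alpha> (hcf (k + 1) \<alpha> (dJ \<rho>))" for \<alpha>
    unfolding hcf by (rule d_bar_rp [OF hcf_coeff [OF \<rho>]])
  then show ?thesis
    by (simp add: d_bar_def rB_def cong: restrict_cong)
qed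

section \<open>Top forms and the cokernel J(u)\<close>

definition r2 :: "(int, 'n) vec mpoly \<Rightarrow> real \<Rightarrow> ('n, 'n laurent) form set" where
  "r2 p = (\<lambda>\<alpha>\<in>\<rat>. gr_class \<rat> (Om (int CARD('n))) (newton_forms P (int CARD('n))) \<alpha> (top_form (Q (sr.hc \<alpha> p))))"

lemma r2_eq: "rB (int CARD('n)) (top_form p) = r2 p"
proof -
  have "(\<lambda>I. Q (sr.hc \<alpha> (top_form p I))) = (top_form (Q (sr.hc \<alpha> p)) :: ('n, _) form)" for \<alpha>
    by (auto simp: top_form_def fun_eq_iff linear_overD [OF Q_linear] linear_overD [OF keep_linear])
  then show ?thesis
    by (simp add: rB_def r2_def rp_def hcf_def wt_def)
qed

lemma presents_r2: "presents r2 cscale UNIV sr.SRideal (Om_bar P u (int CARD('n)))"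
proof -
  have "presents (\<lambda>p. rB (int CARD('n)) (top_form p)) cscale UNIV
      {p \<in> UNIV. (top_form p :: ('n, _) form) \<in> coeff_forms (int CARD('n)) sr.SRideal} (Om_bar P u (int CARD('n)))"
  proof (rule presents_pullback [OF presents_Om_bar csubspace_UNIV cscale_add top_form_forms])
    fix \<omega> :: "('n, (int, 'n) vec mpoly) form" assume "\<omega> \<in> forms (int CARD('n))"
    then have "\<omega> - top_form (\<omega> UNIV) = 0" using forms_top [of \<omega>] by auto
    then show "\<exists>p\<in>UNIV. \<omega> - top_form p \<in> coeff_forms (int CARD('n)) sr.SRideal"
      using csubspaceD(1) [OF csubspace_coeff_Const [OF csubspace_with_keys]] by (metis UNIV_I)
  qed (simp_all add: top_form_add cscale_def top_form_scale)
  moreover have "{p \<in> UNIV. (top_form p :: ('n, (int, 'n) vec mpoly) form) \<in> coeff_forms (int CARD('n)) sr.SRideal} = sr.SRideal"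
    using top_form_forms csubspaceD(1) [OF csubspace_with_keys]
    by (auto simp: coeff_forms_def top_form_def split: if_splits)
  ultimately show ?thesis
    by (simp add: r2_eq)
qed

lemma coboundaries_JN: "coboundaries (Om_bar P u) (d_bar P a) (int CARD('n)) = r2 ` sr.KJ"
proof -
  have "coboundaries (Om_bar P u) (d_bar P a) (int CARD('n))
      = (\<lambda>\<rho>. d_bar P a (int CARD('n) - 1) (rB (int CARD('n) - 1) \<rho>)) ` forms (int CARD('n) - 1)"
    by (simp add: coboundaries_def presentsD(5) [OF presents_Om_bar] image_image)
  also have "\<dots> = (\<lambda>\<rho>. r2 (dJ \<rho> UNIV)) ` forms (int CARD('n) - 1)"
  proof (rule image_cong [OF refl])
    fix \<rho> :: "('n, (int, 'n) vec mpoly) form" assume \<rho>: "\<rho> \<in> forms (int CARD('n) - 1)"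
    then have "dJ \<rho> = top_form (dJ \<rho> UNIV)"
      using dJ_forms [OF \<rho>] forms_top [of "dJ \<rho>"] by simp
    then have "rB (int CARD('n)) (dJ \<rho>) = r2 (dJ \<rho> UNIV)"
      by (metis r2_eq)
    then show "d_bar P a (int CARD('n) - 1) (rB (int CARD('n) - 1) \<rho>) = r2 (dJ \<rho> UNIV)"
      using d_bar_rB [OF \<rho>] by simp
  qed
  also have "\<dots> = r2 ` sr.KJ"
    unfolding dJ_def
  proof (rule top_coboundaries [OF linear_over_mult _ presents_r2])
    show "p \<in> sr.KJ \<longleftrightarrow> (\<exists>g. p - (\<Sum>j\<in>UNIV. sr.Lop (\<lambda>v. of_int (v $ j)) * g j) \<in> sr.SRideal)" for p
      by (simp add: sr.KJ_def)
  qed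
  finally show ?thesis .
qed

definition rJ :: "(int, 'n) vec mpoly \<Rightarrow> (real \<Rightarrow> ('n, 'n laurent) form set) set" where
  "rJ p = JN_class P a u (r2 p)"

lemma presents_JN: "presents rJ cscale UNIV sr.KJ (JN P a u)"
proof -
  let ?n = "int CARD('n)"
  have "d_bar P a ?n x = \<zero>\<^bsub>Om_bar P u (?n + 1)\<^esub>" if x: "x \<in> carrier (Om_bar P u ?n)" for x
  proof -
    obtain \<rho> where \<rho>: "\<rho> \<in> forms ?n" "x = rB ?n \<rho>"
      using x unfolding presentsD(5) [OF presents_Om_bar] by (auto elim!: imageE)
    have "dJ \<rho> = (\<lambda>I. 0)"
      by (rule forms_above [OF dJ_forms [OF \<rho>(1)]])
    then have "dJ \<rho> = 0" by (simp add: zero_fun_def)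
    then have "d_bar P a ?n x = rB (?n + 1) 0"
      using d_bar_rB [OF \<rho>(1)] \<rho>(2) by (simp only:)
    then show ?thesis
      by (simp only: presentsD(6) [OF presents_Om_bar])
  qed
  then have "{x \<in> carrier (Om_bar P u ?n). d_bar P a ?n x = \<zero>\<^bsub>Om_bar P u (?n + 1)\<^esub>} = carrier (Om_bar P u ?n)"
    by blast
  then have "JN P a u = quotient_module (Om_bar P u ?n) (coboundaries (Om_bar P u) (d_bar P a) ?n)"
    by (simp add: JN_def cohomology_def)
  moreover have "rJ = (\<lambda>p. coboundaries (Om_bar P u) (d_bar P a) ?n +>\<^bsub>Om_bar P u ?n\<^esub> r2 p)"
    by (simp add: rJ_def [abs_def] JN_class_def)
  ultimately show ?thesis
    using presents_quotient [OF presents_r2 sr.csubspace_KJ sr.SRideal_KJ _ coboundaries_JN] by simp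
qed

text \<open>Here the form degree stays the same, so raising the polynomial degree by one moves the
  component at \<open>\<alpha> - 1\<close> to \<alpha>.\<close>

lemma f_bar_r2: "f_bar P a (int CARD('n)) (r2 p) = r2 (sr.Lop (\<lambda>_. 1) * p)"
proof -
  let ?n = "int CARD('n)"
  have "induced (Om ?n) (filt_below \<rat> (newton_forms P ?n) \<alpha>) (\<lambda>\<omega> I. laurent_f P a * \<omega> I)
        (gr_class \<rat> (Om ?n) (newton_forms P ?n) (\<alpha> - 1) (top_form (Q (sr.hc (\<alpha> - 1) p))))
      = gr_class \<rat> (Om ?n) (newton_forms P ?n) \<alpha> (top_form (Q (sr.hc \<alpha> (sr.Lop (\<lambda>_. 1) * p))))" for \<alpha>
  proof (rule induced_gr_class)
    have filt: "filt_below \<rat> (newton_forms P ?n) \<alpha> = coeff_forms ?n (NP (<) \<alpha>)" for \<alpha>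
      by (simp add: filt_below_newton)
    show "(\<lambda>I. laurent_f P a * (x + y) I) = (\<lambda>I. laurent_f P a * x I) + (\<lambda>I. laurent_f P a * y I)" for x y
      by (simp add: fun_eq_iff distrib_left)
    show "csubspace_of (form_scale const_L) (filt_below \<rat> (newton_forms P ?n) (\<alpha> - 1))"
      "csubspace_of (form_scale const_L) (filt_below \<rat> (newton_forms P ?n) \<alpha>)"
      by (rule csubspace_filt_newton)+
    show "filt_below \<rat> (newton_forms P ?n) \<alpha> \<subseteq> forms ?n"
      by (rule filt_newton_forms)
    show "(\<lambda>I. laurent_f P a * l I) \<in> filt_below \<rat> (newton_forms P ?n) \<alpha>"
      if "l \<in> filt_below \<rat> (newton_forms P ?n) (\<alpha> - 1)" for l
      using that NP_F_mult [of _ "(<)" "\<alpha> - 1" "\<lambda>_. 1"]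
      by (simp add: filt coeff_forms_def forms_def laurent_f_eq)
    show "(top_form (Q (sr.hc \<alpha> (sr.Lop (\<lambda>_. 1) * p))) :: ('n, _) form) \<in> forms ?n"
      by (rule top_form_forms)
    have "sr.hc \<alpha> (sr.Lop (\<lambda>_. 1) * p) = sr.Lop (\<lambda>_. 1) * sr.hc (\<alpha> - 1) p"
      using sr.hc_Lop [of "\<alpha> - 1"] by simp
    moreover have "F (\<lambda>_. 1) * Q (sr.hc (\<alpha> - 1) p) - Q (sr.Lop (\<lambda>_. 1) * sr.hc (\<alpha> - 1) p) \<in> NP (<) \<alpha>"
      using Q_Lop_homog [OF sr.hc_homog, of "\<lambda>_. 1" "\<alpha> - 1" p] by simp
    ultimately have "F (\<lambda>_. 1) * Q (sr.hc (\<alpha> - 1) p) - Q (sr.hc \<alpha> (sr.Lop (\<lambda>_. 1) * p)) \<in> NP (<) \<alpha>"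
      by simp
    then show "(\<lambda>I. laurent_f P a * top_form (Q (sr.hc (\<alpha> - 1) p)) I) - top_form (Q (sr.hc \<alpha> (sr.Lop (\<lambda>_. 1) * p)))
        \<in> filt_below \<rat> (newton_forms P ?n) \<alpha>"
      using csubspaceD(1) [OF csubspace_NP]
      by (auto simp: filt coeff_forms_def forms_def top_form_def laurent_f_eq)
  qed
  then show ?thesis
    by (simp add: f_bar_def r2_def cong: restrict_cong)
qed

lemma JN_f_rJ: "JN_f P a u (rJ p) = rJ (sr.Lop (\<lambda>_. 1) * p)"
proof -
  let ?n = "int CARD('n)"
  have cos: "rJ p = r2 ` {y. y - p \<in> sr.KJ}" for p
    using coset_image [OF presents_r2 sr.csubspace_KJ] by (simp add: rJ_def JN_class_def coboundaries_JN)
  have "JN_f P a u (rJ p) = coboundaries (Om_bar P u) (d_bar P a) ?n +>\<^bsub>Om_bar P u ?n\<^esub> r2 (sr.Lop (\<lambda>_. 1) * p)"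
    unfolding JN_f_def
  proof (rule induced_eq [OF presents_r2 sr.csubspace_KJ sr.SRideal_KJ subset_UNIV coboundaries_JN])
    show "rJ p \<noteq> {}"
      unfolding cos using csubspaceD(1) [OF sr.csubspace_KJ] by (auto intro: exI [of _ p])
    fix z assume "z \<in> rJ p"
    then obtain y where y: "z = r2 y" "y - p \<in> sr.KJ" unfolding cos by blast
    have "sr.Lop (\<lambda>_. 1) * y - sr.Lop (\<lambda>_. 1) * p \<in> sr.KJ"
      using sr.KJ_mult [OF y(2), of "sr.Lop (\<lambda>_. 1)"] by (simp add: right_diff_distrib)
    then show "\<exists>x\<in>UNIV. f_bar P a ?n z = r2 x \<and> x - sr.Lop (\<lambda>_. 1) * p \<in> sr.KJ"
      using y(1) f_bar_r2 by blast
  qed simp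
  then show ?thesis by (simp add: rJ_def JN_class_def)
qed

lemma gr_class_zero: "gr_class \<rat> (Om k) (newton_forms P k) \<alpha> 0 = \<zero>\<^bsub>GrOm P k \<alpha>\<^esub>"
proof -
  have "rp k \<alpha> 0 = \<zero>\<^bsub>GrOm_box k \<alpha>\<^esub>"
    by (rule presentsD(6) [OF presents_GrOm_box])
  then show ?thesis
    by (simp add: rp_def GrOm_box_def linear_overD [OF Q_linear] zero_fun_def)
qed

text \<open>Intersecting with the box piece turns a component of the full direct sum into one of the
  direct sum of box pieces, where representatives can be chosen homogeneous.\<close>

lemma JN_graded_eq:
  assumes \<alpha>: "\<alpha> \<in> \<rat>"
  shows "JN_graded P a u \<alpha> = rJ ` sr.homog \<alpha>"
proof -
  let ?n = "int CARD('n)"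
  let ?r = "\<lambda>\<alpha> p. gr_class \<rat> (Om ?n) (newton_forms P ?n) \<alpha> (top_form (Q p))"
  have top0: "(top_form 0 :: ('n, 'n laurent) form) = 0"
    by (auto simp: top_form_def fun_eq_iff)
  have "carrier (Om_bar P u ?n) \<inter> dsum_component \<rat> (GrOm P ?n) \<alpha> = dsum_component \<rat> (GrOm_box ?n) \<alpha>"
  proof -
    have "carrier (Om_bar P u ?n) \<subseteq> carrier (direct_sum \<rat> (GrOm P ?n))"
      by (auto simp: Om_bar_def)
    then show ?thesis
      unfolding dsum_component_def Om_bar_eq by (auto simp: GrOm_box_def)
  qed
  moreover have "dsum_component \<rat> (GrOm_box ?n) \<alpha>
      = (\<lambda>x. \<lambda>\<alpha>\<in>\<rat>. ?r \<alpha> (sr.hc \<alpha> x)) ` {x \<in> UNIV. \<forall>i\<in>\<rat> - {\<alpha>}. sr.hc i x = 0}"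
  proof (rule dsum_component_presents)
    show "presents (\<lambda>x. \<lambda>\<alpha>\<in>\<rat>. ?r \<alpha> (sr.hc \<alpha> x)) cscale UNIV sr.SRideal (direct_sum \<rat> (GrOm_box ?n))"
      using presents_r2 by (simp add: r2_def [abs_def] Om_bar_eq)
    show "?r i 0 = \<zero>\<^bsub>GrOm_box ?n i\<^esub>" for i
      using gr_class_zero [of ?n i] by (simp add: linear_overD [OF Q_linear] top0 GrOm_box_def)
    show "\<exists>x'\<in>UNIV. \<forall>i\<in>\<rat>. sr.hc i x' = (if i = \<alpha> then sr.hc i x else 0)" for x
      using sr.homog_hc [OF sr.hc_homog [of \<alpha> x]] by (intro bexI [of _ "sr.hc \<alpha> x"]) auto
  qed
  moreover have "{x \<in> UNIV. \<forall>i\<in>\<rat> - {\<alpha>}. sr.hc i x = 0} = sr.homog \<alpha>"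
  proof (intro antisym subsetI)
    fix x assume x: "x \<in> {x \<in> UNIV. \<forall>i\<in>\<rat> - {\<alpha>}. sr.hc i x = 0}"
    show "x \<in> sr.homog \<alpha>"
    proof (rule csubspace_hc [OF csubspace_with_keys])
      fix m
      show "sr.hc (sr.dg m) x \<in> sr.homog \<alpha>"
        using x sr.hc_homog [of \<alpha> x] csubspaceD(1) [OF csubspace_with_keys] dg_rational [of m]
        by (cases "sr.dg m = \<alpha>") auto
    qed
  next
    fix x assume "x \<in> sr.homog \<alpha>"
    from sr.homog_hc [OF this] show "x \<in> {x \<in> UNIV. \<forall>i\<in>\<rat> - {\<alpha>}. sr.hc i x = 0}"
      by simp
  qed
  ultimately have "carrier (Om_bar P u ?n) \<inter> dsum_component \<rat> (GrOm P ?n) \<alpha> = r2 ` sr.homog \<alpha>"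
    by (simp add: r2_def [abs_def])
  then show ?thesis
    by (simp add: JN_graded_def rJ_def [abs_def] image_image)
qed

lemma JN_monom_eq:
  assumes m: "sr.adm m"
  shows "JN_monom P a u (pt m) = rJ (Const (1 / am m) * Mon m)"
proof -
  let ?x = "Const (1 / am m) * Mon m" and ?n = "int CARD('n)"
  have top0: "(top_form 0 :: ('n, 'n laurent) form) = 0"
    by (auto simp: top_form_def fun_eq_iff)
  have Qx: "Q ?x = Poly_Mapping.single (pt m) 1"
    using m am_nonzero [OF m] by (simp only: linear_overD [OF Q_linear] Q_Mon) (simp add: const_L_def mult_single)
  have x: "?x \<in> sr.homog (sr.dg m)"
    using m keys_Const_mult [of "1 / am m" "Mon m"] by (auto simp: with_keys_def)
  have "dsum_single \<rat> (GrOm P ?n) (sr.dg m) (gr_class \<rat> (Om ?n) (newton_forms P ?n) (sr.dg m) (top_form (Q ?x)))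
      = r2 ?x"
  proof
    fix \<alpha>
    show "dsum_single \<rat> (GrOm P ?n) (sr.dg m) (gr_class \<rat> (Om ?n) (newton_forms P ?n) (sr.dg m) (top_form (Q ?x))) \<alpha>
        = r2 ?x \<alpha>"
      using gr_class_zero [of ?n \<alpha>]
      by (cases "\<alpha> \<in> \<rat>") (auto simp: dsum_single_def r2_def sr.homog_hc [OF x] linear_overD [OF Q_linear] top0)
  qed
  then show ?thesis
    by (simp add: JN_monom_def rJ_def pt_degP [OF m] Qx)
qed

end

section \<open>Conewise polynomials as a Stanley--Reisner ring\<close>

text \<open>Induction on the variables: with the others fixed, a polynomial in one variable that
  vanishes at all natural numbers has zero coefficients. The conclusion sums over all monomials with
  the same exponents on \<open>T\<close>, since evaluation does not distinguish them.\<close>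

lemma monomials_independent:
  fixes c :: "('v \<Rightarrow>\<^sub>0 nat) \<Rightarrow> complex"
  assumes "finite T" "finite K" "\<And>y :: 'v \<Rightarrow> nat. (\<Sum>m\<in>K. c m * (\<Prod>v\<in>T. of_nat (y v) ^ lookup m v)) = 0"
  shows "(\<Sum>m\<in>{m \<in> K. \<forall>v\<in>T. lookup m v = e v}. c m) = 0"
  using assms
proof (induction T arbitrary: K rule: finite_induct)
  case empty
  then show ?case by simp
next
  case (insert v T)
  define h where "h y m = c m * (\<Prod>v\<in>T. of_nat (y v) ^ lookup m v)" for y :: "'v \<Rightarrow> nat" and m
  define g where "g y k = (\<Sum>m\<in>{m \<in> K. lookup m v = k}. h y m)" for y k
  \<comment> \<open>Including \<open>e v\<close> makes it a legitimate index of the one-variable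
    polynomial even if no monomial of \<open>K\<close> has that exponent.\<close>
  define B where "B = Max (insert (e v) ((\<lambda>m. lookup m v) ` K))"
  have B: "lookup m v \<le> B" if "m \<in> K" for m
    unfolding B_def using that insert.prems(1) by (intro Max_ge) auto
  have zero: "(\<Sum>k\<le>B. g y k * of_nat n ^ k) = 0" for y n
  proof -
    have off: "(\<Prod>w\<in>T. complex_of_nat ((y(v := n)) w) ^ lookup m w) = (\<Prod>w\<in>T. of_nat (y w) ^ lookup m w)" for m
      using insert.hyps(2) by (intro prod.cong) auto
    have "(\<Prod>w\<in>insert v T. complex_of_nat ((y(v := n)) w) ^ lookup m w)
        = of_nat n ^ lookup m v * (\<Prod>w\<in>T. of_nat (y w) ^ lookup m w)" for m
      unfolding prod.insert [OF insert.hyps] off by simp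
    then have "(\<Sum>m\<in>K. h y m * of_nat n ^ lookup m v)
        = (\<Sum>m\<in>K. c m * (\<Prod>w\<in>insert v T. of_nat ((y(v := n)) w) ^ lookup m w))"
      by (intro sum.cong refl) (simp add: h_def mult_ac del: fun_upd_apply)
    also have "\<dots> = 0"
      by (rule insert.prems(2))
    finally have "(\<Sum>m\<in>K. h y m * of_nat n ^ lookup m v) = 0" .
    moreover have "(\<Sum>m\<in>K. h y m * of_nat n ^ lookup m v)
        = (\<Sum>k\<le>B. \<Sum>m\<in>{m \<in> K. lookup m v = k}. h y m * of_nat n ^ lookup m v)"
      using insert.prems(1) B by (intro sum.group [symmetric]) auto
    ultimately show ?thesis
      by (simp add: g_def sum_distrib_right)
  qed
  have "g y (e v) = 0" for y
  proof (rule ccontr)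
    assume "g y (e v) \<noteq> 0"
    then have "finite {z :: complex. (\<Sum>k\<le>B. g y k * z ^ k) = 0}"
      using Transcendental.polyfun_rootbound [where c = "g y" and k = "e v" and n = B] by (simp add: B_def insert.prems(1))
    moreover have "range (of_nat :: nat \<Rightarrow> complex) \<subseteq> {z. (\<Sum>k\<le>B. g y k * z ^ k) = 0}"
      using zero by auto
    ultimately have "finite (range (of_nat :: nat \<Rightarrow> complex))"
      by (rule rev_finite_subset)
    then show False
      using finite_imageD [of "of_nat :: nat \<Rightarrow> complex" UNIV] by (simp add: inj_of_nat)
  qed
  then have "(\<Sum>m\<in>{m \<in> {m \<in> K. lookup m v = e v}. \<forall>v\<in>T. lookup m v = e v}. c m) = 0"
    using insert.prems(1) by (intro insert.IH) (auto simp: g_def h_def)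
  moreover have "{m \<in> {m \<in> K. lookup m v = e v}. \<forall>v\<in>T. lookup m v = e v}
      = {m \<in> K. \<forall>v\<in>insert v T. lookup m v = e v}"
    by auto
  ultimately show ?case by simp
qed

section \<open>Evaluation of polynomials in the vertex variables\<close>

definition mon_eval :: "('v \<Rightarrow> 'c::comm_ring_1) \<Rightarrow> ('v \<Rightarrow>\<^sub>0 nat) \<Rightarrow> 'c" where
  "mon_eval y m = (\<Prod>v\<in>keys m. y v ^ lookup m v)"

lemma mon_eval_superset: "finite A \<Longrightarrow> keys m \<subseteq> A \<Longrightarrow> mon_eval y m = (\<Prod>v\<in>A. y v ^ lookup m v)"
  unfolding mon_eval_def by (intro prod.mono_neutral_left) (auto simp: in_keys_iff)

lemma mon_eval_add: "mon_eval y (m + m') = mon_eval y m * mon_eval y m'"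
proof -
  have "mon_eval y (m + m') = (\<Prod>v\<in>keys m \<union> keys m'. y v ^ lookup (m + m') v)"
    by (rule mon_eval_superset) (auto simp: keys_add_nat)
  also have "\<dots> = (\<Prod>v\<in>keys m \<union> keys m'. y v ^ lookup m v) * (\<Prod>v\<in>keys m \<union> keys m'. y v ^ lookup m' v)"
    by (simp add: lookup_add power_add prod.distrib)
  also have "\<dots> = mon_eval y m * mon_eval y m'"
    using mon_eval_superset [of "keys m \<union> keys m'" _ y] by simp
  finally show ?thesis .
qed

lemma mon_eval_zero [simp]: "mon_eval y 0 = 1"
  by (simp add: mon_eval_def)

lemma mon_eval_single [simp]: "mon_eval y (Poly_Mapping.single v 1) = y v"
  by (simp add: mon_eval_def)

definition evp :: "('v \<Rightarrow> complex) \<Rightarrow> 'v mpoly \<Rightarrow> complex" where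
  "evp y = lin (\<lambda>c. c) (mon_eval y)"

lemma evp_linear: "linear_over (\<lambda>c. c) (evp y)"
  unfolding evp_def by (rule lin_linear [OF scalar_hom_id])

lemma evp_mult: "evp y (p * q) = evp y p * evp y q"
  unfolding evp_def by (rule lin_mult [OF scalar_hom_id]) (rule mon_eval_add)

lemma evp_Mon: "evp y (Mon m) = mon_eval y m"
  by (simp add: evp_def lin_Mon [OF scalar_hom_id])

lemma evp_one: "evp y 1 = 1"
  using evp_Mon [of y 0] by simp

lemma peval_eq: "peval p x = lin (\<lambda>c. c) (\<lambda>m. \<Prod>i\<in>UNIV. complex_of_real (x $ i) ^ (m $ i)) p"
  by (simp add: peval_def lin_def)

lemma peval_linear: "linear_over (\<lambda>c. c) (\<lambda>p. peval p x)"
  unfolding peval_eq by (rule lin_linear [OF scalar_hom_id])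

lemma peval_mult: "peval (p * q) x = peval p x * peval q x"
  unfolding peval_eq by (rule lin_mult [OF scalar_hom_id]) (simp add: power_add prod.distrib)

lemma peval_one: "peval 1 x = 1"
  by (simp add: peval_def)

lemma peval_axis: "peval (Mon (axis i 1)) x = complex_of_real (x $ i)"
proof -
  have "peval (Mon (axis i 1)) x = (\<Prod>j\<in>UNIV. if j = i then complex_of_real (x $ i) else 1)"
    unfolding peval_eq lin_Mon [OF scalar_hom_id] by (rule prod.cong) (auto simp: axis_def)
  then show ?thesis by simp
qed

lemma hom_prod_power:
  assumes "\<And>p q. E (p * q) = E p * E q" "E 1 = 1"
  shows "E (\<Prod>v\<in>A. L v ^ k v) = (\<Prod>v\<in>A. (E (L v) :: complex) ^ k v)"
proof -
  have pow: "E (x ^ n) = E x ^ n" for x n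
    by (induction n) (auto simp: assms)
  show ?thesis
    by (induction A rule: infinite_finite_induct) (auto simp: assms pow)
qed

lemma with_keys_Const_mult: "p \<in> with_keys Q \<Longrightarrow> Const c * p \<in> with_keys Q"
  for p :: "'m::comm_monoid_add \<Rightarrow>\<^sub>0 complex"
  using keys_Const_mult [of c p] by (auto simp: with_keys_def)

lemma with_keys_mult:
  fixes \<omega> :: "'m::comm_monoid_add \<Rightarrow> int"
  assumes "\<And>m m'. \<omega> (m + m') = \<omega> m + \<omega> m'"
    and "p \<in> with_keys (\<lambda>m. \<omega> m = k)" "q \<in> with_keys (\<lambda>m. \<omega> m = l)"
  shows "p * q \<in> with_keys (\<lambda>m. \<omega> m = k + l)"
  using keys_mult [of p q] assms by (fastforce simp: with_keys_def)

lemma with_keys_prod_power: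
  fixes \<omega> :: "'m::comm_monoid_add \<Rightarrow> int"
  assumes \<omega>: "\<And>m m'. \<omega> (m + m') = \<omega> m + \<omega> m'"
    and L: "\<And>v. L v \<in> with_keys (\<lambda>m. \<omega> m = 1)" and A: "finite A"
  shows "(\<Prod>v\<in>A. L v ^ e v) \<in> with_keys (\<lambda>m. \<omega> m = (\<Sum>v\<in>A. int (e v)))"
proof -
  have \<omega>0: "\<omega> 0 = 0" using \<omega> [of 0 0] by simp
  have pow: "L v ^ n \<in> with_keys (\<lambda>m. \<omega> m = int n)" for v n
  proof (induction n)
    case (Suc n)
    then show ?case using with_keys_mult [OF \<omega> L Suc] by simp
  qed (simp add: with_keys_def \<omega>0)
  show ?thesis
    using A
  proof induction
    case (insert v A)
    then show ?case using with_keys_mult [OF \<omega> pow insert.IH] by simp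
  qed (simp add: with_keys_def \<omega>0)
qed

lemma homogeneous_iff: "homogeneous k p \<longleftrightarrow> p \<in> with_keys (\<lambda>m. (\<Sum>i\<in>UNIV. int (m $ i)) = k)"
  by (simp add: homogeneous_def with_keys_def)

context box_piece
begin

definition St :: "(int, 'n) vec set set" where
  "St = {T. T \<union> lsupp (emb u) \<in> \<Delta>}"

abbreviation "\<Sigma>u \<equiv> star_fan P u"

lemma adm_St: "sr.adm m \<longleftrightarrow> keys m \<in> St"
  by (simp add: St_def sr.adm_def sr_S)

lemma St_\<Delta>: "T \<in> St \<Longrightarrow> T \<in> \<Delta>"
  unfolding St_def using \<Delta>_mono by blast

lemma St_mono: "T \<in> St \<Longrightarrow> T' \<subseteq> T \<Longrightarrow> T' \<in> St"
  unfolding St_def using \<Delta>_mono [of "T \<union> lsupp (emb u)"] by blast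

lemma finite_St: "finite St"
  by (rule finite_subset [of _ "Pow V"]) (use St_\<Delta> \<Delta>_subset finite_V in auto)

lemma star_St: "\<Sigma>u = cone_of ` St"
  by (simp add: star_fan_eq St_def)

lemma supp_star: "x \<in> supp \<Sigma>u \<longleftrightarrow> x \<in> NQ \<and> lsupp x \<in> St"
proof
  assume "x \<in> supp \<Sigma>u"
  then obtain T where "T \<in> St" "lsupp x \<subseteq> T" "x \<in> NQ"
    by (auto simp: supp_def star_St cone_of_def)
  then show "x \<in> NQ \<and> lsupp x \<in> St"
    using St_mono [of T "lsupp x"] by simp
next
  assume "x \<in> NQ \<and> lsupp x \<in> St"
  then show "x \<in> supp \<Sigma>u"
    by (auto simp: supp_def star_St cone_of_def intro!: bexI [of _ "lsupp x"])
qed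

definition lamc :: "(real, 'n) vec \<Rightarrow> (int, 'n) vec \<Rightarrow> complex" where
  "lamc x v = complex_of_real (lam x v)"

text \<open>The ring map from polynomials onto the conewise polynomials of the star; its kernel is
  the monomial ideal, see \<open>carrier_cpoly\<close> and \<open>ev_zero_iff\<close>.\<close>

definition ev :: "(int, 'n) vec mpoly \<Rightarrow> (real, 'n) vec \<Rightarrow> complex" where
  "ev p = (\<lambda>x\<in>supp \<Sigma>u. evp (lamc x) p)"

lemma evp_cone:
  assumes "lsupp x \<subseteq> T"
  shows "evp (lamc x) p = (\<Sum>m\<in>{m \<in> keys p. keys m \<subseteq> T}. lookup p m * mon_eval (lamc x) m)"
proof -
  have "mon_eval (lamc x) m = 0" if m: "\<not> keys m \<subseteq> T" for m
  proof -
    obtain v where "v \<in> keys m" "v \<notin> T" using m by blast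
    moreover from this have "lamc x v = 0"
      using assms by (auto simp: lsupp_def lamc_def)
    ultimately show ?thesis
      unfolding mon_eval_def by (intro prod_zero) (auto simp: in_keys_iff intro!: bexI [of _ v])
  qed
  then show ?thesis
    unfolding evp_def lin_def by (intro sum.mono_neutral_right) auto
qed

lemma comb_NQ: "comb (\<lambda>v. real (y v)) \<in> NQ"
  unfolding NQ_def comb_def by (auto simp: emb_nth intro!: Rats_sum)

text \<open>The combinations of the generators with arbitrary natural coefficients are rational
  points of the cone, and they suffice to separate the monomials supported on
  \<open>T\<close>.\<close>

lemma evp_cone_unique:
  assumes T: "T \<in> \<Delta>" and eq: "\<And>x. x \<in> cone_of T \<Longrightarrow> x \<in> NQ \<Longrightarrow> evp (lamc x) p = evp (lamc x) q"
    and m: "keys m \<subseteq> T"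
  shows "lookup p m = lookup q m"
proof -
  define r where "r = p - q"
  let ?K = "{k \<in> keys r. keys k \<subseteq> T}"
  have fT: "finite T" using \<Delta>_finite [OF T] .
  have zero: "(\<Sum>k\<in>?K. lookup r k * (\<Prod>v\<in>T. of_nat (y v) ^ lookup k v)) = 0" for y :: "(int, 'n) vec \<Rightarrow> nat"
  proof -
    \<comment> \<open>\<open>y\<close> may be nonzero off \<open>T\<close>, where a point of the
      cone has coordinate 0.\<close>
    define y' where "y' v = (if v \<in> T then y v else 0)" for v
    define x where "x = comb (\<lambda>v. real (y' v))"
    have "supported (\<lambda>v. real (y' v))"
      by (rule supported_subset [OF _ _ T]) (auto simp: y'_def)
    then have lx: "lam x = (\<lambda>v. real (y' v))"
      by (intro lam_eqI) (simp_all add: x_def)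
    then have xT: "lsupp x \<subseteq> T"
      by (auto simp: lsupp_def y'_def)
    have "evp (lamc x) r = 0"
      using eq [of x] xT comb_NQ [of y'] by (simp add: cone_of_def r_def linear_overD [OF evp_linear] x_def)
    then have "(\<Sum>k\<in>?K. lookup r k * mon_eval (lamc x) k) = 0"
      using evp_cone [OF xT, of r] by simp
    moreover have "mon_eval (lamc x) k = (\<Prod>v\<in>T. of_nat (y v) ^ lookup k v)" if "k \<in> ?K" for k
      using that fT by (subst mon_eval_superset [of T]) (auto simp: lamc_def lx y'_def intro!: prod.cong)
    ultimately show ?thesis by simp
  qed
  have "(\<Sum>k\<in>{k \<in> ?K. \<forall>v\<in>T. lookup k v = lookup m v}. lookup r k) = 0"
    by (rule monomials_independent [OF fT _ zero]) simp
  moreover have "{k \<in> ?K. \<forall>v\<in>T. lookup k v = lookup m v} = (if m \<in> keys r then {m} else {})"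
  proof -
    have "k = m" if "keys k \<subseteq> T" "\<forall>v\<in>T. lookup k v = lookup m v" for k
    proof (rule poly_mapping_eqI)
      fix v show "lookup k v = lookup m v"
      proof (cases "v \<in> T")
        case False
        then have "v \<notin> keys k" "v \<notin> keys m" using that(1) m by blast+
        then show ?thesis by (simp add: in_keys_iff)
      qed (use that(2) in blast)
    qed
    then have "{k \<in> ?K. \<forall>v\<in>T. lookup k v = lookup m v} = {k \<in> keys r. k = m}"
      using m by blast
    also have "\<dots> = (if m \<in> keys r then {m} else {})"
      by auto
    finally show ?thesis .
  qed
  ultimately have "lookup r m = 0"
    by (auto simp: in_keys_iff split: if_splits)
  then show ?thesis by (simp add: r_def lookup_minus)
qed

lemma evp_cone_cong:
  assumes "lsupp x \<subseteq> T" "\<And>m. keys m \<subseteq> T \<Longrightarrow> lookup p m = lookup q m"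
  shows "evp (lamc x) p = evp (lamc x) q"
proof -
  have "{m \<in> keys p. keys m \<subseteq> T} = {m \<in> keys q. keys m \<subseteq> T}"
    using assms(2) by (auto simp: in_keys_iff)
  then show ?thesis
    unfolding evp_cone [OF assms(1)] using assms(2) by (intro sum.cong) auto
qed

text \<open>The coefficient of an admissible monomial is determined by the values on the cone over
  its support, which belongs to the star. Conversely, at a point of the star only monomials
  supported on its cone contribute, and these are admissible.\<close>

lemma ev_zero_iff: "ev p = ev q \<longleftrightarrow> p - q \<in> sr.SRideal"
proof
  assume eq: "ev p = ev q"
  show "p - q \<in> sr.SRideal"
    unfolding with_keys_def mem_Collect_eq
  proof (intro ballI notI)
    fix m assume m: "m \<in> keys (p - q)" "sr.adm m"
    then have T: "keys m \<in> St" by (simp add: adm_St)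
    have "lookup p m = lookup q m"
    proof (rule evp_cone_unique [OF St_\<Delta> [OF T] _ order_refl])
      fix x assume "x \<in> cone_of (keys m)" "x \<in> NQ"
      then have "x \<in> supp \<Sigma>u"
        using St_mono [OF T, of "lsupp x"] by (simp add: supp_star cone_of_def)
      then show "evp (lamc x) p = evp (lamc x) q"
        using fun_cong [OF eq, of x] by (simp add: ev_def)
    qed
    then show False using m(1) by (simp add: in_keys_iff lookup_minus)
  qed
next
  assume pq: "p - q \<in> sr.SRideal"
  show "ev p = ev q"
  proof
    fix x
    show "ev p x = ev q x"
    proof (cases "x \<in> supp \<Sigma>u")
      case True
      have "lookup p m = lookup q m" if "keys m \<subseteq> lsupp x" for m
      proof (rule ccontr)
        assume "lookup p m \<noteq> lookup q m"
        then have "m \<in> keys (p - q)" by (simp add: in_keys_iff lookup_minus)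
        moreover have "sr.adm m"
          using True St_mono [OF _ that] by (simp add: supp_star adm_St)
        ultimately show False using pq by (simp add: with_keys_def)
      qed
      from evp_cone_cong [OF order_refl this] show ?thesis
        using True by (simp add: ev_def)
    qed (simp add: ev_def)
  qed
qed

text \<open>On each cone the Courant functions restrict to linear forms. Substituting these for the
  variables gives the polynomial piece and preserves degrees.\<close>

lemma conewise_ev:
  "ev p \<in> conewise (\<lambda>_. True) \<Sigma>u"
  "p \<in> with_keys (\<lambda>m. int (tot m) = k) \<Longrightarrow> ev p \<in> conewise (homogeneous k) \<Sigma>u"
proof -
  have pieces: "\<exists>q. (p \<in> with_keys (\<lambda>m. int (tot m) = k) \<longrightarrow> homogeneous k q) \<and> (\<forall>x\<in>cone_of T \<inter> NQ. ev p x = peval q x)"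
    if T: "T \<in> St" for T k
  proof -
    have "\<forall>v. \<exists>b. \<forall>x\<in>cone_of T. lam x v = (\<Sum>i\<in>UNIV. b $ i * x $ i)"
      using lam_linear_on_cone [OF St_\<Delta> [OF T]] by blast
    then obtain b where b: "\<And>v x. x \<in> cone_of T \<Longrightarrow> lam x v = (\<Sum>i\<in>UNIV. b v $ i * x $ i)"
      by metis
    define L :: "(int, 'n) vec \<Rightarrow> (nat, 'n) vec \<Rightarrow>\<^sub>0 complex"
      where "L v = (\<Sum>i\<in>UNIV. Const (complex_of_real (b v $ i)) * Mon (axis i 1))" for v
    define q where "q = lin Const (\<lambda>m. \<Prod>v\<in>keys m. L v ^ lookup m v) p"
    have L: "peval (L v) x = lamc x v" if "x \<in> cone_of T" for v x
      unfolding L_def linear_over_sum [OF peval_linear] linear_overD [OF peval_linear] peval_axis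
      by (simp add: lamc_def b [OF that])
    have "peval q x = evp (lamc x) p" if x: "x \<in> cone_of T" for x
      unfolding q_def
    proof (rule linear_over_eqI [where p = p, OF _ evp_linear])
      show "linear_over (\<lambda>c. c) (\<lambda>p. peval (lin Const (\<lambda>m. \<Prod>v\<in>keys m. L v ^ lookup m v) p) x)"
        by (rule linear_over_comp [OF peval_linear lin_linear [OF scalar_hom_Const]])
      show "peval (lin Const (\<lambda>m. \<Prod>v\<in>keys m. L v ^ lookup m v) (Mon m)) x = evp (lamc x) (Mon m)" for m
        unfolding lin_Mon [OF scalar_hom_Const] evp_Mon mon_eval_def
        by (simp add: hom_prod_power [where E = "\<lambda>p. peval p x", OF peval_mult peval_one] L [OF x])
    qed
    moreover have "x \<in> supp \<Sigma>u" if "x \<in> cone_of T" "x \<in> NQ" for x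
      using that St_mono [OF T, of "lsupp x"] by (simp add: supp_star cone_of_def)
    ultimately have "\<forall>x\<in>cone_of T \<inter> NQ. ev p x = peval q x"
      by (simp add: ev_def)
    moreover have "homogeneous k q" if p: "p \<in> with_keys (\<lambda>m. int (tot m) = k)"
    proof -
      define \<omega> :: "(nat, 'n) vec \<Rightarrow> int" where "\<omega> m = (\<Sum>i\<in>UNIV. int (m $ i))" for m
      have \<omega>: "\<omega> (m + m') = \<omega> m + \<omega> m'" for m m'
        by (simp add: \<omega>_def sum.distrib)
      have "\<omega> (axis i 1) = 1" for i
      proof -
        have "\<omega> (axis i 1) = (\<Sum>j\<in>UNIV. if j = i then 1 else 0)"
          unfolding \<omega>_def by (rule sum.cong) (auto simp: axis_def)
        then show ?thesis by simp
      qed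
      then have "Mon (axis i 1) \<in> with_keys (\<lambda>m. \<omega> m = 1)" for i
        by (simp add: with_keys_def)
      then have L1: "L v \<in> with_keys (\<lambda>m. \<omega> m = 1)" for v
        unfolding L_def by (intro csubspace_sum [OF csubspace_with_keys] with_keys_Const_mult)
      have "q \<in> with_keys (\<lambda>m. \<omega> m = k)"
        unfolding q_def
      proof (rule linear_over_mem [OF lin_linear [OF scalar_hom_Const] csubspace_with_keys])
        fix m assume "m \<in> keys p"
        then have "int (tot m) = k" using p by (simp add: with_keys_def)
        then have "(\<Sum>v\<in>keys m. int (lookup m v)) = k"
          by (simp add: tot_def)
        then show "lin Const (\<lambda>m. \<Prod>v\<in>keys m. L v ^ lookup m v) (Mon m) \<in> with_keys (\<lambda>m. \<omega> m = k)"
          using with_keys_prod_power [where A = "keys m" and e = "lookup m", OF \<omega> L1 finite_keys]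
          by (simp add: lin_Mon [OF scalar_hom_Const])
      qed
      then show ?thesis by (simp add: homogeneous_iff \<omega>_def)
    qed
    ultimately show ?thesis by blast
  qed
  have ext: "ev p \<in> extensional (supp \<Sigma>u)"
    by (simp add: ev_def)
  have cone: "\<exists>T\<in>St. \<sigma> = cone_of T" if "\<sigma> \<in> \<Sigma>u" for \<sigma>
    using that star_St by blast
  show "ev p \<in> conewise (\<lambda>_. True) \<Sigma>u"
    unfolding conewise_def mem_Collect_eq
  proof (intro conjI ext ballI)
    fix \<sigma> assume "\<sigma> \<in> \<Sigma>u"
    then obtain T where "T \<in> St" "\<sigma> = cone_of T" using cone by blast
    then show "\<exists>q. True \<and> (\<forall>x\<in>\<sigma> \<inter> NQ. ev p x = peval q x)"
      using pieces [of T 0] by blast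
  qed
  show "ev p \<in> conewise (homogeneous k) \<Sigma>u" if p: "p \<in> with_keys (\<lambda>m. int (tot m) = k)"
    unfolding conewise_def mem_Collect_eq
  proof (intro conjI ext ballI)
    fix \<sigma> assume "\<sigma> \<in> \<Sigma>u"
    then obtain T where "T \<in> St" "\<sigma> = cone_of T" using cone by blast
    then show "\<exists>q. homogeneous k q \<and> (\<forall>x\<in>\<sigma> \<inter> NQ. ev p x = peval q x)"
      using pieces [of T k] p by blast
  qed
qed

lemma evp_coordinate: "evp (lamc x) (sr.Lop (\<lambda>v. of_int (v $ i))) = complex_of_real (x $ i)"
proof -
  have "x $ i = comb (lam x) $ i" by (simp add: lam)
  also have "\<dots> = (\<Sum>v\<in>V. of_int (v $ i) * lam x v)"
    by (simp add: comb_def emb_nth mult.commute)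
  finally have "complex_of_real (x $ i) = complex_of_real (\<Sum>v\<in>V. of_int (v $ i) * lam x v)"
    by simp
  then show ?thesis
    unfolding sr.Lop_def linear_over_sum [OF evp_linear] linear_overD [OF evp_linear] evp_Mon mon_eval_single
    by (simp add: lamc_def)
qed

text \<open>The coordinate functions are the values of the linear forms
  \<open>\<Sum> v_i x_v\<close>, and substituting these expresses a polynomial in the coordinates
  through the vertex variables.\<close>

lemma peval_on_cone:
  assumes T: "T \<in> St"
  shows "\<exists>r. (homogeneous k q \<longrightarrow> r \<in> with_keys (\<lambda>m. int (tot m) = k)) \<and>
    (\<forall>x\<in>cone_of T. peval q x = evp (lamc x) r)"
proof -
  define L :: "'n \<Rightarrow> (int, 'n) vec mpoly" where "L i = sr.Lop (\<lambda>v. of_int (v $ i))" for i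
  define r where "r = lin Const (\<lambda>m :: (nat, 'n) vec. \<Prod>i\<in>UNIV. L i ^ (m $ i)) q"
  have L: "evp (lamc x) (L i) = complex_of_real (x $ i)" for x i
    unfolding L_def by (rule evp_coordinate)
  have "evp (lamc x) r = peval q x" for x
    unfolding r_def
  proof (rule linear_over_eqI [where p = q, OF _ peval_linear])
    show "linear_over (\<lambda>c. c) (\<lambda>q. evp (lamc x) (lin Const (\<lambda>m :: (nat, 'n) vec. \<Prod>i\<in>UNIV. L i ^ (m $ i)) q))"
      by (rule linear_over_comp [OF evp_linear lin_linear [OF scalar_hom_Const]])
    show "evp (lamc x) (lin Const (\<lambda>m :: (nat, 'n) vec. \<Prod>i\<in>UNIV. L i ^ (m $ i)) (Mon m)) = peval (Mon m) x" for m
      unfolding lin_Mon [OF scalar_hom_Const] peval_eq lin_Mon [OF scalar_hom_id]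
      by (simp add: hom_prod_power [where E = "evp (lamc x)", OF evp_mult evp_one] L)
  qed
  moreover have "r \<in> with_keys (\<lambda>m. int (tot m) = k)" if q: "homogeneous k q"
  proof -
    have \<omega>: "int (tot (m + m')) = int (tot m) + int (tot m')" for m m' :: "(int, 'n) vec \<Rightarrow>\<^sub>0 nat"
      by (simp add: tot_add)
    have "Var v \<in> with_keys (\<lambda>m. int (tot m) = 1)" for v :: "(int, 'n) vec"
      by (simp add: with_keys_def)
    then have L1: "L i \<in> with_keys (\<lambda>m. int (tot m) = 1)" for i
      unfolding L_def sr.Lop_def by (intro csubspace_sum [OF csubspace_with_keys] with_keys_Const_mult)
    show ?thesis
      unfolding r_def
    proof (rule linear_over_mem [OF lin_linear [OF scalar_hom_Const] csubspace_with_keys])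
      fix m assume "m \<in> keys q"
      then have "(\<Sum>i\<in>UNIV. int (m $ i)) = k" using q by (simp add: homogeneous_def)
      then show "lin Const (\<lambda>m. \<Prod>i\<in>UNIV. L i ^ (m $ i)) (Mon m) \<in> with_keys (\<lambda>m. int (tot m) = k)"
        using with_keys_prod_power [where A = UNIV and e = "\<lambda>i. m $ i", OF \<omega> L1 finite]
        by (simp add: lin_Mon [OF scalar_hom_Const])
    qed
  qed
  ultimately show ?thesis by metis
qed

text \<open>A conewise polynomial is glued from its coefficients: that of a monomial \<open>m\<close> is read off on
  the smallest cone on which \<open>m\<close> does not vanish.\<close>
lemma conewise_onto:
  assumes g: "g \<in> conewise Q0 \<Sigma>u"
  shows "\<exists>p. g = ev p \<and> ((\<forall>q. Q0 q \<longrightarrow> homogeneous k q) \<longrightarrow> p \<in> with_keys (\<lambda>m. int (tot m) = k))"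
proof -
  have "\<exists>r. ((\<forall>q. Q0 q \<longrightarrow> homogeneous k q) \<longrightarrow> r \<in> with_keys (\<lambda>m. int (tot m) = k)) \<and>
      (\<forall>x\<in>cone_of T \<inter> NQ. g x = evp (lamc x) r)" if T: "T \<in> St" for T
  proof -
    obtain q where q: "Q0 q" "\<forall>x\<in>cone_of T \<inter> NQ. g x = peval q x"
      using g T by (auto simp: conewise_def star_St)
    obtain r where "homogeneous k q \<longrightarrow> r \<in> with_keys (\<lambda>m. int (tot m) = k)"
        "\<forall>x\<in>cone_of T. peval q x = evp (lamc x) r"
      using peval_on_cone [OF T] by blast
    then show ?thesis using q by (intro exI [of _ r]) auto
  qed
  then obtain r where r: "\<And>T. T \<in> St \<Longrightarrow> (\<forall>q. Q0 q \<longrightarrow> homogeneous k q) \<Longrightarrow> r T \<in> with_keys (\<lambda>m. int (tot m) = k)"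
      "\<And>T x. T \<in> St \<Longrightarrow> x \<in> cone_of T \<Longrightarrow> x \<in> NQ \<Longrightarrow> g x = evp (lamc x) (r T)"
    by (metis IntI)
  define p where "p = (\<Sum>T\<in>St. keep (\<lambda>m. keys m = T) (r T))"
  have p: "lookup p m = lookup (r (keys m)) m" if "keys m \<in> St" for m
  proof -
    have "lookup p m = (\<Sum>T\<in>St. if T = keys m then lookup (r (keys m)) m else 0)"
      unfolding p_def lookup_sum by (rule sum.cong) (auto simp: lookup_keep)
    then show ?thesis using that finite_St by simp
  qed
  have "g = ev p"
  proof
    fix x
    show "g x = ev p x"
    proof (cases "x \<in> supp \<Sigma>u")
      case True
      let ?T = "lsupp x"
      have T: "?T \<in> St" "x \<in> NQ" using True by (auto simp: supp_star)
      have "lookup p m = lookup (r ?T) m" if m: "keys m \<subseteq> ?T" for m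
      proof -
        have mS: "keys m \<in> St" using St_mono [OF T(1) m] .
        \<comment> \<open>Both local polynomials agree with \<open>g\<close> on the cone over
          \<open>keys m\<close>, a face of the cone of \<open>x\<close>, and the values there
          determine this coefficient.\<close>
        have "lookup (r (keys m)) m = lookup (r ?T) m"
        proof (rule evp_cone_unique [OF St_\<Delta> [OF mS] _ order_refl])
          fix z assume z: "z \<in> cone_of (keys m)" "z \<in> NQ"
          then have "z \<in> cone_of ?T" using m by (auto simp: cone_of_def)
          then show "evp (lamc z) (r (keys m)) = evp (lamc z) (r ?T)"
            using r(2) [OF mS z] r(2) [OF T(1) _ z(2)] by simp
        qed
        then show ?thesis using p [OF mS] by simp
      qed
      then have "evp (lamc x) p = evp (lamc x) (r ?T)"
        by (rule evp_cone_cong [OF order_refl])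
      then show ?thesis
        using True r(2) [OF T(1) _ T(2)] by (simp add: ev_def cone_of_def)
    next
      case False
      then show ?thesis
        using g by (simp add: ev_def conewise_def extensional_def)
    qed
  qed
  moreover have "p \<in> with_keys (\<lambda>m. int (tot m) = k)" if "\<forall>q. Q0 q \<longrightarrow> homogeneous k q"
    unfolding p_def
  proof (rule csubspace_sum [OF csubspace_with_keys])
    fix T assume "T \<in> St"
    from r(1) [OF this that] show "keep (\<lambda>m. keys m = T) (r T) \<in> with_keys (\<lambda>m. int (tot m) = k)"
      by (simp add: with_keys_def keys_keep)
  qed
  ultimately show ?thesis by blast
qed

lemma conewise_homogeneous: "conewise (homogeneous k) \<Sigma>u = ev ` with_keys (\<lambda>m. int (tot m) = k)"
  using conewise_onto [of _ "homogeneous k" k] conewise_ev(2) by blast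

section \<open>The ring of conewise polynomials and its ideal of linear functions\<close>

lemma ev_ops:
  "ev p \<oplus>\<^bsub>cpoly \<Sigma>u\<^esub> ev q = ev (p + q)" "ev p \<otimes>\<^bsub>cpoly \<Sigma>u\<^esub> ev q = ev (p * q)"
  "\<one>\<^bsub>cpoly \<Sigma>u\<^esub> = ev 1" "\<zero>\<^bsub>cpoly \<Sigma>u\<^esub> = ev 0" "c \<odot>\<^bsub>cpoly \<Sigma>u\<^esub> ev p = ev (cscale c p)"
proof -
  have "evp y (cscale c p) = c * evp y p" for y
    unfolding cscale_def by (rule linear_overD(2) [OF evp_linear])
  then show "ev p \<oplus>\<^bsub>cpoly \<Sigma>u\<^esub> ev q = ev (p + q)" "ev p \<otimes>\<^bsub>cpoly \<Sigma>u\<^esub> ev q = ev (p * q)"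
    "\<one>\<^bsub>cpoly \<Sigma>u\<^esub> = ev 1" "\<zero>\<^bsub>cpoly \<Sigma>u\<^esub> = ev 0" "c \<odot>\<^bsub>cpoly \<Sigma>u\<^esub> ev p = ev (cscale c p)"
    by (auto simp: cpoly_def ev_def fun_eq_iff linear_overD(1,3) [OF evp_linear] evp_mult evp_one)
qed

lemma carrier_cpoly: "carrier (cpoly \<Sigma>u) = range ev"
proof -
  have "carrier (cpoly \<Sigma>u) = conewise (\<lambda>_. True) \<Sigma>u"
    by (simp add: cpoly_def)
  also have "\<dots> = range ev"
    using conewise_ev(1) conewise_onto [of _ "\<lambda>_. True"] by blast
  finally show ?thesis .
qed

lemma presents_cpoly: "presents ev cscale UNIV sr.SRideal (cpoly \<Sigma>u)"
  unfolding presents_def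
  by (simp add: csubspace_UNIV csubspace_with_keys cscale_add carrier_cpoly ev_ops ev_zero_iff)

lemma ring_cpoly: "ring (cpoly \<Sigma>u)"
proof (rule ringI)
  show "abelian_group (cpoly \<Sigma>u)"
  proof (rule abelian_groupI)
    fix x assume "x \<in> carrier (cpoly \<Sigma>u)"
    then obtain p where "x = ev p" by (auto simp: carrier_cpoly)
    then show "\<exists>y\<in>carrier (cpoly \<Sigma>u). y \<oplus>\<^bsub>cpoly \<Sigma>u\<^esub> x = \<zero>\<^bsub>cpoly \<Sigma>u\<^esub>"
      by (intro bexI [of _ "ev (- p)"]) (simp_all add: ev_ops carrier_cpoly)
  qed (auto simp: carrier_cpoly ev_ops add_ac)
  show "monoid (cpoly \<Sigma>u)"
    by (rule monoidI) (auto simp: carrier_cpoly ev_ops mult_ac)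
qed (auto simp: carrier_cpoly ev_ops algebra_simps)

lemma ev_coordinate: "ev (sr.Lop (\<lambda>v. of_int (v $ i))) = (\<lambda>x\<in>supp \<Sigma>u. complex_of_real (x $ i))"
  by (simp add: ev_def evp_coordinate)

lemma ev_degP: "ev (sr.Lop (\<lambda>_. 1)) = (\<lambda>x\<in>supp \<Sigma>u. complex_of_real (degP P x))"
proof -
  have "evp (lamc x) (sr.Lop (\<lambda>_. 1)) = complex_of_real (degP P x)" for x
    unfolding sr.Lop_def linear_over_sum [OF evp_linear] linear_overD [OF evp_linear] evp_Mon mon_eval_single
    by (simp add: lamc_def degP_eq)
  then show ?thesis by (simp add: ev_def)
qed

text \<open>The global linear functions are the images of the combinations of the
  \<open>L_j\<close>. Elements of \<open>KJ\<close> are sums of multiples of the \<open>L_j\<close>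
  up to the kernel of \<open>ev\<close>, so their images form exactly the ideal generated by those
  functions.\<close>

lemma lin_ideal_eq: "lin_ideal \<Sigma>u = ev ` sr.KJ"
proof -
  let ?S = "range (\<lambda>c :: (complex, 'n) vec. \<lambda>x\<in>supp \<Sigma>u. \<Sum>i\<in>UNIV. c $ i * complex_of_real (x $ i))"
  let ?X = "\<lambda>i. sr.Lop (\<lambda>v. of_int (v $ i))"
  have lin: "(\<lambda>x\<in>supp \<Sigma>u. \<Sum>i\<in>UNIV. c $ i * complex_of_real (x $ i)) = ev (\<Sum>i\<in>UNIV. Const (c $ i) * ?X i)"
    for c :: "(complex, 'n) vec"
  proof
    fix x
    have "evp (lamc x) (?X i) = complex_of_real (x $ i)" if "x \<in> supp \<Sigma>u" for i
      using fun_cong [OF ev_coordinate, of i x] that by (simp add: ev_def)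
    then show "(\<lambda>x\<in>supp \<Sigma>u. \<Sum>i\<in>UNIV. c $ i * complex_of_real (x $ i)) x = ev (\<Sum>i\<in>UNIV. Const (c $ i) * ?X i) x"
      by (simp add: ev_def linear_over_sum [OF evp_linear] linear_overD [OF evp_linear])
  qed
  have KJ_sum: "(\<Sum>i\<in>UNIV. ?X i * g i) \<in> sr.KJ" for g
    using csubspaceD(1) [OF csubspace_with_keys] by (intro sr.KJ_I [of _ g]) simp
  have id: "ideal (ev ` sr.KJ) (cpoly \<Sigma>u)"
  proof (rule idealI [OF ring_cpoly])
    show "subgroup (ev ` sr.KJ) (add_monoid (cpoly \<Sigma>u))"
    proof
      fix x assume "x \<in> ev ` sr.KJ"
      then obtain p where p: "p \<in> sr.KJ" "x = ev p" by blast
      have "abelian_group (cpoly \<Sigma>u)"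
        using ring_cpoly by (simp add: ring_def)
      then have "\<ominus>\<^bsub>cpoly \<Sigma>u\<^esub> ev p = ev (- p)"
        by (intro abelian_group.minus_equality) (simp_all add: ev_ops carrier_cpoly)
      then show "inv\<^bsub>add_monoid (cpoly \<Sigma>u)\<^esub> x \<in> ev ` sr.KJ"
        using p csubspaceD(5) [OF sr.csubspace_KJ] by (simp add: a_inv_def)
    qed (use csubspaceD [OF sr.csubspace_KJ] in \<open>auto simp: carrier_cpoly ev_ops\<close>)
  next
    fix x y assume "x \<in> ev ` sr.KJ" "y \<in> carrier (cpoly \<Sigma>u)"
    then obtain p q where "p \<in> sr.KJ" "x = ev p" "y = ev q"
      by (auto simp: carrier_cpoly)
    then show "y \<otimes>\<^bsub>cpoly \<Sigma>u\<^esub> x \<in> ev ` sr.KJ" "x \<otimes>\<^bsub>cpoly \<Sigma>u\<^esub> y \<in> ev ` sr.KJ"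
      using sr.KJ_mult [of p q] by (simp_all add: ev_ops mult.commute)
  qed
  have sub: "?S \<subseteq> ev ` sr.KJ"
  proof
    fix x assume "x \<in> ?S"
    then obtain c :: "(complex, 'n) vec" where "x = ev (\<Sum>i\<in>UNIV. ?X i * Const (c $ i))"
      using lin by (auto simp: mult.commute)
    then show "x \<in> ev ` sr.KJ" using KJ_sum [of "\<lambda>i. Const (c $ i)"] by blast
  qed
  have "ev ` sr.KJ \<subseteq> I" if I: "ideal I (cpoly \<Sigma>u)" "?S \<subseteq> I" for I
  proof
    fix x assume "x \<in> ev ` sr.KJ"
    then obtain p g where p: "x = ev p" "p - (\<Sum>j\<in>UNIV. ?X j * g j) \<in> sr.SRideal"
      by (auto simp: sr.KJ_def)
    interpret ideal I "cpoly \<Sigma>u" by (rule I(1))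
    have X: "ev (?X i) \<in> I" for i
    proof -
      \<comment> \<open>\<open>L_i\<close> is the linear function with coefficient vector
        \<open>axis i 1\<close>.\<close>
      have "?X i = (\<Sum>j\<in>UNIV. if j = i then ?X i else 0)" by simp
      also have "\<dots> = (\<Sum>j\<in>UNIV. Const (axis i 1 $ j) * ?X j)"
        by (rule sum.cong) (auto simp: axis_def)
      finally have "ev (?X i) = (\<lambda>x\<in>supp \<Sigma>u. \<Sum>j\<in>UNIV. axis i 1 $ j * complex_of_real (x $ j))"
        using lin [of "axis i 1"] by simp
      then show ?thesis using I(2) by blast
    qed
    have "ev (\<Sum>j\<in>A. ?X j * g j) \<in> I" for A
    proof (induction A rule: infinite_finite_induct)
      case (insert j A)
      have "ev (?X j * g j) \<in> I"
        using I_r_closed [OF X, of "ev (g j)" j] by (simp add: carrier_cpoly ev_ops)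
      from additive_subgroup.a_closed [OF is_additive_subgroup this insert.IH] show ?case
        using insert.hyps by (simp add: ev_ops)
    qed (use additive_subgroup.zero_closed [OF is_additive_subgroup] in \<open>simp_all add: ev_ops\<close>)
    then show "x \<in> I"
      using p ev_zero_iff [of p "\<Sum>j\<in>UNIV. ?X j * g j"] by simp
  qed
  then show ?thesis
    unfolding lin_ideal_def genideal_def using id sub by (intro antisym) auto
qed

definition rS :: "(int, 'n) vec mpoly \<Rightarrow> ((real, 'n) vec \<Rightarrow> complex) set" where
  "rS p = HS_class \<Sigma>u (ev p)"

lemma rS_eq: "rS p = lin_ideal \<Sigma>u +>\<^bsub>cpoly \<Sigma>u\<^esub> ev p"
proof -
  have "(\<lambda>x\<in>supp \<Sigma>u. ev p x) = ev p"
    by (auto simp: ev_def)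
  then show ?thesis
    by (simp only: rS_def HS_class_def)
qed

lemma presents_HS: "presents rS cscale UNIV sr.KJ (HS \<Sigma>u)"
  using presents_quotient [OF presents_cpoly sr.csubspace_KJ sr.SRideal_KJ _ lin_ideal_eq]
  by (simp add: rS_eq [abs_def] HS_def)

lemma HS_graded_eq: "HS_graded \<Sigma>u (p - \<lfloor>dgu\<rfloor>) = rS ` sr.homog (bt p)"
proof -
  have "sr.dg m = bt p \<longleftrightarrow> int (tot m) = p - \<lfloor>dgu\<rfloor>" for m
    unfolding dg_bt bt_eq_iff by auto
  then show ?thesis
    by (simp add: HS_graded_def conewise_homogeneous image_image rS_def [abs_def])
qed

lemma HS_deg_rS: "HS_deg P \<Sigma>u (rS p) = rS (sr.Lop (\<lambda>_. 1) * p)"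
proof -
  have cos: "rS p = ev ` {y. y - p \<in> sr.KJ}" for p
    using coset_image [OF presents_cpoly sr.csubspace_KJ] by (simp add: rS_eq lin_ideal_eq)
  have "HS_deg P \<Sigma>u (rS p) = lin_ideal \<Sigma>u +>\<^bsub>cpoly \<Sigma>u\<^esub> ev (sr.Lop (\<lambda>_. 1) * p)"
    unfolding HS_deg_def
  proof (rule induced_eq [OF presents_cpoly sr.csubspace_KJ sr.SRideal_KJ subset_UNIV lin_ideal_eq])
    show "rS p \<noteq> {}"
      unfolding cos using csubspaceD(1) [OF sr.csubspace_KJ] by (auto intro: exI [of _ p])
    fix z assume "z \<in> rS p"
    then obtain y where y: "z = ev y" "y - p \<in> sr.KJ" unfolding cos by blast
    have "sr.Lop (\<lambda>_. 1) * y - sr.Lop (\<lambda>_. 1) * p \<in> sr.KJ"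
      using sr.KJ_mult [OF y(2), of "sr.Lop (\<lambda>_. 1)"] by (simp add: right_diff_distrib)
    moreover have "(\<lambda>x\<in>supp \<Sigma>u. complex_of_real (degP P x)) \<otimes>\<^bsub>cpoly \<Sigma>u\<^esub> z = ev (sr.Lop (\<lambda>_. 1) * y)"
      by (simp only: y(1) ev_degP [symmetric] ev_ops)
    ultimately show "\<exists>x\<in>UNIV. (\<lambda>x\<in>supp \<Sigma>u. complex_of_real (degP P x)) \<otimes>\<^bsub>cpoly \<Sigma>u\<^esub> z = ev x
        \<and> x - sr.Lop (\<lambda>_. 1) * p \<in> sr.KJ"
      by blast
  qed simp
  then show ?thesis by (simp add: rS_eq)
qed

lemma HS_monom_eq:
  assumes m: "sr.adm m"
  shows "HS_monom P a u (pt m) = rS (Const (1 / am m) * Mon m)"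
proof -
  \<comment> \<open>The coordinates of a box element lie in [0,1), so taking integer parts of the
    coordinates of \<open>w\<close> recovers the exponents \<open>m\<close>.\<close>
  have fl: "nat \<lfloor>lam (emb (pt m)) v\<rfloor> = lookup m v" for v
  proof -
    have "lam (emb u) v < 1" using u Box_fan_iff by blast
    then have "\<lfloor>lam (emb u) v + real (lookup m v)\<rfloor> = int (lookup m v)"
      using lam_nonneg [of "emb u" v] by linarith
    then show ?thesis by (simp add: pt_lam [OF m])
  qed
  have "(\<Prod>v\<in>V. (complex_of_real (lam x v) / a v) ^ lookup m v) = evp (lamc x) (Const (1 / am m) * Mon m)" for x
  proof -
    have "evp (lamc x) (Const (1 / am m) * Mon m) = mon_eval (lamc x) m / mon_eval a m"
      unfolding linear_overD [OF evp_linear] evp_Mon by (simp add: am_def mon_eval_def)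
    then show ?thesis
      by (simp add: mon_eval_superset [OF finite_V adm_keys [OF m]] power_divide prod_dividef lamc_def)
  qed
  then show ?thesis
    by (simp add: HS_monom_def rS_def HS_class_def courant_eq fl ev_def cong: restrict_cong)
qed

section \<open>The comparison isomorphisms\<close>

lemma zero_KJ: "x - x \<in> sr.KJ"
  using csubspaceD(1) [OF sr.csubspace_KJ] by simp

text \<open>\<open>KH\<close> is the \<open>\<Psi>\<close>-preimage of \<open>KJ\<close>, so
  \<open>\<Psi>\<close> is injective on classes; it is onto, and \<open>\<Psi>_Eop\<close> carries N
  to its symbol.\<close>

lemma Hu_GrPhi_iso:
  "\<exists>\<psi>. end_iso (Hu P a u) (N_H P a u) (GrPhi P a u) (N_GrPhi P a u) \<psi> \<and>
    (\<forall>x\<in>UNIV. \<psi> (rH x) = rGG (sr.\<Psi> x))"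
proof (rule presents_end_iso [OF presents_Hu presents_GrPhi,
      where s = "sr.Eop (\<lambda>_. 1)" and t = "\<lambda>x. sr.Lop (\<lambda>_. 1) * x"])
  show "\<exists>x\<in>UNIV. y - sr.\<Psi> x \<in> sr.KJ" for y
    using sr.\<Psi>_surj [of y] zero_KJ by (metis UNIV_I)
qed (use zero_KJ in \<open>auto simp: linear_overD [OF sr.\<Psi>_linear] cscale_def sr.KH_def N_H_rH N_GrPhi_rGG sr.\<Psi>_Eop\<close>)

text \<open>Both spaces are presented by the same ring with the same kernel \<open>KJ\<close>, so
  the identity on representatives induces the map; this fixes its values on monomial
  classes.\<close>

lemma GrPhi_JN_iso:
  "\<exists>\<phi>. end_iso (GrPhi P a u) (N_GrPhi P a u) (JN P a u) (JN_f P a u) \<phi> \<and> (\<forall>x\<in>UNIV. \<phi> (rGG x) = rJ x)"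
proof (rule presents_end_iso [OF presents_GrPhi presents_JN,
      where s = "\<lambda>x. sr.Lop (\<lambda>_. 1) * x" and t = "\<lambda>x. sr.Lop (\<lambda>_. 1) * x"])
  show "\<exists>x\<in>UNIV. y - x \<in> sr.KJ" for y
    using zero_KJ by blast
qed (use zero_KJ in \<open>simp_all add: N_GrPhi_rGG JN_f_rJ\<close>)

lemma JN_HS_iso:
  "\<exists>\<eta>. end_iso (JN P a u) (JN_f P a u) (HS \<Sigma>u) (HS_deg P \<Sigma>u) \<eta> \<and> (\<forall>x\<in>UNIV. \<eta> (rJ x) = rS x)"
proof (rule presents_end_iso [OF presents_JN presents_HS,
      where s = "\<lambda>x. sr.Lop (\<lambda>_. 1) * x" and t = "\<lambda>x. sr.Lop (\<lambda>_. 1) * x"])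
  show "\<exists>x\<in>UNIV. y - x \<in> sr.KJ" for y
    using zero_KJ by blast
qed (use zero_KJ in \<open>simp_all add: JN_f_rJ HS_deg_rS\<close>)

end

theorem corollary4p4:
  fixes P :: "(real ^ 'n::{finite,linorder}) set"
    and a :: "int ^ 'n::_ \<Rightarrow> complex"
    and u :: "int ^ 'n::_"
  assumes P: "lattice_simplicial P"
    and zero: "0 \<in> interior P"
    and a: "\<And>v. v \<in> verts P \<Longrightarrow> a v \<noteq> 0"
    and u: "u \<in> Box_fan P"
  shows "(\<exists>\<psi>. end_iso (Hu P a u) (N_H P a u) (GrPhi P a u) (N_GrPhi P a u) \<psi>) \<and>
    (\<exists>\<phi> \<eta>.
      end_iso (GrPhi P a u) (N_GrPhi P a u) (JN P a u) (JN_f P a u) \<phi> \<and>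
      end_iso (JN P a u) (JN_f P a u) (HS (star_fan P u)) (HS_deg P (star_fan P u)) \<eta> \<and>
      (\<forall>p :: int.
        \<phi> ` dsum_component UNIV (GrPhi_piece P a u) p
          = JN_graded P a u (of_int p + frac (degP P (emb u))) \<and>
        \<eta> ` JN_graded P a u (of_int p + frac (degP P (emb u)))
          = HS_graded (star_fan P u) (p - \<lfloor>degP P (emb u)\<rfloor>)) \<and>
      (\<forall>w\<in>box_fibre P u. \<forall>p :: int.
        degP P (emb w) = of_int p + frac (degP P (emb u)) \<longrightarrow>
          \<phi> (GrPhi_monom P a u p w) = JN_monom P a u w \<and>
          \<eta> (JN_monom P a u w) = HS_monom P a u w))"
proof -
  interpret box_piece P a u
    using P zero a u by unfold_locales
  obtain \<phi> where \<phi>: "end_iso (GrPhi P a u) (N_GrPhi P a u) (JN P a u) (JN_f P a u) \<phi>" "\<And>x. \<phi> (rGG x) = rJ x"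
    using GrPhi_JN_iso by blast
  obtain \<eta> where \<eta>: "end_iso (JN P a u) (JN_f P a u) (HS (star_fan P u)) (HS_deg P (star_fan P u)) \<eta>"
      "\<And>x. \<eta> (rJ x) = rS x"
    using JN_HS_iso by blast
  \<comment> \<open>The degree of a lattice point is rational, so \<open>bt p\<close> is an index of
    the Newton grading of J(u).\<close>
  have rat: "bt p \<in> \<rat>" for p
    using degP_rational [of u] by (simp add: bt_def frac_def)
  have 1: "\<phi> ` dsum_component UNIV (GrPhi_piece P a u) p = JN_graded P a u (bt p)" for p
    by (simp add: GrPhi_component JN_graded_eq [OF rat] image_image \<phi>(2))
  have 2: "\<eta> ` JN_graded P a u (bt p) = HS_graded (star_fan P u) (p - \<lfloor>dgu\<rfloor>)" for p
    by (simp add: HS_graded_eq JN_graded_eq [OF rat] image_image \<eta>(2))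
  have 3: "\<phi> (GrPhi_monom P a u p w) = JN_monom P a u w \<and> \<eta> (JN_monom P a u w) = HS_monom P a u w"
    if w: "w \<in> box_fibre P u" "degP P (emb w) = bt p" for w p
  proof -
    obtain m where m: "sr.adm m" "w = pt m"
      using w(1) box_fibre_eq by blast
    then show ?thesis
      using GrPhi_monom_eq [OF m(1), of p] JN_monom_eq [OF m(1)] HS_monom_eq [OF m(1)] w(2) \<phi>(2) \<eta>(2)
      by (simp add: pt_degP)
  qed
  show ?thesis
    unfolding bt_def [symmetric] using Hu_GrPhi_iso
    by (intro conjI exI [of _ \<phi>] exI [of _ \<eta>] allI ballI impI)
       (blast | simp only: \<phi>(1) \<eta>(1) 1 2 3)+
qed

end
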